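(* There is a deterministic parallel algorithm that, given a weighted directed graph with $n$ vertices, $m$ edges and real edge weights, containing no negative cycles, and a designated source vertex $s$, computes the shortest paths from $s$ to all other vertices spending $O(mn\log^2 n+n^3h^{-3}\log^7 n+n^2h\log^{11} n)$ work with $O(h+\log^{11} n)$ depth, for any $1\le h\le n$.
   Context: Parallel algorithms are measured by work (total number of operations by all processors) and depth (number of parallel steps until the last processor finishes). *)

theory Defs
  imports "Graph_Theory.Shortest_Path"
begin

section \<open>A work/depth model: structured CREW programs over words and reals\<close>

text \<open>
  A fixed finite program is executed by dynamically created processors. Every processor has
  private registers for natural numbers (machine words) and for reals; all processors share a
  memory of words and a memory of reals. Words are only available up to a bound \<open>B\<close>, an operation
  whose result would exceed it gets stuck. Reals can only be moved, added, subtracted and compared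
  (there is no rounding, no conversion to words, and no real constant except \<open>0\<close>, since
  an arbitrary real constant could carry an unbounded amount of nonuniform advice).
\<close>

record state =
  nreg :: "nat \<Rightarrow> nat"
  rreg :: "nat \<Rightarrow> real"
  nmem :: "nat \<Rightarrow> nat"
  rmem :: "nat \<Rightarrow> real"

datatype loc = NLoc nat | RLoc nat

datatype nop = Plus | Minus | Times | Div | Mod

text \<open>Arguments of instructions and tests are register numbers, except the \<open>k\<close> of \<open>NConst x k\<close>.\<close>

datatype instr =
    NConst nat nat
  | NOp nop nat nat nat
  | NLoad nat nat
  | NStore nat nat
  | RZero nat
  | RAdd nat nat nat
  | RSub nat nat nat
  | RLoad nat nat
  | RStore nat nat

datatype test =
    NEq nat nat
  | NLess nat nat
  | RLess nat nat

datatype com =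
    Skip
  | Do instr
  | Seq com com
  | If test com com
  | While test com
  | Par nat nat com

fun nop_val :: "nop \<Rightarrow> nat \<Rightarrow> nat \<Rightarrow> nat" where
  "nop_val Plus a b = a + b"
| "nop_val Minus a b = a - b"
| "nop_val Times a b = a * b"
| "nop_val Div a b = a div b"
| "nop_val Mod a b = a mod b"

definition set_nreg :: "nat \<Rightarrow> nat \<Rightarrow> nat \<Rightarrow> state \<Rightarrow> state option" where
  "set_nreg B x a s = (if a \<le> B then Some (s\<lparr>nreg := (nreg s)(x := a)\<rparr>) else None)"

definition set_rreg :: "nat \<Rightarrow> real \<Rightarrow> state \<Rightarrow> state option" where
  "set_rreg x r s = Some (s\<lparr>rreg := (rreg s)(x := r)\<rparr>)"

fun step :: "nat \<Rightarrow> instr \<Rightarrow> state \<Rightarrow> state option" where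
  "step B (NConst x k) s = set_nreg B x k s"
| "step B (NOp f x y z) s = set_nreg B x (nop_val f (nreg s y) (nreg s z)) s"
| "step B (NLoad x y) s = set_nreg B x (nmem s (nreg s y)) s"
| "step B (NStore x y) s = Some (s\<lparr>nmem := (nmem s)(nreg s x := nreg s y)\<rparr>)"
| "step B (RZero x) s = set_rreg x 0 s"
| "step B (RAdd x y z) s = set_rreg x (rreg s y + rreg s z) s"
| "step B (RSub x y z) s = set_rreg x (rreg s y - rreg s z) s"
| "step B (RLoad x y) s = set_rreg x (rmem s (nreg s y)) s"
| "step B (RStore x y) s = Some (s\<lparr>rmem := (rmem s)(nreg s x := rreg s y)\<rparr>)"

fun reads :: "instr \<Rightarrow> state \<Rightarrow> loc set" where
  "reads (NLoad x y) s = {NLoc (nreg s y)}"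
| "reads (RLoad x y) s = {RLoc (nreg s y)}"
| "reads _ s = {}"

fun writes :: "instr \<Rightarrow> state \<Rightarrow> loc set" where
  "writes (NStore x y) s = {NLoc (nreg s x)}"
| "writes (RStore x y) s = {RLoc (nreg s x)}"
| "writes _ s = {}"

fun holds :: "test \<Rightarrow> state \<Rightarrow> bool" where
  "holds (NEq x y) s \<longleftrightarrow> nreg s x = nreg s y"
| "holds (NLess x y) s \<longleftrightarrow> nreg s x < nreg s y"
| "holds (RLess x y) s \<longleftrightarrow> rreg s x < rreg s y"

text \<open>
  The state after \<open>k\<close> processors, started in \<open>s\<close>, have ended in \<open>T i\<close> having written \<open>W i\<close>:
  private registers are those of the parent, the writes to the shared memory are collected.
  The write sets are disjoint wherever this is used.
\<close>

definition join :: "nat \<Rightarrow> (nat \<Rightarrow> state) \<Rightarrow> (nat \<Rightarrow> loc set) \<Rightarrow> state \<Rightarrow> state" where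
  "join k T W s = s\<lparr>
     nmem := (\<lambda>a. if \<exists>i<k. NLoc a \<in> W i
                  then nmem (T (LEAST i. i < k \<and> NLoc a \<in> W i)) a else nmem s a),
     rmem := (\<lambda>a. if \<exists>i<k. RLoc a \<in> W i
                  then rmem (T (LEAST i. i < k \<and> RLoc a \<in> W i)) a else rmem s a)\<rparr>"

text \<open>
  \<open>exec B c s t R W w d\<close>: with word bound \<open>B\<close>, program \<open>c\<close> started in \<open>s\<close> terminates in \<open>t\<close>,
  having read the shared locations \<open>R\<close> and written the shared locations \<open>W\<close>, with work \<open>w\<close>
  (number of operations of all processors) and depth \<open>d\<close> (number of parallel steps until the last
  processor finishes). \<open>Par x y c\<close> creates as many processors as register \<open>y\<close> says; each starts with
  a copy of the registers of its parent, except that register \<open>x\<close> holds its number. Concurrent reads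
  are allowed, but a location written by one of these processors must not be accessed by another
  one; otherwise the execution gets stuck.
\<close>

inductive exec ::
  "nat \<Rightarrow> com \<Rightarrow> state \<Rightarrow> state \<Rightarrow> loc set \<Rightarrow> loc set \<Rightarrow> nat \<Rightarrow> nat \<Rightarrow> bool"
  for B :: nat
where
  Skip: "exec B Skip s s {} {} 0 0"
| Do: "step B i s = Some t \<Longrightarrow> exec B (Do i) s t (reads i s) (writes i s) 1 1"
| Seq: "exec B c1 s s' R1 W1 w1 d1 \<Longrightarrow> exec B c2 s' t R2 W2 w2 d2 \<Longrightarrow>
    exec B (Seq c1 c2) s t (R1 \<union> R2) (W1 \<union> W2) (w1 + w2) (d1 + d2)"
| IfTrue: "holds b s \<Longrightarrow> exec B c1 s t R W w d \<Longrightarrow>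
    exec B (If b c1 c2) s t R W (1 + w) (1 + d)"
| IfFalse: "\<not> holds b s \<Longrightarrow> exec B c2 s t R W w d \<Longrightarrow>
    exec B (If b c1 c2) s t R W (1 + w) (1 + d)"
| WhileFalse: "\<not> holds b s \<Longrightarrow> exec B (While b c) s s {} {} 1 1"
| WhileTrue: "holds b s \<Longrightarrow> exec B c s s' R1 W1 w1 d1 \<Longrightarrow>
    exec B (While b c) s' t R2 W2 w2 d2 \<Longrightarrow>
    exec B (While b c) s t (R1 \<union> R2) (W1 \<union> W2) (1 + w1 + w2) (1 + d1 + d2)"
| Par: "k = nreg s y \<Longrightarrow>
    (\<And>i. i < k \<Longrightarrow>
      exec B c (s\<lparr>nreg := (nreg s)(x := i)\<rparr>) (T i) (R i) (W i) (w i) (d i)) \<Longrightarrow>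
    (\<And>i j. i < k \<Longrightarrow> j < k \<Longrightarrow> i \<noteq> j \<Longrightarrow> W i \<inter> (R j \<union> W j) = {}) \<Longrightarrow>
    exec B (Par x y c) s (join k T W s) (\<Union>i<k. R i) (\<Union>i<k. W i)
      (1 + k + (\<Sum>i<k. w i)) (1 + Max (insert 0 (d ` {..<k})))"

text \<open>Programs are deterministic, so that ``there is a run'' speaks about the only run.\<close>

lemma join_cong:
  assumes "\<And>i. i < k \<Longrightarrow> T i = T' i \<and> W i = W' i"
  shows "join k T W s = join k T' W' s"
proof -
  have 1: "(i < k \<and> l \<in> W i) = (i < k \<and> l \<in> W' i)" for i l
    using assms by auto
  have 2: "T (LEAST i. i < k \<and> l \<in> W' i) = T' (LEAST i. i < k \<and> l \<in> W' i)"
    if "\<exists>i<k. l \<in> W' i" for l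
    using assms LeastI_ex[OF that] by blast
  show ?thesis
    unfolding join_def 1 using 2 by (simp cong: if_cong)
qed

lemma exec_deterministic:
  assumes "exec B c s t R W w d" and "exec B c s t' R' W' w' d'"
  shows "t' = t \<and> R' = R \<and> W' = W \<and> w' = w \<and> d' = d"
  using assms
proof (induction arbitrary: t' R' W' w' d' rule: exec.induct)
  case (Skip s)
  then show ?case by cases auto
next
  case (Do i s t)
  from Do.prems Do.hyps show ?case by cases auto
next
  case (Seq c1 s s' R1 W1 w1 d1 c2 t R2 W2 w2 d2)
  from Seq.prems show ?case
    by cases (use Seq.IH in blast)
next
  case (IfTrue b s c1 t R W w d c2)
  from IfTrue.prems show ?case
    by cases (use IfTrue.IH IfTrue.hyps in blast)+
next
  case (IfFalse b s c2 t R W w d c1)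
  from IfFalse.prems show ?case
    by cases (use IfFalse.IH IfFalse.hyps in blast)+
next
  case (WhileFalse b s c)
  from WhileFalse.prems WhileFalse.hyps show ?case by cases auto
next
  case (WhileTrue b s c s' R1 W1 w1 d1 t R2 W2 w2 d2)
  from WhileTrue.prems show ?case
    by cases (use WhileTrue.IH WhileTrue.hyps in blast)+
next
  case (Par k s y c x T R W w d)
  from Par.prems show ?case
  proof cases
    case (Par k' T' R'' W'' w'' d'')
    note inv = this
    have k: "k' = k" using inv \<open>k = nreg s y\<close> by simp
    have eq: "T' i = T i \<and> R'' i = R i \<and> W'' i = W i \<and> w'' i = w i \<and> d'' i = d i" if "i < k" for i
      by (rule Par.IH) (use that inv k in auto)
    have "join k T' W'' s = join k T W s"
      by (rule join_cong) (use eq in simp)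
    moreover have "d'' ` {..<k} = d ` {..<k}"
      by (rule image_cong) (use eq in simp_all)
    moreover have "(\<Union>i<k. R'' i) = (\<Union>i<k. R i)" "(\<Union>i<k. W'' i) = (\<Union>i<k. W i)"
      using eq by simp_all
    moreover have "(\<Sum>i<k. w'' i) = (\<Sum>i<k. w i)"
      using eq by simp
    ultimately show ?thesis using inv k by simp
  qed
qed


section \<open>Single-source shortest paths\<close>

text \<open>
  Vertices and arcs are numbered consecutively from \<open>0\<close>. Parallel arcs are excluded (so \<open>m\<close> is at
  most \<open>n^2\<close>), loops are not; a loop counts as a cycle.
\<close>

definition sssp_instance ::
  "(nat, nat) pre_digraph \<Rightarrow> (nat \<Rightarrow> real) \<Rightarrow> nat \<Rightarrow> nat \<Rightarrow> nat \<Rightarrow> bool" where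
  "sssp_instance G c n m s \<longleftrightarrow>
     fin_digraph G \<and> nomulti_digraph G \<and> verts G = {..<n} \<and> arcs G = {..<m} \<and> s \<in> verts G \<and>
     (\<forall>p. pre_digraph.cycle G p \<longrightarrow> wf_digraph.awalk_cost c p \<ge> 0)"

text \<open>The graph is given as a list of arcs in arbitrary order, preceded by the four parameters.\<close>

definition sssp_input ::
  "(nat, nat) pre_digraph \<Rightarrow> (nat \<Rightarrow> real) \<Rightarrow> nat \<Rightarrow> nat \<Rightarrow> nat \<Rightarrow> nat \<Rightarrow> state" where
  "sssp_input G c n m s h = \<lparr>
     nreg = (\<lambda>_. 0),
     rreg = (\<lambda>_. 0),
     nmem = (\<lambda>a. if a = 0 then n else if a = 1 then m else if a = 2 then s else if a = 3 then h
                 else if a < 4 + m then tail G (a - 4)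
                 else if a < 4 + 2 * m then head G (a - (4 + m)) else 0),
     rmem = (\<lambda>a. if a < m then c a else 0)\<rparr>"

text \<open>
  For every vertex \<open>v\<close>, word \<open>v\<close> tells whether \<open>v\<close> is reachable from \<open>s\<close>. If so, real \<open>v\<close> is the
  distance from \<open>s\<close> to \<open>v\<close> (the library's \<open>\<mu>\<close>), and following the arcs stored in the words
  \<open>n + v\<close> backwards from \<open>v\<close> yields a shortest path from \<open>s\<close> to \<open>v\<close>; so these arcs form a
  shortest path tree.
\<close>

definition sssp_output ::
  "(nat, nat) pre_digraph \<Rightarrow> (nat \<Rightarrow> real) \<Rightarrow> nat \<Rightarrow> nat \<Rightarrow> state \<Rightarrow> bool" where
  "sssp_output G c n s t \<longleftrightarrow>
     (\<forall>v \<in> verts G.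
        nmem t v = (if s \<rightarrow>\<^sup>*\<^bsub>G\<^esub> v then 1 else 0) \<and>
        (s \<rightarrow>\<^sup>*\<^bsub>G\<^esub> v \<longrightarrow>
           ereal (rmem t v) = wf_digraph.\<mu> G c s v \<and>
           (\<exists>p. pre_digraph.apath G s p v \<and>
                ereal (wf_digraph.awalk_cost c p) = wf_digraph.\<mu> G c s v \<and>
                (\<forall>e \<in> set p. nmem t (n + head G e) = e))))"

end

(*
  Distances are compared by cost and then by number of arcs, so that optimal walks are simple and
  are split into optimal walks. Starting with all vertices as sources, Bellman-Ford is run for
  l = 1, 2, 4, ... rounds from the current sources, recording the walks. A set S of O(n log n / l)
  vertices that hits all recorded optimal walks with l arcs becomes the next set of sources.
  Splitting an optimal walk with 2l arcs shows inductively that the sources meet every optimal walk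
  with l arcs after its first vertex, hence the walks from S are all that is needed later on, and a
  phase costs O(m |S| l) = O(m n log n). The hitting set is found deterministically by selecting one
  vertex in each block of l vertices, fixing the bits of the choices greedily with a potential.
  Once l reaches h / log n, an optimal walk is composed of optimal walks with at most l arcs between
  the remaining O(n log^2 n / h) sources, so O(log n) min-plus squarings of the matrix of their
  distances and one product give all distances from s.
*)

theory Submission
imports Defs "HOL-Library.Nat_Bijection"
begin

section \<open>Expressions and their compilation\<close>

text \<open>All logarithms are measured by \<open>R\<close>, about 16 log n. A Bellman-Ford round
  has depth of order R, so lengths stop at about h/R: this keeps the rounds at depth O(h) up to
  polylogarithmic terms and leaves of order R^2 n / h sources, whose cube times R squarings is the
  term n^3 h^-3 log^7 n. The term m n log^2 n has one logarithm from the number of sources times the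
  length and one from the number of doublings; it leaves no room for a logarithm in the minima over
  in-arcs, hence a tournament with linear work. Walks are recorded because the hitting set needs
  their vertices; copying them is charged to the n^2 h term. Breaking ties by arcs keeps them simple
  despite cycles of cost 0 and makes the parent pointers acyclic. In the hitting set a row with a
  selected vertices contributes 3 a - a^2, which is at most 2, and 0 for a = 0. So a potential not
  below the number of live rows means that half of them are hit, and \<open>R\<close> passes finish.
  Conditional expectations are scaled to integers because the machine counts with words
  only.\<close>

text \<open>\<open>VX\<close> and \<open>VY\<close> are the processor numbers in two nested parallel loops. In compiled code,
  registers \<open>1\<close>, \<open>2\<close>, \<open>3\<close> hold \<open>V\<close> and these two numbers; higher ones are temporary.\<close>

datatype nexp = C nat | VX | VY | Op nop nexp nexp | Rd nat nexp nexp | Ls nexp nexp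
  | RLs rexp rexp | Cond nexp nexp nexp
and rexp = RZ | RRd nat nexp nexp | RAd rexp rexp | RCond nexp rexp rexp

record store =
  NA :: "nat \<Rightarrow> nat \<Rightarrow> nat \<Rightarrow> nat"
  RA :: "nat \<Rightarrow> nat \<Rightarrow> nat \<Rightarrow> real"

primrec nev :: "store \<Rightarrow> nat \<Rightarrow> nat \<Rightarrow> nexp \<Rightarrow> nat"
  and rev :: "store \<Rightarrow> nat \<Rightarrow> nat \<Rightarrow> rexp \<Rightarrow> real" where
  "nev u x y (C k) = k"
| "nev u x y VX = x"
| "nev u x y VY = y"
| "nev u x y (Op f a b) = nop_val f (nev u x y a) (nev u x y b)"
| "nev u x y (Rd a i j) = NA u a (nev u x y i) (nev u x y j)"
| "nev u x y (Ls a b) = (if nev u x y a < nev u x y b then 1 else 0)"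
| "nev u x y (RLs a b) = (if rev u x y a < rev u x y b then 1 else 0)"
| "nev u x y (Cond c a b) = (if nev u x y c = 0 then nev u x y b else nev u x y a)"
| "rev u x y RZ = 0"
| "rev u x y (RRd a i j) = RA u a (nev u x y i) (nev u x y j)"
| "rev u x y (RAd a b) = rev u x y a + rev u x y b"
| "rev u x y (RCond c a b) = (if nev u x y c = 0 then rev u x y b else rev u x y a)"

text \<open>The footprint of an expression. It decides whether a parallel assignment respects
  exclusive writes, and whether the expression keeps its value when other arrays change.\<close>

primrec arn :: "nexp \<Rightarrow> nat set" and arr :: "rexp \<Rightarrow> nat set" where
  "arn (C k) = {}"
| "arn VX = {}"
| "arn VY = {}"
| "arn (Op f a b) = arn a \<union> arn b"
| "arn (Rd a i j) = insert a (arn i \<union> arn j)"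
| "arn (Ls a b) = arn a \<union> arn b"
| "arn (RLs a b) = arr a \<union> arr b"
| "arn (Cond c a b) = arn c \<union> arn a \<union> arn b"
| "arr RZ = {}"
| "arr (RRd a i j) = insert a (arn i \<union> arn j)"
| "arr (RAd a b) = arr a \<union> arr b"
| "arr (RCond c a b) = arn c \<union> arr a \<union> arr b"

text \<open>One measure bounds the number of instructions an expression compiles to and, as a power
  of the word bound \<open>V\<close>, all intermediate values of its evaluation.\<close>

primrec gn :: "nexp \<Rightarrow> nat" and gr :: "rexp \<Rightarrow> nat" where
  "gn (C k) = k + 1"
| "gn VX = 4"
| "gn VY = 4"
| "gn (Op f a b) = gn a + gn b + 1"
| "gn (Rd a i j) = 32 * (gn i + gn j + a + 1)"
| "gn (Ls a b) = gn a + gn b + 4"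
| "gn (RLs a b) = gr a + gr b + 4"
| "gn (Cond c a b) = gn c + gn a + gn b + 4"
| "gr RZ = 1"
| "gr (RRd a i j) = 32 * (gn i + gn j + a + 1)"
| "gr (RAd a b) = gr a + gr b + 1"
| "gr (RCond c a b) = gn c + gr a + gr b + 4"

fun blk :: "instr list \<Rightarrow> com" where
  "blk [] = Skip"
| "blk (i # l) = Seq (Do i) (blk l)"

text \<open>The Cantor pairing (a + b)(a + b + 1)/2 + a, that is \<open>prod_encode\<close>,
  computed in place; registers up to d + 3 serve as scratch.\<close>

definition penc :: "nat \<Rightarrow> instr list" where
  "penc d = [NOp Plus (d+1) d (d+1), NConst (d+2) 1, NOp Plus (d+3) (d+1) (d+2),
     NOp Times (d+1) (d+1) (d+3), NConst (d+2) 2, NOp Div (d+1) (d+1) (d+2), NOp Plus d (d+1) d]"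

text \<open>Array \<open>0\<close> is the raw memory below \<open>V\<close>; all other arrays live above \<open>V\<close>.\<close>

definition adr :: "nat \<Rightarrow> nat \<Rightarrow> nat \<Rightarrow> nat \<Rightarrow> nat" where
  "adr V a i j = (if a = 0 then i mod V else V + prod_encode (a, prod_encode (i, j)))"

text \<open>The code of the two indices comes first and is moved to register d + 1, where the array
  number is paired with it; register 1 holds V.\<close>

definition adc :: "nat \<Rightarrow> nat \<Rightarrow> instr list" where
  "adc a d = (if a = 0 then [NOp Mod d d 1] else
     penc d @ [NConst (d+2) 0, NOp Plus (d+1) d (d+2), NConst d a] @ penc d @ [NOp Plus d 1 d])"

text \<open>Registers are used as a stack: the value ends in word or real register \<open>d\<close>,
  everything below \<open>d\<close> survives, and a second operand is evaluated at d + 1.\<close>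

primrec cn :: "nexp \<Rightarrow> nat \<Rightarrow> com" and cr :: "rexp \<Rightarrow> nat \<Rightarrow> com" where
  "cn (C k) d = blk [NConst d k]"
| "cn VX d = blk [NConst d 0, NOp Plus d 2 d]"
| "cn VY d = blk [NConst d 0, NOp Plus d 3 d]"
| "cn (Op f a b) d = Seq (cn a d) (Seq (cn b (d+1)) (blk [NOp f d d (d+1)]))"
| "cn (Rd a i j) d = Seq (cn i d) (Seq (cn j (d+1)) (Seq (blk (adc a d)) (Do (NLoad d d))))"
| "cn (Ls a b) d = Seq (cn a d) (Seq (cn b (d+1))
     (If (NLess d (d+1)) (blk [NConst d 1]) (blk [NConst d 0])))"
| "cn (RLs a b) d = Seq (cr a d) (Seq (cr b (d+1))
     (If (RLess d (d+1)) (blk [NConst d 1]) (blk [NConst d 0])))"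
| "cn (Cond c a b) d = Seq (cn c d) (Seq (blk [NConst (d+1) 0]) (If (NEq d (d+1)) (cn b d) (cn a d)))"
| "cr RZ d = blk [RZero d]"
| "cr (RRd a i j) d = Seq (cn i d) (Seq (cn j (d+1)) (Seq (blk (adc a d)) (Do (RLoad d d))))"
| "cr (RAd a b) d = Seq (cr a d) (Seq (cr b (d+1)) (Do (RAdd d d (d+1))))"
| "cr (RCond c a b) d = Seq (cn c d) (Seq (blk [NConst (d+1) 0]) (If (NEq d (d+1)) (cr b d) (cr a d)))"

fun stp :: "nat \<Rightarrow> instr list \<Rightarrow> state \<Rightarrow> state option" where
  "stp B [] s = Some s"
| "stp B (i # l) s = (case step B i s of None \<Rightarrow> None | Some t \<Rightarrow> stp B l t)"

fun alu :: "instr \<Rightarrow> bool" where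
  "alu (NConst x k) = True"
| "alu (NOp f x y z) = True"
| "alu (RZero x) = True"
| "alu _ = False"

lemma exec_blk:
  "stp B l s = Some t \<Longrightarrow> list_all alu l \<Longrightarrow> exec B (blk l) s t {} {} (length l) (length l)"
proof (induction l arbitrary: s)
  case Nil
  then show ?case by (auto intro: exec.Skip)
next
  case (Cons i l)
  obtain s' where s': "step B i s = Some s'" "stp B l s' = Some t"
    using Cons.prems by (auto split: option.splits)
  have rw: "reads i s = {}" "writes i s = {}" using Cons.prems(2) by (cases i; simp)+
  have "exec B (blk l) s' t {} {} (length l) (length l)" using Cons s' by auto
  from exec.Seq[OF exec.Do[OF s'(1)] this] rw show ?case by simp
qed

lemma stp_append: "stp B (l @ l') s = (case stp B l s of None \<Rightarrow> None | Some t \<Rightarrow> stp B l' t)"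
  by (induction l arbitrary: s) (auto split: option.splits)

definition pw :: "nat \<Rightarrow> nat \<Rightarrow> nat" where "pw V k = V ^ k"

text \<open>The largest intermediate value is the product (a + b)(a + b + 1) before halving, whence
  the square in the requirement on \<open>B\<close>.\<close>

lemma stp_penc:
  assumes "4 \<le> d" "(nreg s d + nreg s (d+1) + 1)\<^sup>2 \<le> B" "nreg s d + nreg s (d+1) + 2 \<le> B"
  shows "\<exists>t. stp B (penc d) s = Some t \<and> nmem t = nmem s \<and> rmem t = rmem s \<and> rreg t = rreg s \<and>
    (\<forall>r<d. nreg t r = nreg s r) \<and> nreg t d = prod_encode (nreg s d, nreg s (d+1)) \<and>
    prod_encode (nreg s d, nreg s (d+1)) \<le> (nreg s d + nreg s (d+1) + 1)\<^sup>2"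
proof -
  let ?a = "nreg s d" let ?b = "nreg s (d+1)"
  have 1: "(?a + ?b) * (?a + ?b + 1) \<le> (?a + ?b + 1)\<^sup>2" by (simp add: power2_eq_square)
  have "(?a + ?b) * (?a + ?b + 1) div 2 + ?a \<le> (?a + ?b) * (?a + ?b + 1) + ?a"
    by (simp add: div_le_dividend)
  also have "\<dots> \<le> (?a + ?b + 1)\<^sup>2" by (simp add: power2_eq_square algebra_simps)
  finally have 2: "(?a + ?b) * (?a + ?b + 1) div 2 + ?a \<le> (?a + ?b + 1)\<^sup>2" .
  have 3: "prod_encode (?a, ?b) = (?a + ?b) * (?a + ?b + 1) div 2 + ?a"
    by (simp add: prod_encode_def triangle_def)
  have 4: "(?a + ?b) * (?a + ?b + 1) div 2 \<le> B" "(?a + ?b) * (?a + ?b + 1) \<le> B"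
     "(?a + ?b) * (?a + ?b + 1) div 2 + ?a \<le> B"
    using 1 2 assms(2) by linarith+
  show ?thesis
    unfolding 3 using assms(1,3) 2 4 by (simp add: penc_def set_nreg_def algebra_simps)
qed

text \<open>Cantor pairing is at most quadratic, so two nested pairings of numbers polynomial in V
  stay polynomial in V. The exponents that arise are all below 32 (p + q + a + 1), the measure
  charged for a read access.\<close>

lemma adr_bound:
  assumes "2 \<le> V" "i \<le> V ^ p" "j \<le> V ^ q"
  shows "i + j + 2 \<le> V ^ (p + q + 2)" "(i + j + 1)\<^sup>2 \<le> V ^ (2 * (p + q + 2))"
    "a + prod_encode (i, j) + 2 \<le> V ^ (2 * (p + q + 2) + a + 2)"
    "(a + prod_encode (i, j) + 1)\<^sup>2 \<le> V ^ (2 * (2 * (p + q + 2) + a + 2))"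
    "adr V a i j \<le> V ^ (2 * (2 * (p + q + 2) + a + 2) + 1)"
proof -
  have s: "x + y + 2 \<le> V ^ (k + l + 2)" if "x \<le> V ^ k" "y \<le> V ^ l" for x y k l :: nat
  proof -
    have k: "1 \<le> V ^ k" "1 \<le> V ^ l" using assms(1) by auto
    have "x + y + 2 \<le> V ^ k + V ^ l + 2" using that by simp
    also have "\<dots> \<le> 2 * (2 * (V ^ k * V ^ l))"
    proof -
      obtain u v where "V ^ k = Suc u" "V ^ l = Suc v" using k by (metis Suc_le_D One_nat_def)
      then show ?thesis by simp
    qed
    also have "\<dots> \<le> V * (V * (V ^ k * V ^ l))" using assms(1) by (intro mult_le_mono) auto
    also have "\<dots> = V ^ (k + l + 2)" by (simp add: power_add power2_eq_square)
    finally show ?thesis .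
  qed
  show 1: "i + j + 2 \<le> V ^ (p + q + 2)" by (rule s) fact+
  show 2: "(i + j + 1)\<^sup>2 \<le> V ^ (2 * (p + q + 2))"
    using power_mono[of "i + j + 1" "V ^ (p+q+2)" 2] 1 power_even_eq[of V "p+q+2"] by linarith
  have pe: "prod_encode (i, j) \<le> (i + j + 1)\<^sup>2"
  proof -
    have "prod_encode (i, j) \<le> (i + j) * (i + j + 1) + i"
      by (simp add: prod_encode_def triangle_def)
    also have "\<dots> \<le> (i + j + 1)\<^sup>2" by (simp add: power2_eq_square algebra_simps)
    finally show ?thesis .
  qed
  have a: "a \<le> V ^ a"
    using less_exp[of a] power_mono[OF assms(1), of a] by linarith
  have "prod_encode (i, j) + a + 2 \<le> V ^ (2 * (p + q + 2) + a + 2)"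
    by (rule s) (use 2 pe a in linarith)+
  then show 3: "a + prod_encode (i, j) + 2 \<le> V ^ (2 * (p + q + 2) + a + 2)" by simp
  show 4: "(a + prod_encode (i, j) + 1)\<^sup>2 \<le> V ^ (2 * (2 * (p + q + 2) + a + 2))"
    using power_mono[of "a + prod_encode (i, j) + 1" "V ^ (2 * (p + q + 2) + a + 2)" 2] 3
      power_even_eq[of V "2 * (p + q + 2) + a + 2"] by linarith
  let ?z = "prod_encode (i, j)" let ?K = "2 * (2 * (p + q + 2) + a + 2)"
  have "prod_encode (a, ?z) \<le> (a + ?z) * (a + ?z + 1) + a"
    by (simp add: prod_encode_def triangle_def)
  also have "\<dots> \<le> (a + ?z + 1)\<^sup>2" by (simp add: power2_eq_square algebra_simps)
  finally have 5: "prod_encode (a, ?z) \<le> V ^ ?K" using 4 by linarith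
  have 6: "V \<le> V ^ ?K" using self_le_power[of V ?K] assms(1) by simp
  have "V + V ^ ?K \<le> V * V ^ ?K"
  proof -
    have "V + V ^ ?K \<le> 2 * V ^ ?K" using 6 by simp
    also have "\<dots> \<le> V * V ^ ?K" using assms(1) by simp
    finally show ?thesis .
  qed
  moreover have "i mod V \<le> V" using assms(1) by (simp add: less_imp_le)
  ultimately show "adr V a i j \<le> V ^ (?K + 1)" using 5 unfolding adr_def by auto
qed

lemma stp_adc:
  assumes "4 \<le> d" "2 \<le> V" "nreg s 1 = V" "nreg s d \<le> V ^ p" "nreg s (d+1) \<le> V ^ q"
    "V ^ (32 * (p + q + a + 1)) \<le> B" "1 \<le> p" "1 \<le> q"
  shows "\<exists>t. stp B (adc a d) s = Some t \<and> nmem t = nmem s \<and> rmem t = rmem s \<and> rreg t = rreg s \<and>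
    (\<forall>r<d. nreg t r = nreg s r) \<and> nreg t d = adr V a (nreg s d) (nreg s (d+1))"
proof (cases "a = 0")
  case True
  have "V \<le> V ^ (32 * (p + q + a + 1))" using assms(2) by (intro self_le_power) auto
  moreover have "nreg s d mod V \<le> V" using assms(2) by (simp add: less_imp_le)
  ultimately have "nreg s d mod V \<le> B" using assms(6) by linarith
  then show ?thesis using True assms by (simp add: adc_def adr_def set_nreg_def)
next
  case False
  have B: "V ^ k \<le> B" if "k \<le> 32 * (p + q + a + 1)" for k
    using power_increasing[OF that, of V] assms(2,6) by linarith
  note b = adr_bound(1,2)[OF assms(2,4,5)] adr_bound(3-5)[OF assms(2,4,5), of a]
  obtain s1 where s1: "stp B (penc d) s = Some s1" "nmem s1 = nmem s" "rmem s1 = rmem s"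
     "rreg s1 = rreg s" "\<forall>r<d. nreg s1 r = nreg s r" "nreg s1 d = prod_encode (nreg s d, nreg s (d+1))"
    using stp_penc[OF assms(1), of s B] b(1,2) B[of "p+q+2"] B[of "2*(p+q+2)"] by auto
  define s2 where "s2 = s1\<lparr>nreg := ((nreg s1)(d+2 := 0, d+1 := nreg s1 d, d := a))\<rparr>"
  have le: "nreg s1 d \<le> B" "a \<le> B"
    using b(3) B[of "2 * (p + q + 2) + a + 2"] s1(6) by auto
  have 2: "stp B [NConst (d+2) 0, NOp Plus (d+1) d (d+2), NConst d a] s1 = Some s2"
    using le by (simp add: s2_def set_nreg_def)
  obtain s3 where s3: "stp B (penc d) s2 = Some s3" "nmem s3 = nmem s2" "rmem s3 = rmem s2"
     "rreg s3 = rreg s2" "\<forall>r<d. nreg s3 r = nreg s2 r"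
     "nreg s3 d = prod_encode (a, prod_encode (nreg s d, nreg s (d+1)))"
    using stp_penc[OF assms(1), of s2 B] b(3,4) B[of "2 * (p + q + 2) + a + 2"]
      B[of "2*(2 * (p + q + 2) + a + 2)"] s1(6) by (auto simp: s2_def)
  have r1: "nreg s3 (Suc 0) = V" using s3(5) s1(5) assms(1,3) by (simp add: s2_def)
  have le3: "V + nreg s3 d \<le> B"
    using b(5) B[of "2*(2 * (p + q + 2) + a + 2)+1"] s3(6) False by (simp add: adr_def)
  show ?thesis
    using False s1 2 s3 r1 le3 le[unfolded s1(6)] assms(1)
    by (simp add: adc_def stp_append set_nreg_def adr_def s2_def)
qed

lemma alu_penc: "list_all alu (penc d)" by (simp add: penc_def)

lemma exec_adc:
  assumes "4 \<le> d" "2 \<le> V" "nreg s 1 = V" "nreg s d \<le> V ^ p" "nreg s (d+1) \<le> V ^ q"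
    "V ^ (32 * (p + q + a + 1)) \<le> B" "1 \<le> p" "1 \<le> q"
  shows "\<exists>t w. exec B (blk (adc a d)) s t {} {} w w \<and> w \<le> 18 \<and> nmem t = nmem s \<and> rmem t = rmem s \<and>
    rreg t = rreg s \<and> (\<forall>r<d. nreg t r = nreg s r) \<and> nreg t d = adr V a (nreg s d) (nreg s (d+1))"
proof -
  obtain t where t: "stp B (adc a d) s = Some t" "nmem t = nmem s" "rmem t = rmem s"
    "rreg t = rreg s" "\<forall>r<d. nreg t r = nreg s r" "nreg t d = adr V a (nreg s d) (nreg s (d+1))"
    using stp_adc[OF assms] by blast
  have "list_all alu (adc a d)" by (simp add: adc_def alu_penc)
  from exec_blk[OF t(1) this] t show ?thesis
    by (intro exI[of _ t] exI[of _ "length (adc a d)"]) (simp add: adc_def penc_def)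
qed

section \<open>Evaluation of compiled expressions on a memory seen as a family of arrays\<close>

definition absr :: "nat \<Rightarrow> state \<Rightarrow> store" where
  "absr V s = \<lparr>NA = (\<lambda>a i j. nmem s (adr V a i j)), RA = (\<lambda>a i j. rmem s (adr V a i j))\<rparr>"

definition locs :: "nat \<Rightarrow> nat set \<Rightarrow> loc set" where
  "locs V A = (\<Union>a\<in>A. \<Union>i j. {NLoc (adr V a i j), RLoc (adr V a i j)})"

text \<open>Pure evaluation: the write set is empty and reads stay within the arrays
  \<open>A\<close>. One number bounds both work and depth because the code is sequential.\<close>

definition evs :: "nat \<Rightarrow> nat \<Rightarrow> com \<Rightarrow> nat \<Rightarrow> state \<Rightarrow> nat set \<Rightarrow> nat \<Rightarrow> (state \<Rightarrow> bool) \<Rightarrow> bool" where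
  "evs V B c d s A g P \<longleftrightarrow> (\<exists>t R w e. exec B c s t R {} w e \<and> w \<le> g \<and> e \<le> g \<and> R \<subseteq> locs V A \<and>
     nmem t = nmem s \<and> rmem t = rmem s \<and> (\<forall>r<d. nreg t r = nreg s r) \<and> (\<forall>r<d. rreg t r = rreg s r) \<and> P t)"

lemma evs_Seq:
  assumes "evs V B c d s A g P"
    and "\<And>t. nmem t = nmem s \<Longrightarrow> rmem t = rmem s \<Longrightarrow> \<forall>r<d. nreg t r = nreg s r \<Longrightarrow>
      \<forall>r<d. rreg t r = rreg s r \<Longrightarrow> P t \<Longrightarrow> evs V B c' d' t A' g' Q"
    and "d \<le> d'" "A \<union> A' \<subseteq> A''" "g + g' \<le> g''"
  shows "evs V B (Seq c c') d s A'' g'' Q"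
proof -
  obtain t R w e where t: "exec B c s t R {} w e" "w \<le> g" "e \<le> g" "R \<subseteq> locs V A" "nmem t = nmem s"
     "rmem t = rmem s" "\<forall>r<d. nreg t r = nreg s r" "\<forall>r<d. rreg t r = rreg s r" "P t"
    using assms(1) unfolding evs_def by blast
  obtain t' R' w' e' where t': "exec B c' t t' R' {} w' e'" "w' \<le> g'" "e' \<le> g'" "R' \<subseteq> locs V A'"
     "nmem t' = nmem t" "rmem t' = rmem t" "\<forall>r<d'. nreg t' r = nreg t r" "\<forall>r<d'. rreg t' r = rreg t r" "Q t'"
    using assms(2)[OF t(5-9)] unfolding evs_def by blast
  have l: "locs V A \<union> locs V A' \<subseteq> locs V A''" using assms(4) by (auto simp: locs_def)
  have "exec B (Seq c c') s t' (R \<union> R') {} (w + w') (e + e')"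
    using exec.Seq[OF t(1) t'(1)] by simp
  then show ?thesis unfolding evs_def
    by (intro exI[of _ t'] exI[of _ "R \<union> R'"] exI[of _ "w + w'"] exI[of _ "e + e'"])
      (use t t' l assms(3,5) in auto)
qed

lemma evsI:
  "exec B c s t R {} w e \<Longrightarrow> w \<le> g \<Longrightarrow> e \<le> g \<Longrightarrow> R \<subseteq> locs V A \<Longrightarrow> nmem t = nmem s \<Longrightarrow> rmem t = rmem s \<Longrightarrow>
   \<forall>r<d. nreg t r = nreg s r \<Longrightarrow> \<forall>r<d. rreg t r = rreg s r \<Longrightarrow> P t \<Longrightarrow> evs V B c d s A g P"
  unfolding evs_def by blast

lemma evsE:
  assumes "evs V B c d s A g P"
  obtains t R w e where "exec B c s t R {} w e" "w \<le> g" "e \<le> g" "R \<subseteq> locs V A" "nmem t = nmem s"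
    "rmem t = rmem s" "\<forall>r<d. nreg t r = nreg s r" "\<forall>r<d. rreg t r = rreg s r" "P t"
  using assms unfolding evs_def by blast

lemma locs_mono: "A \<subseteq> A' \<Longrightarrow> locs V A \<subseteq> locs V A'"
  unfolding locs_def by blast

lemma evs_mono: "evs V B c d s A g P \<Longrightarrow> (\<And>t. nmem t = nmem s \<Longrightarrow> rmem t = rmem s \<Longrightarrow> P t \<Longrightarrow> Q t) \<Longrightarrow>
  d' \<le> d \<Longrightarrow> A \<subseteq> A' \<Longrightarrow> g \<le> g' \<Longrightarrow> evs V B c d' s A' g' Q"
  by (elim evsE, rule evsI, assumption) (use locs_mono[of A A' V] in auto)

lemma evs_If:
  assumes "holds b s \<Longrightarrow> evs V B c d s A g P" "\<not> holds b s \<Longrightarrow> evs V B c' d s A g P"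
  shows "evs V B (If b c c') d s A (g + 1) P"
proof (cases "holds b s")
  case True
  from assms(1)[OF this] show ?thesis
    by (rule evsE) (rule evsI, rule exec.IfTrue[OF True], assumption, auto)
next
  case False
  from assms(2)[OF this] show ?thesis
    by (rule evsE) (rule evsI, rule exec.IfFalse[OF False], assumption, auto)
qed

lemmas evs_If2 = evs_If[where g=1, simplified]

lemma evs_blk:
  assumes "stp B l s = Some t" "list_all alu l" "nmem t = nmem s" "rmem t = rmem s"
    "\<forall>r<d. nreg t r = nreg s r" "\<forall>r<d. rreg t r = rreg s r" "P t" "length l \<le> g"
  shows "evs V B (blk l) d s A g P"
  using exec_blk[OF assms(1,2)] assms(3-) unfolding evs_def by blast

lemma gn_pos: "1 \<le> gn e" "1 \<le> gr r"
  by (induction e and r) auto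

lemma vpow: "2 \<le> (V::nat) \<Longrightarrow> i \<le> j \<Longrightarrow> V ^ j \<le> B \<Longrightarrow> V ^ i \<le> B"
  using power_increasing[of i j V] by linarith

lemma nop_bound:
  assumes "2 \<le> (V::nat)" "x \<le> V ^ p" "y \<le> V ^ q"
  shows "nop_val f x y \<le> V ^ (p + q + 1)"
proof -
  have 1: "V ^ p \<le> V ^ (p + q + 1)" "V ^ p * V ^ q \<le> V ^ (p + q + 1)"
    using assms(1) by (auto intro: power_increasing simp: power_add)
  have k: "1 \<le> V ^ p" "1 \<le> V ^ q" using assms(1) by auto
  have "V ^ p + V ^ q \<le> 2 * (V ^ p * V ^ q)"
  proof -
    obtain u v where "V ^ p = Suc u" "V ^ q = Suc v" using k by (metis Suc_le_D One_nat_def)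
    then show ?thesis by simp
  qed
  also have "\<dots> \<le> V ^ (p + q + 1)" using assms(1) by (simp add: power_add)
  finally have 2: "V ^ p + V ^ q \<le> V ^ (p + q + 1)" .
  have 3: "x * y \<le> V ^ p * V ^ q" by (intro mult_le_mono assms)
  have 4: "x div y \<le> x" "x mod y \<le> x" by auto
  have 5: "x \<le> V ^ (p + q + 1)" "x * y \<le> V ^ (p + q + 1)" "x + y \<le> V ^ (p + q + 1)"
    using 1 2 3 assms by linarith+
  show ?thesis
    by (cases f) (use 4 5 in \<open>auto intro: order_trans[OF diff_le_self] order_trans[OF 4(1)] order_trans[OF 4(2)]\<close>)
qed

text \<open>Processor numbers may exceed the bound V on stored words; the exponent 4 is the one that
  \<open>gn\<close> charges for them.\<close>

definition envok :: "nat \<Rightarrow> state \<Rightarrow> nat \<Rightarrow> nat \<Rightarrow> bool" where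
  "envok V s x y \<longleftrightarrow> nreg s 1 = V \<and> nreg s 2 = x \<and> nreg s 3 = y \<and> x \<le> V^4 \<and> y \<le> V^4 \<and> (\<forall>a. nmem s a < V)"

lemma envok_step: "envok V s x y \<Longrightarrow> nmem t = nmem s \<Longrightarrow> \<forall>r<d. nreg t r = nreg s r \<Longrightarrow> 4 \<le> d \<Longrightarrow> envok V t x y"
  by (auto simp: envok_def)

lemma absr_step: "nmem t = nmem s \<Longrightarrow> rmem t = rmem s \<Longrightarrow> absr V t = absr V s"
  by (auto simp: absr_def)

text \<open>The contract of compiled code. Only word expressions carry a size bound, as the machine
  does not limit reals.\<close>

definition nok where "nok V B u x y g e \<longleftrightarrow> (\<forall>s d. 4 \<le> d \<and> envok V s x y \<and> absr V s = u \<longrightarrow>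
   evs V B (cn e d) d s (arn e) g (\<lambda>t. nreg t d = nev u x y e)) \<and> nev u x y e \<le> V ^ gn e"
definition rok where "rok V B u x y g e \<longleftrightarrow> (\<forall>s d. 4 \<le> d \<and> envok V s x y \<and> absr V s = u \<longrightarrow>
   evs V B (cr e d) d s (arr e) g (\<lambda>t. rreg t d = rev u x y e))"

lemma nokD:
  "nok V B u x y g e \<Longrightarrow> 4 \<le> d \<Longrightarrow> envok V s x y \<Longrightarrow> absr V s = u \<Longrightarrow>
     evs V B (cn e d) d s (arn e) g (\<lambda>t. nreg t d = nev u x y e)"
  "nok V B u x y g e \<Longrightarrow> nev u x y e \<le> V ^ gn e"
  "rok V B u x y g r \<Longrightarrow> 4 \<le> d \<Longrightarrow> envok V s x y \<Longrightarrow> absr V s = u \<Longrightarrow>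
     evs V B (cr r d) d s (arr r) g (\<lambda>t. rreg t d = rev u x y r)"
  by (auto simp: nok_def rok_def)

text \<open>The pattern shared by the compound nodes: two evaluations, then finishing code. The
  fourth premise says that the first result depends on registers up to \<open>d\<close> only, so the
  second evaluation at d + 1 cannot spoil it.\<close>

lemma evs_two:
  assumes "\<And>s. envok V s x y \<Longrightarrow> absr V s = u \<Longrightarrow> evs V B c d s A g (P d)"
    "\<And>s. envok V s x y \<Longrightarrow> absr V s = u \<Longrightarrow> evs V B c' (d+1) s A' g' (Q (d+1))"
    "\<And>s. envok V s x y \<Longrightarrow> absr V s = u \<Longrightarrow> P d s \<Longrightarrow> Q (d+1) s \<Longrightarrow> evs V B c'' d s A'' g'' S"
    "\<And>s t. P d s \<Longrightarrow> \<forall>r<d+1. nreg t r = nreg s r \<Longrightarrow> \<forall>r<d+1. rreg t r = rreg s r \<Longrightarrow> P d t"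
    "4 \<le> d" "envok V s x y" "absr V s = u" "A \<union> A' \<union> A'' \<subseteq> AA" "g + g' + g'' \<le> gg"
  shows "evs V B (Seq c (Seq c' c'')) d s AA gg S"
proof (rule evs_Seq[OF assms(1)[OF assms(6,7)] _ _ _ ])
  fix t assume t: "nmem t = nmem s" "rmem t = rmem s" "\<forall>r<d. nreg t r = nreg s r"
     "\<forall>r<d. rreg t r = rreg s r" "P d t"
  note et = envok_step[OF assms(6) t(1,3) assms(5)]
  have at: "absr V t = u" using absr_step[OF t(1,2)] assms(7) by simp
  have "evs V B c' d t A' g' (\<lambda>t'. Q (d+1) t' \<and> P d t')"
    using assms(2)[OF et at]
  proof (rule evsE)
    fix t' R w e assume t': "exec B c' t t' R {} w e" "w \<le> g'" "e \<le> g'" "R \<subseteq> locs V A'" "nmem t' = nmem t"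
      "rmem t' = rmem t" "\<forall>r<d+1. nreg t' r = nreg t r" "\<forall>r<d+1. rreg t' r = rreg t r" "Q (d+1) t'"
    show ?thesis by (rule evsI[OF t'(1-6)]) (use t'(7-9) assms(4)[OF t(5) t'(7,8)] in auto)
  qed
  then show "evs V B (Seq c' c'') d t (A' \<union> A'') (g' + g'') S"
  proof (rule evs_Seq)
    fix t' assume t': "nmem t' = nmem t" "rmem t' = rmem t" "\<forall>r<d. nreg t' r = nreg t r"
      "\<forall>r<d. rreg t' r = rreg t r" "Q (d+1) t' \<and> P d t'"
    have "envok V t' x y" using envok_step[OF et t'(1,3)] assms(5) by simp
    moreover have "absr V t' = u" using absr_step[OF t'(1,2)] at by simp
    ultimately show "evs V B c'' d t' A'' g'' S" using t'(5) assms(3) by blast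
  qed auto
qed (use assms in auto)

text \<open>The same measure serves as step count and as exponent, so the single condition V^(gn e)
  \<le> B both prevents the code from getting stuck and fixes its cost.\<close>

lemma compile_ok:
  assumes V: "2 \<le> V" and xy: "x \<le> V^4" "y \<le> V^4" and mem: "\<And>a i j. NA u a i j < V"
  shows "V ^ gn e \<le> B \<Longrightarrow> nok V B u x y (gn e) e" "V ^ gr r \<le> B \<Longrightarrow> rok V B u x y (gr r) r"
proof (induction e and r)
  case (C k)
  have "k \<le> 2 ^ k" using less_exp[of k] by linarith
  also have "\<dots> \<le> V ^ k" using V by (intro power_mono) auto
  also have "\<dots> \<le> V ^ (k+1)" using V by (intro power_increasing) auto
  finally have k: "k \<le> V ^ (k+1)" .
  then have "k \<le> B" using C by simp
  then show ?case using k unfolding nok_def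
    by (auto intro!: evs_blk simp: set_nreg_def simp del: blk.simps)
next
  case VX
  then show ?case using xy unfolding nok_def
    by (auto intro!: evs_blk simp: set_nreg_def envok_def simp del: blk.simps)
next
  case VY
  then show ?case using xy unfolding nok_def
    by (auto intro!: evs_blk simp: set_nreg_def envok_def simp del: blk.simps)
next
  case (Op f a b)
  have B: "V ^ gn a \<le> B" "V ^ gn b \<le> B" using vpow[OF V _ Op.prems] by auto
  note 1 = Op.IH(1)[OF B(1)] and 2 = Op.IH(2)[OF B(2)]
  have nb: "nev u x y (Op f a b) \<le> V ^ gn (Op f a b)"
    using nop_bound[OF V nokD(2)[OF 1] nokD(2)[OF 2]] by simp
  then have nb': "nop_val f (nev u x y a) (nev u x y b) \<le> B" using Op.prems by simp
  show ?case unfolding nok_def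
  proof (intro conjI allI impI nb)
    fix s :: state and d :: nat assume s: "4 \<le> d \<and> envok V s x y \<and> absr V s = u"
    show "evs V B (cn (Op f a b) d) d s (arn (Op f a b)) (gn (Op f a b)) (\<lambda>t. nreg t d = nev u x y (Op f a b))"
      unfolding cn.simps
      by (rule evs_two[where P="\<lambda>d t. nreg t d = nev u x y a" and Q="\<lambda>d t. nreg t d = nev u x y b"
            and A = "arn a" and A' = "arn b" and A'' = "{}" and g = "gn a" and g' = "gn b" and g'' = 1])
        (use s nokD(1)[OF 1, of d] nokD(1)[OF 2, of "d+1"] nb' in
          \<open>auto intro!: evs_blk simp: set_nreg_def simp del: blk.simps\<close>)
  qed
next
  case (Rd a i j)
  have B: "V ^ gn i \<le> B" "V ^ gn j \<le> B" using vpow[OF V _ Rd.prems] by auto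
  note 1 = Rd.IH(1)[OF B(1)] and 2 = Rd.IH(2)[OF B(2)]
  have "NA u a (nev u x y i) (nev u x y j) < V" using mem by blast
  moreover have "V \<le> V ^ gn (Rd a i j)" using V by (intro self_le_power) auto
  ultimately have nb: "nev u x y (Rd a i j) \<le> V ^ gn (Rd a i j)" by simp
  show ?case unfolding nok_def
  proof (intro conjI allI impI nb)
    fix s :: state and d :: nat assume s: "4 \<le> d \<and> envok V s x y \<and> absr V s = u"
    show "evs V B (cn (Rd a i j) d) d s (arn (Rd a i j)) (gn (Rd a i j)) (\<lambda>t. nreg t d = nev u x y (Rd a i j))"
      unfolding cn.simps
    \<comment> \<open>19 is the length 18 of the address code plus the load.\<close>
    proof (rule evs_two[where P="\<lambda>d t. nreg t d = nev u x y i" and Q="\<lambda>d t. nreg t d = nev u x y j"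
            and A = "arn i" and A' = "arn j" and A'' = "{a}" and g = "gn i" and g' = "gn j" and g'' = 19])
      fix s assume e: "envok V s x y" "absr V s = u" "nreg s d = nev u x y i" "nreg s (d+1) = nev u x y j"
      obtain t w where t: "exec B (blk (adc a d)) s t {} {} w w" "w \<le> 18" "nmem t = nmem s" "rmem t = rmem s"
         "rreg t = rreg s" "\<forall>r<d. nreg t r = nreg s r" "nreg t d = adr V a (nreg s d) (nreg s (d+1))"
        using exec_adc[of d V s "gn i" "gn j" a B] e(1,3,4) nokD(2)[OF 1] nokD(2)[OF 2] s V Rd.prems gn_pos
        by (auto simp: envok_def)
      have v: "nmem t (nreg t d) = nev u x y (Rd a i j)"
        using e t(3,7) by (auto simp: absr_def)
      have "nev u x y (Rd a i j) \<le> B" using nb Rd.prems by linarith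
      then have "step B (NLoad d d) t = Some (t\<lparr>nreg := (nreg t)(d := nev u x y (Rd a i j))\<rparr>)"
        using v by (simp add: set_nreg_def)
      from exec.Seq[OF t(1) exec.Do[OF this]] t e
      show "evs V B (Seq (blk (adc a d)) (Do (NLoad d d))) d s {a} 19 (\<lambda>t. nreg t d = nev u x y (Rd a i j))"
        unfolding evs_def by (auto simp: locs_def intro!: exI)
    qed (use s nokD(1)[OF 1, of d] nokD(1)[OF 2, of "d+1"] in auto)
  qed
next
  case (Ls a b)
  have B: "V ^ gn a \<le> B" "V ^ gn b \<le> B" "V \<le> B"
    using vpow[OF V _ Ls.prems] vpow[OF V _ Ls.prems, of 1] by auto
  note 1 = Ls.IH(1)[OF B(1)] and 2 = Ls.IH(2)[OF B(2)]
  have nb: "nev u x y (Ls a b) \<le> V ^ gn (Ls a b)" using V by simp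
  show ?case unfolding nok_def
  proof (intro conjI allI impI nb)
    fix s :: state and d :: nat assume s: "4 \<le> d \<and> envok V s x y \<and> absr V s = u"
    show "evs V B (cn (Ls a b) d) d s (arn (Ls a b)) (gn (Ls a b)) (\<lambda>t. nreg t d = nev u x y (Ls a b))"
      unfolding cn.simps
      by (rule evs_two[where P="\<lambda>d t. nreg t d = nev u x y a" and Q="\<lambda>d t. nreg t d = nev u x y b"
            and A = "arn a" and A' = "arn b" and A'' = "{}" and g = "gn a" and g' = "gn b" and g'' = "1+1"])
        (use s nokD(1)[OF 1, of d] nokD(1)[OF 2, of "d+1"] B(3) V in
          \<open>auto intro!: evs_blk evs_If2 simp: set_nreg_def simp del: blk.simps\<close>)
  qed
next
  case (RLs a b)
  have B: "V ^ gr a \<le> B" "V ^ gr b \<le> B" "V \<le> B"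
    using vpow[OF V _ RLs.prems] vpow[OF V _ RLs.prems, of 1] by auto
  note 1 = RLs.IH(1)[OF B(1)] and 2 = RLs.IH(2)[OF B(2)]
  have nb: "nev u x y (RLs a b) \<le> V ^ gn (RLs a b)" using V by simp
  show ?case unfolding nok_def
  proof (intro conjI allI impI nb)
    fix s :: state and d :: nat assume s: "4 \<le> d \<and> envok V s x y \<and> absr V s = u"
    show "evs V B (cn (RLs a b) d) d s (arn (RLs a b)) (gn (RLs a b)) (\<lambda>t. nreg t d = nev u x y (RLs a b))"
      unfolding cn.simps
      by (rule evs_two[where P="\<lambda>d t. rreg t d = rev u x y a" and Q="\<lambda>d t. rreg t d = rev u x y b"
            and A = "arr a" and A' = "arr b" and A'' = "{}" and g = "gr a" and g' = "gr b" and g'' = "1+1"])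
        (use s nokD(3)[OF 1, of d] nokD(3)[OF 2, of "d+1"] B(3) V in
          \<open>auto intro!: evs_blk evs_If2 simp: set_nreg_def simp del: blk.simps\<close>)
  qed
next
  case (Cond c a b)
  have B: "V ^ gn a \<le> B" "V ^ gn b \<le> B" "V ^ gn c \<le> B" using vpow[OF V _ Cond.prems] by auto
  note 1 = Cond.IH(1)[OF B(3)] and 2 = Cond.IH(2)[OF B(1)] and 3 = Cond.IH(3)[OF B(2)]
  have nb: "nev u x y (Cond c a b) \<le> V ^ gn (Cond c a b)"
    using nokD(2)[OF 2] nokD(2)[OF 3] V by (auto elim!: order_trans intro: power_increasing)
  show ?case unfolding nok_def
  proof (intro conjI allI impI nb)
    fix s :: state and d :: nat assume s: "4 \<le> d \<and> envok V s x y \<and> absr V s = u"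
    have wa: "evs V B (cn a d) d s (arn a \<union> arn b) (gn a + gn b) (\<lambda>t. nreg t d = nev u x y a)"
      and wb: "evs V B (cn b d) d s (arn a \<union> arn b) (gn a + gn b) (\<lambda>t. nreg t d = nev u x y b)"
      if "envok V s x y" "absr V s = u" for s
      using evs_mono[OF nokD(1)[OF 2 _ that, of d]] evs_mono[OF nokD(1)[OF 3 _ that, of d]] s by auto
    show "evs V B (cn (Cond c a b) d) d s (arn (Cond c a b)) (gn (Cond c a b)) (\<lambda>t. nreg t d = nev u x y (Cond c a b))"
      unfolding cn.simps
      by (rule evs_two[where P="\<lambda>d t. nreg t d = nev u x y c" and Q="\<lambda>d t. nreg t d = 0"
            and A = "arn c" and A' = "{}" and A'' = "arn a \<union> arn b" and g = "gn c" and g' = "1" and g'' = "(gn a + gn b)+1"])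
        (use s nokD(1)[OF 1, of d] wa wb in
          \<open>auto intro!: evs_blk evs_If simp: set_nreg_def simp del: blk.simps One_nat_def add_2_eq_Suc add_2_eq_Suc'\<close>)
  qed
next
  case RZ
  then show ?case unfolding rok_def
    by (auto simp: set_rreg_def intro!: evs_blk simp del: blk.simps)
next
  case (RRd a i j)
  have B: "V ^ gn i \<le> B" "V ^ gn j \<le> B" using vpow[OF V _ RRd.prems] by auto
  note 1 = RRd.IH(1)[OF B(1)] and 2 = RRd.IH(2)[OF B(2)]
  show ?case unfolding rok_def
  proof (intro conjI allI impI)
    fix s :: state and d :: nat assume s: "4 \<le> d \<and> envok V s x y \<and> absr V s = u"
    show "evs V B (cr (RRd a i j) d) d s (arr (RRd a i j)) (gr (RRd a i j)) (\<lambda>t. rreg t d = rev u x y (RRd a i j))"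
      unfolding cr.simps
    proof (rule evs_two[where P="\<lambda>d t. nreg t d = nev u x y i" and Q="\<lambda>d t. nreg t d = nev u x y j"
            and A = "arn i" and A' = "arn j" and A'' = "{a}" and g = "gn i" and g' = "gn j" and g'' = 19])
      fix s assume e: "envok V s x y" "absr V s = u" "nreg s d = nev u x y i" "nreg s (d+1) = nev u x y j"
      obtain t w where t: "exec B (blk (adc a d)) s t {} {} w w" "w \<le> 18" "nmem t = nmem s" "rmem t = rmem s"
         "rreg t = rreg s" "\<forall>r<d. nreg t r = nreg s r" "nreg t d = adr V a (nreg s d) (nreg s (d+1))"
        using exec_adc[of d V s "gn i" "gn j" a B] e(1,3,4) nokD(2)[OF 1] nokD(2)[OF 2] s V RRd.prems gn_pos
        by (auto simp: envok_def)
      have v: "rmem t (nreg t d) = rev u x y (RRd a i j)"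
        using e t(4,7) by (auto simp: absr_def)
      then have "step B (RLoad d d) t = Some (t\<lparr>rreg := (rreg t)(d := rev u x y (RRd a i j))\<rparr>)"
        by (simp add: set_rreg_def)
      from exec.Seq[OF t(1) exec.Do[OF this]] t e
      show "evs V B (Seq (blk (adc a d)) (Do (RLoad d d))) d s {a} 19 (\<lambda>t. rreg t d = rev u x y (RRd a i j))"
        unfolding evs_def by (auto simp: locs_def intro!: exI)
    qed (use s nokD(1)[OF 1, of d] nokD(1)[OF 2, of "d+1"] in auto)
  qed
next
  case (RAd a b)
  have B: "V ^ gr a \<le> B" "V ^ gr b \<le> B" using vpow[OF V _ RAd.prems] by auto
  note 1 = RAd.IH(1)[OF B(1)] and 2 = RAd.IH(2)[OF B(2)]
  show ?case unfolding rok_def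
  proof (intro conjI allI impI)
    fix s :: state and d :: nat assume s: "4 \<le> d \<and> envok V s x y \<and> absr V s = u"
    show "evs V B (cr (RAd a b) d) d s (arr (RAd a b)) (gr (RAd a b)) (\<lambda>t. rreg t d = rev u x y (RAd a b))"
      unfolding cr.simps
    proof (rule evs_two[where P="\<lambda>d t. rreg t d = rev u x y a" and Q="\<lambda>d t. rreg t d = rev u x y b"
            and A = "arr a" and A' = "arr b" and A'' = "{}" and g = "gr a" and g' = "gr b" and g'' = "1"])
      fix s assume e: "envok V s x y" "absr V s = u" "rreg s d = rev u x y a" "rreg s (d+1) = rev u x y b"
      then have "step B (RAdd d d (d+1)) s = Some (s\<lparr>rreg := (rreg s)(d := rev u x y (RAd a b))\<rparr>)"
        by (simp add: set_rreg_def)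
      from exec.Do[OF this]
      show "evs V B (Do (RAdd d d (d+1))) d s {} 1 (\<lambda>t. rreg t d = rev u x y (RAd a b))"
        unfolding evs_def by (auto simp: locs_def intro!: exI)
    qed (use s nokD(3)[OF 1, of d] nokD(3)[OF 2, of "d+1"] in auto)
  qed
next
  case (RCond c a b)
  have B: "V ^ gr a \<le> B" "V ^ gr b \<le> B" "V ^ gn c \<le> B" using vpow[OF V _ RCond.prems] by auto
  note 1 = RCond.IH(1)[OF B(3)] and 2 = RCond.IH(2)[OF B(1)] and 3 = RCond.IH(3)[OF B(2)]
  show ?case unfolding rok_def
  proof (intro conjI allI impI)
    fix s :: state and d :: nat assume s: "4 \<le> d \<and> envok V s x y \<and> absr V s = u"
    have wa: "evs V B (cr a d) d s (arr a \<union> arr b) (gr a + gr b) (\<lambda>t. rreg t d = rev u x y a)"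
      and wb: "evs V B (cr b d) d s (arr a \<union> arr b) (gr a + gr b) (\<lambda>t. rreg t d = rev u x y b)"
      if "envok V s x y" "absr V s = u" for s
      using evs_mono[OF nokD(3)[OF 2 _ that, of d]] evs_mono[OF nokD(3)[OF 3 _ that, of d]] s by auto
    show "evs V B (cr (RCond c a b) d) d s (arr (RCond c a b)) (gr (RCond c a b)) (\<lambda>t. rreg t d = rev u x y (RCond c a b))"
      unfolding cr.simps
      by (rule evs_two[where P="\<lambda>d t. nreg t d = nev u x y c" and Q="\<lambda>d t. nreg t d = 0"
            and A = "arn c" and A' = "{}" and A'' = "arr a \<union> arr b" and g = "gn c" and g' = "1" and g'' = "(gr a + gr b)+1"])
        (use s nokD(1)[OF 1, of d] wa wb in
          \<open>auto intro!: evs_blk evs_If simp: set_nreg_def simp del: blk.simps One_nat_def add_2_eq_Suc add_2_eq_Suc'\<close>)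
  qed
qed


section \<open>Parallel assignments and loops with cost\<close>

text \<open>Array 0 occupies the addresses below V and sees its first index modulo V only; the other
  arrays start at V and are kept apart by the injective pairing.\<close>

lemma adr_eq:
  "0 < V \<Longrightarrow> adr V a i j = adr V b k l \<longleftrightarrow> a = b \<and> (if a = 0 then i mod V = k mod V else i = k \<and> j = l)"
proof -
  assume V: "0 < V"
  then have "x mod V < V" for x by simp
  then have "x mod V \<noteq> V + y" for x y by (metis not_add_less1)
  then have "x mod V \<noteq> V + y" "V + y \<noteq> x mod V" for x y by metis+
  then show ?thesis by (auto simp: adr_def)
qed

text \<open>The write sets \<open>Wf\<close> are prescribed and all reads lie in one set
  \<open>L\<close>, so freedom from conflicts can be checked without inspecting the runs.\<close>

lemma par_lem:
  fixes s :: state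
  assumes k: "nreg s q = k"
    and ex: "\<And>y. y < k \<Longrightarrow> \<exists>t R w e. exec B c (s\<lparr>nreg := (nreg s)(p := y)\<rparr>) t R (Wf y) w e \<and> R \<subseteq> L \<and>
      w \<le> wb y \<and> e \<le> eb \<and> (\<forall>a. NLoc a \<in> Wf y \<longrightarrow> gN y a (nmem t a)) \<and> (\<forall>a. RLoc a \<in> Wf y \<longrightarrow> gR y a (rmem t a))"
    and dis: "\<And>y z. y < k \<Longrightarrow> z < k \<Longrightarrow> y \<noteq> z \<Longrightarrow> Wf y \<inter> (L \<union> Wf z) = {}"
  shows "\<exists>t R w e. exec B (Par p q c) s t R (\<Union>y<k. Wf y) w e \<and> R \<subseteq> L \<and> w \<le> 1 + k + (\<Sum>y<k. wb y) \<and>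
     e \<le> 1 + eb \<and> nreg t = nreg s \<and> rreg t = rreg s \<and>
     (\<forall>y<k. \<forall>a. NLoc a \<in> Wf y \<longrightarrow> gN y a (nmem t a)) \<and> (\<forall>y<k. \<forall>a. RLoc a \<in> Wf y \<longrightarrow> gR y a (rmem t a)) \<and>
     (\<forall>a. NLoc a \<notin> (\<Union>y<k. Wf y) \<longrightarrow> nmem t a = nmem s a) \<and> (\<forall>a. RLoc a \<notin> (\<Union>y<k. Wf y) \<longrightarrow> rmem t a = rmem s a)"
proof -
  define Pr where "Pr = (\<lambda>y t R w e. exec B c (s\<lparr>nreg := (nreg s)(p := y)\<rparr>) t R (Wf y) w e \<and> R \<subseteq> L \<and>
      w \<le> wb y \<and> e \<le> eb \<and> (\<forall>a. NLoc a \<in> Wf y \<longrightarrow> gN y a (nmem t a)) \<and> (\<forall>a. RLoc a \<in> Wf y \<longrightarrow> gR y a (rmem t a)))"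
  have "\<exists>t R w e. Pr y t R w e" if "y < k" for y using ex[OF that] by (simp add: Pr_def)
  then obtain T R w e where "\<And>y. y < k \<Longrightarrow> Pr y (T y) (R y) (w y) (e y)" by metis
  then have x: "\<And>y. y < k \<Longrightarrow> exec B c (s\<lparr>nreg := (nreg s)(p := y)\<rparr>) (T y) (R y) (Wf y) (w y) (e y)"
    "\<And>y. y < k \<Longrightarrow> R y \<subseteq> L" "\<And>y. y < k \<Longrightarrow> w y \<le> wb y" "\<And>y. y < k \<Longrightarrow> e y \<le> eb"
    "\<And>y a. y < k \<Longrightarrow> NLoc a \<in> Wf y \<Longrightarrow> gN y a (nmem (T y) a)"
    "\<And>y a. y < k \<Longrightarrow> RLoc a \<in> Wf y \<Longrightarrow> gR y a (rmem (T y) a)"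
    unfolding Pr_def by blast+
  have E: "exec B (Par p q c) s (join k T Wf s) (\<Union>i<k. R i) (\<Union>i<k. Wf i) (1 + k + (\<Sum>i<k. w i))
      (1 + Max (insert 0 (e ` {..<k})))"
    by (rule exec.Par) (use k x(1,2) dis in \<open>auto simp: disjoint_iff, blast+\<close>)
  \<comment> \<open>Disjointness gives every written location a single owner, and this is the one
    that the \<open>LEAST\<close> in \<open>join\<close> picks.\<close>
  have un: "(LEAST i. i < k \<and> l \<in> Wf i) = y" if "y < k" "l \<in> Wf y" for l y
  proof (rule Least_equality)
    fix z assume "z < k \<and> l \<in> Wf z"
    then have "z = y" using dis[of z y] that by blast
    then show "y \<le> z" by simp
  qed (use that in simp)
  have mx: "Max (insert 0 (e ` {..<k})) \<le> eb" using x(4) by auto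
  show ?thesis
    by (intro exI conjI, rule E)
      (use x un mx in \<open>auto simp: join_def intro!: sum_mono\<close>)
qed

lemma evs_pres: "evs V B c d s A g P \<Longrightarrow>
  evs V B c d s A g (\<lambda>t. P t \<and> (\<forall>r<d. nreg t r = nreg s r) \<and> (\<forall>r<d. rreg t r = rreg s r))"
  by (rule evsE, assumption, rule evsI, assumption) auto

definition pbody :: "nat \<Rightarrow> nexp \<Rightarrow> nexp \<Rightarrow> nexp \<Rightarrow> rexp \<Rightarrow> com" where
  "pbody a i j ne re = Seq (Seq (cn i 4) (Seq (cn j 5) (Seq (blk (adc a 4)) (Seq (cn ne 5) (cr re 6)))))
     (Seq (Do (NStore 4 5)) (Do (RStore 4 6)))"

text \<open>A ragged parallel assignment: the number of inner processors depends on the outer one,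
  so the work is the number of entries and not that of an enclosing rectangle. Each entry receives a
  word and a real at the same address. The whole program writes to shared memory only in this
  way.\<close>

definition PA :: "nat \<Rightarrow> nexp \<Rightarrow> nexp \<Rightarrow> nexp \<Rightarrow> nexp \<Rightarrow> nexp \<Rightarrow> rexp \<Rightarrow> com" where
  "PA a e1 e2 i j ne re = Seq (cn e1 4) (Par 2 4 (Seq (cn e2 4) (Par 3 4 (pbody a i j ne re))))"

definition gb :: "nat \<Rightarrow> nexp \<Rightarrow> nexp \<Rightarrow> nexp \<Rightarrow> rexp \<Rightarrow> nat" where
  "gb a i j ne re = 32 * (gn i + gn j + a + 1) + gn ne + gr re + 20"

lemma exec_pbody:
  assumes V: "2 \<le> V" and g: "V ^ gb a i j ne re \<le> B" and e: "envok V s x y" and u: "absr V s = u"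
  defines "A \<equiv> adr V a (nev u x y i) (nev u x y j)"
  shows "\<exists>t R w e. exec B (pbody a i j ne re) s t R {NLoc A, RLoc A} w e \<and>
    R \<subseteq> locs V (arn i \<union> arn j \<union> arn ne \<union> arr re) \<and> w \<le> gb a i j ne re \<and> e \<le> gb a i j ne re \<and>
    nmem t A = nev u x y ne \<and> rmem t A = rev u x y re"
proof -
  have mem: "\<And>a i j. NA u a i j < V" and xy: "x \<le> V^4" "y \<le> V^4" using e u by (auto simp: envok_def absr_def)
  note ok = compile_ok[OF V xy mem]
  have B: "V ^ gn i \<le> B" "V ^ gn j \<le> B" "V ^ gn ne \<le> B" "V ^ gr re \<le> B" "V ^ (32 * (gn i + gn j + a + 1)) \<le> B"
    using vpow[OF V _ g] by (auto simp: gb_def)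
  note i = ok(1)[OF B(1)] and j = ok(1)[OF B(2)] and ne = ok(1)[OF B(3)] and re = ok(2)[OF B(4)]
  have "evs V B (Seq (cn i 4) (Seq (cn j (4+1)) (Seq (blk (adc a 4)) (Seq (cn ne 5) (cr re 6))))) 4 s
     (arn i \<union> arn j \<union> arn ne \<union> arr re) (gn i + gn j + (18 + (gn ne + gr re)))
     (\<lambda>t. nreg t 4 = A \<and> nreg t 5 = nev u x y ne \<and> rreg t 6 = rev u x y re)"
  proof (rule evs_two[where P="\<lambda>d t. nreg t d = nev u x y i" and Q="\<lambda>d t. nreg t d = nev u x y j"
            and A = "arn i" and A' = "arn j" and A'' = "arn ne \<union> arr re" and g = "gn i" and g' = "gn j"
             and g'' = "18 + (gn ne + gr re)"])
    fix s assume e: "envok V s x y" "absr V s = u" "nreg s 4 = nev u x y i" "nreg s (4+1) = nev u x y j"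
    obtain t w where t: "exec B (blk (adc a 4)) s t {} {} w w" "w \<le> 18" "nmem t = nmem s" "rmem t = rmem s"
         "rreg t = rreg s" "\<forall>r<4. nreg t r = nreg s r" "nreg t 4 = adr V a (nreg s 4) (nreg s (4+1))"
      using exec_adc[of 4 V s "gn i" "gn j" a B] e(1,3,4) nokD(2)[OF i] nokD(2)[OF j] V B(5) gn_pos
      by (auto simp: envok_def)
    have "evs V B (blk (adc a 4)) 4 s {} 18 (\<lambda>t. nreg t 4 = A)"
      by (rule evsI[OF t(1)]) (use t e in \<open>auto simp: A_def\<close>)
    then show "evs V B (Seq (blk (adc a 4)) (Seq (cn ne 5) (cr re 6))) 4 s (arn ne \<union> arr re)
        (18 + (gn ne + gr re)) (\<lambda>t. nreg t 4 = A \<and> nreg t 5 = nev u x y ne \<and> rreg t 6 = rev u x y re)"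
    proof (rule evs_Seq)
      fix t :: state assume t: "nmem t = nmem s" "rmem t = rmem s" "\<forall>r<4. nreg t r = nreg s r" "nreg t 4 = A"
      have e': "envok V t x y" using envok_step[OF e(1) t(1,3)] by simp
      have u': "absr V t = u" using absr_step[OF t(1,2)] e(2) by simp
      show "evs V B (Seq (cn ne 5) (cr re 6)) 5 t (arn ne \<union> arr re) (gn ne + gr re)
         (\<lambda>t. nreg t 4 = A \<and> nreg t 5 = nev u x y ne \<and> rreg t 6 = rev u x y re)"
      proof (rule evs_Seq[OF evs_pres[OF nokD(1)[OF ne _ e' u']]])
        fix t' :: state assume t': "nmem t' = nmem t" "rmem t' = rmem t" "\<forall>r<5. nreg t' r = nreg t r"
          "nreg t' 5 = nev u x y ne \<and> (\<forall>r<5. nreg t' r = nreg t r) \<and> (\<forall>r<5. rreg t' r = rreg t r)"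
        have e'': "envok V t' x y" using envok_step[OF e' t'(1,3)] by simp
        have u'': "absr V t' = u" using absr_step[OF t'(1,2)] u' by simp
        show "evs V B (cr re 6) 6 t' (arr re) (gr re)
         (\<lambda>t. nreg t 4 = A \<and> nreg t 5 = nev u x y ne \<and> rreg t 6 = rev u x y re)"
          by (rule evsE[OF nokD(3)[OF re _ e'' u'', of 6]], simp, rule evsI, assumption) (use t' t in auto)
      qed auto
    qed auto
  qed (use nokD(1)[OF i, of 4] nokD(1)[OF j, of "4+1"] assms in auto)
  then obtain t R w f where t: "exec B (Seq (cn i 4) (Seq (cn j 5) (Seq (blk (adc a 4)) (Seq (cn ne 5) (cr re 6)))))
      s t R {} w f" "w \<le> gn i + gn j + (18 + (gn ne + gr re))" "f \<le> gn i + gn j + (18 + (gn ne + gr re))"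
    "R \<subseteq> locs V (arn i \<union> arn j \<union> arn ne \<union> arr re)" "nmem t = nmem s" "rmem t = rmem s"
    "nreg t 4 = A" "nreg t 5 = nev u x y ne" "rreg t 6 = rev u x y re"
    unfolding evs_def by auto
  let ?t1 = "t\<lparr>nmem := (nmem t)(A := nev u x y ne)\<rparr>"
  let ?t2 = "?t1\<lparr>rmem := (rmem t)(A := rev u x y re)\<rparr>"
  have 1: "exec B (Do (NStore 4 5)) t ?t1 {} {NLoc A} 1 1"
    using exec.Do[of B "NStore 4 5" t ?t1] t by simp
  have 2: "exec B (Do (RStore 4 6)) ?t1 ?t2 {} {RLoc A} 1 1"
    using exec.Do[of B "RStore 4 6" ?t1 ?t2] t by simp
  have 3: "exec B (pbody a i j ne re) s ?t2 R {NLoc A, RLoc A} (w + 2) (f + 2)"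
    using exec.Seq[OF t(1) exec.Seq[OF 1 2]] unfolding pbody_def by (simp add: insert_commute)
  show ?thesis by (intro exI conjI, rule 3) (use t in \<open>auto simp: gb_def\<close>)
qed

text \<open>Outside parallel loops registers 2 and 3 are 0, so scalar expressions are evaluated at x
  = y = 0.\<close>

definition okst :: "nat \<Rightarrow> state \<Rightarrow> bool" where
  "okst V s \<longleftrightarrow> nreg s 1 = V \<and> nreg s 2 = 0 \<and> nreg s 3 = 0 \<and> (\<forall>a. nmem s a < V)"

text \<open>One large constant \<open>G\<close> plays two roles: V^G bounds all intermediate words,
  and \<open>G\<close> is the number of machine steps charged per unit of cost. 10^30 exceeds the
  measure of every statement of the program.\<close>

locale machine =
  fixes V G B :: nat
  assumes V2: "2 \<le> V" and BG: "V ^ G \<le> B" and G_big: "10 ^ 30 \<le> G"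
begin

text \<open>Weakest preconditions with bounds for work and depth, both in units of \<open>G\<close>.\<close>

definition spec :: "com \<Rightarrow> store \<Rightarrow> (store \<Rightarrow> bool) \<Rightarrow> nat \<Rightarrow> nat \<Rightarrow> bool" where
  "spec c u Q w d \<longleftrightarrow> (\<forall>s. okst V s \<and> absr V s = u \<longrightarrow>
     (\<exists>t R W w' d'. exec B c s t R W w' d' \<and> okst V t \<and> Q (absr V t) \<and> w' \<le> G * w \<and> d' \<le> G * d))"

definition bdd :: "store \<Rightarrow> bool" where
  "bdd u \<longleftrightarrow> (\<forall>a i j. NA u a i j < V)"

text \<open>In an admissible state all memory words are below V, so this may be assumed of the
  initial store at no cost.\<close>

lemma spec_bdd: "(bdd u \<Longrightarrow> spec c u Q w d) \<Longrightarrow> spec c u Q w d"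
  unfolding spec_def bdd_def okst_def absr_def by auto

lemma specI: "(\<And>s. okst V s \<Longrightarrow> absr V s = u \<Longrightarrow>
    \<exists>t R W w' d'. exec B c s t R W w' d' \<and> okst V t \<and> Q (absr V t) \<and> w' \<le> G * w \<and> d' \<le> G * d) \<Longrightarrow> spec c u Q w d"
  unfolding spec_def by blast

lemma specE:
  assumes "spec c u Q w d" "okst V s" "absr V s = u"
  obtains t R W w' d' where "exec B c s t R W w' d'" "okst V t" "Q (absr V t)" "w' \<le> G * w" "d' \<le> G * d"
  using assms unfolding spec_def by blast

lemma okst_bdd: "okst V s \<Longrightarrow> bdd (absr V s)"
  by (auto simp: okst_def bdd_def absr_def)

lemma spec_mono:
  assumes "spec c u Q w d" "\<And>u'. bdd u' \<Longrightarrow> Q u' \<Longrightarrow> Q' u'" "w \<le> w'" "d \<le> d'"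
  shows "spec c u Q' w' d'"
proof (rule specI)
  fix s assume "okst V s" "absr V s = u"
  from specE[OF assms(1) this] obtain t R W w1 d1
    where t: "exec B c s t R W w1 d1" "okst V t" "Q (absr V t)" "w1 \<le> G * w" "d1 \<le> G * d" .
  have le: "G * w \<le> G * w'" "G * d \<le> G * d'" using assms(3,4) by auto
  show "\<exists>t R W w'' d''. exec B c s t R W w'' d'' \<and> okst V t \<and> Q' (absr V t) \<and> w'' \<le> G * w' \<and> d'' \<le> G * d'"
    by (intro exI conjI, rule t(1)) (use t(2-5) assms(2) okst_bdd le in \<open>blast, blast, linarith+\<close>)
qed

lemma spec_Seq:
  assumes "spec c1 u (\<lambda>u'. spec c2 u' Q w2 d2) w1 d1"
  shows "spec (Seq c1 c2) u Q (w1 + w2) (d1 + d2)"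
proof (rule specI)
  fix s assume s: "okst V s" "absr V s = u"
  from specE[OF assms(1) this] obtain t R W w d
    where t: "exec B c1 s t R W w d" "okst V t" "spec c2 (absr V t) Q w2 d2" "w \<le> G * w1" "d \<le> G * d1" .
  from specE[OF t(3,2) refl] obtain t' R' W' w' d'
    where t': "exec B c2 t t' R' W' w' d'" "okst V t'" "Q (absr V t')" "w' \<le> G * w2" "d' \<le> G * d2" .
  show "\<exists>t R W w' d'. exec B (Seq c1 c2) s t R W w' d' \<and> okst V t \<and> Q (absr V t) \<and>
     w' \<le> G * (w1 + w2) \<and> d' \<le> G * (d1 + d2)"
    by (intro exI conjI, rule exec.Seq[OF t(1) t'(1)]) (use t t' in \<open>auto simp: algebra_simps\<close>)
qed

text \<open>\<open>sep\<close> expresses exclusive writing: the target array is not read by the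
  loop, unless there is at most one processor, which admits scalar updates such as v := v + 1.
  \<open>inj\<close> speaks of addresses instead of indices because array 0 ignores its second
  index.\<close>

lemma spec_PA:
  assumes r: "nev u 0 0 e1 = r" "r \<le> V^4" and k: "\<And>x. x < r \<Longrightarrow> nev u x 0 e2 \<le> V^4"
    and val: "\<And>x y. x < r \<Longrightarrow> y < nev u x 0 e2 \<Longrightarrow> nev u x y ne < V"
    and inj: "\<And>x y x' y'. x < r \<Longrightarrow> y < nev u x 0 e2 \<Longrightarrow> x' < r \<Longrightarrow> y' < nev u x' 0 e2 \<Longrightarrow>
       adr V a (nev u x y i) (nev u x y j) = adr V a (nev u x' y' i) (nev u x' y' j) \<Longrightarrow> x = x' \<and> y = y'"
    and sep: "a \<notin> arn e2 \<union> arn i \<union> arn j \<union> arn ne \<union> arr re \<or> r \<le> 1 \<and> (\<forall>x<r. nev u x 0 e2 \<le> 1)"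
    and G: "gn e1 + gn e2 + gb a i j ne re + 2 \<le> G"
    and Q: "\<And>u'. (\<And>b. b \<noteq> a \<Longrightarrow> NA u' b = NA u b \<and> RA u' b = RA u b) \<Longrightarrow>
        (\<And>x y. x < r \<Longrightarrow> y < nev u x 0 e2 \<Longrightarrow> NA u' a (nev u x y i) (nev u x y j) = nev u x y ne \<and>
            RA u' a (nev u x y i) (nev u x y j) = rev u x y re) \<Longrightarrow>
        (\<And>p q. (\<And>x y. x < r \<Longrightarrow> y < nev u x 0 e2 \<Longrightarrow> adr V a p q \<noteq> adr V a (nev u x y i) (nev u x y j)) \<Longrightarrow>
           NA u' a p q = NA u a p q \<and> RA u' a p q = RA u a p q) \<Longrightarrow> Q u'"
  shows "spec (PA a e1 e2 i j ne re) u Q (1 + r + (\<Sum>x<r. nev u x 0 e2)) 1"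
proof (rule specI)
  fix s assume s: "okst V s" "absr V s = u"
  let ?k = "\<lambda>x. nev u x 0 e2"
  define A where "A = (\<lambda>x y. adr V a (nev u x y i) (nev u x y j))"
  define g where "g = gb a i j ne re"
  define L where "L = locs V (arn e2 \<union> arn i \<union> arn j \<union> arn ne \<union> arr re)"
  have e0: "envok V s 0 0" using s by (auto simp: okst_def envok_def)
  have mem: "\<And>a i j. NA u a i j < V" using s by (auto simp: okst_def absr_def)
  have B: "V ^ gn e1 \<le> B" "V ^ gn e2 \<le> B" "V ^ g \<le> B" using vpow[OF V2 _ BG] G by (auto simp: g_def)
  have "evs V B (cn e1 4) 4 s (arn e1) (gn e1) (\<lambda>t. nreg t 4 = r)"
    using nokD(1)[OF compile_ok(1)[OF V2 _ _ mem B(1)] _ e0 s(2), of 4] r by simp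
  then obtain s1 R1 w1 d1 where s1: "exec B (cn e1 4) s s1 R1 {} w1 d1" "w1 \<le> gn e1" "d1 \<le> gn e1"
    "nmem s1 = nmem s" "rmem s1 = rmem s" "\<forall>r<4. nreg s1 r = nreg s r" "nreg s1 4 = r"
    by (rule evsE) blast
  have a1: "absr V s1 = u" using absr_step[OF s1(4,5)] s(2) by simp
  have disL: "{NLoc (A x y), RLoc (A x y)} \<inter> L = {}"
    if "x < r" "y < ?k x" "\<not> (r \<le> 1 \<and> (\<forall>x<r. ?k x \<le> 1))" for x y
  proof -
    have "a \<notin> arn e2 \<union> arn i \<union> arn j \<union> arn ne \<union> arr re" using sep that by blast
    then show ?thesis using V2 unfolding L_def locs_def A_def by (auto simp: adr_eq)
  qed
  define Wx where "Wx = (\<lambda>x. \<Union>y<?k x. {NLoc (A x y), RLoc (A x y)})"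
  define gN where "gN = (\<lambda>x b v. \<forall>y<?k x. b = A x y \<longrightarrow> v = nev u x y ne)"
  define gR where "gR = (\<lambda>x b v. \<forall>y<?k x. b = A x y \<longrightarrow> v = rev u x y re)"
  have inner: "\<exists>t R w e. exec B (Seq (cn e2 4) (Par 3 4 (pbody a i j ne re))) (s1\<lparr>nreg := (nreg s1)(2 := x)\<rparr>) t R (Wx x) w e \<and>
      R \<subseteq> L \<and> w \<le> gn e2 + (1 + ?k x + ?k x * g) \<and> e \<le> gn e2 + (1 + g) \<and>
      (\<forall>b. NLoc b \<in> Wx x \<longrightarrow> gN x b (nmem t b)) \<and> (\<forall>b. RLoc b \<in> Wx x \<longrightarrow> gR x b (rmem t b))"
    if x: "x < r" for x
  proof -
    let ?s = "s1\<lparr>nreg := (nreg s1)(2 := x)\<rparr>"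
    have e1: "envok V ?s x 0" using e0 s1(4,6) x r(2) by (auto simp: envok_def)
    have a1': "absr V ?s = u" using a1 by (auto simp: absr_def)
    have "evs V B (cn e2 4) 4 ?s (arn e2) (gn e2) (\<lambda>t. nreg t 4 = ?k x)"
      using nokD(1)[OF compile_ok(1)[OF V2 _ _ mem B(2)] _ e1 a1', of 4] x r(2) by simp
    then obtain s2 R2 w2 d2 where s2: "exec B (cn e2 4) ?s s2 R2 {} w2 d2" "w2 \<le> gn e2" "d2 \<le> gn e2"
      "R2 \<subseteq> locs V (arn e2)" "nmem s2 = nmem ?s" "rmem s2 = rmem ?s" "\<forall>r<4. nreg s2 r = nreg ?s r" "nreg s2 4 = ?k x"
      by (rule evsE) blast
    have a2: "absr V s2 = u" using absr_step[OF s2(5,6)] a1' by simp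
    have "\<exists>t R w e. exec B (Par 3 4 (pbody a i j ne re)) s2 t R (\<Union>y<?k x. {NLoc (A x y), RLoc (A x y)}) w e \<and> R \<subseteq> L \<and>
      w \<le> 1 + ?k x + (\<Sum>y<?k x. g) \<and> e \<le> 1 + g \<and> nreg t = nreg s2 \<and> rreg t = rreg s2 \<and>
      (\<forall>y<?k x. \<forall>b. NLoc b \<in> {NLoc (A x y), RLoc (A x y)} \<longrightarrow> nmem t b = nev u x y ne) \<and>
      (\<forall>y<?k x. \<forall>b. RLoc b \<in> {NLoc (A x y), RLoc (A x y)} \<longrightarrow> rmem t b = rev u x y re) \<and>
      (\<forall>b. NLoc b \<notin> (\<Union>y<?k x. {NLoc (A x y), RLoc (A x y)}) \<longrightarrow> nmem t b = nmem s2 b) \<and>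
      (\<forall>b. RLoc b \<notin> (\<Union>y<?k x. {NLoc (A x y), RLoc (A x y)}) \<longrightarrow> rmem t b = rmem s2 b)"
    proof (rule par_lem[OF s2(8), where L=L])
      fix y assume y: "y < ?k x"
      let ?t = "s2\<lparr>nreg := (nreg s2)(3 := y)\<rparr>"
      have e2: "envok V ?t x y" using e1 s2(5,7) y k[OF x] by (auto simp: envok_def)
      have a2': "absr V ?t = u" using a2 by (auto simp: absr_def)
      have "L \<supseteq> locs V (arn i \<union> arn j \<union> arn ne \<union> arr re)" unfolding L_def by (rule locs_mono) auto
      then show "\<exists>t R w e. exec B (pbody a i j ne re) ?t t R {NLoc (A x y), RLoc (A x y)} w e \<and> R \<subseteq> L \<and> w \<le> g \<and> e \<le> g \<and>
          (\<forall>b. NLoc b \<in> {NLoc (A x y), RLoc (A x y)} \<longrightarrow> nmem t b = nev u x y ne) \<and>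
          (\<forall>b. RLoc b \<in> {NLoc (A x y), RLoc (A x y)} \<longrightarrow> rmem t b = rev u x y re)"
        using exec_pbody[OF V2 B(3)[unfolded g_def] e2 a2'] unfolding A_def g_def by fastforce
    next
      fix y z assume yz: "y < ?k x" "z < ?k x" "y \<noteq> z"
      have "A x y \<noteq> A x z" using inj[OF x yz(1) x yz(2)] yz(3) unfolding A_def by blast
      moreover have "\<not> ?k x \<le> 1" using yz by linarith
      ultimately show "{NLoc (A x y), RLoc (A x y)} \<inter> (L \<union> {NLoc (A x z), RLoc (A x z)}) = {}"
        using disL[OF x yz(1)] x by auto
    qed
    then obtain t R w e where t: "exec B (Par 3 4 (pbody a i j ne re)) s2 t R (Wx x) w e" "R \<subseteq> L"
      "w \<le> 1 + ?k x + ?k x * g" "e \<le> 1 + g"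
      "\<And>y. y < ?k x \<Longrightarrow> nmem t (A x y) = nev u x y ne"
      "\<And>y. y < ?k x \<Longrightarrow> rmem t (A x y) = rev u x y re"
    proof (elim exE conjE, goal_cases)
      case (1 t R w e)
      have 2: "w \<le> 1 + ?k x + ?k x * g" using 1(4) by simp
      have 3: "exec B (Par 3 4 (pbody a i j ne re)) s2 t R (Wx x) w e" using 1(2) by (simp add: Wx_def)
      have 4: "nmem t (A x y) = nev u x y ne" "rmem t (A x y) = rev u x y re" if "y < ?k x" for y
        using 1(8)[rule_format, of y "A x y"] 1(9)[rule_format, of y "A x y"] that by simp_all
      show ?case by (rule 1(1)[OF 3 1(3) 2 1(5)]) (fact 4)+
    qed
    have R2: "R2 \<union> R \<subseteq> L" using s2(4) t(2) locs_mono[of "arn e2" _ V] unfolding L_def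
      by (meson Un_least Un_upper1 order_trans le_supI1)
    show ?thesis
      by (intro exI conjI, rule exec.Seq[OF s2(1) t(1), unfolded Un_empty_left])
        (use t s2 R2 in \<open>auto simp: gN_def gR_def Wx_def\<close>)
  qed
  have "\<exists>t R w e. exec B (Par 2 4 (Seq (cn e2 4) (Par 3 4 (pbody a i j ne re)))) s1 t R (\<Union>x<r. Wx x) w e \<and> R \<subseteq> L \<and>
     w \<le> 1 + r + (\<Sum>x<r. gn e2 + (1 + ?k x + ?k x * g)) \<and> e \<le> 1 + (gn e2 + (1 + g)) \<and> nreg t = nreg s1 \<and> rreg t = rreg s1 \<and>
     (\<forall>x<r. \<forall>b. NLoc b \<in> Wx x \<longrightarrow> gN x b (nmem t b)) \<and> (\<forall>x<r. \<forall>b. RLoc b \<in> Wx x \<longrightarrow> gR x b (rmem t b)) \<and>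
     (\<forall>b. NLoc b \<notin> (\<Union>x<r. Wx x) \<longrightarrow> nmem t b = nmem s1 b) \<and> (\<forall>b. RLoc b \<notin> (\<Union>x<r. Wx x) \<longrightarrow> rmem t b = rmem s1 b)"
  proof (rule par_lem[OF s1(7) inner])
    fix x z assume xz: "x < r" "z < r" "x \<noteq> z"
    have "A x y \<noteq> A z y'" if "y < ?k x" "y' < ?k z" for y y'
      using inj[OF xz(1) that(1) xz(2) that(2)] xz(3) unfolding A_def by blast
    moreover have "\<not> r \<le> 1" using xz by linarith
    ultimately show "Wx x \<inter> (L \<union> Wx z) = {}"
      using disL[OF xz(1)] unfolding Wx_def by (auto simp: disjoint_iff)
  qed
  then obtain t R w e where t: "exec B (Par 2 4 (Seq (cn e2 4) (Par 3 4 (pbody a i j ne re)))) s1 t R (\<Union>x<r. Wx x) w e"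
    "w \<le> 1 + r + (\<Sum>x<r. gn e2 + (1 + ?k x + ?k x * g))" "e \<le> 1 + (gn e2 + (1 + g))" "nreg t = nreg s1"
    "\<And>x y. x < r \<Longrightarrow> y < ?k x \<Longrightarrow> nmem t (A x y) = nev u x y ne"
    "\<And>x y. x < r \<Longrightarrow> y < ?k x \<Longrightarrow> rmem t (A x y) = rev u x y re"
    "\<And>b. (\<And>x y. x < r \<Longrightarrow> y < ?k x \<Longrightarrow> b \<noteq> A x y) \<Longrightarrow> nmem t b = nmem s1 b"
    "\<And>b. (\<And>x y. x < r \<Longrightarrow> y < ?k x \<Longrightarrow> b \<noteq> A x y) \<Longrightarrow> rmem t b = rmem s1 b"
  proof (elim exE conjE, goal_cases)
    case (1 t R w e)
    have A: "NLoc (A x y) \<in> Wx x" "RLoc (A x y) \<in> Wx x" if "y < ?k x" for x y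
      using that by (auto simp: Wx_def)
    have N: "nmem t (A x y) = nev u x y ne" "rmem t (A x y) = rev u x y re" if "x < r" "y < ?k x" for x y
      using 1(8)[rule_format, OF that(1) A(1)[OF that(2)]] 1(9)[rule_format, OF that(1) A(2)[OF that(2)]] that
      by (simp_all add: gN_def gR_def)
    have M: "nmem t b = nmem s1 b" "rmem t b = rmem s1 b" if "\<And>x y. x < r \<Longrightarrow> y < ?k x \<Longrightarrow> b \<noteq> A x y" for b
      using 1(10)[rule_format, of b] 1(11)[rule_format, of b] that by (auto simp: Wx_def)
    show ?case by (rule 1(1)[OF 1(2) 1(4-6)]) (use N M in blast)+
  qed
  have W: "gn e1 + (1 + r + (\<Sum>x<r. gn e2 + (1 + ?k x + ?k x * g))) \<le> G * (1 + r + (\<Sum>x<r. ?k x))"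
  proof -
    have "(\<Sum>x<r. gn e2 + (1 + ?k x + ?k x * g)) = (\<Sum>x<r. (gn e2 + 1) + (1 + g) * ?k x)"
      by (intro sum.cong refl) (simp add: algebra_simps)
    also have "\<dots> = (\<Sum>x<r. gn e2 + 1) + (1 + g) * (\<Sum>x<r. ?k x)"
      by (simp only: sum.distrib sum_distrib_left)
    also have "\<dots> = r * (gn e2 + 1) + (1 + g) * (\<Sum>x<r. ?k x)" by simp
    finally have "gn e1 + (1 + r + (\<Sum>x<r. gn e2 + (1 + ?k x + ?k x * g))) =
       (gn e1 + 1) + r * (gn e2 + 2) + (1 + g) * (\<Sum>x<r. ?k x)" by simp
    also have "\<dots> \<le> G + r * G + G * (\<Sum>x<r. ?k x)"
      by (intro add_mono mult_le_mono) (use G in \<open>auto simp: g_def\<close>)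
    finally show ?thesis by (simp add: algebra_simps)
  qed
  have ex: "exec B (PA a e1 e2 i j ne re) s t (R1 \<union> R) (\<Union>x<r. Wx x) (w1 + w) (d1 + e)"
    unfolding PA_def using exec.Seq[OF s1(1) t(1)] by simp
  have "nmem t b < V" for b
  proof (cases "\<exists>x y. x < r \<and> y < ?k x \<and> b = A x y")
    case True
    then show ?thesis using t(5) val by auto
  next
    case False
    then show ?thesis using t(7)[of b] s1(4) s(1) by (auto simp: okst_def)
  qed
  then have ok: "okst V t" using s(1) s1(6) t(4) by (auto simp: okst_def)
  have Qt: "Q (absr V t)"
  proof (rule Q)
    fix b assume b: "b \<noteq> a"
    have "adr V b p q \<noteq> A x y" for p q x y using b V2 by (auto simp: A_def adr_eq)
    then show "NA (absr V t) b = NA u b \<and> RA (absr V t) b = RA u b"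
      using t(7,8) a1 by (fastforce simp: absr_def)
  next
    fix x y assume "x < r" "y < ?k x"
    from t(5,6)[OF this] show "NA (absr V t) a (nev u x y i) (nev u x y j) = nev u x y ne \<and>
        RA (absr V t) a (nev u x y i) (nev u x y j) = rev u x y re"
      by (simp add: absr_def A_def)
  next
    fix p q assume "\<And>x y. x < r \<Longrightarrow> y < ?k x \<Longrightarrow> adr V a p q \<noteq> adr V a (nev u x y i) (nev u x y j)"
    from t(7,8)[of "adr V a p q", unfolded A_def, OF this] a1
    show "NA (absr V t) a p q = NA u a p q \<and> RA (absr V t) a p q = RA u a p q"
      by (auto simp: absr_def)
  qed
  show "\<exists>t R W w' d'. exec B (PA a e1 e2 i j ne re) s t R W w' d' \<and> okst V t \<and> Q (absr V t) \<and>
     w' \<le> G * (1 + r + (\<Sum>x<r. ?k x)) \<and> d' \<le> G * 1"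
    by (intro exI conjI, rule ex) (use Qt ok W t(2,3) s1(2,3) G in \<open>auto simp: g_def\<close>)
qed

definition setA :: "nat \<Rightarrow> nat \<Rightarrow> (nat \<Rightarrow> nat) \<Rightarrow> (nat \<Rightarrow> nat \<Rightarrow> nat) \<Rightarrow> (nat \<Rightarrow> nat \<Rightarrow> real) \<Rightarrow> store \<Rightarrow> store" where
  "setA a r k f g u = u\<lparr>
     NA := (NA u)(a := \<lambda>x y. if x < r \<and> y < k x then f x y else NA u a x y),
     RA := (RA u)(a := \<lambda>x y. if x < r \<and> y < k x then g x y else RA u a x y)\<rparr>"

lemma setA_same [simp]:
  "NA (setA a r k f g u) a x y = (if x < r \<and> y < k x then f x y else NA u a x y)"
  "RA (setA a r k f g u) a x y = (if x < r \<and> y < k x then g x y else RA u a x y)"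
  by (simp_all add: setA_def)

lemma setA_other [simp]: "b \<noteq> a \<Longrightarrow> NA (setA a r k f g u) b = NA u b" "b \<noteq> a \<Longrightarrow> RA (setA a r k f g u) b = RA u b"
  by (simp_all add: setA_def)

definition PX :: "nat \<Rightarrow> nexp \<Rightarrow> nexp \<Rightarrow> nexp \<Rightarrow> rexp \<Rightarrow> com" where
  "PX a e1 e2 ne re = PA a e1 e2 VX VY ne re"

lemma spec_PX:
  assumes r: "nev u 0 0 e1 = r" "r \<le> V^4" and k: "\<And>x. x < r \<Longrightarrow> nev u x 0 e2 = k x" "\<And>x. x < r \<Longrightarrow> k x \<le> V^4"
    and val: "\<And>x y. x < r \<Longrightarrow> y < k x \<Longrightarrow> nev u x y ne = f x y" "\<And>x y. x < r \<Longrightarrow> y < k x \<Longrightarrow> f x y < V"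
      "\<And>x y. x < r \<Longrightarrow> y < k x \<Longrightarrow> rev u x y re = g x y"
    and a: "0 < a"
    and sep: "a \<notin> arn e2 \<union> arn ne \<union> arr re \<or> r \<le> 1 \<and> (\<forall>x<r. k x \<le> 1)"
    and G: "gn e1 + gn e2 + gb a VX VY ne re + 2 \<le> 10 ^ 30"
    and Q: "Q (setA a r k f g u)"
  shows "spec (PX a e1 e2 ne re) u Q (1 + r + (\<Sum>x<r. k x)) 1"
proof -
  have "spec (PX a e1 e2 ne re) u Q (1 + r + (\<Sum>x<r. nev u x 0 e2)) 1"
    unfolding PX_def
  proof (rule spec_PA[OF r])
    fix u' :: store assume u': "\<And>b. b \<noteq> a \<Longrightarrow> NA u' b = NA u b \<and> RA u' b = RA u b"
      "\<And>x y. x < r \<Longrightarrow> y < nev u x 0 e2 \<Longrightarrow> NA u' a (nev u x y VX) (nev u x y VY) = nev u x y ne \<and>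
            RA u' a (nev u x y VX) (nev u x y VY) = rev u x y re"
      "\<And>p q. (\<And>x y. x < r \<Longrightarrow> y < nev u x 0 e2 \<Longrightarrow> adr V a p q \<noteq> adr V a (nev u x y VX) (nev u x y VY)) \<Longrightarrow>
           NA u' a p q = NA u a p q \<and> RA u' a p q = RA u a p q"
    have 1: "NA u' a p q = f p q \<and> RA u' a p q = g p q" if "p < r" "q < k p" for p q
      using u'(2)[of p q] that k val by simp
    have 2: "NA u' a p q = NA u a p q \<and> RA u' a p q = RA u a p q" if "\<not> (p < r \<and> q < k p)" for p q
      using that k by (intro u'(3)) (use V2 a in \<open>auto simp: adr_eq\<close>)
    have "u' = setA a r k f g u"
      by (rule store.equality, rule ext, goal_cases)
        (use 1 2 u'(1) in \<open>auto simp: setA_def fun_eq_iff\<close>)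
    then show "Q u'" using Q by simp
  qed (use assms V2 G_big in \<open>auto simp: adr_eq\<close>)
  moreover have "(\<Sum>x<r. nev u x 0 e2) = (\<Sum>x<r. k x)" using k by (intro sum.cong) auto
  ultimately show ?thesis by simp
qed

definition Wh :: "nexp \<Rightarrow> com \<Rightarrow> com" where
  "Wh e c = Seq (Seq (cn e 4) (Do (NConst 5 0))) (While (NLess 5 4) (Seq c (Seq (cn e 4) (Do (NConst 5 0)))))"

lemma exec_cond:
  assumes "okst V s" "gn e + 1 \<le> G"
  shows "\<exists>t R w d. exec B (Seq (cn e 4) (Do (NConst 5 0))) s t R {} w d \<and> w \<le> gn e + 1 \<and> d \<le> gn e + 1 \<and>
     okst V t \<and> absr V t = absr V s \<and> nreg t 4 = nev (absr V s) 0 0 e \<and> nreg t 5 = 0"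
proof -
  have e0: "envok V s 0 0" using assms by (auto simp: okst_def envok_def)
  have mem: "\<And>a i j. NA (absr V s) a i j < V" using assms by (auto simp: okst_def absr_def)
  have Bn: "V ^ gn e \<le> B" using vpow[OF V2 _ BG] assms by auto
  have "evs V B (cn e 4) 4 s (arn e) (gn e) (\<lambda>t. nreg t 4 = nev (absr V s) 0 0 e)"
    using nokD(1)[OF compile_ok(1)[OF V2 _ _ mem Bn] _ e0 refl, of 4] by simp
  then obtain s1 R1 w1 d1 where s1: "exec B (cn e 4) s s1 R1 {} w1 d1" "w1 \<le> gn e" "d1 \<le> gn e"
    "nmem s1 = nmem s" "rmem s1 = rmem s" "\<forall>r<4. nreg s1 r = nreg s r" "nreg s1 4 = nev (absr V s) 0 0 e"
    by (rule evsE) blast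
  have 2: "step B (NConst 5 0) s1 = Some (s1\<lparr>nreg := (nreg s1)(5 := 0)\<rparr>)" by (simp add: set_nreg_def)
  show ?thesis
    by (intro exI conjI, rule exec.Seq[OF s1(1) exec.Do[OF 2], unfolded reads.simps writes.simps Un_empty_right])
      (use s1 assms in \<open>auto simp: okst_def absr_def\<close>)
qed

text \<open>The number \<open>L\<close> of rounds is fixed in advance and the invariant is indexed
  by the round, which makes work and depth plain sums over the rounds.\<close>

lemma spec_Wh:
  assumes G: "gn e + 3 \<le> 10 ^ 30" and I0: "I 0 u" and L: "\<And>u. I L u \<Longrightarrow> nev u 0 0 e = 0"
    and step: "\<And>j u. j < L \<Longrightarrow> I j u \<Longrightarrow> nev u 0 0 e \<noteq> 0 \<and> spec c u (I (Suc j)) (w j) (d j)"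
    and Q: "\<And>u. I L u \<Longrightarrow> bdd u \<Longrightarrow> Q u"
  shows "spec (Wh e c) u Q (1 + (\<Sum>j<L. w j + 1)) (1 + (\<Sum>j<L. d j + 1))"
proof (rule specI)
  fix s assume s: "okst V s" "absr V s = u"
  have G': "gn e + 3 \<le> G" and G1: "gn e + 1 \<le> G" using G G_big by simp_all
  let ?W = "While (NLess 5 4) (Seq c (Seq (cn e 4) (Do (NConst 5 0))))"
  have loop: "\<exists>t R W w' d'. exec B ?W s t R W w' d' \<and> okst V t \<and> I L (absr V t) \<and>
      w' \<le> 1 + (\<Sum>j=j..<L. G * (w j + 1)) \<and> d' \<le> 1 + (\<Sum>j=j..<L. G * (d j + 1))"
    if "j \<le> L" "okst V s" "I j (absr V s)" "nreg s 4 = nev (absr V s) 0 0 e" "nreg s 5 = 0" for j s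
    using that
  proof (induction "L - j" arbitrary: j s)
    case 0
    then have j: "j = L" by simp
    have h: "\<not> holds (NLess 5 4) s" using 0 L j by simp
    show ?case by (intro exI conjI, rule exec.WhileFalse[OF h]) (use 0 j in auto)
  next
    case (Suc k)
    then have j: "j < L" by simp
    from step[OF j Suc.prems(3)] have ne: "nev (absr V s) 0 0 e \<noteq> 0" and sp: "spec c (absr V s) (I (Suc j)) (w j) (d j)"
      by auto
    have h: "holds (NLess 5 4) s" using Suc.prems ne by simp
    from specE[OF sp Suc.prems(2) refl] obtain t R W w1 d1 where t: "exec B c s t R W w1 d1" "okst V t"
       "I (Suc j) (absr V t)" "w1 \<le> G * w j" "d1 \<le> G * d j" .
    obtain t2 R2 w2 d2 where t2: "exec B (Seq (cn e 4) (Do (NConst 5 0))) t t2 R2 {} w2 d2" "w2 \<le> gn e + 1"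
      "d2 \<le> gn e + 1" "okst V t2" "absr V t2 = absr V t" "nreg t2 4 = nev (absr V t) 0 0 e" "nreg t2 5 = 0"
      using exec_cond[OF t(2) G1] by blast
    have "k = L - Suc j" "Suc j \<le> L" "I (Suc j) (absr V t2)" "nreg t2 4 = nev (absr V t2) 0 0 e"
      using Suc.hyps(2) j t(3) t2(5,6) by auto
    from Suc.hyps(1)[OF this(1,2) t2(4) this(3,4) t2(7)]
    obtain t3 R3 W3 w3 d3 where t3: "exec B ?W t2 t3 R3 W3 w3 d3" "okst V t3" "I L (absr V t3)"
      "w3 \<le> 1 + (\<Sum>j=Suc j..<L. G * (w j + 1))" "d3 \<le> 1 + (\<Sum>j=Suc j..<L. G * (d j + 1))" by blast
    have sm: "(\<Sum>j=j..<L. f j) = f j + (\<Sum>j=Suc j..<L. f j)" for f :: "nat \<Rightarrow> nat"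
      using j by (simp add: sum.atLeast_Suc_lessThan)
    show ?case
      by (intro exI conjI, rule exec.WhileTrue[OF h exec.Seq[OF t(1) t2(1)] t3(1)])
        (use t t2 t3 G' in \<open>auto simp: sm algebra_simps\<close>)
  qed
  obtain s2 R2 w2 d2 where s2: "exec B (Seq (cn e 4) (Do (NConst 5 0))) s s2 R2 {} w2 d2" "w2 \<le> gn e + 1"
      "d2 \<le> gn e + 1" "okst V s2" "absr V s2 = absr V s" "nreg s2 4 = nev (absr V s) 0 0 e" "nreg s2 5 = 0"
    using exec_cond[OF s(1) G1] by blast
  have "I 0 (absr V s2)" "nreg s2 4 = nev (absr V s2) 0 0 e" using I0 s s2 by auto
  from loop[OF le0 s2(4) this s2(7)] obtain t R W w' d' where t: "exec B ?W s2 t R W w' d'" "okst V t" "I L (absr V t)"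
     "w' \<le> 1 + (\<Sum>j=0..<L. G * (w j + 1))" "d' \<le> 1 + (\<Sum>j=0..<L. G * (d j + 1))" by blast
  have fs: "(\<Sum>j=0..<L. G * (f j + 1)) = G * (\<Sum>j<L. f j + 1)" for f :: "nat \<Rightarrow> nat"
    by (simp only: sum_distrib_left atLeast0LessThan)
  have "w2 + w' \<le> G * (1 + (\<Sum>j<L. w j + 1))" "d2 + d' \<le> G * (1 + (\<Sum>j<L. d j + 1))"
    using t(4,5)[unfolded fs] s2(2,3) G' unfolding distrib_left mult_1_right by linarith+
  note c = this
  show "\<exists>t R W w' d'. exec B (Wh e c) s t R W w' d' \<and> okst V t \<and> Q (absr V t) \<and>
      w' \<le> G * (1 + (\<Sum>j<L. w j + 1)) \<and> d' \<le> G * (1 + (\<Sum>j<L. d j + 1))"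
    unfolding Wh_def
    by (intro exI conjI, rule exec.Seq[OF s2(1) t(1)])
      (fact t(2) Q[OF t(3) okst_bdd[OF t(2)]] c)+
qed

definition asg :: "nat \<Rightarrow> nexp \<Rightarrow> com" where
  "asg a e = PX a (C 1) (C 1) e RZ"

definition sc :: "nat \<Rightarrow> nexp" where "sc a = Rd a (C 0) (C 0)"

definition setv :: "nat \<Rightarrow> nat \<Rightarrow> store \<Rightarrow> store" where
  "setv a v u = setA a 1 (\<lambda>_. 1) (\<lambda>_ _. v) (\<lambda>_ _. 0) u"

lemma setv_same [simp]: "NA (setv a v u) a 0 0 = v"
  by (simp add: setv_def)

lemma setv_other [simp]: "b \<noteq> a \<Longrightarrow> NA (setv a v u) b = NA u b" "b \<noteq> a \<Longrightarrow> RA (setv a v u) b = RA u b"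
  by (simp_all add: setv_def)

lemma sc_simps [simp]: "nev u x y (sc a) = NA u a 0 0" "arn (sc a) = {a}" "gn (sc a) = 32 * (a + 3)"
  by (simp_all add: sc_def)

lemma spec_asg:
  assumes "nev u 0 0 e = v" "v < V" "0 < a" "gn e + (32 * (a + 9) + 27) \<le> 10 ^ 30" "Q (setv a v u)"
  shows "spec (asg a e) u Q 3 1"
proof -
  have "spec (asg a e) u Q (1 + 1 + (\<Sum>x<(1::nat). 1)) 1"
    unfolding asg_def
    by (rule spec_PX[where f = "\<lambda>_ _. v" and g = "\<lambda>_ _. 0"]) (use assms V2 in \<open>auto simp: gb_def setv_def\<close>)
  then show ?thesis by (simp add: numeral_3_eq_3)
qed

definition For :: "nat \<Rightarrow> nexp \<Rightarrow> com \<Rightarrow> com" where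
  "For v e c = Seq (asg v (C 0)) (Wh (Ls (sc v) e) (Seq c (asg v (Op Plus (sc v) (C 1)))))"

text \<open>The counter is an ordinary scalar that the body must leave alone; the invariant of the
  next round is demanded of the store after the increment, hence the \<open>setv\<close>.\<close>

lemma spec_For:
  assumes G: "gn e + 100 * v + 1000 \<le> 10 ^ 29" and v: "0 < v" and LV: "L < V" and I0: "I 0 (setv v 0 u)"
    and L: "\<And>j u. j \<le> L \<Longrightarrow> I j u \<Longrightarrow> nev u 0 0 e = L \<and> NA u v 0 0 = j"
    and step: "\<And>j u. j < L \<Longrightarrow> I j u \<Longrightarrow> spec c u (\<lambda>u'. NA u' v 0 0 = j \<and> I (Suc j) (setv v (Suc j) u')) (w j) (d j)"
    and Q: "\<And>u. I L u \<Longrightarrow> bdd u \<Longrightarrow> Q u"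
  shows "spec (For v e c) u Q (4 + (\<Sum>j<L. w j + 4)) (2 + (\<Sum>j<L. d j + 2))"
proof -
  have 1: "spec (Wh (Ls (sc v) e) (Seq c (asg v (Op Plus (sc v) (C 1))))) (setv v 0 u) Q
     (1 + (\<Sum>j<L. (w j + 3) + 1)) (1 + (\<Sum>j<L. (d j + 1) + 1))"
  proof (rule spec_Wh[where I = I and L = L])
    fix j u assume j: "j < L" "I j u"
    have "spec (Seq c (asg v (Op Plus (sc v) (C 1)))) u (I (Suc j)) (w j + 3) (d j + 1)"
    proof (rule spec_Seq, rule spec_mono[OF step[OF j]])
      fix u' assume "NA u' v 0 0 = j \<and> I (Suc j) (setv v (Suc j) u')"
      then show "spec (asg v (Op Plus (sc v) (C 1))) u' (I (Suc j)) 3 1"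
        by (intro spec_asg[where v = "Suc j"]) (use j v LV G in auto)
    qed auto
    then show "nev u 0 0 (Ls (sc v) e) \<noteq> 0 \<and> spec (Seq c (asg v (Op Plus (sc v) (C 1)))) u (I (Suc j)) (w j + 3) (d j + 1)"
      using L[OF _ j(2)] j(1) by simp
  next
    fix u assume "I L u"
    with L[OF order_refl this] show "nev u 0 0 (Ls (sc v) e) = 0" by simp
  qed (use I0 Q G in auto)
  have "spec (For v e c) u Q (3 + (1 + (\<Sum>j<L. (w j + 3) + 1))) (1 + (1 + (\<Sum>j<L. (d j + 1) + 1)))"
    unfolding For_def
    by (rule spec_Seq, rule spec_asg) (use 1 v V2 G in auto)
  then show ?thesis by (simp add: algebra_simps)
qed

end


section \<open>Prefix sums, minima and compaction\<close>

definition fr :: "nat set \<Rightarrow> store \<Rightarrow> store \<Rightarrow> bool" where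
  "fr F u u' \<longleftrightarrow> (\<forall>a. a \<notin> F \<longrightarrow> NA u' a = NA u a \<and> RA u' a = RA u a)"

lemma fr_refl [simp]: "fr F u u"
  by (simp add: fr_def)

lemma fr_trans: "fr F u u' \<Longrightarrow> fr F' u' u'' \<Longrightarrow> F \<subseteq> H \<Longrightarrow> F' \<subseteq> H \<Longrightarrow> fr H u u''"
  unfolding fr_def by (metis subsetD)

lemma fr_mono: "fr F u u' \<Longrightarrow> F \<subseteq> H \<Longrightarrow> fr H u u'"
  unfolding fr_def by blast

text \<open>The routines below evaluate their bounds and flags again after overwriting the scratch
  arrays \<open>F\<close>; this says that doing so is harmless.\<close>

definition stab :: "nat set \<Rightarrow> store \<Rightarrow> nexp \<Rightarrow> (nat \<Rightarrow> nat \<Rightarrow> nat) \<Rightarrow> bool" where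
  "stab F u e g \<longleftrightarrow> (\<forall>u' x y. fr F u u' \<longrightarrow> nev u' x y e = g x y)"

lemma stabD: "stab F u e g \<Longrightarrow> fr F u u' \<Longrightarrow> nev u' x y e = g x y"
  by (simp add: stab_def)

text \<open>A distance is a pair of a number of arcs plus one and a cost, compared by cost and
  then by number of arcs; a first component \<open>0\<close> stands for an infinite distance.\<close>

type_synonym cell = "nat \<times> real"

definition dlt :: "cell \<Rightarrow> cell \<Rightarrow> bool" where
  "dlt p q \<longleftrightarrow> fst p \<noteq> 0 \<and> (fst q = 0 \<or> snd p < snd q \<or> snd p = snd q \<and> fst p < fst q)"

text \<open>\<open>dlt\<close> is a strict weak order in which all infinite cells are equivalent,
  whatever real they carry; therefore the negation is what gets chained throughout.\<close>

lemma dlt_trans: "\<not> dlt a b \<Longrightarrow> \<not> dlt b c \<Longrightarrow> \<not> dlt a c"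
  and dlt_irrefl [simp]: "\<not> dlt a a"
  and dlt_asym: "dlt a b \<Longrightarrow> \<not> dlt b a"
  by (auto simp: dlt_def)

text \<open>\<open>cN\<close> and \<open>cR\<close> turn an index expression into the two components
  of its key, so keys are compared and not stored values. The result is 1 if \<open>b\<close> has
  the smaller key.\<close>

definition BT :: "(nexp \<Rightarrow> nexp) \<Rightarrow> (nexp \<Rightarrow> rexp) \<Rightarrow> nexp \<Rightarrow> nexp \<Rightarrow> nexp" where
  "BT cN cR a b = Cond (cN b) (Cond (cN a) (Cond (RLs (cR b) (cR a)) (C 1)
     (Cond (RLs (cR a) (cR b)) (C 0) (Ls (cN b) (cN a)))) (C 1)) (C 0)"

lemma nev_BT: "nev u x y (BT cN cR a b) =
    of_bool (dlt (nev u x y (cN b), rev u x y (cR b)) (nev u x y (cN a), rev u x y (cR a)))"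
  by (auto simp: BT_def dlt_def)

context machine
begin

lemma spec_step:
  assumes "spec c1 u P w1 d1" "\<And>u'. bdd u' \<Longrightarrow> P u' \<Longrightarrow> spec c2 u' Q w2 d2" "w1 + w2 \<le> w" "d1 + d2 \<le> d"
  shows "spec (Seq c1 c2) u Q w d"
  by (rule spec_mono[OF spec_Seq[OF spec_mono[OF assms(1) assms(2) order_refl order_refl]] _ assms(3,4)])

lemma fr_setA: "fr F u u' \<Longrightarrow> a \<in> F \<Longrightarrow> fr F u (setA a r k f g u')"
  by (auto simp: fr_def setA_def setv_def)

lemma fr_setv: "fr F u u' \<Longrightarrow> a \<in> F \<Longrightarrow> fr F u (setv a v u')"
  by (auto simp: fr_def setA_def setv_def)

text \<open>Prefix sums of all rows by doubling a window: after j rounds entry y of array 5 is the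
  sum of the last 2^j entries up to y. Array 6 is a buffer, since a location written in a parallel
  step must not be read in it by another processor.\<close>

definition Scan :: "nexp \<Rightarrow> nexp \<Rightarrow> com" where
  "Scan e1 e2 = Seq (asg 3 (C 1)) (For 4 (sc 1) (Seq
     (PX 6 e1 e2 (Cond (Ls VY (sc 3)) (Rd 5 VX VY)
        (Op Plus (Rd 5 VX VY) (Rd 5 VX (Op Minus VY (sc 3))))) RZ)
     (Seq (PX 5 e1 e2 (Rd 6 VX VY) RZ) (asg 3 (Op Times (C 2) (sc 3))))))"

lemma spec_Scan:
  assumes e1: "stab {3,4,5,6} u e1 (\<lambda>_ _. r)" and e2: "stab {3,4,5,6} u e2 (\<lambda>x _. k x)"
    and R: "NA u 1 0 0 = R" "2 ^ R < V" and r: "r \<le> V^4" and k: "\<And>x. x < r \<Longrightarrow> k x \<le> 2 ^ R"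
    and T0: "\<And>x. x < r \<Longrightarrow> (\<Sum>y<k x. T0 x y) < V" "\<And>x y. x < r \<Longrightarrow> y < k x \<Longrightarrow> NA u 5 x y = T0 x y"
    and ar: "5 \<notin> arn e2" "6 \<notin> arn e2" and G: "gn e1 + gn e2 \<le> 10 ^ 20"
  shows "spec (Scan e1 e2) u (\<lambda>u'. fr {3,4,5,6} u u' \<and> (\<forall>x<r. \<forall>y<k x. NA u' 5 x y = (\<Sum>z\<le>y. T0 x z)))
     (7 + R * (9 + 2 * (r + (\<Sum>x<r. k x)))) (3 + R * 5)"
proof -
  let ?S = "\<lambda>j x y. \<Sum>z\<in>{y + 1 - 2 ^ j..y}. T0 x z"
  define I where "I = (\<lambda>j u'. fr {3,4,5,6} u u' \<and> NA u' 3 0 0 = 2 ^ j \<and> NA u' 4 0 0 = j \<and> j \<le> R \<and>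
     (\<forall>x<r. \<forall>y<k x. NA u' 5 x y = ?S j x y))"
  have RV: "R < V" using R(2) less_exp[of R] by linarith
  have k4: "k x \<le> V ^ 4" if "x < r" for x
    using k[OF that] R(2) V2 self_le_power[of V 4] by auto
  have SV: "?S j x y < V" if "x < r" "y < k x" for j x y
  proof -
    have "?S j x y \<le> (\<Sum>y<k x. T0 x y)" by (rule sum_mono2) (use that in auto)
    then show ?thesis using T0(1)[OF that(1)] by simp
  qed
  have SS: "?S (Suc j) x y = (if y < 2 ^ j then ?S j x y else ?S j x y + ?S j x (y - 2 ^ j))" for j x y
  proof (cases "y < 2 ^ j")
    case True
    then have "y + 1 - 2 ^ j = 0" "y + 1 - 2 ^ Suc j = 0" by auto
    then show ?thesis using True by simp
  next
    case False
    have "{y + 1 - 2 ^ Suc j..y} = {y + 1 - 2 ^ j..y} \<union> {y - 2 ^ j + 1 - 2 ^ j..y - 2 ^ j}" using False by auto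
    moreover have "{y + 1 - 2 ^ j..y} \<inter> {y - 2 ^ j + 1 - 2 ^ j..y - 2 ^ j} = {}" using False by auto
    ultimately have "?S (Suc j) x y = ?S j x y + (\<Sum>z\<in>{y - 2 ^ j + 1 - 2 ^ j..y - 2 ^ j}. T0 x z)"
      by (simp add: sum.union_disjoint)
    then show ?thesis using False by simp
  qed
  have "spec (For 4 (sc 1) (Seq
     (PX 6 e1 e2 (Cond (Ls VY (sc 3)) (Rd 5 VX VY)
        (Op Plus (Rd 5 VX VY) (Rd 5 VX (Op Minus VY (sc 3))))) RZ)
     (Seq (PX 5 e1 e2 (Rd 6 VX VY) RZ) (asg 3 (Op Times (C 2) (sc 3))))))
     (setv 3 1 u) (\<lambda>u'. fr {3,4,5,6} u u' \<and> (\<forall>x<r. \<forall>y<k x. NA u' 5 x y = (\<Sum>z\<le>y. T0 x z)))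
     (4 + (\<Sum>j<R. ((1 + r + (\<Sum>x<r. k x)) + ((1 + r + (\<Sum>x<r. k x)) + 3)) + 4)) (2 + (\<Sum>j<R. (1 + (1 + 1)) + 2))"
  proof (rule spec_For[where I = I and L = R])
    show "I 0 (setv 4 0 (setv 3 1 u))" using T0(2) by (auto simp: I_def fr_def)
  next
    fix j u' assume "I j u'"
    then show "nev u' 0 0 (sc 1) = R \<and> NA u' 4 0 0 = j" using R by (auto simp: I_def fr_def)
  next
    fix u' assume "I R u'"
    moreover have "?S R x y = (\<Sum>z\<le>y. T0 x z)" if "x < r" "y < k x" for x y
      using k[OF that(1)] that by (simp add: atLeast0AtMost)
    ultimately show "fr {3,4,5,6} u u' \<and> (\<forall>x<r. \<forall>y<k x. NA u' 5 x y = (\<Sum>z\<le>y. T0 x z))"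
      unfolding I_def by metis
  next
    fix j u' assume j: "j < R" and I: "I j u'"
    have f: "fr {3,4,5,6} u u'" and v3: "NA u' 3 0 0 = 2 ^ j" and v4: "NA u' 4 0 0 = j"
      and T: "\<And>x y. x < r \<Longrightarrow> y < k x \<Longrightarrow> NA u' 5 x y = ?S j x y" using I by (auto simp: I_def)
    let ?u1 = "setA 6 r k (?S (Suc j)) (\<lambda>_ _. 0) u'"
    let ?u2 = "setA 5 r k (?S (Suc j)) (\<lambda>_ _. 0) ?u1"
    have j2: "2 * 2 ^ j < V"
    proof -
      have "(2::nat) ^ Suc j \<le> 2 ^ R" using j by (intro power_increasing) auto
      then show ?thesis using R(2) by simp
    qed
    show "spec (Seq (PX 6 e1 e2 (Cond (Ls VY (sc 3)) (Rd 5 VX VY)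
        (Op Plus (Rd 5 VX VY) (Rd 5 VX (Op Minus VY (sc 3))))) RZ)
       (Seq (PX 5 e1 e2 (Rd 6 VX VY) RZ) (asg 3 (Op Times (C 2) (sc 3))))) u'
       (\<lambda>u'. NA u' 4 0 0 = j \<and> I (Suc j) (setv 4 (Suc j) u'))
       ((1 + r + (\<Sum>x<r. k x)) + ((1 + r + (\<Sum>x<r. k x)) + 3)) (1 + (1 + 1))"
    proof (rule spec_Seq, rule spec_PX[where f = "?S (Suc j)" and g = "\<lambda>_ _. 0"])
      show "nev u' 0 0 e1 = r" "r \<le> V ^ 4" "\<And>x. x < r \<Longrightarrow> nev u' x 0 e2 = k x"
        using stabD[OF e1 f] stabD[OF e2 f] r by auto
      show "nev u' x y (Cond (Ls VY (sc 3)) (Rd 5 VX VY) (Op Plus (Rd 5 VX VY) (Rd 5 VX (Op Minus VY (sc 3))))) =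
          ?S (Suc j) x y" if "x < r" "y < k x" for x y
        unfolding SS using that T v3 by (simp del: sum.cl_ivl_Suc)
      show "spec (Seq (PX 5 e1 e2 (Rd 6 VX VY) RZ) (asg 3 (Op Times (C 2) (sc 3)))) ?u1
         (\<lambda>u'. NA u' 4 0 0 = j \<and> I (Suc j) (setv 4 (Suc j) u')) ((1 + r + (\<Sum>x<r. k x)) + 3) (1 + 1)"
      proof (rule spec_Seq, rule spec_PX[where f = "?S (Suc j)" and g = "\<lambda>_ _. 0"])
        have f1: "fr {3,4,5,6} u ?u1" by (rule fr_setA[OF f]) auto
        show "nev ?u1 0 0 e1 = r" "r \<le> V ^ 4" "\<And>x. x < r \<Longrightarrow> nev ?u1 x 0 e2 = k x"
          using stabD[OF e1 f1] stabD[OF e2 f1] r by auto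
        show "spec (asg 3 (Op Times (C 2) (sc 3))) ?u2 (\<lambda>u'. NA u' 4 0 0 = j \<and> I (Suc j) (setv 4 (Suc j) u')) 3 1"
          by (rule spec_asg[where v = "2 * 2 ^ j"])
            (use v3 v4 j j2 in \<open>auto simp: I_def intro!: fr_setv fr_setA f simp del: sum.cl_ivl_Suc\<close>)
      qed (use SV k4 ar G in \<open>auto simp: gb_def simp del: sum.cl_ivl_Suc power_Suc\<close>)
    qed (use SV k4 ar G in \<open>auto simp: gb_def simp del: sum.cl_ivl_Suc power_Suc\<close>)
  qed (use RV in auto)
  note 1 = this
  show ?thesis unfolding Scan_def
  proof (rule spec_step[where P = "\<lambda>u'. u' = setv 3 1 u"])
    show "spec (asg 3 (C 1)) u (\<lambda>u'. u' = setv 3 1 u) 3 1"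
      by (rule spec_asg) (use V2 in auto)
  qed (use 1 in \<open>auto simp: algebra_simps\<close>)
qed

text \<open>A tournament: after j rounds entry y is the winner of the block y of length 2^j. As the
  rows halve in each round, the work is linear in the number of entries and the logarithm falls on
  the number of rows only; this saves a logarithm in the m n term.\<close>

definition Red :: "(nexp \<Rightarrow> nexp) \<Rightarrow> (nexp \<Rightarrow> rexp) \<Rightarrow> nexp \<Rightarrow> nexp \<Rightarrow> com" where
  "Red cN cR e1 e2 = Seq (asg 3 (C 1)) (For 4 (sc 1) (Seq
     (PX 6 e1 (Op Plus (Op Div e2 (Op Times (C 2) (sc 3))) (C 1))
        (Cond (Ls (Op Times (Op Plus (Op Times (C 2) VY) (C 1)) (sc 3)) e2)
           (Cond (BT cN cR (Rd 5 VX (Op Times (C 2) VY)) (Rd 5 VX (Op Plus (Op Times (C 2) VY) (C 1))))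
              (Rd 5 VX (Op Plus (Op Times (C 2) VY) (C 1))) (Rd 5 VX (Op Times (C 2) VY)))
           (Rd 5 VX (Op Times (C 2) VY))) RZ)
     (Seq (PX 5 e1 (Op Plus (Op Div e2 (Op Times (C 2) (sc 3))) (C 1)) (Rd 6 VX VY) RZ)
        (asg 3 (Op Times (C 2) (sc 3))))))"

lemma sum_div_pow2: "(\<Sum>j<R. k div 2 ^ Suc j) \<le> (k::nat)"
proof -
  have "(\<Sum>j<R. k div 2 ^ Suc j) + k div 2 ^ R \<le> k"
  proof (induction R)
    case (Suc R)
    have "k div 2 ^ Suc R = k div 2 ^ R div 2" by (metis div_mult2_eq power_Suc2)
    then have "k div 2 ^ Suc R + k div 2 ^ Suc R \<le> k div 2 ^ R" by simp
    then show ?case using Suc by simp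
  qed simp
  then show ?thesis by simp
qed

lemma spec_Red:
  assumes e1: "stab {3,4,5,6} u e1 (\<lambda>_ _. r)" and e2: "stab {3,4,5,6} u e2 (\<lambda>x _. k x)"
    and R: "NA u 1 0 0 = R" "2 ^ R < V" and r: "r \<le> V^4" and k: "\<And>x. x < r \<Longrightarrow> k x \<le> 2 ^ R"
    and K: "\<And>u' x y e. fr {3,4,5,6} u u' \<Longrightarrow> (nev u' x y (cN e), rev u' x y (cR e)) = K x (nev u' x y e)"
    and T0: "\<And>x y. x < r \<Longrightarrow> y < k x \<Longrightarrow> NA u 5 x y = T0 x y"
    and ar: "5 \<notin> arn e2" "6 \<notin> arn e2" "\<And>e. 6 \<notin> arn e \<Longrightarrow> 6 \<notin> arn (cN e) \<union> arr (cR e)"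
    and G: "gn e1 + gn e2 \<le> 10 ^ 20" "\<And>e. gn e \<le> 10000 \<Longrightarrow> gn (cN e) + gr (cR e) \<le> 10 ^ 20"
  shows "spec (Red cN cR e1 e2) u (\<lambda>u'. fr {3,4,5,6} u u' \<and> (\<forall>x<r. 0 < k x \<longrightarrow>
      (\<exists>z<k x. NA u' 5 x 0 = T0 x z \<and> (\<forall>z'<k x. \<not> dlt (K x (T0 x z')) (K x (T0 x z))))))
     (7 + R * (9 + 4 * r) + 2 * (\<Sum>x<r. k x)) (3 + R * 5)"
proof -
  \<comment> \<open>The stored value v wins among the entries from a to b - 1 of row x. The negated
    \<open>dlt\<close> allows for ties and infinite keys.\<close>
  define M where "M = (\<lambda>x a b v. (\<exists>z. a \<le> z \<and> z < b \<and> v = T0 x z) \<and>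
     (\<forall>z'. a \<le> z' \<and> z' < b \<longrightarrow> \<not> dlt (K x (T0 x z')) (K x v)))"
  have M1: "M x a (Suc a) (T0 x a)" for x a
  proof -
    have "z' = a" if "a \<le> z' \<and> z' < Suc a" for z' using that by linarith
    then show ?thesis unfolding M_def by (metis dlt_irrefl lessI order_refl)
  qed
  have M2: "M x a c (if dlt (K x w) (K x v) then w else v)" if "M x a b v" "M x b c w" "a \<le> b" "b \<le> c" for x a b c v w
  proof -
    have v: "\<exists>z. a \<le> z \<and> z < b \<and> v = T0 x z" and w: "\<exists>z. b \<le> z \<and> z < c \<and> w = T0 x z"
      and nv: "\<And>z'. a \<le> z' \<Longrightarrow> z' < b \<Longrightarrow> \<not> dlt (K x (T0 x z')) (K x v)"
      and nw: "\<And>z'. b \<le> z' \<Longrightarrow> z' < c \<Longrightarrow> \<not> dlt (K x (T0 x z')) (K x w)"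
      using that(1,2) by (simp_all add: M_def)
    have "\<exists>z. a \<le> z \<and> z < c \<and> v = T0 x z" "\<exists>z. a \<le> z \<and> z < c \<and> w = T0 x z"
      using v w \<open>a \<le> b\<close> \<open>b \<le> c\<close> by (meson order_trans less_le_trans)+
    moreover have "\<not> dlt (K x (T0 x z')) (K x w)" if "a \<le> z'" "z' < c" "dlt (K x w) (K x v)" for z'
      using dlt_trans[OF nv dlt_asym[OF that(3)], of z'] nw[of z'] that(1,2) by (cases "z' < b") simp_all
    moreover have "\<not> dlt (K x (T0 x z')) (K x v)" if "a \<le> z'" "z' < c" "\<not> dlt (K x w) (K x v)" for z'
      using nv[of z'] dlt_trans[OF nw that(3), of z'] that(1,2) by (cases "z' < b") simp_all
    ultimately show ?thesis by (simp add: M_def)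
  qed
  define I where "I = (\<lambda>j u'. fr {3,4,5,6} u u' \<and> NA u' 3 0 0 = 2 ^ j \<and> NA u' 4 0 0 = j \<and> j \<le> R \<and> bdd u' \<and>
     (\<forall>x<r. \<forall>y. y * 2 ^ j < k x \<longrightarrow> M x (y * 2 ^ j) (min ((y + 1) * 2 ^ j) (k x)) (NA u' 5 x y)))"
  let ?len = "\<lambda>j x. k x div 2 ^ Suc j + 1"
  let ?e2 = "Op Plus (Op Div e2 (Op Times (C 2) (sc 3))) (C 1)"
  let ?v = "Cond (Ls (Op Times (Op Plus (Op Times (C 2) VY) (C 1)) (sc 3)) e2)
           (Cond (BT cN cR (Rd 5 VX (Op Times (C 2) VY)) (Rd 5 VX (Op Plus (Op Times (C 2) VY) (C 1))))
              (Rd 5 VX (Op Plus (Op Times (C 2) VY) (C 1))) (Rd 5 VX (Op Times (C 2) VY)))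
           (Rd 5 VX (Op Times (C 2) VY))"
  have RV: "R < V" using R(2) less_exp[of R] by linarith
  have k4: "?len j x \<le> V ^ 4" if "x < r" for x j
  proof -
    have "?len j x \<le> k x + 1" by simp
    also have "\<dots> \<le> V" using k[OF that] R(2) by simp
    also have "\<dots> \<le> V ^ 4" using V2 by (intro self_le_power) auto
    finally show ?thesis .
  qed
  let ?Q = "\<lambda>u'. fr {3,4,5,6} u u' \<and> (\<forall>x<r. 0 < k x \<longrightarrow>
      (\<exists>z<k x. NA u' 5 x 0 = T0 x z \<and> (\<forall>z'<k x. \<not> dlt (K x (T0 x z')) (K x (T0 x z)))))"
  let ?w = "\<lambda>j. 1 + r + (\<Sum>x<r. ?len j x)"
  have 1: "spec (For 4 (sc 1) (Seq (PX 6 e1 ?e2 ?v RZ) (Seq (PX 5 e1 ?e2 (Rd 6 VX VY) RZ) (asg 3 (Op Times (C 2) (sc 3))))))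
     (setv 3 1 u) ?Q (4 + (\<Sum>j<R. (?w j + (?w j + 3)) + 4)) (2 + (\<Sum>j<R. (1 + (1 + 1)) + 2))" if b: "bdd u"
  proof (rule spec_For[where I = I and L = R])
    have "bdd (setv 4 0 (setv 3 1 u))" using b V2 by (auto simp: bdd_def setv_def setA_def)
    then show "I 0 (setv 4 0 (setv 3 1 u))" using T0 M1 by (auto simp: I_def fr_def)
  next
    fix j u' assume "I j u'"
    then show "nev u' 0 0 (sc 1) = R \<and> NA u' 4 0 0 = j" using R by (auto simp: I_def fr_def)
  next
    fix u' assume I: "I R u'"
    have "\<exists>z<k x. NA u' 5 x 0 = T0 x z \<and> (\<forall>z'<k x. \<not> dlt (K x (T0 x z')) (K x (T0 x z)))" if "x < r" "0 < k x" for x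
    proof -
      have "\<forall>x<r. \<forall>y. y * 2 ^ R < k x \<longrightarrow> M x (y * 2 ^ R) (min ((y + 1) * 2 ^ R) (k x)) (NA u' 5 x y)"
        using I unfolding I_def by blast
      from this[rule_format, OF that(1), of 0] that(2)
      have "M x (0 * 2 ^ R) (min ((0 + 1) * 2 ^ R) (k x)) (NA u' 5 x 0)" by simp
      then show ?thesis using k[OF that(1)] by (auto simp: M_def min_def split: if_splits)
    qed
    then show "?Q u'" using I unfolding I_def by blast
  next
    fix j u' assume j: "j < R" and I: "I j u'"
    have f: "fr {3,4,5,6} u u'" and v3: "NA u' 3 0 0 = 2 ^ j" and v4: "NA u' 4 0 0 = j" and b: "bdd u'"
      and T: "\<And>x y. x < r \<Longrightarrow> y * 2 ^ j < k x \<Longrightarrow> M x (y * 2 ^ j) (min ((y + 1) * 2 ^ j) (k x)) (NA u' 5 x y)"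
      using I by (auto simp: I_def)
    define f' where "f' = (\<lambda>x y. nev u' x y ?v)"
    let ?f = f'
    let ?u1 = "setA 6 r (?len j) ?f (\<lambda>_ _. 0) u'"
    let ?u2 = "setA 5 r (?len j) ?f (\<lambda>_ _. 0) ?u1"
    have j2: "2 * 2 ^ j < V"
    proof -
      have "(2::nat) ^ Suc j \<le> 2 ^ R" using j by (intro power_increasing) auto
      then show ?thesis using R(2) by simp
    qed
    \<comment> \<open>Winners are copies of stored words, which is why the invariant carries
      \<open>bdd\<close>.\<close>
    have fV: "?f x y < V" for x y using b by (auto simp: bdd_def f'_def)
    have fM: "M x (y * 2 ^ Suc j) (min ((y + 1) * 2 ^ Suc j) (k x)) (?f x y)" if x: "x < r" "y * 2 ^ Suc j < k x" for x y
    proof (cases "(2 * y + 1) * 2 ^ j < k x")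
      case False
      have "M x (2 * y * 2 ^ j) (min ((2 * y + 1) * 2 ^ j) (k x)) (NA u' 5 x (2 * y))" using T[OF x(1), of "2*y"] x(2) by (simp add: algebra_simps)
      moreover have "min ((2 * y + 1) * 2 ^ j) (k x) = k x" "min ((y + 1) * 2 ^ Suc j) (k x) = k x" using False by (auto simp: algebra_simps)
      ultimately show ?thesis using False stabD[OF e2 f] v3 by (simp add: f'_def algebra_simps)
    next
      case True
      have "M x (2 * y * 2 ^ j) (min ((2 * y + 1) * 2 ^ j) (k x)) (NA u' 5 x (2 * y))" using T[OF x(1), of "2*y"] x(2) by (simp add: algebra_simps)
      then have 1: "M x (y * 2 ^ Suc j) ((2 * y + 1) * 2 ^ j) (NA u' 5 x (2 * y))" using True by (simp add: algebra_simps)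
      have 2: "M x ((2 * y + 1) * 2 ^ j) (min ((y + 1) * 2 ^ Suc j) (k x)) (NA u' 5 x (2 * y + 1))"
        using T[OF x(1), of "2*y+1"] True by (simp add: algebra_simps)
      have "?f x y = (if dlt (K x (NA u' 5 x (2*y+1))) (K x (NA u' 5 x (2*y))) then NA u' 5 x (2*y+1) else NA u' 5 x (2*y))"
        using True stabD[OF e2 f] v3 K[OF f] by (simp add: f'_def nev_BT)
      then show ?thesis using M2[OF 1 2] True by simp
    qed
    show "spec (Seq (PX 6 e1 ?e2 ?v RZ) (Seq (PX 5 e1 ?e2 (Rd 6 VX VY) RZ) (asg 3 (Op Times (C 2) (sc 3))))) u'
       (\<lambda>u'. NA u' 4 0 0 = j \<and> I (Suc j) (setv 4 (Suc j) u')) (?w j + (?w j + 3)) (1 + (1 + 1))"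
    proof (rule spec_Seq, rule spec_PX[where f = ?f and g = "\<lambda>_ _. 0"])
      show "nev u' 0 0 e1 = r" "r \<le> V ^ 4" "\<And>x. x < r \<Longrightarrow> nev u' x 0 ?e2 = ?len j x"
        using stabD[OF e1 f] stabD[OF e2 f] r v3 by (auto simp: )
      show "spec (Seq (PX 5 e1 ?e2 (Rd 6 VX VY) RZ) (asg 3 (Op Times (C 2) (sc 3)))) ?u1
         (\<lambda>u'. NA u' 4 0 0 = j \<and> I (Suc j) (setv 4 (Suc j) u')) (?w j + 3) (1 + 1)"
      proof (rule spec_Seq, rule spec_PX[where f = "?f" and g = "\<lambda>_ _. 0"])
        have f1: "fr {3,4,5,6} u ?u1" by (rule fr_setA[OF f]) auto
        show "nev ?u1 0 0 e1 = r" "r \<le> V ^ 4" "\<And>x. x < r \<Longrightarrow> nev ?u1 x 0 ?e2 = ?len j x"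
          using stabD[OF e1 f1] stabD[OF e2 f1] r v3 by (auto simp: )
        have b2: "bdd (setv 4 (Suc j) (setv 3 (2 * 2 ^ j) ?u2))"
          using b fV j2 j RV V2 unfolding bdd_def setv_def setA_def by auto
        \<comment> \<open>The extra 1 in the row length covers the last, possibly incomplete,
          block.\<close>
        have ln: "y < ?len j x" if "y * 2 ^ Suc j < k x" for x y
          using that by (metis div_le_mono less_imp_le nonzero_mult_div_cancel_right less_Suc_eq_le Suc_eq_plus1 power_not_zero zero_neq_numeral)
        show "spec (asg 3 (Op Times (C 2) (sc 3))) ?u2 (\<lambda>u'. NA u' 4 0 0 = j \<and> I (Suc j) (setv 4 (Suc j) u')) 3 1"
          by (rule spec_asg[where v = "2 * 2 ^ j"])
            (use v3 v4 j j2 b2 fM ln in \<open>auto simp: I_def intro!: fr_setv fr_setA f\<close>)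
      qed (use fV k4 ar G(1) in \<open>auto simp: gb_def simp del: power_Suc\<close>)
      have "gn (cN e) + gr (cR e) \<le> 10 ^ 20" if "gn e \<le> 10000" for e using G(2) that by simp
      from this[of "Rd 5 VX (Op Times (C 2) VY)"] this[of "Rd 5 VX (Op Plus (Op Times (C 2) VY) (C 1))"]
      show "gn e1 + gn ?e2 + gb 6 VX VY ?v RZ + 2 \<le> 10 ^ 30"
        using G(1) by (simp add: gb_def BT_def)
      from ar(3)[of "Rd 5 VX (Op Times (C 2) VY)"] ar(3)[of "Rd 5 VX (Op Plus (Op Times (C 2) VY) (C 1))"]
      show "6 \<notin> arn ?e2 \<union> arn ?v \<union> arr RZ \<or> r \<le> 1 \<and> (\<forall>x<r. ?len j x \<le> 1)"
        using ar(1,2) by (simp add: BT_def)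
    qed (use fV k4 in \<open>auto simp: f'_def simp del: power_Suc nev.simps\<close>)
  qed (use RV in auto)
  have le: "(\<Sum>j<R. \<Sum>x<r. k x div 2 ^ Suc j) \<le> (\<Sum>x<r. k x)"
    by (subst sum.swap) (intro sum_mono sum_div_pow2)
  have c: "3 + (4 + (\<Sum>j<R. (?w j + (?w j + 3)) + 4)) \<le> 7 + R * (9 + 4 * r) + 2 * (\<Sum>x<r. k x)"
  proof -
    have "(?w j + (?w j + 3)) + 4 = (9 + 4 * r) + 2 * (\<Sum>x<r. k x div 2 ^ Suc j)" for j
      by (simp only: sum.distrib sum_constant card_lessThan) simp
    then have "(\<Sum>j<R. (?w j + (?w j + 3)) + 4) = R * (9 + 4 * r) + 2 * (\<Sum>j<R. \<Sum>x<r. k x div 2 ^ Suc j)"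
      by (simp only: sum.distrib sum_distrib_left[symmetric] sum_constant card_lessThan) (simp add: algebra_simps)
    then show ?thesis using le by linarith
  qed
  show ?thesis unfolding Red_def
  proof (rule spec_bdd, rule spec_step[where P = "\<lambda>u'. u' = setv 3 1 u"])
    show "spec (asg 3 (C 1)) u (\<lambda>u'. u' = setv 3 1 u) 3 1"
      by (rule spec_asg) (use V2 in auto)
  qed (use 1 c in auto)
qed

text \<open>An assignment writes for every y, so an unflagged y is sent to position k + y, beyond
  all ranks; this keeps the writes exclusive without a conditional store. An empty row has no last
  prefix sum, hence the test on \<open>e2\<close>.\<close>

definition Compact :: "nat \<Rightarrow> nat \<Rightarrow> nexp \<Rightarrow> nexp \<Rightarrow> nexp \<Rightarrow> com" where
  "Compact L N e1 e2 fl = Seq (PX 5 e1 e2 fl RZ) (Seq (Scan e1 e2) (Seq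
     (PA L e1 e2 VX (Cond fl (Op Minus (Rd 5 VX VY) (C 1)) (Op Plus e2 VY)) VY RZ)
     (PX N e1 (C 1) (Cond e2 (Rd 5 VX (Op Minus e2 (C 1))) (C 0)) RZ)))"

lemma rank_image:
  fixes P :: "nat set"
  assumes "finite P"
  defines "p \<equiv> \<lambda>y. card {z \<in> P. z \<le> y} - 1"
  shows "inj_on p P" "p ` P = {..<card P}"
proof -
  have pos: "card {z \<in> P. z \<le> y} \<ge> 1" if "y \<in> P" for y
  proof -
    have "card {y} \<le> card {z \<in> P. z \<le> y}" using assms(1) that by (intro card_mono) auto
    then show ?thesis by simp
  qed
  have less: "p x < p y" if "x \<in> P" "y \<in> P" "x < y" for x y
  proof -
    have "{z \<in> P. z \<le> x} \<subseteq> {z \<in> P. z \<le> y}" "y \<in> {z \<in> P. z \<le> y}" "y \<notin> {z \<in> P. z \<le> x}"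
      using that by auto
    then have "{z \<in> P. z \<le> x} \<subset> {z \<in> P. z \<le> y}" by blast
    then have "card {z \<in> P. z \<le> x} < card {z \<in> P. z \<le> y}" using assms(1) by (intro psubset_card_mono) auto
    then show ?thesis using pos[OF that(1)] unfolding p_def by linarith
  qed
  show inj: "inj_on p P" by (rule inj_onI) (metis less less_irrefl nat_neq_iff)
  have "p y < card P" if "y \<in> P" for y
  proof -
    have "card {z \<in> P. z \<le> y} \<le> card P" using assms(1) by (intro card_mono) auto
    then show ?thesis using pos[OF that] unfolding p_def by linarith
  qed
  then show "p ` P = {..<card P}" using card_image[OF inj] by (intro card_subset_eq) auto
qed

lemma spec_Compact:
  fixes L N :: nat
  defines "F \<equiv> {3,4,5,6,L,N}"
  assumes LN: "L \<notin> {0,3,4,5,6}" "N \<notin> {0,3,4,5,6}" "L \<noteq> N"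
    and e1: "stab F u e1 (\<lambda>_ _. r)" and e2: "stab F u e2 (\<lambda>x _. k x)" and fl: "stab F u fl (\<lambda>x y. of_bool (f x y))"
    and R: "NA u 1 0 0 = R" "2 ^ R < V" and r: "r \<le> V^4" and k: "\<And>x. x < r \<Longrightarrow> k x \<le> 2 ^ R"
    and ar: "{5,6,L,N} \<inter> arn e2 = {}" "{5,L} \<inter> arn fl = {}" and G: "gn e1 + gn e2 + gn fl + L + N \<le> 10 ^ 10"
  shows "spec (Compact L N e1 e2 fl) u (\<lambda>u'. fr F u u' \<and> (\<forall>x<r. NA u' N x 0 = card {y. y < k x \<and> f x y} \<and>
      NA u' L x ` {..<NA u' N x 0} = {y. y < k x \<and> f x y}))
     ((1 + r + (\<Sum>x<r. k x)) + ((7 + R * (9 + 2 * (r + (\<Sum>x<r. k x)))) + ((1 + r + (\<Sum>x<r. k x)) + (1 + r + r))))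
     (1 + ((3 + R * 5) + (1 + 1)))"
proof -
  let ?S = "1 + r + (\<Sum>x<r. k x)"
  let ?P = "\<lambda>x. {y. y < k x \<and> f x y}"
  let ?c = "\<lambda>x y. \<Sum>z\<le>y. (of_bool (f x z) :: nat)"
  let ?u1 = "setA 5 r k (\<lambda>x y. of_bool (f x y)) (\<lambda>_ _. 0) u"
  have fm: "fr F u u' \<Longrightarrow> fr {3,4,5,6} u' u'' \<Longrightarrow> fr F u u''" for u' u''
    unfolding F_def by (rule fr_trans) auto
  have st: "stab {3,4,5,6} u' e g" if "stab F u e g" "fr F u u'" for e g u'
    using that fm unfolding stab_def by blast
  have f1: "fr F u ?u1" by (rule fr_setA) (auto simp: F_def)
  have c: "?c x y = card {z \<in> ?P x. z \<le> y}" if "y < k x" for x y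
  proof -
    have "{z \<in> ?P x. z \<le> y} = {z \<in> {..y}. f x z}" using that by auto
    moreover have "?c x y = card {z \<in> {..y}. f x z}" by (simp add: Int_def)
    ultimately show ?thesis by simp
  qed
  have k4: "k x \<le> V ^ 4" "k x < V" if "x < r" for x
    using k[OF that] R(2) V2 self_le_power[of V 4] by auto
  have cV: "card {y. y < k x \<and> Pq y} < V" if "x < r" for x Pq
  proof -
    have "card {y. y < k x \<and> Pq y} \<le> card {..<k x}" by (intro card_mono) auto
    then show ?thesis using k4[OF that] by simp
  qed
  have sb: "(\<Sum>y<k x. of_bool (f x y)) < V" if "x < r" for x
  proof -
    have "(\<Sum>y<k x. of_bool (f x y) :: nat) \<le> (\<Sum>y<k x. 1)" by (intro sum_mono) auto
    then show ?thesis using k4[OF that] by simp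
  qed
  have tot: "card (?P x) = (if k x = 0 then 0 else ?c x (k x - 1))" for x
  proof (cases "k x")
    case (Suc n)
    then have "{z \<in> ?P x. z \<le> k x - 1} = ?P x" by auto
    then show ?thesis using c[of "k x - 1" x] Suc by simp
  qed simp
  show ?thesis unfolding Compact_def
  proof (rule spec_Seq, rule spec_PX[where f = "\<lambda>x y. of_bool (f x y)" and g = "\<lambda>_ _. 0"])
    show "nev u 0 0 e1 = r" "\<And>x. x < r \<Longrightarrow> nev u x 0 e2 = k x"
      "\<And>x y. x < r \<Longrightarrow> y < k x \<Longrightarrow> nev u x y fl = of_bool (f x y)"
      using stabD[OF e1 fr_refl] stabD[OF e2 fr_refl] stabD[OF fl fr_refl] by auto
    show "spec (Seq (Scan e1 e2) (Seq (PA L e1 e2 VX (Cond fl (Op Minus (Rd 5 VX VY) (C 1)) (Op Plus e2 VY)) VY RZ)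
       (PX N e1 (C 1) (Cond e2 (Rd 5 VX (Op Minus e2 (C 1))) (C 0)) RZ))) ?u1
       (\<lambda>u'. fr F u u' \<and> (\<forall>x<r. NA u' N x 0 = card {y. y < k x \<and> f x y} \<and>
         NA u' L x ` {..<NA u' N x 0} = {y. y < k x \<and> f x y}))
        ((7 + R * (9 + 2 * (r + (\<Sum>x<r. k x)))) + (?S + (1 + r + r))) ((3 + R * 5) + (1 + 1))"
    proof (rule spec_step[OF spec_Scan[OF st[OF e1 f1] st[OF e2 f1], where ?T0.0 = "\<lambda>x y. of_bool (f x y)"]])
      fix u2 assume b2: "bdd u2" and u2: "fr {3,4,5,6} ?u1 u2 \<and> (\<forall>x<r. \<forall>y<k x. NA u2 5 x y = ?c x y)"
      have f2: "fr F u u2" using fm[OF f1] u2 by blast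
      have T: "NA u2 5 x y = card {z \<in> ?P x. z \<le> y}" if "x < r" "y < k x" for x y using u2 c that by metis
      let ?j = "\<lambda>x y. nev u2 x y (Cond fl (Op Minus (Rd 5 VX VY) (C 1)) (Op Plus e2 VY))"
      have j: "?j x y = (if f x y then card {z \<in> ?P x. z \<le> y} - 1 else k x + y)" if "x < r" "y < k x" for x y
        using T[OF that] stabD[OF fl f2] stabD[OF e2 f2] by simp
      have fin: "finite (?P x)" for x by simp
      note rk = rank_image[OF fin]
      have lt: "card {z \<in> ?P x. z \<le> y} - 1 < k x" if "y < k x" "f x y" for x y
      proof -
        have "card {z \<in> ?P x. z \<le> y} - 1 < card (?P x)" using rk(2)[of x] that by blast
        also have "\<dots> \<le> card {..<k x}" by (intro card_mono) auto
        finally show ?thesis by simp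
      qed
      have inj: "y = y'" if "x < r" "y < k x" "y' < k x" "?j x y = ?j x y'" for x y y'
      proof (cases "f x y = f x y'")
        case True
        then show ?thesis using that j rk(1)[of x] by (cases "f x y") (auto simp: inj_on_def)
      next
        case False
        then show ?thesis using that j lt[of y x] lt[of y' x] by (cases "f x y") auto
      qed
      show "spec (Seq (PA L e1 e2 VX (Cond fl (Op Minus (Rd 5 VX VY) (C 1)) (Op Plus e2 VY)) VY RZ)
       (PX N e1 (C 1) (Cond e2 (Rd 5 VX (Op Minus e2 (C 1))) (C 0)) RZ)) u2
       (\<lambda>u'. fr F u u' \<and> (\<forall>x<r. NA u' N x 0 = card {y. y < k x \<and> f x y} \<and>
         NA u' L x ` {..<NA u' N x 0} = {y. y < k x \<and> f x y})) (?S + (1 + r + r)) (1 + 1)"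
      proof (rule spec_Seq, rule spec_mono[OF spec_PA[where Q = "\<lambda>u3. fr F u u3 \<and> (\<forall>x<r. \<forall>y<k x. f x y \<longrightarrow>
          NA u3 L x (card {z \<in> ?P x. z \<le> y} - 1) = y) \<and> NA u3 5 = NA u2 5"]])
        show "nev u2 0 0 e1 = r" "r \<le> V ^ 4" using stabD[OF e1 f2] r by auto
        fix u3 :: store assume b3: "bdd u3" and u3: "fr F u u3 \<and> (\<forall>x<r. \<forall>y<k x. f x y \<longrightarrow>
          NA u3 L x (card {z \<in> ?P x. z \<le> y} - 1) = y) \<and> NA u3 5 = NA u2 5"
        then have f3: "fr F u u3" by blast
        have ff: "fr F u (setA N r (\<lambda>_. 1) (\<lambda>x _. card (?P x)) (\<lambda>_ _. 0) u3)"
          by (rule fr_setA[OF f3]) (auto simp: F_def)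
        have im: "NA u3 L x ` {..<card (?P x)} = ?P x" if "x < r" for x
        proof -
          have "NA u3 L x ` {..<card (?P x)} = (\<lambda>y. NA u3 L x (card {z \<in> ?P x. z \<le> y} - 1)) ` ?P x"
            using rk(2)[of x, symmetric] by (simp add: image_image)
          also have "\<dots> = (\<lambda>y. y) ` ?P x" using u3 that by (intro image_cong) auto
          finally show ?thesis by simp
        qed
        have "spec (PX N e1 (C 1) (Cond e2 (Rd 5 VX (Op Minus e2 (C 1))) (C 0)) RZ) u3
          (\<lambda>u'. fr F u u' \<and> (\<forall>x<r. NA u' N x 0 = card {y. y < k x \<and> f x y} \<and>
            NA u' L x ` {..<NA u' N x 0} = {y. y < k x \<and> f x y})) (1 + r + (\<Sum>x<r. 1)) 1"
        proof (rule spec_PX[where f = "\<lambda>x _. card (?P x)" and g = "\<lambda>_ _. 0" and k = "\<lambda>_. 1"])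
          show "nev u3 0 0 e1 = r" using stabD[OF e1 f3] by auto
          show "nev u3 x y (Cond e2 (Rd 5 VX (Op Minus e2 (C 1))) (C 0)) = card (?P x)" if "x < r" "y < 1" for x y
            using stabD[OF e2 f3] u3 T[OF that(1), of "k x - 1"] tot[of x] c[of "k x - 1" x] by simp
          show "fr F u (setA N r (\<lambda>_. 1) (\<lambda>x _. card (?P x)) (\<lambda>_ _. 0) u3) \<and> (\<forall>x<r.
             NA (setA N r (\<lambda>_. 1) (\<lambda>x _. card (?P x)) (\<lambda>_ _. 0) u3) N x 0 = card (?P x) \<and>
             NA (setA N r (\<lambda>_. 1) (\<lambda>x _. card (?P x)) (\<lambda>_ _. 0) u3) L x ` {..<NA (setA N r (\<lambda>_. 1) (\<lambda>x _. card (?P x)) (\<lambda>_ _. 0) u3) N x 0} = ?P x)"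
            using ff im LN by simp
        qed (use r cV LN ar G V2 in \<open>auto simp: gb_def\<close>)
        then show "spec (PX N e1 (C 1) (Cond e2 (Rd 5 VX (Op Minus e2 (C 1))) (C 0)) RZ) u3
          (\<lambda>u'. fr F u u' \<and> (\<forall>x<r. NA u' N x 0 = card {y. y < k x \<and> f x y} \<and>
            NA u' L x ` {..<NA u' N x 0} = {y. y < k x \<and> f x y})) (1 + r + r) 1" by simp
      next
        show "nev u2 x 0 e2 \<le> V ^ 4" if "x < r" for x using stabD[OF e2 f2] k4[OF that] by simp
        show "nev u2 x y VY < V" if "x < r" "y < nev u2 x 0 e2" for x y
          using that k4[OF that(1)] stabD[OF e2 f2] by simp
        show "x = x' \<and> y = y'" if "x < r" "y < nev u2 x 0 e2" "x' < r" "y' < nev u2 x' 0 e2"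
          "adr V L (nev u2 x y VX) (?j x y) = adr V L (nev u2 x' y' VX) (?j x' y')" for x y x' y'
          using that LN V2 stabD[OF e2 f2] inj[of x y y'] by (auto simp: adr_eq simp del: nev.simps(8))
        show "L \<notin> arn e2 \<union> arn VX \<union> arn (Cond fl (Op Minus (Rd 5 VX VY) (C 1)) (Op Plus e2 VY)) \<union> arn VY \<union> arr RZ \<or>
           r \<le> 1 \<and> (\<forall>x<r. nev u2 x 0 e2 \<le> 1)" using ar LN by auto
      next
        fix u3 :: store assume o: "\<And>b. b \<noteq> L \<Longrightarrow> NA u3 b = NA u2 b \<and> RA u3 b = RA u2 b"
          and v: "\<And>x y. x < r \<Longrightarrow> y < nev u2 x 0 e2 \<Longrightarrow> NA u3 L (nev u2 x y VX) (?j x y) = nev u2 x y VY \<and>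
            RA u3 L (nev u2 x y VX) (?j x y) = rev u2 x y RZ"
        have "fr F u u3" using f2 o unfolding fr_def F_def by auto
        moreover have "NA u3 L x (card {z \<in> ?P x. z \<le> y} - 1) = y" if "x < r" "y < k x" "f x y" for x y
          using v[of x y] j[of x y] that stabD[OF e2 f2] by simp
        ultimately show "fr F u u3 \<and> (\<forall>x<r. \<forall>y<k x. f x y \<longrightarrow>
          NA u3 L x (card {z \<in> ?P x. z \<le> y} - 1) = y) \<and> NA u3 5 = NA u2 5" using o LN by auto
      qed (use ar LN G G_big stabD[OF e2 f2] in \<open>auto simp: gb_def\<close>)
    qed (use R r k sb ar G LN in \<open>auto simp: \<close>)
  qed (use r k4 V2 ar LN G in \<open>auto simp: gb_def\<close>)
qed

end


section \<open>Walks in graphs without negative cycles\<close>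

fun ext :: "cell \<Rightarrow> real \<Rightarrow> cell" where
  "ext (a, x) y = (if a = 0 then 0 else a + 1, x + y)"

text \<open>Concatenation of walks. Counts are stored plus one, so their sum is lowered by
  one.\<close>

fun cpl :: "cell \<Rightarrow> cell \<Rightarrow> cell" where
  "cpl (a, x) (b, y) = (if a = 0 \<or> b = 0 then 0 else a + b - 1, x + y)"

lemma dlt_minimal:
  assumes "finite A" "A \<noteq> {}"
  shows "\<exists>d\<in>A. \<forall>e\<in>A. \<not> dlt e d"
  using assms
proof (induction rule: finite_ne_induct)
  case (insert a A)
  then obtain d where d: "d \<in> A" "\<forall>e\<in>A. \<not> dlt e d" by blast
  show ?case
  proof (cases "dlt a d")
    case True
    then have "\<not> dlt e a" if "e \<in> A" for e using dlt_trans[OF _ dlt_asym[OF True], of e] d that by blast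
    then show ?thesis by auto
  next
    case False
    then show ?thesis using d by auto
  qed
qed auto

text \<open>Walks as a relation between arc count and cost, without vertex sequences: optimality
  only compares these two numbers, and \<open>W_path\<close> recovers the vertices where they
  matter.\<close>

primrec wk :: "(nat \<Rightarrow> nat \<Rightarrow> bool) \<Rightarrow> (nat \<Rightarrow> nat \<Rightarrow> real) \<Rightarrow> nat \<Rightarrow> nat \<Rightarrow> nat \<Rightarrow> real \<Rightarrow> bool" where
  "wk E w 0 u v x \<longleftrightarrow> v = u \<and> x = 0"
| "wk E w (Suc k) u v x \<longleftrightarrow> (\<exists>z y. wk E w k u z y \<and> E z v \<and> x = y + w z v)"

locale wgraph =
  fixes n :: nat and E :: "nat \<Rightarrow> nat \<Rightarrow> bool" and w :: "nat \<Rightarrow> nat \<Rightarrow> real"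
  assumes E_less: "E u v \<Longrightarrow> u < n \<and> v < n"
    and nonneg: "wk E w k u u x \<Longrightarrow> 0 \<le> x"
begin

abbreviation "W \<equiv> wk E w"

lemma W_append: "W k u z x \<Longrightarrow> W l z v y \<Longrightarrow> W (k + l) u v (x + y)"
  by (induction l arbitrary: v y) (auto, metis add.assoc)

lemma W_split: "W (k + l) u v x \<Longrightarrow> \<exists>z a b. W k u z a \<and> W l z v b \<and> x = a + b"
proof (induction l arbitrary: v x)
  case (Suc l)
  then obtain y c where y: "W (k + l) u y c" "E y v" "x = c + w y v" by auto
  from Suc.IH[OF y(1)] obtain z a b where "W k u z a" "W l z y b" "c = a + b" by blast
  then show ?case using y by (intro exI[of _ z] exI[of _ a] exI[of _ "b + w y v"]) auto
qed auto

lemma W_less: "W k u v x \<Longrightarrow> u < n \<Longrightarrow> v < n"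
  by (cases k) (auto dest: E_less)

definition pcost :: "(nat \<Rightarrow> nat) \<Rightarrow> nat \<Rightarrow> real" where
  "pcost p k = (\<Sum>i<k. w (p i) (p (Suc i)))"

definition arcs_along :: "(nat \<Rightarrow> nat) \<Rightarrow> nat \<Rightarrow> bool" where
  "arcs_along p k \<longleftrightarrow> (\<forall>i<k. E (p i) (p (Suc i)))"

lemma W_between:
  assumes "arcs_along p k" "i \<le> j" "j \<le> k"
  shows "W (j - i) (p i) (p j) (pcost p j - pcost p i)"
  using assms(2,3)
proof (induction rule: dec_induct)
  case (step j)
  then have "W (j - i) (p i) (p j) (pcost p j - pcost p i)" "E (p j) (p (Suc j))" "Suc j - i = Suc (j - i)"
    using assms(1) by (auto simp: arcs_along_def)
  then show ?case by (force simp: pcost_def)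
qed simp

lemma W_path: "W k u v x \<Longrightarrow> \<exists>p. p 0 = u \<and> p k = v \<and> arcs_along p k \<and> pcost p k = x"
proof (induction k arbitrary: v x)
  case 0
  then show ?case by (intro exI[of _ "\<lambda>_. u"]) (auto simp: arcs_along_def pcost_def)
next
  case (Suc k)
  then obtain z y where y: "W k u z y" "E z v" "x = y + w z v" by auto
  from Suc.IH[OF y(1)] obtain p where p: "p 0 = u" "p k = z" "arcs_along p k" "pcost p k = y" by blast
  have "pcost (p(Suc k := v)) k = pcost p k" unfolding pcost_def by (intro sum.cong) auto
  then show ?case using p y
    by (intro exI[of _ "p(Suc k := v)"]) (auto simp: arcs_along_def less_Suc_eq pcost_def)
qed

text \<open>Pigeonhole: with n or more arcs some vertex repeats, and cutting out the closed part
  between its two visits does not raise the cost, by \<open>nonneg\<close>.\<close>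

lemma W_shorten:
  assumes "W k u v x" "n \<le> k" "u < n"
  shows "\<exists>k' x'. k' < k \<and> x' \<le> x \<and> W k' u v x'"
proof -
  obtain p where p: "p 0 = u" "p k = v" "arcs_along p k" "pcost p k = x" using W_path[OF assms(1)] by blast
  have "p i < n" if "i \<le> k" for i
  proof (cases i)
    case (Suc j)
    then have "E (p j) (p i)" using p(3) that by (auto simp: arcs_along_def)
    then show ?thesis using E_less by blast
  qed (use p assms(3) in simp)
  then have "p ` {..k} \<subseteq> {..<n}" by auto
  then have "card (p ` {..k}) \<le> n" using card_mono[of "{..<n}"] by fastforce
  then have "card (p ` {..k}) < card {..k}" using assms(2) by simp
  then have "\<not> inj_on p {..k}" by (rule pigeonhole)
  then obtain i j where ij: "i < j" "j \<le> k" "p i = p j"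
    unfolding inj_on_def by (metis atMost_iff linorder_neqE_nat)
  have 1: "W i u (p i) (pcost p i)" using W_between[OF p(3), of 0 i] ij p by (simp add: pcost_def)
  have 2: "W (k - j) (p i) v (x - pcost p j)" using W_between[OF p(3), of j k] ij p by simp
  have "W (j - i) (p i) (p i) (pcost p j - pcost p i)" using W_between[OF p(3), of i j] ij by simp
  from nonneg[OF this] have "pcost p i + (x - pcost p j) \<le> x" by simp
  moreover have "i + (k - j) < k" using ij by simp
  ultimately show ?thesis using W_append[OF 1 2] by blast
qed

text \<open>The Bellman-Ford value: an optimum over the walks with at most j arcs, attained by one
  of them whenever it is finite.\<close>

definition bst :: "nat \<Rightarrow> nat \<Rightarrow> nat \<Rightarrow> cell \<Rightarrow> bool" where
  "bst j u v d \<longleftrightarrow> (\<forall>k x. k \<le> j \<longrightarrow> W k u v x \<longrightarrow> fst d \<noteq> 0 \<and> \<not> dlt (Suc k, x) d) \<and>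
     (fst d \<noteq> 0 \<longrightarrow> fst d \<le> Suc j \<and> W (fst d - 1) u v (snd d))"

lemma bst_0: "fst d = of_bool (u = v) \<Longrightarrow> snd d = 0 \<Longrightarrow> bst 0 u v d"
  by (auto simp: bst_def dlt_def split: if_splits)

lemma not_dlt_nz: "\<not> dlt a b \<Longrightarrow> fst a \<noteq> 0 \<Longrightarrow> fst b \<noteq> 0"
  by (auto simp: dlt_def)

text \<open>Removing the last arc of a walk with j + 1 arcs leaves one that \<open>D\<close> already
  covers. Ties between candidates may be broken arbitrarily, as only the fact that no candidate
  improves on \<open>d\<close> is used.\<close>

lemma bst_step:
  assumes D: "\<And>z. z < n \<Longrightarrow> bst j u z (D z)" and v: "v < n"
    and d: "d = D v \<or> (\<exists>z. E z v \<and> d = ext (D z) (w z v))"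
    and min: "\<not> dlt (D v) d" "\<And>z. E z v \<Longrightarrow> \<not> dlt (ext (D z) (w z v)) d"
  shows "bst (Suc j) u v d"
proof -
  have 1: "fst d \<le> Suc (Suc j) \<and> W (fst d - 1) u v (snd d)" if "fst d \<noteq> 0"
    using d
  proof (elim disjE exE conjE)
    assume "d = D v" then show ?thesis using D[OF v] that unfolding bst_def by auto
  next
    fix z assume z: "E z v" "d = ext (D z) (w z v)"
    have *: "bst j u z (D z)" using D E_less z(1) by blast
    have nz: "fst (D z) \<noteq> 0" using z that by (cases "D z") (auto split: if_splits)
    obtain k where k: "fst (D z) = Suc k" using nz by (cases "fst (D z)") auto
    then have "k \<le> j" "W k u z (snd (D z))" using * nz unfolding bst_def by auto
    moreover have "d = (Suc (Suc k), snd (D z) + w z v)" using z(2) k by (cases "D z") auto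
    ultimately show ?thesis using z(1) by auto
  qed
  have 2: "fst d \<noteq> 0 \<and> \<not> dlt (Suc k, x) d" if "k \<le> Suc j" "W k u v x" for k x
  proof -
    have "\<exists>e. \<not> dlt (Suc k, x) e \<and> fst e \<noteq> 0 \<and> \<not> dlt e d"
    proof (cases "k \<le> j")
      case True
      then have "\<not> dlt (Suc k, x) (D v)" "fst (D v) \<noteq> 0" using D[OF v] that unfolding bst_def by blast+
      then show ?thesis using min(1) by blast
    next
      case False
      define i where "i = j"
      have i: "k = Suc i" "i \<le> j" using that False by (simp_all add: i_def)
      obtain z y where z: "W i u z y" "E z v" "x = y + w z v" using \<open>W k u v x\<close> i(1) by auto
      have "bst j u z (D z)" using D E_less z(2) by blast
      then have "fst (D z) \<noteq> 0" "\<not> dlt (Suc i, y) (D z)" using z(1) i(2) unfolding bst_def by blast+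
      then have "\<not> dlt (Suc k, x) (ext (D z) (w z v))" "fst (ext (D z) (w z v)) \<noteq> 0"
        using z i by (cases "D z"; auto simp: dlt_def)+
      then show ?thesis using min(2) z(2) by blast
    qed
    then obtain e where e: "\<not> dlt (Suc k, x) e" "fst e \<noteq> 0" "\<not> dlt e d" by blast
    show ?thesis using dlt_trans[OF e(1,3)] not_dlt_nz[OF e(3,2)] by blast
  qed
  show ?thesis unfolding bst_def using 1 2 by blast
qed

lemma bst_exists: "u < n \<Longrightarrow> v < n \<Longrightarrow> \<exists>d. bst j u v d"
proof (induction j arbitrary: v)
  case 0
  show ?case by (rule exI[of _ "(of_bool (u = v), 0)"], rule bst_0) auto
next
  case (Suc j)
  then obtain D where D: "\<And>z. z < n \<Longrightarrow> bst j u z (D z)" by metis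
  let ?A = "insert (D v) ((\<lambda>z. ext (D z) (w z v)) ` {z. E z v})"
  have "finite {z. E z v}" by (rule finite_subset[of _ "{..<n}"]) (auto dest: E_less)
  then have "finite ?A" "?A \<noteq> {}" by auto
  from dlt_minimal[OF this] obtain d where d: "d \<in> ?A" "\<forall>e\<in>?A. \<not> dlt e d" by (elim bexE)
  have "bst (Suc j) u v d" by (rule bst_step[OF D Suc.prems(2)]) (use d in auto)
  then show ?case ..
qed

text \<open>Optimal among all walks, of any length. The order is total on finite cells, so u and v
  determine k and x.\<close>

definition ow :: "nat \<Rightarrow> nat \<Rightarrow> nat \<Rightarrow> real \<Rightarrow> bool" where
  "ow k u v x \<longleftrightarrow> W k u v x \<and> (\<forall>k' x'. W k' u v x' \<longrightarrow> \<not> dlt (Suc k', x') (Suc k, x))"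

lemma ow_unique: "ow k u v x \<Longrightarrow> ow k' u v x' \<Longrightarrow> k = k' \<and> x = x'"
proof -
  assume "ow k u v x" "ow k' u v x'"
  then have "\<not> dlt (Suc k', x') (Suc k, x)" "\<not> dlt (Suc k, x) (Suc k', x')" unfolding ow_def by blast+
  then show ?thesis by (auto simp: dlt_def)
qed

text \<open>There may be infinitely many walks, but each is matched by one with at most n arcs, and
  among those a \<open>bst\<close> value exists.\<close>

lemma ow_exists:
  assumes "W k u v x" "u < n"
  shows "\<exists>k x. ow k u v x"
proof -
  have v: "v < n" using W_less assms by blast
  obtain d where d: "bst n u v d" using bst_exists[OF assms(2) v] by blast
  have short: "\<exists>k'\<le>n. \<exists>x'. W k' u v x' \<and> \<not> dlt (Suc k, x) (Suc k', x')" if "W k u v x" for k x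
    using that
  proof (induction k arbitrary: x rule: less_induct)
    case (less k)
    show ?case
    proof (cases "k \<le> n")
      case True
      then show ?thesis using less.prems by (intro exI[of _ k]) auto
    next
      case False
      then obtain k' x' where *: "k' < k" "x' \<le> x" "W k' u v x'" using W_shorten[OF less.prems] assms(2) by auto
      from less.IH[OF *(1,3)] obtain k'' x'' where "k'' \<le> n" "W k'' u v x''" "\<not> dlt (Suc k', x') (Suc k'', x'')" by blast
      moreover have "\<not> dlt (Suc k, x) (Suc k', x')" using * by (auto simp: dlt_def)
      ultimately show ?thesis using dlt_trans by blast
    qed
  qed
  have all: "fst d \<noteq> 0 \<and> \<not> dlt (Suc k, x) d" if "W k u v x" for k x
    using short[OF that] d dlt_trans unfolding bst_def by blast
  have "fst d \<noteq> 0" using all assms by blast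
  then have "W (fst d - 1) u v (snd d)" "(Suc (fst d - 1), snd d) = d" using d unfolding bst_def by auto
  then show ?thesis unfolding ow_def using all by metis
qed

text \<open>Exchange argument: cost and arc count both add up under concatenation, so a better part
  would yield a better whole.\<close>

lemma ow_parts:
  assumes "ow (k + l) u v (x + y)" "W k u z x" "W l z v y"
  shows "ow k u z x" "ow l z v y"
proof -
  have 1: "\<not> dlt (Suc k', x') (Suc k, x)" if "W k' u z x'" for k' x'
    using assms(1) W_append[OF that assms(3)] unfolding ow_def dlt_def by force
  have 2: "\<not> dlt (Suc k', x') (Suc l, y)" if "W k' z v x'" for k' x'
    using assms(1) W_append[OF assms(2) that] unfolding ow_def dlt_def by force
  show "ow k u z x" "ow l z v y" using 1 2 assms(2,3) unfolding ow_def by blast+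
qed

lemma ow_split:
  assumes "ow (k + l) u v x"
  obtains z a b where "ow k u z a" "ow l z v b" "x = a + b"
proof -
  obtain z a b where "W k u z a" "W l z v b" "x = a + b" using assms W_split unfolding ow_def by blast
  then show ?thesis using that ow_parts assms by blast
qed

lemma bst_ow:
  assumes "bst l u v d" "ow k u v x" "k \<le> l"
  shows "d = (Suc k, x)"
proof -
  have 1: "fst d \<noteq> 0" "\<not> dlt (Suc k, x) d" "W (fst d - 1) u v (snd d)"
    using assms unfolding bst_def ow_def by blast+
  then have "\<not> dlt d (Suc k, x)" using assms(2) unfolding ow_def
    by (metis Suc_pred' bot_nat_0.not_eq_extremum prod.collapse)
  then show ?thesis using 1 by (cases d) (auto simp: dlt_def)
qed

text \<open>No vertex sequence is fixed: any walk with the same count and cost may be the one that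
  passes through z. Requiring k \<ge> 1 makes the passage to z consume an arc, which drives the
  induction in \<open>chain_exists\<close>.\<close>

definition meets :: "nat set \<Rightarrow> nat \<Rightarrow> nat \<Rightarrow> nat \<Rightarrow> real \<Rightarrow> bool" where
  "meets S l u v x \<longleftrightarrow> (\<exists>z\<in>S. \<exists>k\<ge>1. \<exists>k' a b. l = k + k' \<and> x = a + b \<and> W k u z a \<and> W k' z v b)"

definition hits :: "nat \<Rightarrow> nat set \<Rightarrow> bool" where
  "hits l S \<longleftrightarrow> (\<forall>u v x. u < n \<longrightarrow> ow l u v x \<longrightarrow> meets S l u v x)"

lemma hits_1: "{..<n} \<subseteq> S \<Longrightarrow> hits 1 S"
  unfolding hits_def meets_def
proof (intro allI impI)
  fix u v x assume S: "{..<n} \<subseteq> S" and u: "u < n" and o: "ow 1 u v x"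
  have "v \<in> S" using W_less[of 1 u v x] o u S unfolding ow_def by auto
  then show "\<exists>z\<in>S. \<exists>k\<ge>1. \<exists>k' a b. 1 = k + k' \<and> x = a + b \<and> W k u z a \<and> W k' z v b"
    using o unfolding ow_def by (intro bexI[of _ v] exI[of _ 1] conjI exI[of _ 0] exI[of _ x]) auto
qed

text \<open>The old set is met at some z within the first half, so at least l arcs of the walk
  remain after z. The next l of them form an optimal walk that starts in a source, and such walks
  are all that \<open>S'\<close> has to meet.\<close>

lemma hits_double:
  assumes S: "hits l S" "S \<subseteq> {..<n}" and l: "1 \<le> l"
    and S': "\<And>z y x. z \<in> S \<Longrightarrow> ow l z y x \<Longrightarrow> meets S' l z y x"
  shows "hits (2 * l) S'"
  unfolding hits_def
proof (intro allI impI)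
  fix u v x assume u: "u < n" and o: "ow (2 * l) u v x"
  from ow_split[of l l u v x] o obtain y a b where y: "ow l u y a" "ow l y v b" "x = a + b" by (auto simp: mult_2)
  from S(1) u y(1) obtain z k k' a1 a2 where z: "z \<in> S" "1 \<le> k" "l = k + k'" "a = a1 + a2" "W k u z a1" "W k' z y a2"
    unfolding hits_def meets_def by blast
  have 1: "W (k' + l) z v (a2 + b)" using W_append[OF z(6)] y(2) unfolding ow_def by blast
  have "ow (k + (k' + l)) u v (a1 + (a2 + b))" using o y(3) z(4) unfolding mult_2 z(3) by (simp add: ac_simps)
  from ow_parts(2)[OF this z(5) 1] have "ow (l + k') z v (a2 + b)" by (simp add: add.commute)
  from ow_split[OF this] obtain y' c d where y': "ow l z y' c" "ow k' y' v d" "a2 + b = c + d" .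
  from S'[OF z(1) y'(1)] obtain z' i i' c1 c2 where z': "z' \<in> S'" "1 \<le> i" "l = i + i'" "c = c1 + c2"
      "W i z z' c1" "W i' z' y' c2"
    unfolding meets_def by blast
  show "meets S' (2 * l) u v x" unfolding meets_def
  proof (intro bexI[OF _ z'(1)] exI conjI)
    show "W (k + i) u z' (a1 + c1)" by (rule W_append) fact+
    show "W (i' + k') z' v (c2 + d)" using W_append[OF z'(6)] y'(2) unfolding ow_def by blast
  qed (use z(2-4) z'(3,4) y(3) y'(3) in auto)
qed

text \<open>Walks composed of r optimal links; it is the number of links, not of arcs, that min-plus
  squaring doubles.\<close>

primrec chain :: "nat \<Rightarrow> nat set \<Rightarrow> nat \<Rightarrow> nat \<Rightarrow> nat \<Rightarrow> nat \<Rightarrow> real \<Rightarrow> bool" where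
  "chain l S 0 u v k x \<longleftrightarrow> v = u \<and> k = 0 \<and> x = 0"
| "chain l S (Suc r) u v k x \<longleftrightarrow> (\<exists>z\<in>S. \<exists>i a j b. ow i u z a \<and> i \<le> l \<and> chain l S r z v j b \<and> k = i + j \<and> x = a + b)"

lemma chain_split:
  "chain l S (r + r') u v k x \<Longrightarrow> u \<in> S \<Longrightarrow> \<exists>z\<in>S. \<exists>i a j b. chain l S r u z i a \<and> chain l S r' z v j b \<and> k = i + j \<and> x = a + b"
proof (induction r arbitrary: u k x)
  case (Suc r)
  then obtain z i a j b where z: "z \<in> S" "ow i u z a" "i \<le> l" "chain l S (r + r') z v j b" "k = i + j" "x = a + b" by auto
  from Suc.IH[OF z(4,1)] obtain y i' a' j' b' where
    "y \<in> S" "chain l S r z y i' a'" "chain l S r' y v j' b'" "j = i' + j'" "b = a' + b'" by blast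
  note y = this
  have "chain l S (Suc r) u y (i + i') (a + a')" using z y unfolding chain.simps by blast
  then show ?case using z y
    by (intro bexI[of _ y] exI[of _ "i + i'"] exI[of _ "a + a'"] exI[of _ j'] exI[of _ b'] conjI) simp_all
qed auto

text \<open>An optimal walk longer than l meets S within its first l arcs but not before its first
  arc. Both parts are optimal and the second is shorter, so induction applies; since each link uses
  an arc, there are at most k of them.\<close>

lemma chain_exists:
  assumes S: "hits l S" "S \<subseteq> {..<n}" and "1 \<le> l"
  shows "ow k u v x \<Longrightarrow> u \<in> S \<Longrightarrow> \<exists>r\<le>k. \<exists>z\<in>S. \<exists>i a j b. chain l S r u z i a \<and> ow j z v b \<and> j \<le> l \<and> k = i + j \<and> x = a + b"
proof (induction k arbitrary: u x rule: less_induct)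
  case (less k)
  show ?case
  proof (cases "k \<le> l")
    case True
    then show ?thesis using less.prems by (intro exI[of _ 0]) force
  next
    case False
    then have "ow (l + (k - l)) u v x" using less.prems by simp
    from ow_split[OF this] obtain y a b where y: "ow l u y a" "ow (k - l) y v b" "x = a + b" .
    from S y(1) less.prems obtain z i i' a1 a2 where z: "z \<in> S" "1 \<le> i" "l = i + i'" "a = a1 + a2" "W i u z a1" "W i' z y a2"
      unfolding hits_def meets_def by blast
    have 1: "W (k - i) z v (a2 + b)" using W_append[OF z(6), of "k - l" v b] y(2) False z(3) unfolding ow_def by simp
    have "ow (i + (k - i)) u v (a1 + (a2 + b))" using less.prems y(3) z(3,4) False by (simp add: add.assoc)
    from ow_parts[OF this z(5) 1] have o: "ow i u z a1" "ow (k - i) z v (a2 + b)" by auto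
    have ik: "k - i < k" using z(2,3) False by simp
    from less.IH[OF ik o(2) z(1)] obtain r z' i'' a'' j b'' where
      "r \<le> k - i" "z' \<in> S" "chain l S r z z' i'' a''" "ow j z' v b''" "j \<le> l" "k - i = i'' + j" "a2 + b = a'' + b''" by blast
    note h = this
    have "i \<le> l" using z(3) by simp
    then have "chain l S (Suc r) u z' (i + i'') (a1 + a'')" using o(1) z(1) h(3) unfolding chain.simps by blast
    moreover have "Suc r \<le> k" "k = (i + i'') + j" "x = (a1 + a'') + b''" using h z y False by auto
    ultimately show ?thesis using h by blast
  qed
qed

text \<open>A sandwich instead of an exact value: \<open>d\<close> comes from some walk, and no
  chain with at most R links is better. Global optimality closes the gap in the end.\<close>

definition sq_ok :: "nat \<Rightarrow> nat set \<Rightarrow> nat \<Rightarrow> nat \<Rightarrow> nat \<Rightarrow> cell \<Rightarrow> bool" where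
  "sq_ok l S R u v d \<longleftrightarrow> (fst d \<noteq> 0 \<longrightarrow> W (fst d - 1) u v (snd d)) \<and>
     (\<forall>r k x. r \<le> R \<longrightarrow> chain l S r u v k x \<longrightarrow> fst d \<noteq> 0 \<and> \<not> dlt (Suc k, x) d)"

lemma sq_ok_1: "bst l u v d \<Longrightarrow> sq_ok l S 1 u v d"
  unfolding sq_ok_def
proof (intro conjI allI impI, goal_cases)
  case (2 r k x)
  then have "k \<le> l \<and> W k u v x" by (cases r) (auto simp: ow_def)
  then show ?case using 2 unfolding bst_def by auto
next
  case (3 r k x)
  then have "k \<le> l \<and> W k u v x" by (cases r) (auto simp: ow_def)
  then show ?case using 3 unfolding bst_def by auto
qed (auto simp: bst_def)

lemma cpl_W:
  assumes "fst a \<noteq> 0 \<longrightarrow> W (fst a - 1) u z (snd a)" "fst b \<noteq> 0 \<longrightarrow> W (fst b - 1) z v (snd b)" "fst (cpl a b) \<noteq> 0"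
  shows "W (fst (cpl a b) - 1) u v (snd (cpl a b))"
proof -
  obtain k x l y where *: "a = (Suc k, x)" "b = (Suc l, y)"
    using assms(3) by (cases a; cases b; cases "fst a"; cases "fst b") auto
  then show ?thesis using assms W_append[of k u z x l v y] by auto
qed

lemma cpl_mono:
  assumes "fst a \<noteq> 0" "\<not> dlt (Suc k, x) a" "fst b \<noteq> 0" "\<not> dlt (Suc l, y) b"
  shows "fst (cpl a b) \<noteq> 0" "\<not> dlt (Suc (k + l), x + y) (cpl a b)"
  using assms by (cases a; cases b; auto simp: dlt_def)+

lemma sq_ok_double:
  assumes u: "u \<in> S" and d: "\<exists>z\<in>S. \<exists>a b. sq_ok l S R u z a \<and> sq_ok l S R z v b \<and> d = cpl a b"
    and min: "\<And>z. z \<in> S \<Longrightarrow> \<exists>a b. sq_ok l S R u z a \<and> sq_ok l S R z v b \<and> \<not> dlt (cpl a b) d"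
  shows "sq_ok l S (2 * R) u v d"
proof -
  have 1: "W (fst d - 1) u v (snd d)" if "fst d \<noteq> 0"
    using d that cpl_W unfolding sq_ok_def by blast
  have 2: "fst d \<noteq> 0 \<and> \<not> dlt (Suc k, x) d" if r: "r \<le> 2 * R" "chain l S r u v k x" for r k x
  proof -
    \<comment> \<open>For r \<le> R the second part is the empty chain, because r - R is then
      0.\<close>
    have "chain l S (min r R + (r - R)) u v k x" using r(2) by (simp add: min_def split: if_splits)
    from chain_split[OF this u] obtain z i p j q where z: "z \<in> S" "chain l S (min r R) u z i p"
      "chain l S (r - R) z v j q" "k = i + j" "x = p + q" by blast
    obtain a b where ab: "sq_ok l S R u z a" "sq_ok l S R z v b" "\<not> dlt (cpl a b) d" using min[OF z(1)] by blast
    have "fst a \<noteq> 0" "\<not> dlt (Suc i, p) a" using ab(1) z(2) unfolding sq_ok_def by (meson min.cobounded2)+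
    moreover have "r - R \<le> R" using r by simp
    then have "fst b \<noteq> 0" "\<not> dlt (Suc j, q) b" using ab(2) z(3) unfolding sq_ok_def by blast+
    ultimately have *: "fst (cpl a b) \<noteq> 0" "\<not> dlt (Suc k, x) (cpl a b)"
      using cpl_mono z(4,5) by blast+
    show ?thesis using dlt_trans[OF *(2) ab(3)] not_dlt_nz[OF ab(3) *(1)] by blast
  qed
  show ?thesis unfolding sq_ok_def using 1 2 by blast
qed

definition dist_ok :: "nat \<Rightarrow> nat \<Rightarrow> cell \<Rightarrow> bool" where
  "dist_ok u v d \<longleftrightarrow> (fst d \<noteq> 0 \<longrightarrow> W (fst d - 1) u v (snd d)) \<and> (\<forall>k x. ow k u v x \<longrightarrow> d = (Suc k, x))"

text \<open>An optimal walk has at most n arcs, hence at most n links followed by a rest of at most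
  l arcs. The rest is covered exactly by \<open>bst\<close>, the links by \<open>sq_ok\<close>, and
  nothing can beat the optimum.\<close>

lemma dist_ok_final:
  assumes S: "hits l S" "S \<subseteq> {..<n}" "1 \<le> l" and u: "u \<in> S" and R: "n \<le> R"
    and d: "\<exists>z\<in>S. \<exists>a b. sq_ok l S R u z a \<and> bst l z v b \<and> d = cpl a b"
    and min: "\<And>z. z \<in> S \<Longrightarrow> \<exists>a b. sq_ok l S R u z a \<and> bst l z v b \<and> \<not> dlt (cpl a b) d"
  shows "dist_ok u v d"
proof -
  have 1: "W (fst d - 1) u v (snd d)" if "fst d \<noteq> 0"
    using d that cpl_W unfolding sq_ok_def bst_def by blast
  have 2: "d = (Suc k, x)" if o: "ow k u v x" for k x
  proof -
    have "k \<le> n"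
    proof (rule ccontr)
      assume "\<not> k \<le> n"
      then obtain k' x' where "k' < k" "x' \<le> x" "W k' u v x'" using W_shorten[of k u v x] o u S unfolding ow_def by auto
      then show False using o unfolding ow_def dlt_def by force
    qed
    from chain_exists[OF S o u] obtain r z i p j q where z: "r \<le> k" "z \<in> S" "chain l S r u z i p" "ow j z v q" "j \<le> l"
      "k = i + j" "x = p + q" by blast
    obtain a b where ab: "sq_ok l S R u z a" "bst l z v b" "\<not> dlt (cpl a b) d" using min[OF z(2)] by blast
    have "r \<le> R" using z(1) \<open>k \<le> n\<close> R by simp
    then have "fst a \<noteq> 0" "\<not> dlt (Suc i, p) a" using ab(1) z(3) unfolding sq_ok_def by blast+
    moreover have "b = (Suc j, q)" by (rule bst_ow[OF ab(2) z(4,5)])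
    ultimately have *: "fst (cpl a b) \<noteq> 0" "\<not> dlt (Suc k, x) (cpl a b)"
      using cpl_mono[of a i p b j q] z(6,7) by auto
    have nd: "\<not> dlt (Suc k, x) d" "fst d \<noteq> 0"
      using dlt_trans[OF *(2) ab(3)] not_dlt_nz[OF ab(3) *(1)] by blast+
    then have "\<not> dlt (Suc (fst d - 1), snd d) (Suc k, x)" using 1 o unfolding ow_def by blast
    then show ?thesis using nd by (cases d) (auto simp: dlt_def)
  qed
  show ?thesis unfolding dist_ok_def using 1 2 by blast
qed

text \<open>The best predecessor must realise both the cost and the arc count of the optimum. Thus
  the optimal arc count drops by one along parents, and not even arcs of a cycle of cost 0 can trap
  the pointers.\<close>

lemma parent_ok:
  assumes F: "\<And>z. z < n \<Longrightarrow> dist_ok s z (F z)" and s: "s < n" and o: "ow k s v x" and vs: "v \<noteq> s"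
    and p: "E p v" and min: "\<And>z. E z v \<Longrightarrow> \<not> dlt (ext (F z) (w z v)) (ext (F p) (w p v))"
  shows "\<exists>i. k = Suc i \<and> ow i s p (x - w p v)"
proof -
  obtain i where k: "k = Suc i" using o vs by (cases k) (auto simp: ow_def)
  then obtain z y where z: "W i s z y" "E z v" "x = y + w z v" using o unfolding ow_def by auto
  have "W 1 z v (w z v)" using z by auto
  from ow_parts(1)[OF _ z(1) this] have "ow i s z y" using o k z(3) by simp
  then have Fz: "F z = (Suc i, y)" using F E_less z(2) unfolding dist_ok_def by blast
  have "\<not> dlt (Suc k, x) (ext (F p) (w p v))" using min[OF z(2)] Fz k z(3) by simp
  then have nd: "fst (F p) \<noteq> 0" "\<not> dlt (Suc k, x) (Suc (fst (F p)), snd (F p) + w p v)"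
    by (cases "F p"; auto simp: dlt_def split: if_splits)+
  have Wp: "W (fst (F p) - 1) s p (snd (F p))" using F[of p] E_less p nd(1) unfolding dist_ok_def by blast
  then have "W (fst (F p)) s v (snd (F p) + w p v)" using p nd(1) by (cases "fst (F p)") auto
  then have "\<not> dlt (Suc (fst (F p)), snd (F p) + w p v) (Suc k, x)" using o unfolding ow_def by blast
  then have eq: "fst (F p) = k" "snd (F p) + w p v = x" using nd(2) by (auto simp: dlt_def)
  have "W 1 p v (w p v)" using p by auto
  from ow_parts(1)[OF _ Wp this] show ?thesis using o eq k by (auto simp: algebra_simps)
qed

text \<open>The source itself is not stored, so that entry \<open>i\<close> of \<open>f\<close> is vertex \<open>i + 1\<close> of the walk.\<close>

definition trk :: "nat \<Rightarrow> nat \<Rightarrow> cell \<Rightarrow> (nat \<Rightarrow> nat) \<Rightarrow> bool" where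
  "trk u v d f \<longleftrightarrow> (\<forall>k. fst d = Suc k \<longrightarrow> (case_nat u f) k = v \<and> arcs_along (case_nat u f) k \<and> pcost (case_nat u f) k = snd d)"

lemma trk_0: "fst d = of_bool (u = v) \<Longrightarrow> snd d = 0 \<Longrightarrow> trk u v d f"
  by (auto simp: trk_def arcs_along_def pcost_def split: if_splits)

lemma trk_cong: "(\<And>i. i + 1 < fst d \<Longrightarrow> f i = g i) \<Longrightarrow> trk u v d f \<Longrightarrow> trk u v d g"
proof -
  assume eq: "\<And>i. i + 1 < fst d \<Longrightarrow> f i = g i" and t: "trk u v d f"
  have "case_nat u f i = case_nat u g i" if "fst d = Suc k" "i \<le> k" for i k
    using eq[of "i - 1"] that by (cases i) auto
  note e = this
  show ?thesis unfolding trk_def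
  proof (intro allI impI)
    fix k assume k: "fst d = Suc k"
    have "arcs_along (case_nat u g) k = arcs_along (case_nat u f) k"
      unfolding arcs_along_def using e[OF k] by (intro all_cong) (metis Suc_leI less_imp_le)
    moreover have "pcost (case_nat u g) k = pcost (case_nat u f) k"
      unfolding pcost_def using e[OF k] by (intro sum.cong) (metis Suc_leI less_imp_le lessThan_iff)+
    ultimately show "case_nat u g k = v \<and> arcs_along (case_nat u g) k \<and> pcost (case_nat u g) k = snd d"
      using t k e[OF k, of k] unfolding trk_def by auto
  qed
qed

text \<open>As the source is not stored, appending v to a walk with fst d - 1 arcs fills position
  fst d - 1.\<close>

lemma trk_ext:
  assumes t: "trk u z d f" and E: "E z v" and d': "d' = ext d (w z v)"
    and g: "\<And>i. i + 1 < fst d \<Longrightarrow> g i = f i" "fst d \<noteq> 0 \<Longrightarrow> g (fst d - 1) = v"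
  shows "trk u v d' g"
proof (cases "fst d")
  case 0
  then show ?thesis using d' by (cases d) (auto simp: trk_def)
next
  case (Suc k)
  let ?p = "case_nat u f" and ?q = "case_nat u g"
  have p: "?p k = z" "arcs_along ?p k" "pcost ?p k = snd d" using t Suc unfolding trk_def by blast+
  have eq: "?q i = ?p i" if "i \<le> k" for i using g(1)[of "i - 1"] Suc that by (cases i) auto
  have "pcost ?q k = pcost ?p k" unfolding pcost_def using eq by (intro sum.cong) (metis Suc_leI less_imp_le lessThan_iff)+
  moreover have "?q (Suc k) = v" using g(2) Suc by simp
  moreover have "arcs_along ?q k" unfolding arcs_along_def
  proof (intro allI impI)
    fix i assume "i < k"
    then show "E (?q i) (?q (Suc i))" using p(2) eq[of i] eq[of "Suc i"] unfolding arcs_along_def by simp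
  qed
  ultimately have "?q (Suc k) = v \<and> arcs_along ?q (Suc k) \<and> pcost ?q (Suc k) = snd d + w z v"
    using p eq[of k] E unfolding arcs_along_def by (auto simp: less_Suc_eq pcost_def)
  moreover have "d' = (Suc (Suc k), snd d + w z v)" using d' Suc by (cases d) auto
  ultimately show ?thesis unfolding trk_def by auto
qed

text \<open>A repeated vertex would allow a closed part to be cut out, giving fewer arcs at no
  higher cost. This is where the tie-breaking is needed, for cycles of cost 0.\<close>

lemma trk_inj:
  assumes t: "trk u v d f" and b: "bst l u v d" and d: "fst d = Suc k"
  shows "inj_on f {..<k}"
proof -
  let ?p = "case_nat u f"
  have p: "?p k = v" "arcs_along ?p k" "pcost ?p k = snd d" using t d unfolding trk_def by auto
  have "False" if ij: "i < j" "j \<le> k" "?p i = ?p j" for i j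
  proof -
    have 1: "W i u (?p i) (pcost ?p i)" using W_between[OF p(2), of 0 i] ij by (simp add: pcost_def)
    have 2: "W (k - j) (?p i) v (snd d - pcost ?p j)" using W_between[OF p(2), of j k] ij p by simp
    have "W (j - i) (?p i) (?p i) (pcost ?p j - pcost ?p i)" using W_between[OF p(2), of i j] ij by simp
    from nonneg[OF this] have "pcost ?p i + (snd d - pcost ?p j) \<le> snd d" by simp
    moreover have "i + (k - j) < k" "i + (k - j) \<le> l" using ij b d unfolding bst_def by auto
    moreover have "\<not> dlt (Suc (i + (k - j)), pcost ?p i + (snd d - pcost ?p j)) d"
      using W_append[OF 1 2] b calculation(3) unfolding bst_def by blast
    ultimately show False using d unfolding dlt_def by auto
  qed
  then have "?p (Suc i) \<noteq> ?p (Suc j)" if "i < j" "j < k" for i j using that by (metis Suc_leI Suc_less_eq)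
  then show ?thesis by (intro inj_onI) (metis lessThan_iff linorder_neqE_nat nat.case(2))
qed

text \<open>Entry i is vertex i + 1 of the walk, so every stored vertex lies after the first
  one.\<close>

lemma trk_meets:
  assumes t: "trk u v (Suc l, x) f" and i: "i < l" "f i \<in> S"
  shows "meets S l u v x"
proof -
  let ?p = "case_nat u f"
  have p: "?p l = v" "arcs_along ?p l" "pcost ?p l = x" using t unfolding trk_def by auto
  have 1: "W (Suc i) u (f i) (pcost ?p (Suc i))" using W_between[OF p(2), of 0 "Suc i"] i by (simp add: pcost_def)
  have 2: "W (l - Suc i) (f i) v (x - pcost ?p (Suc i))" using W_between[OF p(2), of "Suc i" l] i p by simp
  show ?thesis unfolding meets_def
    by (intro bexI[OF _ i(2)] exI[of _ "Suc i"] conjI exI[of _ "l - Suc i"] exI[of _ "pcost ?p (Suc i)"]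
        exI[of _ "x - pcost ?p (Suc i)"]) (use 1 2 i in auto)
qed

lemma trk_less:
  assumes t: "trk u v d f" and i: "i + 1 < fst d"
  shows "f i < n"
proof -
  obtain k where k: "fst d = Suc k" "i < k" using i by (cases "fst d") auto
  then have "E (case_nat u f i) (case_nat u f (Suc i))" using t unfolding trk_def arcs_along_def by blast
  then show ?thesis using E_less by auto
qed

end

section \<open>A derandomised hitting set\<close>

text \<open>Of every block of \<open>l = 2 ^ t\<close> consecutive numbers one element is selected by fixing one bit
  of its position in the block after the other, as a sum of bits of the block number. For random
  coefficients of these sums, different blocks are pairwise independent; the coefficients are
  chosen greedily such that a potential (scaled number of selected elements minus number of
  selected pairs in one row) falls at most by a factor of four for each bit.\<close>

lemma sum_div_mod: "(\<Sum>Y<a * b. F (Y div b) (Y mod b)) = (\<Sum>x<a. \<Sum>y<b. F x y)"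
  for F :: "nat \<Rightarrow> nat \<Rightarrow> 'a::comm_monoid_add"
proof (cases "b = 0")
  case False
  have "(\<Sum>Y<a * b. F (Y div b) (Y mod b)) = (\<Sum>x<a. \<Sum>Y = x * b..<x * b + b. F (Y div b) (Y mod b))"
    by (rule sum.nat_group[symmetric])
  also have "\<dots> = (\<Sum>x<a. \<Sum>y<b. F x y)"
  proof (rule sum.cong[OF refl])
    fix x
    have "(\<Sum>Y = x * b..<x * b + b. F (Y div b) (Y mod b)) = (\<Sum>y = 0..<b. F ((y + x * b) div b) ((y + x * b) mod b))"
      using sum.shift_bounds_nat_ivl[of "\<lambda>Y. F (Y div b) (Y mod b)" 0 "x * b" b] by (simp add: add.commute)
    also have "\<dots> = (\<Sum>y<b. F x y)" using False by (intro sum.cong) auto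
    finally show "(\<Sum>Y = x * b..<x * b + b. F (Y div b) (Y mod b)) = (\<Sum>y<b. F x y)" .
  qed
  finally show ?thesis .
qed simp

text \<open>Two numbers in the same interval of length 2 q but in different ones of length q lie in
  opposite halves.\<close>

lemma div_double_odd: "x div (2 * q) = y div (2 * q) \<Longrightarrow> x div q \<noteq> y div q \<Longrightarrow> odd (x div q) \<noteq> odd (y div q)"
  for x y q :: nat
  by (metis div_mult2_eq mult.commute parity_cases odd_two_times_div_two_nat even_two_times_div_two odd_two_times_div_two_succ)

text \<open>Row X consists of the elements f X i for i < l, and \<open>al\<close> marks the rows
  still to be hit. A triple (X, i, j) is coded as one number Y < K * l * l, so that a single long
  sum evaluates the potential.\<close>

locale rows =
  fixes K l n :: nat and al :: "nat \<Rightarrow> bool" and f :: "nat \<Rightarrow> nat \<Rightarrow> nat"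
begin

definition x1 :: "nat \<Rightarrow> nat" where "x1 Y = f (Y div (l * l)) (Y div l mod l)"
definition x2 :: "nat \<Rightarrow> nat" where "x2 Y = f (Y div (l * l)) (Y mod l)"
text \<open>\<open>A\<close> holds the candidates consistent with the digits fixed so far.
  \<open>dg\<close> uses the diagonal i = j to count candidates, \<open>pr\<close> counts ordered
  pairs of candidates from different blocks.\<close>

definition dg :: "(nat \<Rightarrow> bool) \<Rightarrow> nat \<Rightarrow> bool" where
  "dg A Y \<longleftrightarrow> al (Y div (l * l)) \<and> Y div l mod l = Y mod l \<and> A (x1 Y)"
definition pr :: "(nat \<Rightarrow> bool) \<Rightarrow> nat \<Rightarrow> bool" where
  "pr A Y \<longleftrightarrow> al (Y div (l * l)) \<and> x1 Y div l \<noteq> x2 Y div l \<and> A (x1 Y) \<and> A (x2 Y)"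

definition cnt :: "(nat \<Rightarrow> bool) \<Rightarrow> int" where "cnt P = (\<Sum>Y<K * l * l. of_bool (P Y))"

lemma cnt_add: "(\<And>Y. Y < K * l * l \<Longrightarrow> of_bool (P Y) = (of_bool (Q Y) + of_bool (R Y) :: int)) \<Longrightarrow> cnt P = cnt Q + cnt R"
  unfolding cnt_def sum.distrib[symmetric] by (intro sum.cong) auto

lemma cnt_cong: "(\<And>Y. Y < K * l * l \<Longrightarrow> P Y = Q Y) \<Longrightarrow> cnt P = cnt Q"
  unfolding cnt_def by (intro sum.cong) auto

lemma cnt_nonneg: "0 \<le> cnt P" unfolding cnt_def by (intro sum_nonneg) auto

text \<open>What remains of pairwise independence when coefficients are fixed greedily: of the pairs
  inside a common aligned interval of length q, at most half get equal signs. At q = l there are no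
  such pairs, since \<open>pr\<close> asks for different blocks of length l; q doubles with each
  coefficient.\<close>

definition halved :: "(nat \<Rightarrow> bool) \<Rightarrow> nat \<Rightarrow> (nat \<Rightarrow> bool) \<Rightarrow> bool" where
  "halved A q sg \<longleftrightarrow> 2 * cnt (\<lambda>Y. pr A Y \<and> x1 Y div q = x2 Y div q \<and> sg (x1 Y) = sg (x2 Y)) \<le>
     cnt (\<lambda>Y. pr A Y \<and> x1 Y div q = x2 Y div q)"

lemma halved_0: "halved A l sg"
  unfolding halved_def by (subst (1 2) cnt_cong[where Q = "\<lambda>_. False"]) (auto simp: pr_def cnt_def)

text \<open>Pairs separated at this level count 2 if their signs agree and 0 if not, everything else
  counts 1. So a sum of naturals, compared with the number of triples, reveals the majority.\<close>

definition rval :: "(nat \<Rightarrow> bool) \<Rightarrow> nat \<Rightarrow> (nat \<Rightarrow> bool) \<Rightarrow> nat \<Rightarrow> nat" where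
  "rval A q sg Y = (if pr A Y \<and> x1 Y div (2 * q) = x2 Y div (2 * q) \<and> x1 Y div q \<noteq> x2 Y div q
     then if sg (x1 Y) = sg (x2 Y) then 2 else 0 else 1)"

text \<open>The coefficient flips the signs on the odd intervals of length q. Pairs inside one such
  interval are flipped together; of pairs separated by q but not by 2 q exactly one element is
  flipped, which exchanges agreement and disagreement. So the agreeing ones can be made the
  minority.\<close>

lemma halved_step:
  assumes h: "halved A q sg" and r: "r \<longleftrightarrow> K * l * l < (\<Sum>Y<K * l * l. rval A q sg Y)"
  shows "halved A (2 * q) (\<lambda>v. sg v \<noteq> (r \<and> odd (v div q)))" (is "halved A _ ?sg")
proof -
  let ?c = "\<lambda>Y. pr A Y \<and> x1 Y div (2 * q) = x2 Y div (2 * q) \<and> x1 Y div q \<noteq> x2 Y div q"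
  let ?E = "cnt (\<lambda>Y. ?c Y \<and> sg (x1 Y) = sg (x2 Y))" let ?U = "cnt (\<lambda>Y. ?c Y \<and> sg (x1 Y) \<noteq> sg (x2 Y))"
  have sm: "x1 Y div (2 * q) = x2 Y div (2 * q)" if "x1 Y div q = x2 Y div q" for Y
    using that by (metis div_mult2_eq mult.commute)
  have "int (\<Sum>Y<K * l * l. rval A q sg Y) = (\<Sum>Y<K * l * l. 1 + (of_bool (?c Y \<and> sg (x1 Y) = sg (x2 Y)) - of_bool (?c Y \<and> sg (x1 Y) \<noteq> sg (x2 Y))))"
    unfolding of_nat_sum by (intro sum.cong) (auto simp: rval_def)
  also have "\<dots> = int (K * l * l) + (?E - ?U)" by (simp only: sum.distrib sum_subtractf cnt_def) simp
  finally have r': "r \<longleftrightarrow> ?U < ?E" using r by linarith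
  have eq: "(?sg (x1 Y) = ?sg (x2 Y)) \<longleftrightarrow> (sg (x1 Y) = sg (x2 Y)) \<noteq> r" if "?c Y" for Y
    using div_double_odd[of "x1 Y" q "x2 Y"] that by auto
  have 1: "cnt (\<lambda>Y. pr A Y \<and> x1 Y div (2 * q) = x2 Y div (2 * q)) = cnt (\<lambda>Y. pr A Y \<and> x1 Y div q = x2 Y div q) + (?E + ?U)"
    by (subst cnt_add[of _ "\<lambda>Y. pr A Y \<and> x1 Y div q = x2 Y div q" ?c], use sm in auto)
      (rule cnt_add, auto)
  have 2: "cnt (\<lambda>Y. pr A Y \<and> x1 Y div (2 * q) = x2 Y div (2 * q) \<and> ?sg (x1 Y) = ?sg (x2 Y)) =
     cnt (\<lambda>Y. pr A Y \<and> x1 Y div q = x2 Y div q \<and> sg (x1 Y) = sg (x2 Y)) + (if r then ?U else ?E)"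
  proof (cases r)
    case True
    then show ?thesis by (subst if_P, simp, intro cnt_add) (use sm eq in \<open>auto simp: True\<close>)
  next
    case False
    then show ?thesis by (subst if_not_P, simp, intro cnt_add) (use sm eq in \<open>auto simp: False\<close>)
  qed
  show ?thesis using h r' cnt_nonneg unfolding halved_def 1 2 by (auto split: if_splits)
qed

text \<open>psi c / c^2 is the conditional expectation of twice the selected elements minus the
  pairs, if each candidate survives the remaining digits with probability 1/c and each pair with
  1/c^2. Multiplying by c^2 keeps it an integer.\<close>

definition psi :: "nat \<Rightarrow> (nat \<Rightarrow> bool) \<Rightarrow> int" where
  "psi c A = 2 * int c * cnt (dg A) - cnt (pr A)"

text \<open>The shift by 2 l keeps all summands natural. Relative to the total shift, the sum is the
  potential of sign False minus that of sign True.\<close>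

definition sval :: "nat \<Rightarrow> (nat \<Rightarrow> bool) \<Rightarrow> (nat \<Rightarrow> bool) \<Rightarrow> nat \<Rightarrow> nat" where
  "sval c A sg Y = (if dg A Y then if sg (x1 Y) then 2 * l - c else 2 * l + c
     else if pr A Y \<and> sg (x1 Y) = sg (x2 Y) then if sg (x1 Y) then 2 * l + 1 else 2 * l - 1 else 2 * l)"

text \<open>The two signs together keep all candidates but, by \<open>halved\<close>, at most half
  of the pairs. Hence the two new potentials add up to at least half of the old one and the better
  is at least a quarter, which is exactly the change of c^2.\<close>

lemma psi_step:
  assumes h: "halved A q sg" and q: "\<And>Y. Y < K * l * l \<Longrightarrow> pr A Y \<Longrightarrow> x1 Y div q = x2 Y div q" and c: "2 * c \<le> l" "1 \<le> c"
    and s: "s \<longleftrightarrow> (\<Sum>Y<K * l * l. sval (2 * c) A sg Y) < 2 * l * (K * l * l)"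
  shows "psi (2 * c) A \<le> 4 * psi c (\<lambda>v. A v \<and> sg v = s)"
proof -
  let ?a = "\<lambda>b. cnt (\<lambda>Y. dg A Y \<and> sg (x1 Y) = b)" let ?b = "\<lambda>b. cnt (\<lambda>Y. pr A Y \<and> sg (x1 Y) = sg (x2 Y) \<and> sg (x1 Y) = b)"
  have x: "x1 Y = x2 Y" if "Y div l mod l = Y mod l" for Y using that by (simp add: x1_def x2_def)
  have nd: "\<not> (dg A Y \<and> pr A Y)" for Y using x[of Y] by (auto simp: dg_def pr_def)
  have "int (\<Sum>Y<K * l * l. sval (2 * c) A sg Y) = (\<Sum>Y<K * l * l. 2 * int l + (int (2 * c) * (of_bool (dg A Y \<and> sg (x1 Y) = False) - of_bool (dg A Y \<and> sg (x1 Y) = True))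
     - (of_bool (pr A Y \<and> sg (x1 Y) = sg (x2 Y) \<and> sg (x1 Y) = False) - of_bool (pr A Y \<and> sg (x1 Y) = sg (x2 Y) \<and> sg (x1 Y) = True))))"
    unfolding of_nat_sum using nd c by (intro sum.cong) (auto simp: sval_def of_nat_diff)
  also have "\<dots> = int (2 * l * (K * l * l)) + (int (2 * c) * (?a False - ?a True) - (?b False - ?b True))"
    by (simp only: sum.distrib sum_subtractf sum_distrib_left[symmetric] cnt_def) (simp add: algebra_simps)
  finally have s': "s \<longleftrightarrow> int (2 * c) * (?a False - ?a True) - (?b False - ?b True) < 0" using s by linarith
  have 1: "cnt (dg A) = ?a False + ?a True" by (rule cnt_add) auto
  have "cnt (\<lambda>Y. pr A Y \<and> x1 Y div q = x2 Y div q \<and> sg (x1 Y) = sg (x2 Y)) = ?b False + ?b True" by (rule cnt_add) (use q in auto)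
  moreover have "cnt (\<lambda>Y. pr A Y \<and> x1 Y div q = x2 Y div q) = cnt (pr A)" by (rule cnt_cong) (use q in auto)
  ultimately have 2: "2 * (?b False + ?b True) \<le> cnt (pr A)" using h unfolding halved_def by simp
  have 3: "cnt (dg (\<lambda>v. A v \<and> sg v = s)) = ?a s" by (rule cnt_cong) (auto simp: dg_def)
  have 4: "cnt (pr (\<lambda>v. A v \<and> sg v = s)) = ?b s" by (rule cnt_cong) (auto simp: pr_def)
  have "psi (2 * c) A = 2 * (int (2 * c) * ?a False + int (2 * c) * ?a True) - cnt (pr A)" unfolding psi_def 1 by (simp add: algebra_simps)
  moreover have "psi c (\<lambda>v. A v \<and> sg v = s) = int (2 * c) * ?a s - ?b s" unfolding psi_def 3 4 by simp
  moreover have "int (2 * c) * ?a False - int (2 * c) * ?a True - (?b False - ?b True) < 0 \<longleftrightarrow> s"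
    using s' by (simp add: algebra_simps)
  ultimately show ?thesis using 2 by (cases s) auto
qed

lemma cnt_rows:
  "cnt (\<lambda>Y. P (Y div (l * l)) (Y div l mod l) (Y mod l)) = (\<Sum>X<K. \<Sum>i<l. \<Sum>j<l. of_bool (P X i j))"
proof -
  have "cnt (\<lambda>Y. P (Y div (l * l)) (Y div l mod l) (Y mod l)) =
      (\<Sum>Y<K * (l * l). (\<lambda>X Z. of_bool (P X (Z div l) (Z mod l))) (Y div (l * l)) (Y mod (l * l)))"
  proof -
    have "Y mod (l * l) div l = Y div l mod l" if "Y < K * (l * l)" for Y
      using that by (cases "l = 0") (simp_all add: mod_mult2_eq)
    then show ?thesis unfolding cnt_def mult.assoc[of K] by (intro sum.cong) (auto simp: mod_mod_cancel)
  qed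
  also have "\<dots> = (\<Sum>X<K. \<Sum>Z<l * l. of_bool (P X (Z div l) (Z mod l)))" by (rule sum_div_mod)
  also have "\<dots> = (\<Sum>X<K. \<Sum>i<l. \<Sum>j<l. of_bool (P X i j))" by (intro sum.cong refl sum_div_mod)
  finally show ?thesis .
qed

definition live :: int where "live = (\<Sum>X<K. of_bool (al X))"

lemma dg_rows: "cnt (dg A) = (\<Sum>X<K. of_bool (al X) * (\<Sum>i<l. of_bool (A (f X i))))"
proof -
  have "cnt (dg A) = (\<Sum>X<K. \<Sum>i<l. \<Sum>j<l. of_bool (al X \<and> i = j \<and> A (f X i)))"
    unfolding dg_def[abs_def] x1_def by (rule cnt_rows)
  also have "\<dots> = (\<Sum>X<K. \<Sum>i<l. of_bool (al X) * of_bool (A (f X i)))"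
  proof (intro sum.cong refl)
    fix X i assume "i \<in> {..<l}"
    have "(\<Sum>j<l. of_bool (al X \<and> i = j \<and> A (f X i))) = (\<Sum>j<l. if i = j then of_bool (al X) * of_bool (A (f X i)) else 0 :: int)"
      by (intro sum.cong) auto
    then show "(\<Sum>j<l. of_bool (al X \<and> i = j \<and> A (f X i))) = (of_bool (al X) * of_bool (A (f X i)) :: int)"
      using \<open>i \<in> {..<l}\<close> by simp
  qed
  finally show ?thesis unfolding sum_distrib_left .
qed

lemma pr_rows: "cnt (pr A) = (\<Sum>X<K. of_bool (al X) * (\<Sum>i<l. \<Sum>j<l. of_bool (f X i div l \<noteq> f X j div l \<and> A (f X i) \<and> A (f X j))))"
proof -
  have "cnt (pr A) = (\<Sum>X<K. \<Sum>i<l. \<Sum>j<l. of_bool (al X \<and> f X i div l \<noteq> f X j div l \<and> A (f X i) \<and> A (f X j)))"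
    unfolding pr_def[abs_def] x1_def x2_def by (rule cnt_rows)
  also have "\<dots> = (\<Sum>X<K. of_bool (al X) * (\<Sum>i<l. \<Sum>j<l. of_bool (f X i div l \<noteq> f X j div l \<and> A (f X i) \<and> A (f X j))))"
    unfolding sum_distrib_left by (intro sum.cong) auto
  finally show ?thesis .
qed

text \<open>Each live row has l candidates and at most l^2 pairs, and 2 l * l - l^2 = l^2.\<close>

lemma psi_start:
  assumes A: "\<And>X i. X < K \<Longrightarrow> al X \<Longrightarrow> i < l \<Longrightarrow> A (f X i)"
  shows "int l * int l * live \<le> psi l A"
proof -
  have "cnt (dg A) = (\<Sum>X<K. of_bool (al X) * int l)"
    unfolding dg_rows
  proof (intro sum.cong refl)
    fix X assume "X \<in> {..<K}"
    then have "of_bool (al X) * (\<Sum>i<l. of_bool (A (f X i))) = of_bool (al X) * (\<Sum>i<l. 1 :: int)"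
      using A by (cases "al X") (auto intro!: sum.cong simp del: sum_of_bool_eq)
    then show "of_bool (al X) * (\<Sum>i<l. of_bool (A (f X i))) = of_bool (al X) * int l" by simp
  qed
  then have 1: "cnt (dg A) = int l * live"
    unfolding live_def by (simp add: sum_distrib_left mult.commute)
  have "cnt (pr A) \<le> (\<Sum>X<K. of_bool (al X) * (int l * int l))"
    unfolding pr_rows
  proof (intro sum_mono mult_left_mono)
    fix X
    have "(\<Sum>i<l. \<Sum>j<l. of_bool (f X i div l \<noteq> f X j div l \<and> A (f X i) \<and> A (f X j))) \<le> (\<Sum>i<l. \<Sum>j<l. 1 :: int)" by (intro sum_mono) auto
    then show "(\<Sum>i<l. \<Sum>j<l. of_bool (f X i div l \<noteq> f X j div l \<and> A (f X i) \<and> A (f X j))) \<le> int l * int l" by simp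
  qed auto
  also have "\<dots> = int l * int l * live" unfolding live_def by (simp add: sum_distrib_left mult.commute)
  finally show ?thesis unfolding psi_def 1 by (simp add: algebra_simps)
qed

text \<open>A row with a candidates has a^2 - a pairs, and 3 a - a^2 \<le> 2 because (a - 1)(a - 2)
  \<ge> 0 for integers; for a = 0 the contribution vanishes. So the potential is at most twice the
  number of live rows that are hit.\<close>

lemma psi_end:
  assumes inj: "\<And>X. X < K \<Longrightarrow> al X \<Longrightarrow> inj_on (f X) {..<l}" and n: "\<And>X i. X < K \<Longrightarrow> al X \<Longrightarrow> i < l \<Longrightarrow> f X i < n"
    and A: "\<And>x y. x < n \<Longrightarrow> y < n \<Longrightarrow> A x \<Longrightarrow> A y \<Longrightarrow> x div l = y div l \<Longrightarrow> x = y"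
  shows "psi 1 A \<le> 2 * (\<Sum>X<K. of_bool (al X \<and> (\<exists>i<l. A (f X i))))"
proof -
  have row: "2 * (\<Sum>i<l. of_bool (A (f X i))) - (\<Sum>i<l. \<Sum>j<l. of_bool (f X i div l \<noteq> f X j div l \<and> A (f X i) \<and> A (f X j)))
      \<le> (2 * of_bool (\<exists>i<l. A (f X i)) :: int)" if X: "X < K" "al X" for X
  proof -
    let ?a = "\<Sum>i<l. of_bool (A (f X i)) :: int"
    \<comment> \<open>Positions of a row hold distinct elements and candidates of one block
      coincide, so only the diagonal is missing from the full product.\<close>
    have "of_bool (f X i div l \<noteq> f X j div l \<and> A (f X i) \<and> A (f X j)) =
        of_bool (A (f X i)) * of_bool (A (f X j)) - (if i = j then of_bool (A (f X i)) else 0 :: int)" if "i < l" "j < l" for i j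
      using A[OF n[OF X that(1)] n[OF X that(2)]] inj_onD[OF inj[OF X], of i j] that by auto
    then have "(\<Sum>i<l. \<Sum>j<l. of_bool (f X i div l \<noteq> f X j div l \<and> A (f X i) \<and> A (f X j)) :: int) =
       (\<Sum>i<l. \<Sum>j<l. of_bool (A (f X i)) * of_bool (A (f X j)) - (if i = j then of_bool (A (f X i)) else 0))"
      by (intro sum.cong) auto
    also have "\<dots> = ?a * ?a - ?a"
      by (simp only: sum_subtractf sum_distrib_left[symmetric] sum_distrib_right[symmetric]) simp
    finally have 1: "(\<Sum>i<l. \<Sum>j<l. of_bool (f X i div l \<noteq> f X j div l \<and> A (f X i) \<and> A (f X j)) :: int) = ?a * ?a - ?a" .
    have nn: "0 \<le> ?a" by (intro sum_nonneg) auto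
    show ?thesis
    proof (cases "\<exists>i<l. A (f X i)")
      case False
      then have "?a = 0" by (intro sum.neutral) auto
      then show ?thesis unfolding 1 using False by simp
    next
      case True
      have "0 \<le> (?a - 1) * (?a - 2)"
        using nn by (cases "?a \<le> 1") (auto intro: mult_nonneg_nonneg mult_nonpos_nonpos simp del: sum_of_bool_eq)
      then show ?thesis unfolding 1 using True by (simp add: algebra_simps del: sum_of_bool_eq)
    qed
  qed
  have "psi 1 A = (\<Sum>X<K. of_bool (al X) * (2 * (\<Sum>i<l. of_bool (A (f X i))) -
      (\<Sum>i<l. \<Sum>j<l. of_bool (f X i div l \<noteq> f X j div l \<and> A (f X i) \<and> A (f X j)))))"
    unfolding psi_def dg_rows pr_rows sum_distrib_left sum_subtractf[symmetric]
    by (intro sum.cong refl) (simp add: right_diff_distrib sum_distrib_left mult.left_commute del: sum_of_bool_eq)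
  also have "\<dots> \<le> (\<Sum>X<K. 2 * of_bool (al X \<and> (\<exists>i<l. A (f X i))))"
  proof (rule sum_mono)
    fix X assume "X \<in> {..<K}"
    then show "of_bool (al X) * (2 * (\<Sum>i<l. of_bool (A (f X i))) -
      (\<Sum>i<l. \<Sum>j<l. of_bool (f X i div l \<noteq> f X j div l \<and> A (f X i) \<and> A (f X j)))) \<le> (2 * of_bool (al X \<and> (\<exists>i<l. A (f X i))) :: int)"
      using row[of X] by (cases "al X") (simp_all del: sum_of_bool_eq)
  qed
  finally show ?thesis by (simp add: sum_distrib_left del: sum_of_bool_eq)
qed

end

text \<open>Within a block the sign is the binary digit of weight p up to a common flip; fixing the
  sign therefore fixes one more digit of the position.\<close>

lemma block_step:
  fixes p l :: nat
  assumes A: "\<And>x y. A x \<Longrightarrow> A y \<Longrightarrow> x div l = y div l \<Longrightarrow> x mod p = y mod p"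
    and sg: "\<And>x y. A x \<Longrightarrow> A y \<Longrightarrow> x div l = y div l \<Longrightarrow> sg x = sg y \<longleftrightarrow> odd (x div p) = odd (y div p)"
    and xy: "A x \<and> sg x = s" "A y \<and> sg y = s" "x div l = y div l"
  shows "x mod (2 * p) = y mod (2 * p)"
proof -
  have par: "odd a = odd b \<Longrightarrow> a mod 2 = b mod 2" for a b :: nat by presburger
  have "x div p mod 2 = y div p mod 2" by (rule par) (use sg[OF _ _ xy(3)] xy in simp)
  then show ?thesis using A[of x y] xy by (simp add: mult.commute[of 2] mod_mult2_eq)
qed

text \<open>Once all digits of the position are fixed, a candidate is determined by its block
  number.\<close>

lemma card_selection:
  fixes l n :: nat
  assumes A: "\<And>x y. A x \<Longrightarrow> A y \<Longrightarrow> x div l = y div l \<Longrightarrow> x mod l = y mod l"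
  shows "card {v. v < n \<and> A v} \<le> n div l + 1"
proof -
  have "inj_on (\<lambda>v. v div l) {v. v < n \<and> A v}" using A by (intro inj_onI) (metis div_mult_mod_eq mem_Collect_eq)
  moreover have "(\<lambda>v. v div l) ` {v. v < n \<and> A v} \<subseteq> {..n div l}" by (auto intro: div_le_mono)
  ultimately have "card {v. v < n \<and> A v} \<le> card {..n div l}" by (intro card_inj_on_le) auto
  then show ?thesis by simp
qed

section \<open>Bounded shortest paths from several sources\<close>

lemma nev_cong:
  "(\<forall>a\<in>arn e. NA u' a = NA u a \<and> RA u' a = RA u a) \<Longrightarrow> nev u' x y e = nev u x y e"
  "(\<forall>a\<in>arr re. NA u' a = NA u a \<and> RA u' a = RA u a) \<Longrightarrow> rev u' x y re = rev u x y re"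
  by (induction e and re) auto

lemma nev_fr: "fr F u u' \<Longrightarrow> arn e \<inter> F = {} \<Longrightarrow> nev u' x y e = nev u x y e"
  by (rule nev_cong) (auto simp: fr_def)

lemma stabI: "arn e \<inter> F = {} \<Longrightarrow> (\<And>x y. nev u x y e = g x y) \<Longrightarrow> stab F u e g"
  unfolding stab_def using nev_fr by metis

definition eqE :: "nexp \<Rightarrow> nexp \<Rightarrow> nexp" where
  "eqE a b = Cond (Ls a b) (C 0) (Cond (Ls b a) (C 0) (C 1))"
definition andE :: "nexp \<Rightarrow> nexp \<Rightarrow> nexp" where
  "andE a b = Cond a (Cond b (C 1) (C 0)) (C 0)"
definition notE :: "nexp \<Rightarrow> nexp" where
  "notE a = Cond a (C 0) (C 1)"

lemma eqE_simps [simp]: "nev u x y (eqE a b) = of_bool (nev u x y a = nev u x y b)"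
    "arn (eqE a b) = arn a \<union> arn b" "gn (eqE a b) = 2 * gn a + 2 * gn b + 20"
  by (auto simp: eqE_def)

lemma andE_simps [simp]: "nev u x y (andE a b) = of_bool (nev u x y a \<noteq> 0 \<and> nev u x y b \<noteq> 0)"
    "arn (andE a b) = arn a \<union> arn b" "gn (andE a b) = gn a + gn b + 12"
  by (auto simp: andE_def)

lemma notE_simps [simp]: "nev u x y (notE a) = of_bool (nev u x y a = 0)"
    "arn (notE a) = arn a" "gn (notE a) = gn a + 7"
  by (auto simp: notE_def)

section \<open>Row sums, positions of row minima, and buffered updates\<close>

context machine
begin

definition Sm :: "nexp \<Rightarrow> nexp \<Rightarrow> nexp \<Rightarrow> com" where
  "Sm e1 e2 ne = Seq (PX 5 e1 e2 ne RZ) (Scan e1 e2)"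

lemma spec_Sm:
  assumes e1: "\<And>x y. nev u x y e1 = r" and e2: "\<And>x y. nev u x y e2 = k x"
    and R: "NA u 1 0 0 = R" "2 ^ R < V" and r: "r \<le> V^4" and k: "\<And>x. x < r \<Longrightarrow> k x \<le> 2 ^ R"
    and v: "\<And>x y. x < r \<Longrightarrow> y < k x \<Longrightarrow> nev u x y ne = f x y" "\<And>x. x < r \<Longrightarrow> (\<Sum>y<k x. f x y) < V"
    and ar: "arn e1 \<inter> {3,4,5,6} = {}" "arn e2 \<inter> {3,4,5,6} = {}" "5 \<notin> arn ne" and G: "gn e1 + gn e2 + gn ne \<le> 10 ^ 20"
  shows "spec (Sm e1 e2 ne) u (\<lambda>u'. fr {3,4,5,6} u u' \<and> (\<forall>x<r. 0 < k x \<longrightarrow> NA u' 5 x (k x - 1) = (\<Sum>y<k x. f x y)))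
     ((R + 1) * (16 + 3 * (r + (\<Sum>x<r. k x)))) (5 * R + 5)"
proof -
  let ?u1 = "setA 5 r k f (\<lambda>_ _. 0) u"
  have k4: "k x \<le> V ^ 4" if "x < r" for x
    using k[OF that] R(2) V2 self_le_power[of V 4] by auto
  have fV: "f x y < V" if "x < r" "y < k x" for x y
  proof -
    have "f x y \<le> (\<Sum>y<k x. f x y)" using that by (intro member_le_sum) auto
    then show ?thesis using v(2)[OF that(1)] by simp
  qed
  have f1: "fr {3,4,5,6} u ?u1" by (rule fr_setA) auto
  have n1: "nev ?u1 x y e1 = r" "nev ?u1 x y e2 = k x" for x y using nev_fr[OF f1] ar e1 e2 by metis+
  show ?thesis unfolding Sm_def
  proof (rule spec_step[where P = "\<lambda>u'. u' = ?u1"])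
    show "spec (PX 5 e1 e2 ne RZ) u (\<lambda>u'. u' = ?u1) (1 + r + (\<Sum>x<r. k x)) 1"
      by (rule spec_PX) (use e1 e2 v fV r k4 ar G in \<open>auto simp: gb_def\<close>)
    fix u' assume u': "u' = ?u1"
    show "spec (Scan e1 e2) u' (\<lambda>u'. fr {3,4,5,6} u u' \<and> (\<forall>x<r. 0 < k x \<longrightarrow> NA u' 5 x (k x - 1) = (\<Sum>y<k x. f x y)))
      (7 + R * (9 + 2 * (r + (\<Sum>x<r. k x)))) (3 + R * 5)"
    proof (rule spec_mono[OF spec_Scan[where ?T0.0 = f and r = r and k = k and R = R]])
      show "stab {3,4,5,6} u' e1 (\<lambda>_ _. r)" "stab {3,4,5,6} u' e2 (\<lambda>x _. k x)"
        unfolding u' using n1 ar by (auto intro!: stabI)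
      fix u'' assume b: "fr {3,4,5,6} u' u'' \<and> (\<forall>x<r. \<forall>y<k x. NA u'' 5 x y = (\<Sum>z\<le>y. f x z))"
      have eq: "(\<Sum>z\<le>k x - 1. f x z) = (\<Sum>y<k x. f x y)" if "0 < k x" for x
        using that by (intro sum.cong) auto
      show "fr {3,4,5,6} u u'' \<and> (\<forall>x<r. 0 < k x \<longrightarrow> NA u'' 5 x (k x - 1) = (\<Sum>y<k x. f x y))"
        using b fr_trans[OF f1, of "{3,4,5,6}" u''] eq unfolding u' by auto
    qed (use R r k v(2) ar G u' in auto)
  qed (simp_all add: algebra_simps)
qed

text \<open>Filling the rows with 0, 1, 2, ... makes the tournament return the index of a minimum,
  in entry 0 of the row.\<close>

definition Mn :: "(nexp \<Rightarrow> nexp) \<Rightarrow> (nexp \<Rightarrow> rexp) \<Rightarrow> nexp \<Rightarrow> nexp \<Rightarrow> com" where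
  "Mn cN cR e1 e2 = Seq (PX 5 e1 e2 VY RZ) (Red cN cR e1 e2)"

lemma spec_Mn:
  assumes e1: "\<And>x y. nev u x y e1 = r" and e2: "\<And>x y. nev u x y e2 = k x"
    and R: "NA u 1 0 0 = R" "2 ^ R < V" and r: "r \<le> V^4" and k: "\<And>x. x < r \<Longrightarrow> k x \<le> 2 ^ R"
    and K: "\<And>u' x y e. fr {3,4,5,6} u u' \<Longrightarrow> (nev u' x y (cN e), rev u' x y (cR e)) = K x (nev u' x y e)"
    and ar: "arn e1 \<inter> {3,4,5,6} = {}" "arn e2 \<inter> {3,4,5,6} = {}"  "\<And>e. 6 \<notin> arn e \<Longrightarrow> 6 \<notin> arn (cN e) \<union> arr (cR e)"
    and G: "gn e1 + gn e2 \<le> 10 ^ 10" "\<And>e. gn e \<le> 10000 \<Longrightarrow> gn (cN e) + gr (cR e) \<le> 10 ^ 20"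
  shows "spec (Mn cN cR e1 e2) u (\<lambda>u'. fr {3,4,5,6} u u' \<and> (\<forall>x<r. 0 < k x \<longrightarrow> NA u' 5 x 0 < k x \<and>
      (\<forall>z'<k x. \<not> dlt (K x z') (K x (NA u' 5 x 0)))))
     (8 + R * (9 + 4 * r) + r + 3 * (\<Sum>x<r. k x)) (4 + R * 5)"
proof -
  let ?u1 = "setA 5 r k (\<lambda>_ y. y) (\<lambda>_ _. 0) u"
  have k4: "k x \<le> V ^ 4" "k x < V" if "x < r" for x
    using k[OF that] R(2) V2 self_le_power[of V 4] by auto
  have f1: "fr {3,4,5,6} u ?u1" by (rule fr_setA) auto
  have n1: "nev ?u1 x y e1 = r" "nev ?u1 x y e2 = k x" for x y using nev_fr[OF f1] ar e1 e2 by metis+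
  have ft: "fr {3,4,5,6} u u''" if "fr {3,4,5,6} ?u1 u''" for u'' using fr_trans[OF f1 that] by simp
  show ?thesis unfolding Mn_def
  proof (rule spec_step[where P = "\<lambda>u'. u' = ?u1"])
    show "spec (PX 5 e1 e2 VY RZ) u (\<lambda>u'. u' = ?u1) (1 + r + (\<Sum>x<r. k x)) 1"
      by (rule spec_PX) (use e1 e2 r k4 ar G in \<open>auto simp: gb_def intro: less_trans\<close>)
    fix u' assume u': "u' = ?u1"
    show "spec (Red cN cR e1 e2) u' (\<lambda>u'. fr {3,4,5,6} u u' \<and> (\<forall>x<r. 0 < k x \<longrightarrow> NA u' 5 x 0 < k x \<and>
      (\<forall>z'<k x. \<not> dlt (K x z') (K x (NA u' 5 x 0)))))
      (7 + R * (9 + 4 * r) + 2 * (\<Sum>x<r. k x)) (3 + R * 5)"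
    proof (rule spec_mono[OF spec_Red[where ?T0.0 = "\<lambda>_ y. y" and r = r and k = k and R = R and K = K]])
      show "stab {3,4,5,6} u' e1 (\<lambda>_ _. r)" "stab {3,4,5,6} u' e2 (\<lambda>x _. k x)"
        unfolding u' using n1 ar by (auto intro!: stabI)
    next
      fix e :: nexp assume "gn e \<le> 10000" then show "gn (cN e) + gr (cR e) \<le> 10 ^ 20" by (rule G(2))
    next
      fix u'' x y e assume "fr {3,4,5,6} u' u''"
      then show "(nev u'' x y (cN e), rev u'' x y (cR e)) = K x (nev u'' x y e)" using K ft u' by blast
    next
      fix e :: nexp assume "6 \<notin> arn e" then show "6 \<notin> arn (cN e) \<union> arr (cR e)" by (rule ar(3))
    qed (use R r k ar G(1) u' ft in \<open>auto simp: Let_def\<close>)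
  qed (simp_all add: algebra_simps)
qed

text \<open>The detour through array 6 lets the new contents of \<open>a\<close> depend on the old
  ones, which \<open>PX\<close> forbids for more than one processor.\<close>

definition Up :: "nat \<Rightarrow> nexp \<Rightarrow> nexp \<Rightarrow> nexp \<Rightarrow> rexp \<Rightarrow> com" where
  "Up a e1 e2 ne re = Seq (PX 6 e1 e2 ne re) (PX a e1 e2 (Rd 6 VX VY) (RRd 6 VX VY))"

lemma spec_Up:
  assumes e1: "nev u 0 0 e1 = r" "r \<le> V^4" and e2: "\<And>x. x < r \<Longrightarrow> nev u x 0 e2 = k x" "\<And>x. x < r \<Longrightarrow> k x \<le> V^4"
    and val: "\<And>x y. x < r \<Longrightarrow> y < k x \<Longrightarrow> nev u x y ne = f x y" "\<And>x y. x < r \<Longrightarrow> y < k x \<Longrightarrow> f x y < V"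
      "\<And>x y. x < r \<Longrightarrow> y < k x \<Longrightarrow> rev u x y re = g x y"
    and a: "0 < a" "a \<noteq> 6" and ar: "6 \<notin> arn e1 \<union> arn e2 \<union> arn ne \<union> arr re" "a \<notin> arn e2"
    and G: "gn e1 + gn e2 + gn ne + gr re + a \<le> 10 ^ 20"
    and Q: "Q (setA a r k f g (setA 6 r k f g u))"
  shows "spec (Up a e1 e2 ne re) u Q (2 * (1 + r + (\<Sum>x<r. k x))) 2"
proof -
  let ?u1 = "setA 6 r k f g u"
  have f1: "fr {6} u ?u1" by (rule fr_setA) auto
  have n1: "nev ?u1 x y e1 = nev u x y e1" "nev ?u1 x y e2 = nev u x y e2" for x y using nev_fr[OF f1] ar by auto
  show ?thesis unfolding Up_def
  proof (rule spec_step[where P = "\<lambda>u'. u' = ?u1"])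
    show "spec (PX 6 e1 e2 ne re) u (\<lambda>u'. u' = ?u1) (1 + r + (\<Sum>x<r. k x)) 1"
      by (rule spec_PX) (use e1 e2 val ar G in \<open>auto simp: gb_def\<close>)
    fix u' assume u': "u' = ?u1"
    show "spec (PX a e1 e2 (Rd 6 VX VY) (RRd 6 VX VY)) u' Q (1 + r + (\<Sum>x<r. k x)) 1"
      by (rule spec_PX[where f = f and g = g]) (use u' n1 e1 e2 val ar a G Q in \<open>auto simp: gb_def\<close>)
  qed simp_all
qed

end

text \<open>Use of the arrays, scalars being the entries \<open>[0, 0]\<close>: 1 \<open>R\<close>, about \<open>16 * log 2 n\<close>; 7 \<open>n\<close>; 8 \<open>m\<close>;
  9 \<open>s\<close>; 10 \<open>hp\<close>; 11 numbers of the arcs into a vertex; 12 in-degrees; 13 tails and weights of these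
  arcs; 14 sources; 15 number of sources; 16 length bound \<open>l\<close>; 17 distances from the sources;
  18 walks attaining them; 20 hitting set; 21 rows not yet hit; 22 current selection; 23 one bit of each number;
  24 and 25 powers of two; 31 source-to-source distances; 33 distances from \<open>s\<close>; 34 parents.
  The others are loop counters and scratch.\<close>

locale sssp_machine = machine V G B + wgraph n E w
  for V G B n :: nat and E :: "nat \<Rightarrow> nat \<Rightarrow> bool" and w :: "nat \<Rightarrow> nat \<Rightarrow> real" +
  fixes R s hp M :: nat and ideg :: "nat \<Rightarrow> nat" and tl arc :: "nat \<Rightarrow> nat \<Rightarrow> nat"
  assumes n0: "0 < n" and s: "s < n" and R_ge: "(n + 2) ^ 16 \<le> 2 ^ R" and R_le: "2 ^ R \<le> 2 * (n + 2) ^ 16"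
    and V_ge: "(n + 2) ^ 40 \<le> V" and hp: "1 \<le> hp" "hp \<le> n + 1"
    and E_iff: "E x v \<longleftrightarrow> v < n \<and> (\<exists>y<ideg v. tl v y = x)"
    and ideg: "\<And>v. v < n \<Longrightarrow> ideg v \<le> n" "(\<Sum>v<n. ideg v) = M"
begin

definition static :: "store \<Rightarrow> bool" where
  "static u \<longleftrightarrow> NA u 1 0 0 = R \<and> NA u 7 0 0 = n \<and> NA u 9 0 0 = s \<and> NA u 10 0 0 = hp \<and>
     (\<forall>v<n. NA u 12 v 0 = ideg v \<and> (\<forall>y<ideg v. NA u 11 v y = arc v y \<and> NA u 13 v y = tl v y \<and> RA u 13 v y = w (tl v y) v))"

lemma static_fr: "static u \<Longrightarrow> fr F u u' \<Longrightarrow> {1,7,9,10,11,12,13} \<inter> F = {} \<Longrightarrow> static u'"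
  unfolding static_def by (simp add: fr_def)

lemma pow_mono: "a \<le> b \<Longrightarrow> (n + 2) ^ a \<le> (n + 2) ^ b"
  by (rule power_increasing) auto

text \<open>This is what the exponent 40 is for: 2^R is at most 2 (n + 2)^16, and words beyond 2^R
  occur, such as arc counts in the squared matrix and the interval lengths q.\<close>

lemma P_V: "2 ^ R * (n + 2) ^ 20 < V"
proof -
  have "2 ^ R * (n + 2) ^ 20 \<le> 2 * (n + 2) ^ 16 * (n + 2) ^ 20" using R_le by simp
  also have "\<dots> = 2 * (n + 2) ^ 36" by (simp add: power_add[symmetric] flip: mult.assoc)
  also have "\<dots> < (n + 2) ^ 4 * (n + 2) ^ 36"
  proof (rule mult_strict_right_mono)
    have "(2::nat) < 2 ^ 4" by simp
    also have "\<dots> \<le> (n + 2) ^ 4" by (rule power_mono) auto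
    finally show "2 < (n + 2) ^ 4" .
  qed simp
  also have "\<dots> = (n + 2) ^ 40" by (simp add: power_add[symmetric])
  finally show ?thesis using V_ge by simp
qed

lemma R_V: "2 ^ R < V"
proof -
  have "2 ^ R * 1 \<le> 2 ^ R * (n + 2) ^ 20" by (intro mult_le_mono) auto
  then show ?thesis using P_V by linarith
qed

text \<open>All row lengths in the algorithm are below (n + 2)^16, so the same number
  \<open>R\<close> of rounds suffices for every doubling loop.\<close>

lemma le_P: "x \<le> (n + 2) ^ a \<Longrightarrow> a \<le> 16 \<Longrightarrow> x \<le> 2 ^ R"
  using pow_mono[of a 16] R_ge by linarith

lemma less_V: "x \<le> (n + 2) ^ a \<Longrightarrow> a \<le> 16 \<Longrightarrow> x < V"
  using le_P R_V by (meson le_less_trans)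

lemma le_V4: "x \<le> (n + 2) ^ a \<Longrightarrow> a \<le> 16 \<Longrightarrow> x \<le> V ^ 4"
  using less_V[of x a] self_le_power[of V 4] V2 by (meson dual_order.trans le_numeral_extra(4) less_imp_le_nat zero_less_numeral Suc_leI numeral_2_eq_2 one_le_numeral)

lemma R_pos: "1 \<le> R"
proof (rule ccontr)
  assume "\<not> 1 \<le> R"
  then have "(n + 2) ^ 16 \<le> 1" using R_ge by (simp add: not_le)
  moreover have "1 < (n + 2) ^ 16" by (rule one_less_power) auto
  ultimately show False by simp
qed

lemma mult_bd: "x \<le> (n + 2) ^ a \<Longrightarrow> y \<le> (n + 2) ^ b \<Longrightarrow> x * y \<le> (n + 2) ^ (a + b)"
  by (simp add: power_add mult_le_mono)

definition cell :: "nat \<Rightarrow> store \<Rightarrow> nat \<Rightarrow> cell" where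
  "cell a u X = (NA u a X 0, RA u a X 0)"

text \<open>Sources \<open>z c\<close> for \<open>c < k\<close>; row \<open>c * n + v\<close> belongs to the walks from \<open>z c\<close> to \<open>v\<close>.\<close>

definition srcs :: "nat \<Rightarrow> nat \<Rightarrow> (nat \<Rightarrow> nat) \<Rightarrow> store \<Rightarrow> bool" where
  "srcs k l z u \<longleftrightarrow> static u \<and> NA u 15 0 0 = k \<and> NA u 16 0 0 = l \<and> (\<forall>c<k. NA u 14 0 c = z c \<and> z c < n) \<and>
     1 \<le> k \<and> k \<le> n + 1 \<and> 1 \<le> l \<and> l \<le> 2 * n + 2"

definition BFst :: "nat \<Rightarrow> nat \<Rightarrow> (nat \<Rightarrow> nat) \<Rightarrow> store \<Rightarrow> bool" where
  "BFst k j z u \<longleftrightarrow> (\<forall>X<k * n. bst j (z (X div n)) (X mod n) (cell 17 u X) \<and> trk (z (X div n)) (X mod n) (cell 17 u X) (NA u 18 X))"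

lemma srcs_fr: "srcs k l z u \<Longrightarrow> fr F u u' \<Longrightarrow> {1,7,9,10,11,12,13,14,15,16} \<inter> F = {} \<Longrightarrow> srcs k l z u'"
  using static_fr[of u F u'] unfolding srcs_def by (simp add: fr_def)

lemma BFst_fr: "BFst k j z u \<Longrightarrow> fr F u u' \<Longrightarrow> {17,18} \<inter> F = {} \<Longrightarrow> BFst k j z u'"
  unfolding BFst_def cell_def by (simp add: fr_def)

section \<open>Bellman-Ford rounds for all sources at once\<close>

abbreviation "kn \<equiv> Op Times (sc 15) (sc 7)"
abbreviation "vX \<equiv> Op Mod VX (sc 7)"
abbreviation "dX \<equiv> Rd 12 vX (C 0)"

text \<open>Candidate e below the in-degree is the e-th arc into the vertex and points to the row of
  its tail; candidate e equal to the in-degree keeps the old value and points to the row itself.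
  Thus each row has one candidate more than arcs.\<close>

definition src :: "nexp \<Rightarrow> nexp" where
  "src e = Cond (Ls e dX) (Op Plus (Op Times (Op Div VX (sc 7)) (sc 7)) (Rd 13 vX e)) VX"
definition bfN :: "nexp \<Rightarrow> nexp" where
  "bfN e = Cond (Rd 17 (src e) (C 0)) (Op Plus (Rd 17 (src e) (C 0)) (Ls e dX)) (C 0)"
definition bfR :: "nexp \<Rightarrow> rexp" where
  "bfR e = RAd (RRd 17 (src e) (C 0)) (RCond (Ls e dX) (RRd 13 vX e) RZ)"

text \<open>The walks in array 18 are updated before the distances in array 17, because the position
  of the appended vertex is the old arc count of the predecessor.\<close>

definition BFit :: com where
  "BFit = Seq (Mn bfN bfR kn (Op Plus dX (C 1))) (Seq
     (Up 18 kn (sc 16) (Cond (Ls (Rd 5 VX (C 0)) dX)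
        (Cond (eqE (Op Plus VY (C 1)) (Rd 17 (src (Rd 5 VX (C 0))) (C 0))) vX (Rd 18 (src (Rd 5 VX (C 0))) VY)) (Rd 18 VX VY)) RZ)
     (Up 17 kn (C 1) (bfN (Rd 5 VX (C 0))) (bfR (Rd 5 VX (C 0)))))"

definition bfK :: "store \<Rightarrow> nat \<Rightarrow> nat \<Rightarrow> cell" where
  "bfK u X i = (if i < NA u 12 (X mod n) 0 then ext (cell 17 u (X div n * n + NA u 13 (X mod n) i)) (RA u 13 (X mod n) i)
     else cell 17 u X)"

lemma bfK:
  assumes "NA u 7 0 0 = n" "fr F u u'" "{7,12,13,17} \<inter> F = {}"
  shows "(nev u' x y (bfN e), rev u' x y (bfR e)) = bfK u x (nev u' x y e)"
  using assms by (simp add: bfN_def bfR_def src_def bfK_def cell_def fr_def)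

lemma E_tl: "v < n \<Longrightarrow> y < ideg v \<Longrightarrow> E (tl v y) v \<and> tl v y < n"
  using E_iff E_less by blast

lemma row_index:
  assumes "c < k" "t < n"
  shows "c * n + t < k * n" "(c * n + t) div n = c" "(c * n + t) mod n = t"
proof -
  have "c * n + t < Suc c * n" using assms by simp
  also have "\<dots> \<le> k * n" using assms by (intro mult_le_mono1) simp
  finally show "c * n + t < k * n" .
qed (use assms in auto)

lemma BF_step_math:
  assumes S: "srcs k l z u" and B: "BFst k j z u" and X: "X < k * n"
    and b: "b < NA u 12 (X mod n) 0 + 1" and min: "\<And>b'. b' < NA u 12 (X mod n) 0 + 1 \<Longrightarrow> \<not> dlt (bfK u X b') (bfK u X b)"
    and f: "\<And>i. i < l \<Longrightarrow> f i = (if b < NA u 12 (X mod n) 0 then let X' = X div n * n + NA u 13 (X mod n) b in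
        if i + 1 = NA u 17 X' 0 then X mod n else NA u 18 X' i else NA u 18 X i)" and jl: "j < l"
  shows "bst (Suc j) (z (X div n)) (X mod n) (bfK u X b)" "trk (z (X div n)) (X mod n) (bfK u X b) f"
proof -
  let ?c = "X div n" let ?v = "X mod n"
  have v: "?v < n" using n0 by simp
  have c: "?c < k" using X n0 by (simp add: less_mult_imp_div_less)
  note in_row = row_index[OF c]
  have g: "NA u 12 ?v 0 = ideg ?v" "\<And>y. y < ideg ?v \<Longrightarrow> NA u 13 ?v y = tl ?v y \<and> RA u 13 ?v y = w (tl ?v y) ?v"
    using S v unfolding srcs_def static_def by blast+
  let ?D = "\<lambda>t. cell 17 u (?c * n + t)"
  have D: "bst j (z ?c) t (?D t)" "trk (z ?c) t (?D t) (NA u 18 (?c * n + t))" if "t < n" for t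
    using B[unfolded BFst_def, rule_format, OF in_row(1)[OF that]] unfolding in_row(2,3)[OF that] by blast+
  have Xv: "?c * n + ?v = X" by simp
  have Kb: "bfK u X b' = (if b' < ideg ?v then ext (?D (tl ?v b')) (w (tl ?v b') ?v) else ?D ?v)" for b'
    using g(2)[of b'] unfolding bfK_def g(1) by simp
  show "bst (Suc j) (z ?c) ?v (bfK u X b)"
  proof (rule bst_step[where D = ?D])
    show "bfK u X b = ?D ?v \<or> (\<exists>t. E t ?v \<and> bfK u X b = ext (?D t) (w t ?v))"
      unfolding Kb using E_tl[OF v] by auto
    show "\<not> dlt (?D ?v) (bfK u X b)" using min[of "ideg ?v"] unfolding g(1) Kb[of "ideg ?v"] by simp
    fix t assume "E t ?v"
    then obtain y where y: "y < ideg ?v" "tl ?v y = t" using E_iff by blast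
    then show "\<not> dlt (ext (?D t) (w t ?v)) (bfK u X b)" using min[of y] unfolding g(1) Kb[of y] by simp
  qed (use D v in auto)
  show "trk (z ?c) ?v (bfK u X b) f"
  proof (cases "b < ideg ?v")
    case True
    let ?t = "tl ?v b"
    have t: "?t < n" "E ?t ?v" using E_tl[OF v True] by auto
    have jb: "fst (?D ?t) \<le> Suc j" using D(1)[OF t(1)] unfolding bst_def by auto
    have K: "bfK u X b = ext (?D ?t) (w ?t ?v)" using True Kb by simp
    have F: "f i = (if i + 1 = fst (?D ?t) then ?v else NA u 18 (?c * n + ?t) i)" if "i < l" for i
      using f[OF that] True g by (simp add: cell_def Let_def)
    show ?thesis
      by (rule trk_ext[OF D(2)[OF t(1)] t(2) K]) (use F jb jl in auto)
  next
    case False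
    then have K: "bfK u X b = ?D ?v" using Kb by simp
    have jb: "fst (?D ?v) \<le> Suc j" using D(1)[OF v] unfolding bst_def by auto
    show ?thesis unfolding K
      by (rule trk_cong[OF _ D(2)[OF v]]) (use f False g jb jl in auto)
  qed
qed

lemma sum_rows: "(\<Sum>X<k * n. ideg (X mod n) + 1) = k * M + k * n"
proof -
  have "(\<Sum>X<k * n. ideg (X mod n) + 1) = (\<Sum>c<k. \<Sum>v<n. ideg v + 1)"
    by (rule sum_div_mod)
  also have "\<dots> = (\<Sum>c<k. M + n)" by (simp only: sum.distrib ideg(2)) simp
  finally show ?thesis by (simp add: distrib_left)
qed

end

context sssp_machine
begin

text \<open>The term k n l is the price of copying the recorded walks. Over l rounds it amounts to
  (k l) n l and so belongs to the n^2 h part of the final bound; only k M enters the m n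
  part.\<close>

lemma spec_BFit:
  assumes S: "srcs k l z u" and B: "BFst k j z u" and jl: "j < l" and bd: "bdd u"
  shows "spec BFit u (\<lambda>u'. fr {3,4,5,6,17,18} u u' \<and> BFst k (Suc j) z u')
     (3 * k * M + 2 * k * n * l + 40 * R * k * n) (13 * R)"
proof -
  let ?r = "k * n" let ?k = "\<lambda>X. NA u 12 (X mod n) 0 + 1"
  have st: "static u" and k: "NA u 15 0 0 = k" "1 \<le> k" "k \<le> n + 1" and l: "NA u 16 0 0 = l" "1 \<le> l" "l \<le> 2 * n + 2"
    using S unfolding srcs_def by auto
  have n: "NA u 7 0 0 = n" and R1: "NA u 1 0 0 = R" and dg: "\<And>v. v < n \<Longrightarrow> NA u 12 v 0 = ideg v"
    using st unfolding static_def by auto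
  have kk: "?k X = ideg (X mod n) + 1" for X using dg n0 by simp
  have rV: "?r \<le> V ^ 4" "?r < V"
    using mult_bd[of k 1 n 1] k le_V4[of ?r 2] less_V[of ?r 2] by (auto simp: numeral_2_eq_2)
  have lV: "l \<le> V ^ 4"
  proof -
    have "2 * n + 2 \<le> (n + 2) ^ 2" by (simp add: power2_eq_square)
    then show ?thesis using l le_V4[of l 2] by simp
  qed
  have kP: "?k X \<le> 2 ^ R" for X
    using ideg(1)[of "X mod n"] n0 le_P[of "?k X" 1] unfolding kk by simp
  have g: "gn (bfN e) + gr (bfR e) \<le> 10 ^ 20" if "gn e \<le> 10000" for e
    using that by (simp add: bfN_def bfR_def src_def)
  have nV: "n < V" using less_V[of n 1] by simp
  \<comment> \<open>After round j walks have at most j + 1 arcs, so the shifted count is at most j +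
    2.\<close>
  have KV: "fst (bfK u X b) < V" if "b < ?k X" "X < k * n" for X b
  proof -
    have v: "X mod n < n" using n0 by simp
    have c: "X div n < k" using that n0 by (simp add: less_mult_imp_div_less)
    have 1: "fst (cell 17 u (X div n * n + t)) \<le> Suc j" if "t < n" for t
    proof -
      have "bst j (z (X div n)) t (cell 17 u (X div n * n + t))"
        using B[unfolded BFst_def, rule_format, OF row_index(1)[OF c that]] unfolding row_index(2,3)[OF c that] by blast
      then show ?thesis unfolding bst_def by auto
    qed
    have "fst (cell 17 u X) \<le> Suc j" using 1[OF v] by simp
    moreover have "fst (ext (cell 17 u (X div n * n + NA u 13 (X mod n) b)) y) \<le> Suc (Suc j)" if "b < ideg (X mod n)" for y
      using 1[of "tl (X mod n) b"] E_tl[OF v that] st v that unfolding static_def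
      by (cases "cell 17 u (X div n * n + NA u 13 (X mod n) b)") auto
    ultimately have "fst (bfK u X b) \<le> Suc (Suc j)" unfolding bfK_def dg[OF v] by auto
    moreover have "Suc (Suc j) \<le> (n + 2) ^ 2" using jl l(3) n0 by (simp add: power2_eq_square)
    ultimately show ?thesis using less_V[of "fst (bfK u X b)" 2] by simp
  qed
  have K: "(nev u' x y (bfN e), rev u' x y (bfR e)) = bfK u x (nev u' x y e)" if "fr {3,4,5,6,18} u u'" for u' x y e
    by (rule bfK[OF n that]) auto
  show ?thesis unfolding BFit_def
  proof (rule spec_step[OF spec_Mn[where r = ?r and k = ?k and K = "bfK u" and R = R]])
    fix u1 assume u1: "fr {3,4,5,6} u u1 \<and> (\<forall>X<?r. 0 < ?k X \<longrightarrow> NA u1 5 X 0 < ?k X \<and> (\<forall>b'<?k X. \<not> dlt (bfK u X b') (bfK u X (NA u1 5 X 0))))"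
      and b1: "bdd u1"
    let ?b = "\<lambda>X. NA u1 5 X 0"
    have f1: "fr {3,4,5,6} u u1" using u1 by blast
    have v1: "NA u1 7 0 0 = n" "NA u1 15 0 0 = k" "NA u1 16 0 0 = l" "NA u1 12 = NA u 12" "NA u1 13 = NA u 13" "NA u1 17 = NA u 17" "NA u1 18 = NA u 18"
      using n k l f1 by (simp_all add: fr_def)
    define F where "F = (\<lambda>X i. if ?b X < NA u 12 (X mod n) 0 then let X' = X div n * n + NA u 13 (X mod n) (?b X) in
        if i + 1 = NA u 17 X' 0 then X mod n else NA u 18 X' i else NA u 18 X i)"
    let ?f = F
    let ?u2 = "setA 18 ?r (\<lambda>_. l) ?f (\<lambda>_ _. 0) (setA 6 ?r (\<lambda>_. l) ?f (\<lambda>_ _. 0) u1)"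
    have f2: "fr {6,18} u1 ?u2" by (intro fr_setA fr_refl) auto
    have f2': "fr {3,4,5,6,18} u ?u2" by (rule fr_trans[OF f1 f2]) auto
    let ?g = "\<lambda>X (y::nat). bfK u X (?b X)"
    let ?u3 = "setA 17 ?r (\<lambda>_. 1) (\<lambda>X y. fst (?g X y)) (\<lambda>X y. snd (?g X y)) (setA 6 ?r (\<lambda>_. 1) (\<lambda>X y. fst (?g X y)) (\<lambda>X y. snd (?g X y)) ?u2)"
    have f3: "fr {6,17} ?u2 ?u3" by (intro fr_setA fr_refl) auto
    have f3': "fr {3,4,5,6,17,18} u ?u3" by (rule fr_trans[OF f2' f3]) auto
    have fV: "?f X i < V" for X i using bd n0 nV less_trans[of "X mod n" n V] unfolding bdd_def Let_def F_def by simp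
    have "BFst k (Suc j) z ?u3" unfolding BFst_def
    proof (intro allI impI)
      fix X assume X: "X < ?r"
      have c: "cell 17 ?u3 X = bfK u X (?b X)" using X by (simp add: cell_def)
      show "bst (Suc j) (z (X div n)) (X mod n) (cell 17 ?u3 X) \<and> trk (z (X div n)) (X mod n) (cell 17 ?u3 X) (NA ?u3 18 X)"
        unfolding c by (intro conjI BF_step_math[OF S B X _ _ _ jl, where f = "NA ?u3 18 X"]) (use u1 X in \<open>auto simp: F_def\<close>)
    qed
    then have Q: "fr {3,4,5,6,17,18} u ?u3 \<and> BFst k (Suc j) z ?u3" using f3' by blast
    have bg: "gn (bfN (Rd 5 VX (C 0))) + gr (bfR (Rd 5 VX (C 0))) \<le> 10 ^ 15"
      by (simp add: bfN_def bfR_def src_def)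
    have ar: "6 \<notin> arn (bfN (Rd 5 VX (C 0)))" "6 \<notin> arr (bfR (Rd 5 VX (C 0)))"
      by (simp_all add: bfN_def bfR_def src_def)
    show "spec (Seq (Up 18 kn (sc 16) (Cond (Ls (Rd 5 VX (C 0)) dX)
        (Cond (eqE (Op Plus VY (C 1)) (Rd 17 (src (Rd 5 VX (C 0))) (C 0))) vX (Rd 18 (src (Rd 5 VX (C 0))) VY)) (Rd 18 VX VY)) RZ)
       (Up 17 kn (C 1) (bfN (Rd 5 VX (C 0))) (bfR (Rd 5 VX (C 0))))) u1
       (\<lambda>u'. fr {3,4,5,6,17,18} u u' \<and> BFst k (Suc j) z u') (2 * (1 + ?r + (\<Sum>X<?r. l)) + 2 * (1 + ?r + (\<Sum>X<?r. 1))) (2 + 2)"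
    proof (rule spec_step[where P = "\<lambda>u'. u' = ?u2"])
      show "spec (Up 18 kn (sc 16) (Cond (Ls (Rd 5 VX (C 0)) dX)
        (Cond (eqE (Op Plus VY (C 1)) (Rd 17 (src (Rd 5 VX (C 0))) (C 0))) vX (Rd 18 (src (Rd 5 VX (C 0))) VY)) (Rd 18 VX VY)) RZ)
        u1 (\<lambda>u'. u' = ?u2) (2 * (1 + ?r + (\<Sum>X<?r. l))) 2"
      proof (rule spec_Up[where r = ?r and k = "\<lambda>_. l" and f = F and g = "\<lambda>_ _. 0"])
        fix X i
        show "nev u1 X i (Cond (Ls (Rd 5 VX (C 0)) dX)
          (Cond (eqE (Op Plus VY (C 1)) (Rd 17 (src (Rd 5 VX (C 0))) (C 0))) vX (Rd 18 (src (Rd 5 VX (C 0))) VY)) (Rd 18 VX VY)) = F X i"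
        proof (cases "?b X < NA u 12 (X mod n) 0")
          case True
          then have "nev u1 X i (src (Rd 5 VX (C 0))) = X div n * n + NA u 13 (X mod n) (?b X)" using v1 by (simp add: src_def)
          then show ?thesis using v1 True by (simp add: F_def Let_def)
        qed (use v1 in \<open>simp add: F_def\<close>)
      qed (use v1 rV lV fV in \<open>simp_all add: src_def\<close>)
    next
      fix u2 assume u2: "u2 = ?u2"
      show "spec (Up 17 kn (C 1) (bfN (Rd 5 VX (C 0))) (bfR (Rd 5 VX (C 0)))) u2
         (\<lambda>u'. fr {3,4,5,6,17,18} u u' \<and> BFst k (Suc j) z u') (2 * (1 + ?r + (\<Sum>X<?r. 1))) 2"
      proof (rule spec_Up[where f = "\<lambda>X y. fst (?g X y)" and g = "\<lambda>X y. snd (?g X y)"])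
        fix X y :: nat assume X: "X < ?r" "y < 1"
        have "(nev u2 X y (bfN (Rd 5 VX (C 0))), rev u2 X y (bfR (Rd 5 VX (C 0)))) = bfK u X (nev u2 X y (Rd 5 VX (C 0)))"
          using K f2' unfolding u2 by blast
        moreover have "nev u2 X y (Rd 5 VX (C 0)) = ?b X" unfolding u2 by simp
        ultimately have "bfK u X (?b X) = (nev u2 X y (bfN (Rd 5 VX (C 0))), rev u2 X y (bfR (Rd 5 VX (C 0))))" by simp
        then show "nev u2 X y (bfN (Rd 5 VX (C 0))) = fst (?g X y)" "rev u2 X y (bfR (Rd 5 VX (C 0))) = snd (?g X y)" by simp_all
        show "fst (?g X y) < V" using KV[of "?b X" X] u1 X by simp
      next
        show "(\<lambda>u'. fr {3,4,5,6,17,18} u u' \<and> BFst k (Suc j) z u') (setA 17 ?r (\<lambda>_. 1) (\<lambda>X y. fst (?g X y)) (\<lambda>X y. snd (?g X y))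
          (setA 6 ?r (\<lambda>_. 1) (\<lambda>X y. fst (?g X y)) (\<lambda>X y. snd (?g X y)) u2))" unfolding u2 using Q .
      qed (use rV v1 u2 bg ar V2 in simp_all)
    qed simp_all
  next
    fix u' x y e assume "fr {3,4,5,6} u u'"
    then show "(nev u' x y (bfN e), rev u' x y (bfR e)) = bfK u x (nev u' x y e)" by (rule K[OF fr_mono]) auto
  next
    have "(\<Sum>X<?r. ?k X) = k * M + k * n" unfolding kk by (rule sum_rows)
    moreover have "1 \<le> k * n" using k n0 by simp
    then have "R \<le> R * (k * n)" by simp
    moreover have "k * n \<le> R * (k * n)" "1 \<le> R * (k * n)" using R_pos \<open>1 \<le> k * n\<close> by simp_all
    ultimately have "12 + R * 9 + 10 * (k * n) \<le> 36 * (R * (k * n))" "(\<Sum>X<?r. ?k X) = k * M + k * n" by linarith+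
    then show "8 + R * (9 + 4 * ?r) + ?r + 3 * (\<Sum>X<?r. ?k X) + (2 * (1 + ?r + (\<Sum>X<?r. l)) + 2 * (1 + ?r + (\<Sum>X<?r. 1)))
       \<le> 3 * k * M + 2 * k * n * l + 40 * R * k * n"
      by (simp add: algebra_simps)
  qed (use g n k R1 R_V rV kP R_pos in \<open>auto simp: bfN_def bfR_def src_def\<close>)
qed

definition BF :: com where
  "BF = Seq (PX 17 kn (C 1) (eqE (Rd 14 (C 0) (Op Div VX (sc 7))) vX) RZ) (For 19 (sc 16) BFit)"

lemma spec_BF:
  assumes S: "srcs k l z u"
  shows "spec BF u (\<lambda>u'. fr {3,4,5,6,17,18,19} u u' \<and> BFst k l z u')
     (l * (3 * k * M + 2 * k * n * l + 60 * R * k * n)) (20 * R * l)"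
proof -
  let ?r = "k * n"
  have st: "static u" and k: "NA u 15 0 0 = k" "1 \<le> k" "k \<le> n + 1" and l: "NA u 16 0 0 = l" "1 \<le> l" "l \<le> 2 * n + 2"
    and z: "\<And>c. c < k \<Longrightarrow> NA u 14 0 c = z c"
    using S unfolding srcs_def by auto
  have n: "NA u 7 0 0 = n" using st unfolding static_def by auto
  have rV: "?r \<le> V ^ 4" using mult_bd[of k 1 n 1] k le_V4[of ?r 2] by (auto simp: numeral_2_eq_2)
  let ?u1 = "setA 17 ?r (\<lambda>_. 1) (\<lambda>X y. of_bool (z (X div n) = X mod n)) (\<lambda>_ _. 0) u"
  have f1: "fr {17} u ?u1" by (intro fr_setA fr_refl) auto
  have lV: "l < V"
  proof -
    have "2 * n + 2 \<le> (n + 2) ^ 2" by (simp add: power2_eq_square)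
    then show ?thesis using l less_V[of l 2] by simp
  qed
  define I where "I = (\<lambda>j u'. fr {3,4,5,6,17,18,19} u u' \<and> NA u' 19 0 0 = j \<and> BFst k j z u' \<and> bdd u')"
  let ?w = "3 * k * M + 2 * k * n * l + 40 * R * k * n"
  show ?thesis unfolding BF_def
  proof (rule spec_bdd, rule spec_step[where P = "\<lambda>u'. u' = ?u1"])
    show "spec (PX 17 kn (C 1) (eqE (Rd 14 (C 0) (Op Div VX (sc 7))) vX) RZ) u (\<lambda>u'. u' = ?u1) (1 + ?r + (\<Sum>X<?r. 1)) 1"
      by (rule spec_PX) (use n k z rV V2 in \<open>auto simp: gb_def less_mult_imp_div_less\<close>)
    fix u1 assume bu: "bdd u" and b1: "bdd u1" and u1: "u1 = ?u1"
    show "spec (For 19 (sc 16) BFit) u1 (\<lambda>u'. fr {3,4,5,6,17,18,19} u u' \<and> BFst k l z u')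
      (4 + (\<Sum>j<l. ?w + 4)) (2 + (\<Sum>j<l. 13 * R + 2))"
    proof (rule spec_For[where I = I and L = l])
      have "BFst k 0 z ?u1" unfolding BFst_def cell_def by (auto intro!: bst_0 trk_0)
      then have "BFst k 0 z (setv 19 0 u1)" unfolding u1 by (rule BFst_fr[OF _ fr_setv[OF fr_refl, of 19]]) auto
      moreover have "bdd (setv 19 0 u1)" using b1 V2 by (auto simp: bdd_def setv_def setA_def)
      ultimately show "I 0 (setv 19 0 u1)" unfolding I_def u1
        by (auto intro!: fr_setv fr_setA)
    next
      fix j u' assume "I j u'"
      then show "nev u' 0 0 (sc 16) = l \<and> NA u' 19 0 0 = j" using l unfolding I_def by (auto simp: fr_def)
    next
      fix j u' assume j: "j < l" and I: "I j u'"
      have f: "fr {3,4,5,6,17,18,19} u u'" and i: "NA u' 19 0 0 = j" "BFst k j z u'" "bdd u'" using I by (auto simp: I_def)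
      have S': "srcs k l z u'" by (rule srcs_fr[OF S f]) auto
      show "spec BFit u' (\<lambda>u'. NA u' 19 0 0 = j \<and> I (Suc j) (setv 19 (Suc j) u')) ?w (13 * R)"
      proof (rule spec_mono[OF spec_BFit[OF S' i(2) j i(3)]])
        fix u'' assume b: "bdd u''" and h: "fr {3,4,5,6,17,18} u' u'' \<and> BFst k (Suc j) z u''"
        have "fr {3,4,5,6,17,18,19} u u''" by (rule fr_trans[OF f conjunct1[OF h]]) auto
        moreover have "BFst k (Suc j) z (setv 19 (Suc j) u'')" by (rule BFst_fr[OF conjunct2[OF h] fr_setv[OF fr_refl, of 19]]) auto
        moreover have "bdd (setv 19 (Suc j) u'')" using b j lV by (auto simp: bdd_def setv_def setA_def)
        moreover have "NA u'' 19 0 0 = j" using h i by (simp add: fr_def)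
        ultimately show "NA u'' 19 0 0 = j \<and> I (Suc j) (setv 19 (Suc j) u'')" unfolding I_def by (auto intro: fr_setv)
      qed auto
    qed (use lV in \<open>auto simp: I_def\<close>)
  next
    have kn: "1 \<le> k * n" using k n0 by simp
    have a: "k * n \<le> R * (k * n)" "1 \<le> R * (k * n)" using R_pos kn by simp_all
    have "6 + 2 * ?r + 4 * l \<le> l * (20 * (R * (k * n)))"
    proof -
      have "6 + 2 * ?r + 4 * l \<le> l * (6 + 2 * ?r + 4)" using l(2) by (cases l) auto
      also have "\<dots> \<le> l * (20 * (R * (k * n)))" using a by (intro mult_le_mono2) linarith
      finally show ?thesis .
    qed
    then show "1 + ?r + (\<Sum>X<?r. 1) + (4 + (\<Sum>j<l. ?w + 4)) \<le> l * (3 * k * M + 2 * k * n * l + 60 * R * k * n)"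
      by (simp add: algebra_simps)
    have "3 + 2 * l \<le> 5 * (l * R)" using l(2) R_pos by (cases l; cases R) auto
    then show "1 + (2 + (\<Sum>j<l. 13 * R + 2)) \<le> 20 * R * l"
      by (simp add: algebra_simps)
  qed
qed

end

section \<open>The hitting set computation\<close>

text \<open>Signs of discarded elements never enter the counts, so it is enough to know the sign on
  the candidates.\<close>

lemma (in rows) cong_sg:
  assumes "\<And>v. A v \<Longrightarrow> sg v = sg' v"
  shows "halved A q sg = halved A q sg'" "rval A q sg = rval A q sg'" "sval c A sg = sval c A sg'"
proof -
  have p: "(pr A Y \<and> P \<and> sg (x1 Y) = sg (x2 Y)) = (pr A Y \<and> P \<and> sg' (x1 Y) = sg' (x2 Y))" for Y P
    using assms unfolding pr_def by auto
  show "halved A q sg = halved A q sg'" unfolding halved_def p ..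
  show "rval A q sg = rval A q sg'" using assms by (auto simp: rval_def pr_def fun_eq_iff)
  show "sval c A sg = sval c A sg'" using assms by (auto simp: sval_def pr_def dg_def fun_eq_iff)
qed

context sssp_machine
begin

abbreviation "lE \<equiv> sc 16"
abbreviation "TE \<equiv> Op Times (Op Times kn lE) lE"
definition "rowE = Op Div VY (Op Times lE lE)"
definition "iE = Op Mod (Op Div VY lE) lE"
definition "jE = Op Mod VY lE"
definition "x1E = Rd 18 rowE iE"
definition "x2E = Rd 18 rowE jE"
definition "prE = andE (Rd 21 rowE (C 0)) (andE (notE (eqE (Op Div x1E lE) (Op Div x2E lE))) (andE (Rd 22 x1E (C 0)) (Rd 22 x2E (C 0))))"
definition "dgE = andE (Rd 21 rowE (C 0)) (andE (eqE iE jE) (Rd 22 x1E (C 0)))"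
text \<open>\<open>rvE\<close> and \<open>svE\<close> evaluate \<open>rval\<close> and
  \<open>sval\<close>, the latter with l div p as its scaling; scalar 25 holds q and scalar 24 holds
  p. The triple is \<open>VY\<close>, as all triples form one row.\<close>

definition "rvE = Cond (andE prE (andE (eqE (Op Div x1E (Op Times (C 2) (sc 25))) (Op Div x2E (Op Times (C 2) (sc 25))))
    (notE (eqE (Op Div x1E (sc 25)) (Op Div x2E (sc 25))))))
  (Cond (eqE (Rd 23 x1E (C 0)) (Rd 23 x2E (C 0))) (C 2) (C 0)) (C 1)"
definition "svE = Cond dgE (Cond (Rd 23 x1E (C 0)) (Op Minus (Op Times (C 2) lE) (Op Div lE (sc 24))) (Op Plus (Op Times (C 2) lE) (Op Div lE (sc 24))))
  (Cond (andE prE (eqE (Rd 23 x1E (C 0)) (Rd 23 x2E (C 0)))) (Cond (Rd 23 x1E (C 0)) (Op Plus (Op Times (C 2) lE) (C 1)) (Op Minus (Op Times (C 2) lE) (C 1)))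
  (Op Times (C 2) lE))"

definition alv :: "store \<Rightarrow> nat \<Rightarrow> bool" where "alv u X \<longleftrightarrow> NA u 21 X 0 \<noteq> 0"
definition Av :: "store \<Rightarrow> nat \<Rightarrow> bool" where "Av u v \<longleftrightarrow> v < n \<and> NA u 22 v 0 \<noteq> 0"
definition sgv :: "store \<Rightarrow> nat \<Rightarrow> bool" where "sgv u v \<longleftrightarrow> NA u 23 v 0 \<noteq> 0"

text \<open>Live rows must hold l distinct vertices, which is what the final estimate of the
  potential relies on.\<close>

definition HI :: "nat \<Rightarrow> nat \<Rightarrow> (nat \<Rightarrow> nat) \<Rightarrow> store \<Rightarrow> bool" where
  "HI k l z u \<longleftrightarrow> srcs k l z u \<and> (\<forall>X<k * n. alv u X \<longrightarrow> inj_on (NA u 18 X) {..<l} \<and> (\<forall>i<l. NA u 18 X i < n))"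

lemma HI_fr: "HI k l z u \<Longrightarrow> fr F u u' \<Longrightarrow> {1,7,9,10,11,12,13,14,15,16,18,21} \<inter> F = {} \<Longrightarrow> HI k l z u'"
  using srcs_fr[of k l z u F u'] unfolding HI_def alv_def by (simp add: fr_def)

abbreviation "hpr l u \<equiv> rows.pr l (alv u) (NA u 18)"
abbreviation "hdg l u \<equiv> rows.dg l (alv u) (NA u 18)"
abbreviation "hhalved K l u \<equiv> rows.halved K l (alv u) (NA u 18)"
abbreviation "hrval l u \<equiv> rows.rval l (alv u) (NA u 18)"
abbreviation "hsval l u \<equiv> rows.sval l (alv u) (NA u 18)"
abbreviation "hpsi K l u \<equiv> rows.psi K l (alv u) (NA u 18)"
abbreviation "hlive K u \<equiv> rows.live K (alv u)"

context
  fixes k l :: nat and z :: "nat \<Rightarrow> nat" and u :: store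
  assumes H: "HI k l z u"
begin

lemma HI_simps: "NA u 7 0 0 = n" "NA u 1 0 0 = R" "NA u 15 0 0 = k" "NA u 16 0 0 = l" "1 \<le> k" "k \<le> n + 1" "1 \<le> l" "l \<le> 2 * n + 2"
  using H unfolding HI_def srcs_def static_def by auto

lemma HI_T: "k * n * l * l \<le> (n + 2) ^ 6" "k * n * l \<le> (n + 2) ^ 4" "n \<le> k * n * l * l" "k * n \<le> k * n * l * l" "k * n * l \<le> k * n * l * l" "l \<le> (n + 2) ^ 2"
proof -
  show l: "l \<le> (n + 2) ^ 2"
  proof -
    have "2 * n + 2 \<le> (n + 2) ^ 2" by (simp add: power2_eq_square)
    then show ?thesis using HI_simps(8) by simp
  qed
  have kn: "k * n \<le> (n + 2) ^ 2" using mult_bd[of k 1 n 1] HI_simps by (simp add: numeral_2_eq_2)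
  show knl: "k * n * l \<le> (n + 2) ^ 4" using mult_bd[OF kn l] by simp
  show "k * n * l * l \<le> (n + 2) ^ 6" using mult_bd[OF knl l] by simp
  show "n \<le> k * n * l * l" "k * n \<le> k * n * l * l" "k * n * l \<le> k * n * l * l" using HI_simps(5,7) by auto
qed

lemma nev_x: "nev u x Y x1E = rows.x1 l (NA u 18) Y" "nev u x Y x2E = rows.x2 l (NA u 18) Y"
  using HI_simps by (simp_all add: x1E_def x2E_def rowE_def iE_def jE_def rows.x1_def rows.x2_def)

lemma x_less:
  assumes "Y < k * n * l * l" "alv u (Y div (l * l))"
  shows "rows.x1 l (NA u 18) Y < n" "rows.x2 l (NA u 18) Y < n"
proof -
  have l: "0 < l" using HI_simps by simp
  have "Y div (l * l) < k * n" using assms(1) by (simp add: less_mult_imp_div_less mult.assoc)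
  moreover have "Y div l mod l < l" "Y mod l < l" using l by auto
  ultimately show "rows.x1 l (NA u 18) Y < n" "rows.x2 l (NA u 18) Y < n"
    using H assms(2) unfolding HI_def rows.x1_def rows.x2_def by blast+
qed

lemma nev_pr: "Y < k * n * l * l \<Longrightarrow> nev u x Y prE = of_bool (hpr l u (Av u) Y)"
  using HI_simps x_less[of Y]
  by (auto simp: prE_def nev_x rows.pr_def Av_def rowE_def alv_def)

lemma nev_dg: "Y < k * n * l * l \<Longrightarrow> nev u x Y dgE = of_bool (hdg l u (Av u) Y)"
  using HI_simps x_less[of Y]
  by (auto simp: dgE_def nev_x rows.dg_def Av_def rowE_def alv_def iE_def jE_def)

lemma nev_sg:
  assumes b: "\<And>v. v < n \<Longrightarrow> NA u 23 v 0 < 2" and Y: "Y < k * n * l * l" "hpr l u (Av u) Y"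
  shows "nev u x Y (Rd 23 x1E (C 0)) = of_bool (sgv u (rows.x1 l (NA u 18) Y))" "nev u x Y (Rd 23 x2E (C 0)) = of_bool (sgv u (rows.x2 l (NA u 18) Y))"
proof -
  have "rows.x1 l (NA u 18) Y < n" "rows.x2 l (NA u 18) Y < n" using Y(2) unfolding rows.pr_def Av_def by auto
  from b[OF this(1)] b[OF this(2)] show "nev u x Y (Rd 23 x1E (C 0)) = of_bool (sgv u (rows.x1 l (NA u 18) Y))" "nev u x Y (Rd 23 x2E (C 0)) = of_bool (sgv u (rows.x2 l (NA u 18) Y))"
    by (auto simp: nev_x sgv_def)
qed

lemma nev_rv:
  assumes "\<And>v. v < n \<Longrightarrow> NA u 23 v 0 < 2" "NA u 25 0 0 = q" "Y < k * n * l * l"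
  shows "nev u x Y rvE = hrval l u (Av u) q (sgv u) Y"
  using nev_sg[of Y x] nev_pr[of Y x] assms
  by (auto simp: rvE_def nev_x rows.rval_def simp del: nev.simps(5))

lemma nev_sv:
  assumes "\<And>v. v < n \<Longrightarrow> NA u 23 v 0 < 2" "NA u 24 0 0 = p" "Y < k * n * l * l"
  shows "nev u x Y svE = hsval l u (l div p) (Av u) (sgv u) Y"
proof -
  have 1: "nev u x Y (Rd 23 x1E (C 0)) = 0 \<longleftrightarrow> \<not> sgv u (rows.x1 l (NA u 18) Y)" by (simp add: nev_x sgv_def)
  have 2: "nev u x Y (sc 24) = p" "nev u x Y lE = l" using assms HI_simps by auto
  show ?thesis using nev_sg[of Y x] nev_pr[of Y x] nev_dg[of Y x] assms 1 2
    by (simp add: svE_def rows.sval_def del: nev.simps(5) sc_simps(1))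
qed

end

lemma arn_hit [simp]:
  "arn x1E = {16,18}" "arn x2E = {16,18}" "arn prE = {16,18,21,22}" "arn dgE = {16,18,21,22}"
  "arn rvE = {16,18,21,22,23,25}" "arn svE = {16,18,21,22,23,24}"
  by (auto simp: x1E_def x2E_def rowE_def iE_def jE_def prE_def dgE_def rvE_def svE_def)

lemma gn_hit: "gn rvE \<le> 10 ^ 15" "gn svE \<le> 10 ^ 15"
  by (simp_all add: x1E_def x2E_def rowE_def iE_def jE_def prE_def dgE_def rvE_def svE_def)

lemma cost_HitR: "1 \<le> r \<Longrightarrow> 1 \<le> t \<Longrightarrow> m \<le> t \<Longrightarrow>
    (r + 1) * (16 + 3 * (1 + t)) + (3 + (2 * (1 + m + m) + 3)) \<le> 56 * r * t" for r t m :: nat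
  by (cases r; cases t) (simp_all add: algebra_simps)

text \<open>Fixes one coefficient: scalar 28 records whether agreeing pairs are in the majority, and
  in that case the signs on odd intervals of length q are flipped.\<close>

definition HitR :: com where
  "HitR = Seq (Sm (C 1) TE rvE) (Seq (asg 28 (Ls TE (Rd 5 (C 0) (Op Minus TE (C 1)))))
     (Seq (Up 23 (sc 7) (C 1) (Op Mod (Op Plus (Rd 23 VX (C 0)) (Op Times (sc 28) (Op Div VX (sc 25)))) (C 2)) RZ)
       (asg 25 (Op Times (C 2) (sc 25)))))"

text \<open>Inside a block of length l the sign is the binary digit of weight p up to a flip
  depending on the block only.\<close>

definition blk_ok :: "nat \<Rightarrow> nat \<Rightarrow> store \<Rightarrow> bool" where
  "blk_ok l p u \<longleftrightarrow> (\<forall>v<n. NA u 23 v 0 < 2) \<and>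
     (\<forall>x y. x < n \<longrightarrow> y < n \<longrightarrow> x div l = y div l \<longrightarrow> sgv u x = sgv u y \<longleftrightarrow> odd (x div p) = odd (y div p))"

lemma spec_HitR:
  assumes H: "HI k l z u" and q: "NA u 25 0 0 = q" "l dvd q" "2 * q < V" and bk: "blk_ok l p u"
    and h: "hhalved (k * n) l u (Av u) q (sgv u)"
  shows "spec HitR u (\<lambda>u'. fr {3,4,5,6,23,25,28} u u' \<and> NA u' 25 0 0 = 2 * q \<and> blk_ok l p u' \<and> hhalved (k * n) l u (Av u) (2 * q) (sgv u'))
     (56 * R * (k * n * l * l)) (14 * R)"
proof -
  note S = HI_simps[OF H] note T = HI_T[OF H]
  let ?T = "k * n * l * l"
  have TV: "?T \<le> 2 ^ R" "?T < V" using le_P[OF T(1)] less_V[OF T(1)] by auto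
  have T1: "1 \<le> ?T" using S n0 by (simp add: Suc_leI)
  have nV: "n \<le> V ^ 4" using le_V4[of n 1] by simp
  have b2: "\<And>v. v < n \<Longrightarrow> NA u 23 v 0 < 2" using bk unfolding blk_ok_def by blast
  let ?f = "hrval l u (Av u) q (sgv u)"
  have sumV: "(\<Sum>Y<?T. ?f Y) < V"
  proof -
    have "(\<Sum>Y<?T. ?f Y) \<le> (\<Sum>Y<?T. 2)" by (intro sum_mono) (auto simp: rows.rval_def)
    also have "\<dots> = ?T * 2" by simp
    also have "\<dots> \<le> (n + 2) ^ 7" using mult_bd[OF T(1), of 2 1] by simp
    finally show ?thesis using less_V by simp
  qed
  let ?r = "?T < (\<Sum>Y<?T. ?f Y)"
  show ?thesis unfolding HitR_def
  proof (rule spec_step[OF spec_Sm[where r = 1 and k = "\<lambda>_. ?T" and f = "\<lambda>_. ?f" and R = R]])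
    fix u1 assume "fr {3,4,5,6} u u1 \<and> (\<forall>x<1. 0 < ?T \<longrightarrow> NA u1 5 x (?T - 1) = (\<Sum>Y<?T. ?f Y))"
    then have f1: "fr {3,4,5,6} u u1" and s1: "NA u1 5 0 (?T - 1) = (\<Sum>Y<?T. ?f Y)" using T1 by auto
    let ?u2 = "setv 28 (of_bool ?r) u1"
    let ?g = "\<lambda>v (y::nat). (NA u 23 v 0 + of_bool ?r * (v div q)) mod 2"
    let ?u3 = "setA 23 n (\<lambda>_. 1) ?g (\<lambda>_ _. 0) (setA 6 n (\<lambda>_. 1) ?g (\<lambda>_ _. 0) ?u2)"
    have f2: "fr {3,4,5,6,28} u ?u2" by (intro fr_setv fr_mono[OF f1]) auto
    have f3: "fr {3,4,5,6,23,28} u ?u3" by (intro fr_setA fr_mono[OF f2]) auto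
    have S1: "NA u1 7 0 0 = n" "NA u1 15 0 0 = k" "NA u1 16 0 0 = l" "NA u1 25 0 0 = q" "NA u1 23 = NA u 23"
      using S q f1 by (simp_all add: fr_def)
    let ?u4 = "setv 25 (2 * q) ?u3"
    have f4: "fr {3,4,5,6,23,25,28} u ?u4" by (intro fr_setv fr_mono[OF f3]) auto
    have sg: "sgv ?u4 v \<longleftrightarrow> sgv u v \<noteq> (?r \<and> odd (v div q))" if "v < n" for v
    proof -
      have par: "(a + b) mod 2 \<noteq> 0 \<longleftrightarrow> (a \<noteq> 0) \<noteq> odd b" if "a < 2" for a b :: nat using that by presburger
      show ?thesis using that b2[OF that] par[OF b2[OF that], of "v div q"] by (cases ?r) (auto simp: sgv_def)
    qed
    have "blk_ok l p ?u4" unfolding blk_ok_def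
    proof (intro conjI allI impI)
      fix x y assume xy: "x < n" "y < n" "x div l = y div l"
      \<comment> \<open>q is a multiple of l, so the elements of a block are flipped
        together.\<close>
      have "x div q = y div q" using xy(3) q(2) by (metis div_mult2_eq dvdE)
      then show "sgv ?u4 x = sgv ?u4 y \<longleftrightarrow> odd (x div p) = odd (y div p)"
        using bk xy unfolding sg[OF xy(1)] sg[OF xy(2)] blk_ok_def by auto
    qed simp
    moreover have "hhalved (k * n) l u (Av u) (2 * q) (sgv ?u4)"
    proof -
      have "hhalved (k * n) l u (Av u) (2 * q) (\<lambda>v. sgv u v \<noteq> (?r \<and> odd (v div q)))"
        by (rule rows.halved_step[OF h refl])
      moreover have "sgv ?u4 v = (sgv u v \<noteq> (?r \<and> odd (v div q)))" if "Av u v" for v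
        using sg that unfolding Av_def by blast
      note rows.cong_sg(1)[OF this]
      ultimately show ?thesis by (simp only:)
    qed
    ultimately have Q: "fr {3,4,5,6,23,25,28} u ?u4 \<and> NA ?u4 25 0 0 = 2 * q \<and> blk_ok l p ?u4 \<and> hhalved (k * n) l u (Av u) (2 * q) (sgv ?u4)"
      using f4 by (simp add: setv_def[of 25])
    show "spec (Seq (asg 28 (Ls TE (Rd 5 (C 0) (Op Minus TE (C 1)))))
     (Seq (Up 23 (sc 7) (C 1) (Op Mod (Op Plus (Rd 23 VX (C 0)) (Op Times (sc 28) (Op Div VX (sc 25)))) (C 2)) RZ)
       (asg 25 (Op Times (C 2) (sc 25))))) u1 (\<lambda>u'. fr {3,4,5,6,23,25,28} u u' \<and> NA u' 25 0 0 = 2 * q \<and> blk_ok l p u' \<and> hhalved (k * n) l u (Av u) (2 * q) (sgv u'))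
       (3 + (2 * (1 + n + (\<Sum>x<n. 1)) + 3)) (1 + (2 + 1))"
    proof (rule spec_step[where P = "\<lambda>u'. u' = ?u2"])
      show "spec (asg 28 (Ls TE (Rd 5 (C 0) (Op Minus TE (C 1))))) u1 (\<lambda>u'. u' = ?u2) 3 1"
        by (rule spec_asg[where v = "of_bool ?r"]) (use S1 s1 V2 in auto)
      fix u2 assume u2: "u2 = ?u2"
      show "spec (Seq (Up 23 (sc 7) (C 1) (Op Mod (Op Plus (Rd 23 VX (C 0)) (Op Times (sc 28) (Op Div VX (sc 25)))) (C 2)) RZ)
       (asg 25 (Op Times (C 2) (sc 25)))) u2 (\<lambda>u'. fr {3,4,5,6,23,25,28} u u' \<and> NA u' 25 0 0 = 2 * q \<and> blk_ok l p u' \<and> hhalved (k * n) l u (Av u) (2 * q) (sgv u'))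
       (2 * (1 + n + (\<Sum>x<n. 1)) + 3) (2 + 1)"
      proof (rule spec_step[where P = "\<lambda>u'. u' = ?u3"])
        show "spec (Up 23 (sc 7) (C 1) (Op Mod (Op Plus (Rd 23 VX (C 0)) (Op Times (sc 28) (Op Div VX (sc 25)))) (C 2)) RZ) u2 (\<lambda>u'. u' = ?u3)
          (2 * (1 + n + (\<Sum>x<n. 1))) 2"
        proof (rule spec_Up[where f = ?g and g = "\<lambda>_ _. 0"])
          fix x y :: nat show "?g x y < V" using V2 by (meson less_le_trans mod_less_divisor zero_less_numeral)
        qed (use u2 S1 nV V2 in auto)
        fix u3 assume u3: "u3 = ?u3"
        show "spec (asg 25 (Op Times (C 2) (sc 25))) u3 (\<lambda>u'. fr {3,4,5,6,23,25,28} u u' \<and> NA u' 25 0 0 = 2 * q \<and> blk_ok l p u' \<and> hhalved (k * n) l u (Av u) (2 * q) (sgv u')) 3 1"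
          by (rule spec_asg[where v = "2 * q"]) (use u3 S1 q Q in auto)
      qed simp_all
    qed simp_all
  next
    have "(\<Sum>x<(1::nat). ?T) = ?T" "(\<Sum>x<n. 1) = n" by simp_all
    then show "(R + 1) * (16 + 3 * (1 + (\<Sum>x<(1::nat). ?T))) + (3 + (2 * (1 + n + (\<Sum>x<n. 1)) + 3)) \<le> 56 * R * ?T"
      using cost_HitR[OF R_pos T1 T(3)] by (simp only:)
  qed (use S TV nev_rv[OF H b2 q(1)] sumV gn_hit R_pos R_V V2 in auto)
qed

end

section \<open>Fixing one binary digit of the selected positions\<close>

context sssp_machine
begin

lemma fr_views:
  assumes "fr F u u'" "{18,21} \<inter> F = {}"
  shows "alv u' = alv u" "NA u' 18 = NA u 18"
  using assms by (auto simp: fr_def alv_def fun_eq_iff)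

lemma fr_Av: "fr F u u' \<Longrightarrow> 22 \<notin> F \<Longrightarrow> Av u' = Av u"
  by (auto simp: fr_def Av_def fun_eq_iff)

text \<open>The sign starts as the digit of weight p, R coefficients mix in the digits of the block
  number, and the sum of \<open>sval\<close> decides which of the two signs survives.\<close>

definition HitS :: com where
  "HitS = Seq (PX 23 (sc 7) (C 1) (Op Mod (Op Div VX (sc 24)) (C 2)) RZ)
    (Seq (asg 25 lE) (Seq (For 27 (sc 1) HitR)
    (Seq (Sm (C 1) TE svE) (Seq (asg 28 (Ls (Rd 5 (C 0) (Op Minus TE (C 1))) (Op Times (Op Times (C 2) lE) TE)))
    (Seq (Up 22 (sc 7) (C 1) (andE (Rd 22 VX (C 0)) (eqE (Rd 23 VX (C 0)) (sc 28))) RZ)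
      (asg 24 (Op Times (C 2) (sc 24))))))))"

text \<open>With c = l / p the last inequality reads live \<le> psi c / c^2: the expectation never
  falls below the number of live rows.\<close>

definition SI :: "nat \<Rightarrow> nat \<Rightarrow> (nat \<Rightarrow> nat) \<Rightarrow> nat \<Rightarrow> store \<Rightarrow> bool" where
  "SI k l z p u \<longleftrightarrow> HI k l z u \<and> NA u 24 0 0 = p \<and>
     (\<forall>x y. Av u x \<longrightarrow> Av u y \<longrightarrow> x div l = y div l \<longrightarrow> x mod p = y mod p) \<and>
     int (l * l) * hlive (k * n) u \<le> int (p * p) * hpsi (k * n) l u (l div p) (Av u)"

lemma cost_HitS:
  fixes r t m :: nat
  assumes "1 \<le> r" "1 \<le> t" "m \<le> t"
  shows "(1 + m + m) + (3 + ((4 + r * (56 * r * t + 4)) + ((r + 1) * (16 + 3 * (1 + t)) + (3 + (2 * (1 + m + m) + 3))))) \<le> 130 * r * r * t"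
proof -
  obtain a b where "r = Suc a" "t = Suc b" using assms by (metis One_nat_def Suc_le_D)
  then show ?thesis using assms(3) by (simp add: algebra_simps)
qed

lemma cost_HitS_d: "1 \<le> r \<Longrightarrow> 1 + (1 + ((2 + r * (14 * r + 2)) + ((5 * r + 5) + (1 + (2 + 1))))) \<le> 34 * r * r" for r :: nat
  by (cases r) (simp_all add: algebra_simps)

lemma spec_HitS:
  assumes I: "SI k l z p u" and p: "2 * p dvd l" "0 < p"
  shows "spec HitS u (\<lambda>u'. fr {3,4,5,6,22,23,24,25,27,28} u u' \<and> SI k l z (2 * p) u')
     (130 * R * R * (k * n * l * l)) (34 * R * R)"
proof -
  let ?T = "k * n * l * l" let ?F = "{3,4,5,6,22,23,24,25,27,28}"
  have H: "HI k l z u" and p24: "NA u 24 0 0 = p" using I unfolding SI_def by auto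
  note S = HI_simps[OF H] note T = HI_T[OF H]
  have TV: "?T \<le> 2 ^ R" "?T < V" using le_P[OF T(1)] less_V[OF T(1)] by auto
  have T1: "1 \<le> ?T" using S n0 by (simp add: Suc_leI)
  have nV: "n \<le> V ^ 4" using le_V4[of n 1] by simp
  define c where "c = l div (2 * p)"
  have l: "l = 2 * p * c" using p(1) unfolding c_def by simp
  have c: "1 \<le> c" "l div p = 2 * c" "2 * c \<le> l" "l div (2 * p) = c" using S(7) p(2) l by (auto simp: Suc_le_eq)
  let ?g = "\<lambda>v (y::nat). (v div p) mod 2"
  let ?u1 = "setA 23 n (\<lambda>_. 1) ?g (\<lambda>_ _. 0) u"
  let ?u2 = "setv 25 l ?u1"
  \<comment> \<open>q is doubled R times starting from l, so it reaches l 2^R but still fits below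
    V.\<close>
  have lq: "2 * (l * 2 ^ b) < V" if "b < R" for b
  proof -
    have "2 * (l * 2 ^ b) = 2 ^ Suc b * l" by simp
    also have "\<dots> \<le> 2 ^ R * (n + 2) ^ 2" using that T(6) by (intro mult_le_mono power_increasing) auto
    also have "\<dots> \<le> 2 ^ R * (n + 2) ^ 20" by (intro mult_le_mono pow_mono) auto
    also have "\<dots> < V" by (rule P_V)
    finally show ?thesis .
  qed
  have lV: "l < V" using less_V[OF T(6)] by simp
  have f2: "fr {23,25} u ?u2" by (intro fr_setv fr_setA fr_refl) auto
  have H2: "HI k l z ?u2" by (rule HI_fr[OF H f2]) auto
  have Av2: "Av ?u2 = Av u" by (rule fr_Av[OF f2]) auto
  note vw2 = fr_views[OF f2, simplified]
  have bk2: "blk_ok l p ?u2"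
    unfolding blk_ok_def sgv_def by (auto simp: odd_iff_mod_2_eq_one) 
  define J where "J = (\<lambda>b u'. fr {3,4,5,6,23,25,27,28} ?u2 u' \<and> NA u' 27 0 0 = b \<and> NA u' 25 0 0 = l * 2 ^ b \<and> blk_ok l p u' \<and>
     hhalved (k * n) l u (Av u) (l * 2 ^ b) (sgv u'))"
  show ?thesis unfolding HitS_def
  proof (rule spec_step[where P = "\<lambda>u'. u' = ?u1"])
    show "spec (PX 23 (sc 7) (C 1) (Op Mod (Op Div VX (sc 24)) (C 2)) RZ) u (\<lambda>u'. u' = ?u1) (1 + n + (\<Sum>x<n. 1)) 1"
    proof (rule spec_PX[where f = ?g and g = "\<lambda>_ _. 0"])
      fix x y :: nat show "?g x y < V" using V2 by (meson less_le_trans mod_less_divisor zero_less_numeral)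
    qed (use S nV V2 p24 in \<open>auto simp: gb_def\<close>)
    fix u1 assume u1: "u1 = ?u1"
    show "spec (Seq (asg 25 lE) (Seq (For 27 (sc 1) HitR)
    (Seq (Sm (C 1) TE svE) (Seq (asg 28 (Ls (Rd 5 (C 0) (Op Minus TE (C 1))) (Op Times (Op Times (C 2) lE) TE)))
    (Seq (Up 22 (sc 7) (C 1) (andE (Rd 22 VX (C 0)) (eqE (Rd 23 VX (C 0)) (sc 28))) RZ)
      (asg 24 (Op Times (C 2) (sc 24)))))))) u1 (\<lambda>u'. fr ?F u u' \<and> SI k l z (2 * p) u')
      (3 + ((4 + (\<Sum>b<R. 56 * R * ?T + 4)) + ((R + 1) * (16 + 3 * (1 + (\<Sum>x<(1::nat). ?T))) + (3 + (2 * (1 + n + (\<Sum>x<n. 1)) + 3)))))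
      (1 + ((2 + (\<Sum>b<R. 14 * R + 2)) + ((5 * R + 5) + (1 + (2 + 1)))))"
    proof (rule spec_step[where P = "\<lambda>u'. u' = ?u2"])
      show "spec (asg 25 lE) u1 (\<lambda>u'. u' = ?u2) 3 1" by (rule spec_asg) (use u1 S lV in auto)
      fix u2 assume u2: "u2 = ?u2"
      show "spec (Seq (For 27 (sc 1) HitR) (Seq (Sm (C 1) TE svE) (Seq (asg 28 (Ls (Rd 5 (C 0) (Op Minus TE (C 1))) (Op Times (Op Times (C 2) lE) TE)))
      (Seq (Up 22 (sc 7) (C 1) (andE (Rd 22 VX (C 0)) (eqE (Rd 23 VX (C 0)) (sc 28))) RZ)
      (asg 24 (Op Times (C 2) (sc 24))))))) u2 (\<lambda>u'. fr ?F u u' \<and> SI k l z (2 * p) u')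
      ((4 + (\<Sum>b<R. 56 * R * ?T + 4)) + ((R + 1) * (16 + 3 * (1 + (\<Sum>x<(1::nat). ?T))) + (3 + (2 * (1 + n + (\<Sum>x<n. 1)) + 3))))
      ((2 + (\<Sum>b<R. 14 * R + 2)) + ((5 * R + 5) + (1 + (2 + 1))))"
      proof (rule spec_step[OF spec_For[where I = J and L = R and Q = "J R"]])
        show "R < V" using R_V less_exp[of R] by linarith
        have "blk_ok l p (setv 27 0 ?u2)" using bk2 unfolding blk_ok_def sgv_def by simp
        moreover have "fr {3,4,5,6,23,25,27,28} ?u2 (setv 27 0 ?u2)" by (rule fr_setv[OF fr_refl]) auto
        ultimately show "J 0 (setv 27 0 u2)" unfolding J_def u2 using rows.halved_0 by simp
      next
        fix b u' assume "J b u'"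
        then show "nev u' 0 0 (sc 1) = R \<and> NA u' 27 0 0 = b" using S unfolding J_def by (auto simp: fr_def)
      next
        fix b u' assume b: "b < R" and J: "J b u'"
        have f: "fr {3,4,5,6,23,25,27,28} ?u2 u'" and o: "NA u' 27 0 0 = b" "NA u' 25 0 0 = l * 2 ^ b" "blk_ok l p u'"
          and h: "hhalved (k * n) l u (Av u) (l * 2 ^ b) (sgv u')" using J unfolding J_def by auto
        have H': "HI k l z u'" by (rule HI_fr[OF H2 f]) auto
        note vw = fr_views[OF f, simplified, unfolded vw2]
        have A': "Av u' = Av u" using fr_Av[OF f] Av2 by simp
        have h': "hhalved (k * n) l u' (Av u') (l * 2 ^ b) (sgv u')" unfolding vw A' by (rule h)
        show "spec HitR u' (\<lambda>u'. NA u' 27 0 0 = b \<and> J (Suc b) (setv 27 (Suc b) u')) (56 * R * ?T) (14 * R)"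
        proof (rule spec_mono[OF spec_HitR[OF H' o(2) _ lq[OF b] o(3) h']])
          fix u'' assume a: "fr {3,4,5,6,23,25,28} u' u'' \<and> NA u'' 25 0 0 = 2 * (l * 2 ^ b) \<and> blk_ok l p u'' \<and>
             hhalved (k * n) l u' (Av u') (2 * (l * 2 ^ b)) (sgv u'')"
          have "fr {3,4,5,6,23,25,27,28} ?u2 u''" by (rule fr_trans[OF f conjunct1[OF a]]) auto
          moreover have "sgv (setv 27 (Suc b) u'') = sgv u''" by (simp add: sgv_def[abs_def])
          moreover have "blk_ok l p (setv 27 (Suc b) u'')" using a unfolding blk_ok_def sgv_def by simp
          moreover have "hhalved (k * n) l u (Av u) (l * 2 ^ Suc b) (sgv u'')" using a unfolding vw A' by (simp add: mult.left_commute)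
          moreover have "NA u'' 27 0 0 = b" using a o by (simp add: fr_def)
          ultimately show "NA u'' 27 0 0 = b \<and> J (Suc b) (setv 27 (Suc b) u'')" using a unfolding J_def by (auto intro: fr_setv)
        qed auto
      next
        fix u3 assume b3: "bdd u3" and J: "J R u3"
        have f: "fr {3,4,5,6,23,25,27,28} ?u2 u3" and bk3: "blk_ok l p u3"
          and h: "hhalved (k * n) l u (Av u) (l * 2 ^ R) (sgv u3)" using J unfolding J_def by auto
        have f3: "fr ?F u u3" by (rule fr_trans[OF f2 f]) auto
        have H3: "HI k l z u3" by (rule HI_fr[OF H f3]) auto
        note vw3 = fr_views[OF f, simplified, unfolded vw2]
        have A3: "Av u3 = Av u" using fr_Av[OF f] Av2 by simp
        have b23: "\<And>v. v < n \<Longrightarrow> NA u3 23 v 0 < 2" using bk3 unfolding blk_ok_def by blast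
        have p3: "NA u3 24 0 0 = p" using f p24 by (simp add: fr_def)
        let ?f = "hsval l u (2 * c) (Av u) (sgv u3)"
        have f3': "nev u3 x Y svE = ?f Y" if "Y < ?T" for x Y
          using nev_sv[OF H3 b23 p3 that] unfolding vw3 A3 c(2) .
        have fle: "?f Y \<le> 4 * l" for Y using c S(7) by (auto simp: rows.sval_def)
        have sumle: "(\<Sum>Y<?T. ?f Y) \<le> ?T * (4 * l)"
          using sum_mono[of "{..<?T}" ?f "\<lambda>_. 4 * l"] fle by simp
        have big: "?T * (4 * l) < V"
        proof -
          have "(4::nat) \<le> 2 ^ 2" by simp
          also have "\<dots> \<le> (n + 2) ^ 2" by (rule power_mono) auto
          finally have "?T * (4 * l) \<le> (n + 2) ^ 10" using mult_bd[OF T(1) mult_bd[OF _ T(6), of 4 2]] by simp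
          then show ?thesis using less_V by simp
        qed
        have sumV: "(\<Sum>Y<?T. ?f Y) < V" using sumle big by linarith
        let ?s = "(\<Sum>Y<?T. ?f Y) < 2 * l * ?T"
        show "spec (Seq (Sm (C 1) TE svE) (Seq (asg 28 (Ls (Rd 5 (C 0) (Op Minus TE (C 1))) (Op Times (Op Times (C 2) lE) TE)))
           (Seq (Up 22 (sc 7) (C 1) (andE (Rd 22 VX (C 0)) (eqE (Rd 23 VX (C 0)) (sc 28))) RZ)
           (asg 24 (Op Times (C 2) (sc 24)))))) u3 (\<lambda>u'. fr ?F u u' \<and> SI k l z (2 * p) u')
           ((R + 1) * (16 + 3 * (1 + (\<Sum>x<(1::nat). ?T))) + (3 + (2 * (1 + n + (\<Sum>x<n. 1)) + 3)))
           ((5 * R + 5) + (1 + (2 + 1)))"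
        proof (rule spec_step[OF spec_Sm[where r = 1 and k = "\<lambda>_. ?T" and f = "\<lambda>_. ?f" and R = R]])
          fix u4 assume "fr {3,4,5,6} u3 u4 \<and> (\<forall>x<1. 0 < ?T \<longrightarrow> NA u4 5 x (?T - 1) = (\<Sum>Y<?T. ?f Y))"
          then have f4: "fr {3,4,5,6} u3 u4" and s4: "NA u4 5 0 (?T - 1) = (\<Sum>Y<?T. ?f Y)" using T1 by auto
          have F4: "fr ?F u u4" by (rule fr_trans[OF f3 f4]) auto
          let ?u5 = "setv 28 (of_bool ?s) u4"
          let ?h = "\<lambda>v (y::nat). of_bool (NA u 22 v 0 \<noteq> 0 \<and> NA u3 23 v 0 = of_bool ?s) :: nat"
          let ?u6 = "setA 22 n (\<lambda>_. 1) ?h (\<lambda>_ _. 0) (setA 6 n (\<lambda>_. 1) ?h (\<lambda>_ _. 0) ?u5)"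
          let ?u7 = "setv 24 (2 * p) ?u6"
          have F7: "fr ?F u ?u7" by (intro fr_setv fr_setA fr_mono[OF F4]) auto
          have S4: "NA u4 7 0 0 = n" "NA u4 15 0 0 = k" "NA u4 16 0 0 = l" "NA u4 24 0 0 = p"
            using S p3 f3 f4 by (simp_all add: fr_def)
          have S4': "NA u4 22 = NA u 22" "NA u4 23 = NA u3 23"
            using f4 f by (simp_all add: fr_def)
          have A7: "Av ?u7 = (\<lambda>v. Av u v \<and> sgv u3 v = ?s)"
          proof
            fix v show "Av ?u7 v = (Av u v \<and> sgv u3 v = ?s)"
              using b23[of v] by (cases "v < n"; cases ?s) (auto simp: Av_def sgv_def less_2_cases_iff)
          qed
          have H7: "HI k l z ?u7" by (rule HI_fr[OF H F7]) auto
          have vw7: "alv ?u7 = alv u" "NA ?u7 18 = NA u 18" by (rule fr_views[OF F7]; simp)+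
          have "SI k l z (2 * p) ?u7" unfolding SI_def
          proof (intro conjI allI impI)
            fix x y assume xy: "Av ?u7 x" "Av ?u7 y" "x div l = y div l"
            show "x mod (2 * p) = y mod (2 * p)"
            proof (rule block_step[where A = "Av u" and l = l and sg = "sgv u3" and s = ?s])
              show "Av u x \<Longrightarrow> Av u y \<Longrightarrow> x div l = y div l \<Longrightarrow> x mod p = y mod p" for x y using I unfolding SI_def by blast
              show "Av u x \<Longrightarrow> Av u y \<Longrightarrow> x div l = y div l \<Longrightarrow> (sgv u3 x = sgv u3 y) = (odd (x div p) = odd (y div p))" for x y
                using bk3 unfolding blk_ok_def Av_def by blast
            qed (use xy in \<open>simp_all only: A7\<close>)
          next
            have "hpsi (k * n) l u (2 * c) (Av u) \<le> 4 * hpsi (k * n) l u c (\<lambda>v. Av u v \<and> sgv u3 v = ?s)"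
            proof (rule rows.psi_step[OF h _ c(3,1)])
              fix Y assume "hpr l u (Av u) Y"
              then have "rows.x1 l (NA u 18) Y < n" "rows.x2 l (NA u 18) Y < n" unfolding rows.pr_def Av_def by auto
              \<comment> \<open>After R doublings the interval of length q contains all vertices, so
                \<open>halved\<close> speaks about all pairs.\<close>
              moreover have "n \<le> l * 2 ^ R" using le_P[of n 1] S(7) mult_le_mono[of 1 l n "2 ^ R"] by simp
              ultimately show "rows.x1 l (NA u 18) Y div (l * 2 ^ R) = rows.x2 l (NA u 18) Y div (l * 2 ^ R)" by simp
            qed simp
            then have "int (p * p) * hpsi (k * n) l u (2 * c) (Av u) \<le> int (p * p) * (4 * hpsi (k * n) l u c (Av ?u7))"
              unfolding A7 by (intro mult_left_mono) auto
            also have "\<dots> = int (2 * p * (2 * p)) * hpsi (k * n) l u c (Av ?u7)" by simp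
            finally show "int (l * l) * hlive (k * n) ?u7 \<le> int (2 * p * (2 * p)) * hpsi (k * n) l ?u7 (l div (2 * p)) (Av ?u7)"
              using I unfolding SI_def c(2,4) vw7 by linarith
          qed (use H7 in \<open>simp_all add: setv_def[of 24]\<close>)
          then have Q: "fr ?F u ?u7 \<and> SI k l z (2 * p) ?u7" using F7 by blast
          show "spec (Seq (asg 28 (Ls (Rd 5 (C 0) (Op Minus TE (C 1))) (Op Times (Op Times (C 2) lE) TE)))
           (Seq (Up 22 (sc 7) (C 1) (andE (Rd 22 VX (C 0)) (eqE (Rd 23 VX (C 0)) (sc 28))) RZ)
           (asg 24 (Op Times (C 2) (sc 24))))) u4 (\<lambda>u'. fr ?F u u' \<and> SI k l z (2 * p) u') (3 + (2 * (1 + n + (\<Sum>x<n. 1)) + 3)) (1 + (2 + 1))"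
          proof (rule spec_step[where P = "\<lambda>u'. u' = ?u5"])
            show "spec (asg 28 (Ls (Rd 5 (C 0) (Op Minus TE (C 1))) (Op Times (Op Times (C 2) lE) TE))) u4 (\<lambda>u'. u' = ?u5) 3 1"
              by (rule spec_asg[where v = "of_bool ?s"]) (use S4 s4 V2 in auto)
            fix u5 assume u5: "u5 = ?u5"
            show "spec (Seq (Up 22 (sc 7) (C 1) (andE (Rd 22 VX (C 0)) (eqE (Rd 23 VX (C 0)) (sc 28))) RZ)
              (asg 24 (Op Times (C 2) (sc 24)))) u5 (\<lambda>u'. fr ?F u u' \<and> SI k l z (2 * p) u') (2 * (1 + n + (\<Sum>x<n. 1)) + 3) (2 + 1)"
            proof (rule spec_step[where P = "\<lambda>u'. u' = ?u6"])
              show "spec (Up 22 (sc 7) (C 1) (andE (Rd 22 VX (C 0)) (eqE (Rd 23 VX (C 0)) (sc 28))) RZ) u5 (\<lambda>u'. u' = ?u6)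
                (2 * (1 + n + (\<Sum>x<n. 1))) 2"
                by (rule spec_Up[where f = ?h and g = "\<lambda>_ _. 0"]) (use u5 S4 S4' nV V2 in auto)
              fix u6 assume u6: "u6 = ?u6"
              have "2 * p \<le> l" using p(1) S(7) by (auto intro: dvd_imp_le)
              then show "spec (asg 24 (Op Times (C 2) (sc 24))) u6 (\<lambda>u'. fr ?F u u' \<and> SI k l z (2 * p) u') 3 1"
                by (intro spec_asg[where v = "2 * p"]) (use u6 S4 lV Q in auto)
            qed simp_all
          qed simp_all
        next
          show "NA u3 1 0 0 = R" "\<And>x y. nev u3 x y TE = ?T" using HI_simps[OF H3] by auto
        qed (use TV f3' sumV gn_hit R_V V2 in auto)
      qed simp_all
    qed simp_all
  next
    have "(\<Sum>x<(1::nat). ?T) = ?T" "(\<Sum>x<n. 1) = n" "(\<Sum>b<R. 56 * R * ?T + 4) = R * (56 * R * ?T + 4)" by simp_all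
    then show "1 + n + (\<Sum>x<n. 1) + (3 + ((4 + (\<Sum>b<R. 56 * R * ?T + 4)) + ((R + 1) * (16 + 3 * (1 + (\<Sum>x<(1::nat). ?T))) + (3 + (2 * (1 + n + (\<Sum>x<n. 1)) + 3)))))
       \<le> 130 * R * R * ?T"
      using cost_HitS[OF R_pos T1 T(3)] by (simp only:)
    have "(\<Sum>b<R. 14 * R + 2) = R * (14 * R + 2)" by simp
    then show "1 + (1 + ((2 + (\<Sum>b<R. 14 * R + 2)) + ((5 * R + 5) + (1 + (2 + 1))))) \<le> 34 * R * R"
      using cost_HitS_d[OF R_pos] by (simp only:)
  qed
qed

end

section \<open>Passes over the live rows and the new set of sources\<close>

context sssp_machine
begin

text \<open>One pass: select at most one vertex per block, retire the rows hit by the selection, and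
  add it to the hitting set.\<close>

definition HitP :: com where
  "HitP = Seq (PX 22 (sc 7) (C 1) (C 1) RZ) (Seq (asg 24 (C 1)) (Seq (Wh (Ls (sc 24) lE) HitS)
    (Seq (Sm kn lE (andE (Rd 21 VX (C 0)) (Rd 22 (Rd 18 VX VY) (C 0))))
    (Seq (Up 21 kn (C 1) (andE (Rd 21 VX (C 0)) (notE (Rd 5 VX (Op Minus lE (C 1))))) RZ)
      (Up 20 (sc 7) (C 1) (notE (andE (notE (Rd 20 VX (C 0))) (notE (Rd 22 VX (C 0))))) RZ)))))"

definition hitset :: "store \<Rightarrow> nat set" where
  "hitset u = {v. v < n \<and> NA u 20 v 0 \<noteq> 0}"

text \<open>After \<open>ph\<close> passes: retired rows are really hit, the live rows have been
  halved \<open>ph\<close> times, and each pass has added at most one vertex per block.\<close>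

definition PI :: "nat \<Rightarrow> nat \<Rightarrow> (nat \<Rightarrow> nat) \<Rightarrow> nat \<Rightarrow> store \<Rightarrow> bool" where
  "PI k l z ph u \<longleftrightarrow> HI k l z u \<and>
     (\<forall>X<k * n. NA u 17 X 0 = l + 1 \<longrightarrow> \<not> alv u X \<longrightarrow> (\<exists>i<l. NA u 18 X i \<in> hitset u)) \<and>
     hlive (k * n) u * 2 ^ ph \<le> int (k * n) \<and> card (hitset u) \<le> ph * (n div l + 1)"

lemma cost_HitP:
  fixes r t m a b c :: nat
  assumes "1 \<le> r" "1 \<le> t" "m \<le> t" "a \<le> t" "b \<le> t" "c \<le> r"
  shows "(1 + m + m) + (3 + ((1 + c * (130 * r * r * t + 1)) + ((r + 1) * (16 + 3 * (a + b)) +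
     (2 * (1 + a + a) + 2 * (1 + m + m))))) \<le> 200 * r * r * r * t"
proof -
  have "(1 + m + m) + (3 + ((1 + c * (130 * r * r * t + 1)) + ((r + 1) * (16 + 3 * (a + b)) +
     (2 * (1 + a + a) + 2 * (1 + m + m))))) \<le> (1 + t + t) + (3 + ((1 + r * (130 * r * r * t + 1)) + ((r + 1) * (16 + 3 * (t + t)) +
     (2 * (1 + t + t) + 2 * (1 + t + t)))))"
    by (intro add_mono mult_le_mono order_refl assms)
  also have "(1 + t + t) + (3 + ((1 + r * (130 * r * r * t + 1)) + ((r + 1) * (16 + 3 * (t + t)) +
     (2 * (1 + t + t) + 2 * (1 + t + t))))) \<le> 200 * r * r * r * t"
  proof -
    obtain x y where "r = Suc x" "t = Suc y" using assms by (metis One_nat_def Suc_le_D)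
    then show ?thesis by (simp add: algebra_simps)
  qed
  finally show ?thesis .
qed

lemma cost_HitP_d:
  fixes r c :: nat
  assumes "1 \<le> r" "c \<le> r"
  shows "1 + (1 + ((1 + c * (34 * r * r + 1)) + ((5 * r + 5) + (2 + 2)))) \<le> 52 * r * r * r"
proof -
  have "c * (34 * r * r + 1) \<le> r * (34 * r * r + 1)" using assms by (intro mult_le_mono) simp_all
  moreover have "1 + (1 + ((1 + r * (34 * r * r + 1)) + ((5 * r + 5) + (2 + 2)))) \<le> 52 * r * r * r"
    using assms by (cases r) (simp_all add: algebra_simps)
  ultimately show ?thesis by linarith
qed

lemma spec_HitP:
  assumes I: "PI k l z ph u" and l2: "l = 2 ^ t"
  shows "spec HitP u (\<lambda>u'. fr {3,4,5,6,20,21,22,23,24,25,27,28} u u' \<and> PI k l z (Suc ph) u')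
     (200 * R * R * R * (k * n * l * l)) (52 * R * R * R)"
proof -
  let ?T = "k * n * l * l" let ?F = "{3,4,5,6,20,21,22,23,24,25,27,28}" let ?G = "{3,4,5,6,22,23,24,25,27,28}"
  have H: "HI k l z u" using I unfolding PI_def by auto
  note S = HI_simps[OF H] note T = HI_T[OF H]
  have T1: "1 \<le> ?T" using S n0 by (simp add: Suc_leI)
  have nV: "n \<le> V ^ 4" using le_V4[of n 1] by simp
  have rV: "k * n \<le> V ^ 4" using le_V4[OF order_trans[OF T(4,1)]] by simp
  have lP: "l \<le> 2 ^ R" "l < V" using le_P[OF T(6)] less_V[OF T(6)] by auto
  have tR: "t \<le> R" using lP(1) unfolding l2 by (metis one_less_numeral_iff power_le_imp_le_exp semiring_norm(76))
  let ?u1 = "setA 22 n (\<lambda>_. 1) (\<lambda>_ _. 1) (\<lambda>_ _. 0) u"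
  let ?u2 = "setv 24 1 ?u1"
  have f2: "fr ?G u ?u2" by (intro fr_setv fr_setA fr_refl) auto
  have H2: "HI k l z ?u2" by (rule HI_fr[OF H f2]) auto
  have vw2: "alv ?u2 = alv u" "NA ?u2 18 = NA u 18" by (rule fr_views[OF f2]; simp)+
  have A2: "Av ?u2 = (\<lambda>v. v < n)" by (auto simp: Av_def)
  have al: "NA u 18 X i < n" if "X < k * n" "alv u X" "i < l" for X i using H that unfolding HI_def by blast
  have SI2: "SI k l z 1 ?u2" unfolding SI_def
  proof (intro conjI)
    have "int l * int l * hlive (k * n) u \<le> hpsi (k * n) l u l (\<lambda>v. v < n)" by (rule rows.psi_start) (rule al)
    then show "int (l * l) * hlive (k * n) ?u2 \<le> int (1 * 1) * hpsi (k * n) l ?u2 (l div 1) (Av ?u2)"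
      unfolding vw2 A2 by simp
  qed (use H2 in \<open>simp_all add: setv_def[of 24]\<close>)
  define J where "J = (\<lambda>j u'. fr ?G u u' \<and> SI k l z (2 ^ j) u')"
  show ?thesis unfolding HitP_def
  proof (rule spec_step[where P = "\<lambda>u'. u' = ?u1"])
    show "spec (PX 22 (sc 7) (C 1) (C 1) RZ) u (\<lambda>u'. u' = ?u1) (1 + n + (\<Sum>x<n. 1)) 1"
      by (rule spec_PX) (use S nV V2 in \<open>auto simp: gb_def\<close>)
    fix u1 assume u1: "u1 = ?u1"
    show "spec (Seq (asg 24 (C 1)) (Seq (Wh (Ls (sc 24) lE) HitS)
    (Seq (Sm kn lE (andE (Rd 21 VX (C 0)) (Rd 22 (Rd 18 VX VY) (C 0))))
    (Seq (Up 21 kn (C 1) (andE (Rd 21 VX (C 0)) (notE (Rd 5 VX (Op Minus lE (C 1))))) RZ)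
      (Up 20 (sc 7) (C 1) (notE (andE (notE (Rd 20 VX (C 0))) (notE (Rd 22 VX (C 0))))) RZ))))) u1
     (\<lambda>u'. fr ?F u u' \<and> PI k l z (Suc ph) u')
     (3 + ((1 + (\<Sum>j<t. 130 * R * R * ?T + 1)) + ((R + 1) * (16 + 3 * (k * n + (\<Sum>X<k * n. l))) +
        (2 * (1 + k * n + (\<Sum>X<k * n. 1)) + 2 * (1 + n + (\<Sum>x<n. 1))))))
     (1 + ((1 + (\<Sum>j<t. 34 * R * R + 1)) + ((5 * R + 5) + (2 + 2))))"
    proof (rule spec_step[where P = "\<lambda>u'. u' = ?u2"])
      show "spec (asg 24 (C 1)) u1 (\<lambda>u'. u' = ?u2) 3 1" by (rule spec_asg) (use u1 V2 in auto)
      fix u2 assume u2: "u2 = ?u2"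
      show "spec (Seq (Wh (Ls (sc 24) lE) HitS)
       (Seq (Sm kn lE (andE (Rd 21 VX (C 0)) (Rd 22 (Rd 18 VX VY) (C 0))))
       (Seq (Up 21 kn (C 1) (andE (Rd 21 VX (C 0)) (notE (Rd 5 VX (Op Minus lE (C 1))))) RZ)
       (Up 20 (sc 7) (C 1) (notE (andE (notE (Rd 20 VX (C 0))) (notE (Rd 22 VX (C 0))))) RZ)))) u2
       (\<lambda>u'. fr ?F u u' \<and> PI k l z (Suc ph) u')
       ((1 + (\<Sum>j<t. 130 * R * R * ?T + 1)) + ((R + 1) * (16 + 3 * (k * n + (\<Sum>X<k * n. l))) +
        (2 * (1 + k * n + (\<Sum>X<k * n. 1)) + 2 * (1 + n + (\<Sum>x<n. 1)))))
       ((1 + (\<Sum>j<t. 34 * R * R + 1)) + ((5 * R + 5) + (2 + 2)))"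
      proof (rule spec_step[OF spec_Wh[where I = J and L = t and Q = "J t"]])
        show "J 0 u2" unfolding J_def u2 using f2 SI2 by simp
      next
        fix u' assume "J t u'"
        then have "SI k l z (2 ^ t) u'" unfolding J_def by blast
        then show "nev u' 0 0 (Ls (sc 24) lE) = 0" using HI_simps[of k l z u'] unfolding SI_def l2 by auto
      next
        fix j u' assume j: "j < t" and J: "J j u'"
        have f: "fr ?G u u'" and si: "SI k l z (2 ^ j) u'" using J unfolding J_def by auto
        have "(2::nat) ^ j < 2 ^ t" using j by simp
        then have "nev u' 0 0 (Ls (sc 24) lE) \<noteq> 0" using si HI_simps[of k l z u'] unfolding SI_def l2 by auto
        moreover have "spec HitS u' (J (Suc j)) (130 * R * R * ?T) (34 * R * R)"
        proof (rule spec_mono[OF spec_HitS[OF si]])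
          have "(2::nat) ^ Suc j dvd 2 ^ t" using j by (intro le_imp_power_dvd) simp
          then show "2 * 2 ^ j dvd l" unfolding l2 by simp
          fix u'' assume a: "fr ?G u' u'' \<and> SI k l z (2 * 2 ^ j) u''"
          have "fr ?G u u''" by (rule fr_trans[OF f conjunct1[OF a]]) auto
          then show "J (Suc j) u''" using a unfolding J_def by simp
        qed auto
        ultimately show "nev u' 0 0 (Ls (sc 24) lE) \<noteq> 0 \<and> spec HitS u' (J (Suc j)) (130 * R * R * ?T) (34 * R * R)" by blast
      next
        fix u3 assume b3: "bdd u3" and J: "J t u3"
        have f3: "fr ?G u u3" and si: "SI k l z l u3" using J unfolding J_def l2 by auto
        have F3: "fr ?F u u3" by (rule fr_mono[OF f3]) auto
        have H3: "HI k l z u3" using si unfolding SI_def by blast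
        note S3 = HI_simps[OF H3]
        have vw3: "alv u3 = alv u" "NA u3 18 = NA u 18" by (rule fr_views[OF f3]; simp)+
        let ?al = "alv u" let ?f = "NA u 18" let ?A = "Av u3"
        let ?hit = "\<lambda>X. \<exists>i<l. ?A (?f X i)"
        have l0: "0 < l" using S by simp
        have blk: "\<And>x y. ?A x \<Longrightarrow> ?A y \<Longrightarrow> x div l = y div l \<Longrightarrow> x mod l = y mod l"
          and psi: "int (l * l) * rows.live (k * n) ?al \<le> int (l * l) * rows.psi (k * n) l ?al ?f 1 ?A"
          using si unfolding SI_def vw3 div_self[OF l0[THEN less_imp_neq, symmetric]] by blast+
        have "0 < int (l * l)" using l0 by simp
        then have lv: "rows.live (k * n) ?al \<le> rows.psi (k * n) l ?al ?f 1 ?A" using psi mult_le_cancel_left_pos by blast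
        have "rows.psi (k * n) l ?al ?f 1 ?A \<le> 2 * (\<Sum>X<k * n. of_bool (?al X \<and> ?hit X))"
        proof (rule rows.psi_end)
          show "inj_on (?f X) {..<l}" if "X < k * n" "?al X" for X using H that unfolding HI_def by blast
          show "?f X i < n" if "X < k * n" "?al X" "i < l" for X i using al that by blast
          show "x = y" if "?A x" "?A y" "x div l = y div l" for x y
            using blk[OF that] that(3) by (metis div_mult_mod_eq)
        qed
        \<comment> \<open>At c = 1 the potential is at least the number of live rows and at most
          twice the number of those hit, so at least half of them are hit.\<close>
        then have hitle: "rows.live (k * n) ?al \<le> 2 * (\<Sum>X<k * n. of_bool (?al X \<and> ?hit X))" using lv by linarith
        let ?c = "\<lambda>X i. of_bool (?al X \<and> NA u3 22 (?f X i) 0 \<noteq> 0) :: nat"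
        have cle: "(\<Sum>i<l. ?c X i) < V" for X
        proof -
          have "(\<Sum>i<l. ?c X i) \<le> (\<Sum>i<l. 1)" by (intro sum_mono) auto
          then show ?thesis using lP by simp
        qed
        have c0: "(\<Sum>i<l. ?c X i) = 0 \<longleftrightarrow> \<not> ?hit X" if "X < k * n" "?al X" for X
          using al[OF that] that(2) by (auto simp: Av_def simp del: sum_of_bool_eq)
        show "spec (Seq (Sm kn lE (andE (Rd 21 VX (C 0)) (Rd 22 (Rd 18 VX VY) (C 0))))
         (Seq (Up 21 kn (C 1) (andE (Rd 21 VX (C 0)) (notE (Rd 5 VX (Op Minus lE (C 1))))) RZ)
         (Up 20 (sc 7) (C 1) (notE (andE (notE (Rd 20 VX (C 0))) (notE (Rd 22 VX (C 0))))) RZ))) u3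
         (\<lambda>u'. fr ?F u u' \<and> PI k l z (Suc ph) u')
         ((R + 1) * (16 + 3 * (k * n + (\<Sum>X<k * n. l))) + (2 * (1 + k * n + (\<Sum>X<k * n. 1)) + 2 * (1 + n + (\<Sum>x<n. 1))))
         ((5 * R + 5) + (2 + 2))"
        proof (rule spec_step[OF spec_Sm[where r = "k * n" and k = "\<lambda>_. l" and f = ?c and R = R]])
          fix u4 assume u4: "fr {3,4,5,6} u3 u4 \<and> (\<forall>X<k * n. 0 < l \<longrightarrow> NA u4 5 X (l - 1) = (\<Sum>i<l. ?c X i))"
          have f4: "fr {3,4,5,6} u3 u4" using u4 by blast
          have s4: "NA u4 5 X (l - 1) = (\<Sum>i<l. ?c X i)" if "X < k * n" for X using u4 that l0 by blast
          have F4: "fr ?F u u4" by (rule fr_trans[OF F3 f4]) auto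
          have S4: "NA u4 7 0 0 = n" "NA u4 15 0 0 = k" "NA u4 16 0 0 = l" "NA u4 20 = NA u 20" "NA u4 21 = NA u 21" "NA u4 22 = NA u3 22"
            using S3 f3 f4 by (simp_all add: fr_def)
          let ?p = "\<lambda>X (y::nat). of_bool (?al X \<and> (\<Sum>i<l. ?c X i) = 0) :: nat"
          define u5 where "u5 = setA 21 (k * n) (\<lambda>_. 1) ?p (\<lambda>_ _. 0) (setA 6 (k * n) (\<lambda>_. 1) ?p (\<lambda>_ _. 0) u4)"
          have F5: "fr ?F u u5" unfolding u5_def by (intro fr_setA F4) auto
          let ?h = "\<lambda>v (y::nat). of_bool (NA u 20 v 0 \<noteq> 0 \<or> NA u3 22 v 0 \<noteq> 0) :: nat"
          define u6 where "u6 = setA 20 n (\<lambda>_. 1) ?h (\<lambda>_ _. 0) (setA 6 n (\<lambda>_. 1) ?h (\<lambda>_ _. 0) u5)"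
          have F6: "fr ?F u u6" unfolding u6_def by (intro fr_setA F5) auto
          have al6: "alv u6 X \<longleftrightarrow> ?al X \<and> \<not> ?hit X" if "X < k * n" for X
            using that c0[OF that] by (auto simp: alv_def u5_def u6_def simp del: sum_of_bool_eq sum_eq_0_iff)
          have hs6: "hitset u6 = hitset u \<union> {v. v < n \<and> ?A v}" by (auto simp: hitset_def u6_def Av_def)
          have e6: "NA u6 18 = NA u 18" "NA u6 17 = NA u 17" using F6 by (simp_all add: fr_def)
          have "srcs k l z u6" using H by (intro srcs_fr[OF _ F6]) (auto simp: HI_def)
          then have H6: "HI k l z u6" using H al6 unfolding HI_def e6 by blast
          have live6: "2 * hlive (k * n) u6 \<le> hlive (k * n) u"
          proof -
            have "hlive (k * n) u6 = (\<Sum>X<k * n. of_bool (?al X) - of_bool (?al X \<and> ?hit X))"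
              unfolding rows.live_def using al6 by (intro sum.cong) auto
            also have "\<dots> = hlive (k * n) u - (\<Sum>X<k * n. of_bool (?al X \<and> ?hit X))"
              unfolding rows.live_def by (rule sum_subtractf)
            finally show ?thesis using hitle by linarith
          qed
          have "PI k l z (Suc ph) u6" unfolding PI_def e6
          proof (intro conjI allI impI)
            show "HI k l z u6" by (rule H6)
            fix X assume X: "X < k * n" "NA u 17 X 0 = l + 1" "\<not> alv u6 X"
            show "\<exists>i<l. NA u 18 X i \<in> hitset u6"
            proof (cases "?al X")
              case True
              then obtain i where i: "i < l" "?A (?f X i)" using al6[OF X(1)] X(3) by blast
              then show ?thesis using al[OF X(1) True i(1)] unfolding hs6 by blast
            next
              case False
              then show ?thesis using I X(1,2) unfolding PI_def hs6 by blast
            qed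
          next
            have "hlive (k * n) u6 * 2 ^ Suc ph = (2 * hlive (k * n) u6) * 2 ^ ph" by simp
            also have "\<dots> \<le> hlive (k * n) u * 2 ^ ph" using live6 by (intro mult_right_mono) auto
            finally show "hlive (k * n) u6 * 2 ^ Suc ph \<le> int (k * n)" using I unfolding PI_def by linarith
          next
            have "card (hitset u6) \<le> card (hitset u) + card {v. v < n \<and> ?A v}" unfolding hs6 by (rule card_Un_le)
            moreover have "card {v. v < n \<and> ?A v} \<le> n div l + 1" by (rule card_selection[OF blk])
            ultimately show "card (hitset u6) \<le> Suc ph * (n div l + 1)" using I unfolding PI_def by simp
          qed
          then have Q: "fr ?F u u6 \<and> PI k l z (Suc ph) u6" using F6 by blast
          show "spec (Seq (Up 21 kn (C 1) (andE (Rd 21 VX (C 0)) (notE (Rd 5 VX (Op Minus lE (C 1))))) RZ)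
           (Up 20 (sc 7) (C 1) (notE (andE (notE (Rd 20 VX (C 0))) (notE (Rd 22 VX (C 0))))) RZ)) u4
           (\<lambda>u'. fr ?F u u' \<and> PI k l z (Suc ph) u') (2 * (1 + k * n + (\<Sum>X<k * n. 1)) + 2 * (1 + n + (\<Sum>x<n. 1))) (2 + 2)"
          proof (rule spec_step[where P = "\<lambda>u'. u' = u5"])
            show "spec (Up 21 kn (C 1) (andE (Rd 21 VX (C 0)) (notE (Rd 5 VX (Op Minus lE (C 1))))) RZ) u4 (\<lambda>u'. u' = u5)
               (2 * (1 + k * n + (\<Sum>X<k * n. 1))) 2"
              unfolding u5_def by (rule spec_Up[where f = ?p and g = "\<lambda>_ _. 0"])
                (use S4 s4 rV V2 in \<open>auto simp: alv_def simp del: sum_of_bool_eq sum_eq_0_iff\<close>)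
            fix u' assume u': "u' = u5"
            show "spec (Up 20 (sc 7) (C 1) (notE (andE (notE (Rd 20 VX (C 0))) (notE (Rd 22 VX (C 0))))) RZ) u'
               (\<lambda>u'. fr ?F u u' \<and> PI k l z (Suc ph) u') (2 * (1 + n + (\<Sum>x<n. 1))) 2"
            proof (rule spec_Up[where f = ?h and g = "\<lambda>_ _. 0"])
              show "fr ?F u (setA 20 n (\<lambda>_. 1) ?h (\<lambda>_ _. 0) (setA 6 n (\<lambda>_. 1) ?h (\<lambda>_ _. 0) u')) \<and>
                PI k l z (Suc ph) (setA 20 n (\<lambda>_. 1) ?h (\<lambda>_ _. 0) (setA 6 n (\<lambda>_. 1) ?h (\<lambda>_ _. 0) u'))"
                using Q unfolding u' u6_def .
            qed (use S4 nV V2 in \<open>auto simp: u' u5_def\<close>)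
          qed simp_all
        next
          show "NA u3 1 0 0 = R" "\<And>x y. nev u3 x y kn = k * n" "\<And>x y. nev u3 x y lE = l" using S3 by auto
          show "nev u3 X i (andE (Rd 21 VX (C 0)) (Rd 22 (Rd 18 VX VY) (C 0))) = ?c X i" for X i
            using f3 by (simp add: alv_def fr_def)
        qed (use rV lP cle R_V V2 in auto)
      qed simp_all
    qed simp_all
  next
    have "(\<Sum>X<k * n. l) = k * n * l" "(\<Sum>x<n. 1) = n" "(\<Sum>X<k * n. 1) = k * n" "(\<Sum>j<t. 130 * R * R * ?T + 1) = t * (130 * R * R * ?T + 1)"
      "(\<Sum>j<t. 34 * R * R + 1) = t * (34 * R * R + 1)" by simp_all
    note sums = this
    show "1 + n + (\<Sum>x<n. 1) + (3 + ((1 + (\<Sum>j<t. 130 * R * R * ?T + 1)) + ((R + 1) * (16 + 3 * (k * n + (\<Sum>X<k * n. l))) +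
        (2 * (1 + k * n + (\<Sum>X<k * n. 1)) + 2 * (1 + n + (\<Sum>x<n. 1)))))) \<le> 200 * R * R * R * ?T"
      unfolding sums by (rule cost_HitP[OF R_pos T1 T(3,4,5) tR])
    show "1 + (1 + ((1 + (\<Sum>j<t. 34 * R * R + 1)) + ((5 * R + 5) + (2 + 2)))) \<le> 52 * R * R * R"
      unfolding sums by (rule cost_HitP_d[OF R_pos tR])
  qed
qed

text \<open>Only rows whose recorded optimum has exactly l arcs are live at the start; they are
  recognised by the shifted count l + 1.\<close>

definition Hit :: com where
  "Hit = Seq (PX 20 (sc 7) (C 1) (C 0) RZ) (Seq (PX 21 kn (C 1) (eqE (Rd 17 VX (C 0)) (Op Plus lE (C 1))) RZ) (For 26 (sc 1) HitP))"

lemma cost_Hit: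
  fixes r t m a :: nat
  assumes "1 \<le> r" "1 \<le> t" "m \<le> t" "a \<le> t"
  shows "(1 + m + m) + ((1 + a + a) + (4 + r * (200 * r * r * r * t + 4))) \<le> 220 * r * r * r * r * t"
proof -
  have "(1 + t + t) + ((1 + t + t) + (4 + r * (200 * r * r * r * t + 4))) \<le> 220 * r * r * r * r * t"
  proof -
    obtain x y where "r = Suc x" "t = Suc y" using assms by (metis One_nat_def Suc_le_D)
    then show ?thesis by (simp add: algebra_simps)
  qed
  then show ?thesis using assms by linarith
qed

lemma cost_Hit_d: "1 \<le> r \<Longrightarrow> 1 + (1 + (2 + r * (52 * r * r * r + 2))) \<le> 60 * r * r * r * r" for r :: nat
  by (cases r) (simp_all add: algebra_simps)

lemma spec_Hit:
  assumes S: "srcs k l z u" and B: "BFst k l z u" and l2: "l = 2 ^ t"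
  shows "spec Hit u (\<lambda>u'. fr {3,4,5,6,20,21,22,23,24,25,26,27,28} u u' \<and> card (hitset u') \<le> R * (n div l + 1) \<and>
      (\<forall>X<k * n. NA u 17 X 0 = l + 1 \<longrightarrow> (\<exists>i<l. NA u 18 X i \<in> hitset u')))
     (220 * R * R * R * R * (k * n * l * l)) (60 * R * R * R * R)"
proof -
  let ?T = "k * n * l * l" let ?F = "{3,4,5,6,20,21,22,23,24,25,26,27,28}"
  let ?u1 = "setA 20 n (\<lambda>_. 1) (\<lambda>_ _. 0) (\<lambda>_ _. 0) u"
  let ?u2 = "setA 21 (k * n) (\<lambda>_. 1) (\<lambda>X _. of_bool (NA u 17 X 0 = l + 1)) (\<lambda>_ _. 0) ?u1"
  have f2: "fr ?F u ?u2" by (intro fr_setA fr_refl) auto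
  have al2: "alv ?u2 X \<longleftrightarrow> NA u 17 X 0 = l + 1" if "X < k * n" for X using that by (simp add: alv_def)
  have H2: "HI k l z ?u2" unfolding HI_def
  proof (intro conjI allI impI)
    show "srcs k l z ?u2" by (rule srcs_fr[OF S f2]) auto
    fix X assume X: "X < k * n" "alv ?u2 X"
    have d: "fst (cell 17 u X) = Suc l" using X al2 by (simp add: cell_def)
    have b: "bst l (z (X div n)) (X mod n) (cell 17 u X)" "trk (z (X div n)) (X mod n) (cell 17 u X) (NA u 18 X)"
      using B X(1) unfolding BFst_def by auto
    show "inj_on (NA ?u2 18 X) {..<l}" using trk_inj[OF b(2,1) d] by simp
    show "NA ?u2 18 X i < n" if "i < l" for i using trk_less[OF b(2), of i] d that by simp
  qed
  note S2 = HI_simps[OF H2] note T = HI_T[OF H2]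
  have T1: "1 \<le> ?T" using S2 n0 by (simp add: Suc_leI)
  have nV: "n \<le> V ^ 4" using le_V4[of n 1] by simp
  have rV: "k * n \<le> V ^ 4" using le_V4[OF order_trans[OF T(4,1)]] by simp
  have S1: "NA u 7 0 0 = n" "NA u 15 0 0 = k" "NA u 16 0 0 = l" using S unfolding srcs_def static_def by auto
  have RV: "R < V" using R_V less_exp[of R] by linarith
  have PI0: "PI k l z 0 ?u2" unfolding PI_def
  proof (intro conjI allI impI)
    have "hlive (k * n) ?u2 \<le> (\<Sum>X<k * n. 1)" unfolding rows.live_def by (intro sum_mono) auto
    then show "hlive (k * n) ?u2 * 2 ^ 0 \<le> int (k * n)" by simp
    show "card (hitset ?u2) \<le> 0 * (n div l + 1)" by (simp add: hitset_def)
  qed (use H2 al2 in auto)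
  have PI_setv: "PI k l z ph (setv 26 v u') \<longleftrightarrow> PI k l z ph u'" if "srcs k l z u'" for ph v u'
  proof -
    have f: "fr {26} u' (setv 26 v u')" by (rule fr_setv[OF fr_refl]) simp
    have s: "srcs k l z (setv 26 v u')" by (rule srcs_fr[OF that f]) auto
    have e: "alv (setv 26 v u') = alv u'" "hitset (setv 26 v u') = hitset u'" "NA (setv 26 v u') 17 = NA u' 17" "NA (setv 26 v u') 18 = NA u' 18"
      by (simp_all add: alv_def[abs_def] hitset_def)
    show ?thesis unfolding PI_def HI_def e using s that by blast
  qed
  define J where "J = (\<lambda>ph u'. fr ?F u u' \<and> NA u' 26 0 0 = ph \<and> PI k l z ph u')"
  have Js: "srcs k l z u'" if "fr ?F u u'" for u' by (rule srcs_fr[OF S that]) auto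
  show ?thesis unfolding Hit_def
  proof (rule spec_step[where P = "\<lambda>u'. u' = ?u1"])
    show "spec (PX 20 (sc 7) (C 1) (C 0) RZ) u (\<lambda>u'. u' = ?u1) (1 + n + (\<Sum>x<n. 1)) 1"
      by (rule spec_PX) (use S1 nV V2 in \<open>auto simp: gb_def\<close>)
    fix u1 assume u1: "u1 = ?u1"
    show "spec (Seq (PX 21 kn (C 1) (eqE (Rd 17 VX (C 0)) (Op Plus lE (C 1))) RZ) (For 26 (sc 1) HitP)) u1
      (\<lambda>u'. fr ?F u u' \<and> card (hitset u') \<le> R * (n div l + 1) \<and>
      (\<forall>X<k * n. NA u 17 X 0 = l + 1 \<longrightarrow> (\<exists>i<l. NA u 18 X i \<in> hitset u')))
      ((1 + k * n + (\<Sum>X<k * n. 1)) + (4 + (\<Sum>j<R. 200 * R * R * R * ?T + 4))) (1 + (2 + (\<Sum>j<R. 52 * R * R * R + 2)))"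
    proof (rule spec_step[where P = "\<lambda>u'. u' = ?u2"])
      show "spec (PX 21 kn (C 1) (eqE (Rd 17 VX (C 0)) (Op Plus lE (C 1))) RZ) u1 (\<lambda>u'. u' = ?u2) (1 + k * n + (\<Sum>X<k * n. 1)) 1"
        unfolding u1 by (rule spec_PX[where f = "\<lambda>X _. of_bool (NA u 17 X 0 = l + 1)" and g = "\<lambda>_ _. 0"]) (use S1 rV V2 in \<open>auto simp: gb_def\<close>)
      fix u2 assume u2: "u2 = ?u2"
      show "spec (For 26 (sc 1) HitP) u2 (\<lambda>u'. fr ?F u u' \<and> card (hitset u') \<le> R * (n div l + 1) \<and>
        (\<forall>X<k * n. NA u 17 X 0 = l + 1 \<longrightarrow> (\<exists>i<l. NA u 18 X i \<in> hitset u')))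
        (4 + (\<Sum>j<R. 200 * R * R * R * ?T + 4)) (2 + (\<Sum>j<R. 52 * R * R * R + 2))"
      proof (rule spec_For[where I = J and L = R])
        have "fr ?F u (setv 26 0 ?u2)" by (rule fr_setv[OF f2]) simp
        then show "J 0 (setv 26 0 u2)" unfolding J_def u2 using PI0 PI_setv[OF Js[OF f2]] by simp
      next
        fix j u' assume J: "J j u'"
        then have "static u'" using Js[of u'] unfolding J_def srcs_def by blast
        then show "nev u' 0 0 (sc 1) = R \<and> NA u' 26 0 0 = j" using J unfolding J_def static_def by auto
      next
        fix j u' assume j: "j < R" and J: "J j u'"
        have f: "fr ?F u u'" and v: "NA u' 26 0 0 = j" and p: "PI k l z j u'" using J unfolding J_def by auto
        show "spec HitP u' (\<lambda>u'. NA u' 26 0 0 = j \<and> J (Suc j) (setv 26 (Suc j) u')) (200 * R * R * R * ?T) (52 * R * R * R)"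
        proof (rule spec_mono[OF spec_HitP[OF p l2]])
          fix u'' assume a: "fr {3,4,5,6,20,21,22,23,24,25,27,28} u' u'' \<and> PI k l z (Suc j) u''"
          have f'': "fr ?F u u''" by (rule fr_trans[OF f conjunct1[OF a]]) auto
          have "NA u'' 26 0 0 = j" using a v by (simp add: fr_def)
          then show "NA u'' 26 0 0 = j \<and> J (Suc j) (setv 26 (Suc j) u'')"
            unfolding J_def PI_setv[OF Js[OF f'']] using a fr_setv[OF f'', of 26] by simp
        qed auto
      next
        fix u' assume J: "J R u'"
        have f: "fr ?F u u'" and p: "PI k l z R u'" using J unfolding J_def by auto
        have e: "NA u' 17 = NA u 17" "NA u' 18 = NA u 18" using f by (simp_all add: fr_def)
        have "k * n + 1 \<le> (n + 2) ^ 3"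
        proof -
          have "k * n \<le> (n + 1) * (n + 2)" using S2(6) by (intro mult_le_mono) auto
          then have "k * n + 1 \<le> (n + 2) * (n + 2)" by simp
          also have "\<dots> \<le> (n + 2) ^ 3" by (simp add: power3_eq_cube)
          finally show ?thesis .
        qed
        then have "k * n < 2 ^ R" using le_P[of "k * n + 1" 3] by simp
        then have "int (k * n) < 2 ^ R" by (metis of_nat_less_iff of_nat_numeral of_nat_power)
        moreover have "hlive (k * n) u' * 2 ^ R \<le> int (k * n)" using p unfolding PI_def by blast
        \<comment> \<open>Fewer than 2^R rows, halved R times, leave less than one.\<close>
        ultimately have "hlive (k * n) u' * 2 ^ R < 1 * 2 ^ R" by linarith
        then have "hlive (k * n) u' < 1" by (simp only: mult_less_cancel_right) simp
        then have "(\<Sum>X<k * n. of_bool (alv u' X) :: int) = 0"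
          unfolding rows.live_def by (intro antisym sum_nonneg) (auto simp del: sum_of_bool_eq)
        then have dead: "\<not> alv u' X" if "X < k * n" for X
          using that by (subst (asm) sum_nonneg_eq_0_iff) auto
        show "fr ?F u u' \<and> card (hitset u') \<le> R * (n div l + 1) \<and>
           (\<forall>X<k * n. NA u 17 X 0 = l + 1 \<longrightarrow> (\<exists>i<l. NA u 18 X i \<in> hitset u'))"
          using f p dead unfolding PI_def e by blast
      qed (use RV in auto)
    qed simp_all
  next
    have sums: "(\<Sum>x<n. 1) = n" "(\<Sum>X<k * n. 1) = k * n" "(\<Sum>j<R. 200 * R * R * R * ?T + 4) = R * (200 * R * R * R * ?T + 4)"
      "(\<Sum>j<R. 52 * R * R * R + 2) = R * (52 * R * R * R + 2)" by simp_all
    show "1 + n + (\<Sum>x<n. 1) + (1 + k * n + (\<Sum>X<k * n. 1) + (4 + (\<Sum>j<R. 200 * R * R * R * ?T + 4))) \<le> 220 * R * R * R * R * ?T"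
      unfolding sums by (rule cost_Hit[OF R_pos T1 T(3,4)])
    show "1 + (1 + (2 + (\<Sum>j<R. 52 * R * R * R + 2))) \<le> 60 * R * R * R * R"
      unfolding sums by (rule cost_Hit_d[OF R_pos])
  qed
qed

text \<open>The vertex s is always source number 0, whether or not it was selected, so that the last
  product can start from row 0 of the matrix.\<close>

definition NewC :: com where
  "NewC = Seq (Compact 29 30 (C 1) (sc 7) (notE (notE (Rd 20 VY (C 0)))))
    (Seq (PX 14 (C 1) (Op Plus (sc 30) (C 1)) (Cond VY (Rd 29 (C 0) (Op Minus VY (C 1))) (sc 9)) RZ)
    (Seq (asg 15 (Op Plus (sc 30) (C 1))) (asg 16 (Op Times (C 2) lE))))"

lemma spec_NewC:
  assumes S: "srcs k l z u" and l: "l \<le> n"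
  shows "spec NewC u (\<lambda>u'. fr {3,4,5,6,14,15,16,29,30} u u' \<and> (\<exists>z'. srcs (card (hitset u) + 1) (2 * l) z' u' \<and> z' 0 = s \<and>
      z' ` {..<card (hitset u) + 1} = insert s (hitset u))) (50 * R * n) (20 * R)"
proof -
  let ?F = "{3,4,5,6,14,15,16,29,30}" let ?N = "card (hitset u)"
  have st: "static u" and S1: "NA u 16 0 0 = l" "1 \<le> l" using S unfolding srcs_def by auto
  have S2: "NA u 7 0 0 = n" "NA u 1 0 0 = R" "NA u 9 0 0 = s" using st unfolding static_def by auto
  have N: "?N \<le> n"
  proof -
    have "?N \<le> card {..<n}" unfolding hitset_def by (intro card_mono) auto
    then show ?thesis by simp
  qed
  have nP: "n \<le> 2 ^ R" "n + 2 \<le> 2 ^ R" "n < V" "n + 1 < V" "2 * n < V" "n + 1 \<le> V ^ 4"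
    using le_P[of n 1] le_P[of "n + 2" 1] less_V[of n 1] less_V[of "n + 1" 1] less_V[of "2 * n" 2] le_V4[of "n + 1" 1]
    by (simp_all add: power2_eq_square)
  have hs: "{y. y < n \<and> NA u 20 y 0 \<noteq> 0} = hitset u" unfolding hitset_def by auto
  show ?thesis unfolding NewC_def
  proof (rule spec_step[OF spec_Compact[where r = 1 and k = "\<lambda>_. n" and R = R and f = "\<lambda>_ y. NA u 20 y 0 \<noteq> 0"]])
    fix u1 assume "fr {3,4,5,6,29,30} u u1 \<and> (\<forall>x<1. NA u1 30 x 0 = card {y. y < n \<and> NA u 20 y 0 \<noteq> 0} \<and>
       NA u1 29 x ` {..<NA u1 30 x 0} = {y. y < n \<and> NA u 20 y 0 \<noteq> 0})"
    then have f1: "fr {3,4,5,6,29,30} u u1" and N1: "NA u1 30 0 0 = ?N" and L1: "NA u1 29 0 ` {..<?N} = hitset u"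
      unfolding hs by auto
    have S3: "NA u1 9 0 0 = s" "NA u1 16 0 0 = l" using S1 S2 f1 by (simp_all add: fr_def)
    have Ln: "NA u1 29 0 y < n" if "y < ?N" for y
    proof -
      have "NA u1 29 0 y \<in> hitset u" using that L1 by blast
      then show ?thesis unfolding hitset_def by simp
    qed
    define z' where "z' = (\<lambda>c. if c = 0 then s else NA u1 29 0 (c - 1))"
    have z'n: "z' c < n" if "c < ?N + 1" for c using that s Ln[of "c - 1"] by (auto simp: z'_def)
    have z'im: "z' ` {..<?N + 1} = insert s (hitset u)"
    proof -
      have "{..<?N + 1} = insert 0 (Suc ` {..<?N})" by (simp add: lessThan_Suc_eq_insert_0)
      then have "z' ` {..<?N + 1} = insert (z' 0) ((\<lambda>y. z' (Suc y)) ` {..<?N})" by (simp add: image_image)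
      also have "\<dots> = insert s (NA u1 29 0 ` {..<?N})" by (simp add: z'_def)
      finally show ?thesis unfolding L1 .
    qed
    define u2 where "u2 = setA 14 1 (\<lambda>_. ?N + 1) (\<lambda>_. z') (\<lambda>_ _. 0) u1"
    define u3 where "u3 = setv 15 (?N + 1) u2"
    define u4 where "u4 = setv 16 (2 * l) u3"
    have f4: "fr ?F u u4" unfolding u4_def u3_def u2_def by (intro fr_setv fr_setA fr_mono[OF f1]) auto
    have "static u4" by (rule static_fr[OF st f4]) auto
    then have "srcs (?N + 1) (2 * l) z' u4"
      unfolding srcs_def using z'n N l S1 by (auto simp: u4_def u3_def u2_def)
    then have Q: "fr ?F u u4 \<and> (\<exists>z'. srcs (?N + 1) (2 * l) z' u4 \<and> z' 0 = s \<and> z' ` {..<?N + 1} = insert s (hitset u))"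
      using f4 z'im by (intro conjI exI[of _ z']) (auto simp: z'_def)
    show "spec (Seq (PX 14 (C 1) (Op Plus (sc 30) (C 1)) (Cond VY (Rd 29 (C 0) (Op Minus VY (C 1))) (sc 9)) RZ)
      (Seq (asg 15 (Op Plus (sc 30) (C 1))) (asg 16 (Op Times (C 2) lE)))) u1
      (\<lambda>u'. fr ?F u u' \<and> (\<exists>z'. srcs (?N + 1) (2 * l) z' u' \<and> z' 0 = s \<and> z' ` {..<?N + 1} = insert s (hitset u)))
      ((1 + 1 + (\<Sum>x<(1::nat). ?N + 1)) + (3 + 3)) (1 + (1 + 1))"
    proof (rule spec_step[where P = "\<lambda>u'. u' = u2"])
      have "z' c < V" if "c < ?N + 1" for c using z'n[OF that] nP by linarith
      then show "spec (PX 14 (C 1) (Op Plus (sc 30) (C 1)) (Cond VY (Rd 29 (C 0) (Op Minus VY (C 1))) (sc 9)) RZ) u1 (\<lambda>u'. u' = u2)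
        (1 + 1 + (\<Sum>x<(1::nat). ?N + 1)) 1"
        unfolding u2_def by (intro spec_PX[where f = "\<lambda>_. z'" and g = "\<lambda>_ _. 0"])
          (use N1 S3 N nP V2 in \<open>auto simp: gb_def z'_def\<close>)
      fix v2 assume v2: "v2 = u2"
      show "spec (Seq (asg 15 (Op Plus (sc 30) (C 1))) (asg 16 (Op Times (C 2) lE))) v2
        (\<lambda>u'. fr ?F u u' \<and> (\<exists>z'. srcs (?N + 1) (2 * l) z' u' \<and> z' 0 = s \<and> z' ` {..<?N + 1} = insert s (hitset u))) (3 + 3) (1 + 1)"
      proof (rule spec_step[where P = "\<lambda>u'. u' = u3"])
        show "spec (asg 15 (Op Plus (sc 30) (C 1))) v2 (\<lambda>u'. u' = u3) 3 1"
          by (rule spec_asg[where v = "?N + 1"]) (use v2 N1 N nP in \<open>auto simp: u3_def u2_def\<close>)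
        fix v3 assume v3: "v3 = u3"
        show "spec (asg 16 (Op Times (C 2) lE)) v3
         (\<lambda>u'. fr ?F u u' \<and> (\<exists>z'. srcs (?N + 1) (2 * l) z' u' \<and> z' 0 = s \<and> z' ` {..<?N + 1} = insert s (hitset u))) 3 1"
          by (rule spec_asg[where v = "2 * l"]) (use v3 S3 l nP Q in \<open>auto simp: u4_def u3_def u2_def\<close>)
      qed simp_all
    qed simp_all
  next
    show "stab {3,4,5,6,29,30} u (C 1) (\<lambda>_ _. 1)" "stab {3,4,5,6,29,30} u (sc 7) (\<lambda>_ _. n)"
      "stab {3,4,5,6,29,30} u (notE (notE (Rd 20 VY (C 0)))) (\<lambda>x y. of_bool (NA u 20 y 0 \<noteq> 0))"
      by (rule stabI; use S2 in simp)+
  next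
    have a: "1 \<le> R" "1 \<le> n" using R_pos n0 by auto
    then obtain x y where xy: "R = Suc x" "n = Suc y" by (metis One_nat_def Suc_le_D)
    have "(\<Sum>x<(1::nat). n) = n" "(\<Sum>x<(1::nat). ?N + 1) = ?N + 1" by simp_all
    note sums = this
    have "(1 + 1 + n) + ((7 + R * (9 + 2 * (1 + n))) + ((1 + 1 + n) + (1 + 1 + 1))) + ((1 + 1 + (n + 1)) + (3 + 3)) \<le> 50 * R * n"
      unfolding xy by (simp add: algebra_simps)
    then show "1 + 1 + (\<Sum>x<(1::nat). n) + (7 + R * (9 + 2 * (1 + (\<Sum>x<(1::nat). n))) + (1 + 1 + (\<Sum>x<(1::nat). n) + (1 + 1 + 1))) +
      (1 + 1 + (\<Sum>x<(1::nat). ?N + 1) + (3 + 3)) \<le> 50 * R * n"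
      unfolding sums using N by linarith
    show "1 + (3 + R * 5 + (1 + 1)) + (1 + (1 + 1)) \<le> 20 * R" using a(1) by linarith
  qed (use S2 R_V nP V2 in auto)
qed

end

section \<open>All pairs of sources, distances and parents\<close>

context sssp_machine
begin

text \<open>Here s stands in position 0 and once more among all vertices, whence k \<le> n + 1 in
  \<open>srcs\<close>.\<close>

definition InitC :: com where
  "InitC = Seq (PX 14 (C 1) (Op Plus (sc 7) (C 1)) (Cond VY (Op Minus VY (C 1)) (sc 9)) RZ)
    (Seq (asg 15 (Op Plus (sc 7) (C 1))) (asg 16 (C 1)))"

lemma spec_InitC:
  assumes st: "static u"
  shows "spec InitC u (\<lambda>u'. \<exists>z. srcs (n + 1) 1 z u' \<and> z 0 = s \<and> z ` {..<n + 1} = {..<n}) (9 + n) 3"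
proof -
  have S: "NA u 7 0 0 = n" "NA u 9 0 0 = s" using st unfolding static_def by auto
  have nP: "n + 1 < V" "n + 1 \<le> V ^ 4" using less_V[of "n + 1" 1] le_V4[of "n + 1" 1] by simp_all
  define z where "z = (\<lambda>c. if c = 0 then s else c - 1)"
  have zn: "z c < n" if "c < n + 1" for c using that s by (auto simp: z_def)
  have zim: "z ` {..<n + 1} = {..<n}"
  proof (intro equalityI subsetI)
    fix v assume "v \<in> {..<n}"
    then have "v = z (Suc v)" "Suc v \<in> {..<n + 1}" by (auto simp: z_def)
    then show "v \<in> z ` {..<n + 1}" by blast
  qed (use zn in auto)
  define u1 where "u1 = setA 14 1 (\<lambda>_. n + 1) (\<lambda>_. z) (\<lambda>_ _. 0) u"
  define u2 where "u2 = setv 15 (n + 1) u1"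
  define u3 where "u3 = setv 16 1 u2"
  have f3: "fr {14,15,16} u u3" unfolding u3_def u2_def u1_def by (intro fr_setv fr_setA fr_refl) auto
  have "static u3" by (rule static_fr[OF st f3]) auto
  then have "srcs (n + 1) 1 z u3"
    unfolding srcs_def using zn by (auto simp: u3_def u2_def u1_def)
  then have Q: "\<exists>z. srcs (n + 1) 1 z u3 \<and> z 0 = s \<and> z ` {..<n + 1} = {..<n}"
    using zim by (intro exI[of _ z]) (simp add: z_def)
  show ?thesis unfolding InitC_def
  proof (rule spec_step[where P = "\<lambda>u'. u' = u1"])
    have "z c < V" if "c < n + 1" for c using zn[OF that] nP by linarith
    then show "spec (PX 14 (C 1) (Op Plus (sc 7) (C 1)) (Cond VY (Op Minus VY (C 1)) (sc 9)) RZ) u (\<lambda>u'. u' = u1)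
      (1 + 1 + (\<Sum>x<(1::nat). n + 1)) 1"
      unfolding u1_def by (intro spec_PX[where f = "\<lambda>_. z" and g = "\<lambda>_ _. 0"])
        (use S nP V2 in \<open>auto simp: gb_def z_def\<close>)
    fix v1 assume v1: "v1 = u1"
    show "spec (Seq (asg 15 (Op Plus (sc 7) (C 1))) (asg 16 (C 1))) v1
      (\<lambda>u'. \<exists>z. srcs (n + 1) 1 z u' \<and> z 0 = s \<and> z ` {..<n + 1} = {..<n}) (3 + 3) (1 + 1)"
    proof (rule spec_step[where P = "\<lambda>u'. u' = u2"])
      show "spec (asg 15 (Op Plus (sc 7) (C 1))) v1 (\<lambda>u'. u' = u2) 3 1"
        by (rule spec_asg[where v = "n + 1"]) (use v1 S nP in \<open>auto simp: u2_def u1_def\<close>)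
      fix v2 assume v2: "v2 = u2"
      show "spec (asg 16 (C 1)) v2 (\<lambda>u'. \<exists>z. srcs (n + 1) 1 z u' \<and> z 0 = s \<and> z ` {..<n + 1} = {..<n}) 3 1"
        by (rule spec_asg[where v = 1]) (use v2 V2 Q in \<open>auto simp: u3_def\<close>)
    qed simp_all
  qed simp_all
qed

definition OI :: "nat \<Rightarrow> store \<Rightarrow> bool" where
  "OI l u \<longleftrightarrow> (\<exists>k z. srcs k l z u \<and> BFst k l z u \<and> hits l (z ` {..<k}) \<and> z 0 = s \<and> k * l \<le> 6 * R * n)"

definition Dbl :: com where "Dbl = Seq Hit (Seq NewC BF)"

lemma pow56: "r ^ 5 = r * r * r * r * r" "r ^ 6 = r * r * r * r * r * r" for r :: nat
  by (simp_all add: eval_nat_numeral)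

text \<open>Each large term contains one of the two products of source count and length, both at
  most 6 r m. The hitting set contributes r^4 and this product one more r; the lower-order terms are
  absorbed into r^5 m^2 l.\<close>

lemma cost_Dbl:
  fixes r m l k k' :: nat
  assumes "1 \<le> r" "1 \<le> m" "1 \<le> l" "k * l \<le> 6 * r * m" "k' * (2 * l) \<le> 6 * r * m"
  shows "220 * r * r * r * r * (k * m * l * l) + (50 * r * m + 2 * l * (3 * k' * M + 2 * k' * m * (2 * l) + 60 * r * k' * m))
     \<le> 18 * r * m * M + 1800 * r ^ 5 * m * m * l"
proof -
  have 1: "220 * r * r * r * r * (k * m * l * l) \<le> 1320 * r ^ 5 * m * m * l"
  proof -
    have "220 * r * r * r * r * (k * m * l * l) = 220 * r ^ 4 * m * l * (k * l)" by (simp add: power4_eq_xxxx algebra_simps)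
    also have "\<dots> \<le> 220 * r ^ 4 * m * l * (6 * r * m)" using assms(4) by (intro mult_le_mono2)
    also have "\<dots> = 1320 * r ^ 5 * m * m * l" by (simp add: pow56 power4_eq_xxxx algebra_simps)
    finally show ?thesis .
  qed
  have 2: "2 * l * (3 * k' * M + 2 * k' * m * (2 * l) + 60 * r * k' * m) \<le> 18 * r * m * M + 24 * r * m * m * l + 360 * r * r * m * m"
  proof -
    have "2 * l * (3 * k' * M + 2 * k' * m * (2 * l) + 60 * r * k' * m) = (k' * (2 * l)) * (3 * M + 4 * m * l + 60 * r * m)"
      by (simp add: algebra_simps)
    also have "\<dots> \<le> (6 * r * m) * (3 * M + 4 * m * l + 60 * r * m)" using assms(5) by (intro mult_le_mono1)
    also have "\<dots> = 18 * r * m * M + 24 * r * m * m * l + 360 * r * r * m * m" by (simp add: algebra_simps)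
    finally show ?thesis .
  qed
  have 3: "r * m * m * l \<le> r ^ 5 * m * m * l" "r * r * m * m \<le> r ^ 5 * m * m * l" "r * m \<le> r ^ 5 * m * m * l"
  proof -
    have "1 \<le> r * r * r * r" "1 \<le> r * r * r" "1 \<le> m * l * (r * r * r * r)" "1 \<le> l * (r * r * r)" using assms(1-3) by (simp_all add: Suc_le_eq)
    then have "r * m * m * l * 1 \<le> r * m * m * l * (r * r * r * r)" "r * r * m * m * 1 \<le> r * r * m * m * (l * (r * r * r))"
      "r * m * 1 \<le> r * m * (m * l * (r * r * r * r))" by (blast intro: mult_le_mono2)+
    then show "r * m * m * l \<le> r ^ 5 * m * m * l" "r * r * m * m \<le> r ^ 5 * m * m * l" "r * m \<le> r ^ 5 * m * m * l"
      unfolding pow56 by (simp_all add: ac_simps)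
  qed
  show ?thesis using 1 2 3 unfolding mult.assoc by linarith
qed

text \<open>The 6 collects three contributions of at most 2 R n: the full blocks, the incomplete
  block of each pass, and the additional source s.\<close>

lemma k_bound:
  assumes "1 \<le> l" "l \<le> n" "c \<le> R * (n div l + 1)"
  shows "(c + 1) * (2 * l) \<le> 6 * R * n"
proof -
  have "(c + 1) * (2 * l) \<le> (R * (n div l + 1) + 1) * (2 * l)" using assms by (intro mult_le_mono1) simp
  also have "\<dots> = 2 * R * (n div l * l) + 2 * R * l + 2 * l" by (simp add: algebra_simps)
  also have "\<dots> \<le> 2 * R * n + 2 * R * n + 2 * R * n"
  proof (intro add_mono mult_le_mono2)
    show "2 * l \<le> 2 * R * n" using R_pos assms(2) mult_le_mono[of 1 R l n] by simp
  qed (use assms(2) in simp_all)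
  finally show ?thesis by simp
qed

lemma spec_Dbl:
  assumes I: "OI l u" and l: "l = 2 ^ t" "l \<le> n"
  shows "spec Dbl u (OI (2 * l)) (18 * R * n * M + 1800 * R ^ 5 * n * n * l) (60 * R * R * R * R + (20 * R + 20 * R * (2 * l)))"
proof -
  obtain k z where S: "srcs k l z u" and B: "BFst k l z u" and h: "hits l (z ` {..<k})" and z0: "z 0 = s" and kl: "k * l \<le> 6 * R * n"
    using I unfolding OI_def by blast
  have l1: "1 \<le> l" and zn: "\<And>c. c < k \<Longrightarrow> z c < n" using S unfolding srcs_def by auto
  let ?F = "{3,4,5,6,20,21,22,23,24,25,26,27,28}"
  have main: "spec (Seq NewC BF) u1 (OI (2 * l)) (50 * R * n + 2 * l * (3 * (card (hitset u1) + 1) * M + 2 * (card (hitset u1) + 1) * n * (2 * l) + 60 * R * (card (hitset u1) + 1) * n))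
      (20 * R + 20 * R * (2 * l)) \<and> (card (hitset u1) + 1) * (2 * l) \<le> 6 * R * n"
    if u1: "fr ?F u u1 \<and> card (hitset u1) \<le> R * (n div l + 1) \<and> (\<forall>X<k * n. NA u 17 X 0 = l + 1 \<longrightarrow> (\<exists>i<l. NA u 18 X i \<in> hitset u1))" for u1
  proof
    let ?k = "card (hitset u1) + 1"
    have S1: "srcs k l z u1" by (rule srcs_fr[OF S]) (use u1 in auto)
    show kb: "?k * (2 * l) \<le> 6 * R * n" by (rule k_bound[OF l1 l(2)]) (use u1 in blast)
    have hd: "hits (2 * l) (insert s (hitset u1))"
    proof (rule hits_double[OF h _ l1])
      show "z ` {..<k} \<subseteq> {..<n}" using zn by auto
      fix y v x assume y: "y \<in> z ` {..<k}" and o: "ow l y v x"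
      then obtain c where c: "c < k" "y = z c" by auto
      have v: "v < n" using W_less[of l y v x] o zn[OF c(1)] c(2) unfolding ow_def by blast
      note ri = row_index[OF c(1) v]
      let ?X = "c * n + v"
      have b: "bst l y v (cell 17 u ?X)" "trk y v (cell 17 u ?X) (NA u 18 ?X)"
        using B[unfolded BFst_def, rule_format, OF ri(1)] unfolding ri(2,3) c(2) by blast+
      \<comment> \<open>The recorded walk need not be the given one, but both have the same count
        and cost, and \<open>meets\<close> asks for no more.\<close>
      have d: "cell 17 u ?X = (Suc l, x)" by (rule bst_ow[OF b(1) o]) simp
      then have "NA u 17 ?X 0 = l + 1" by (simp add: cell_def)
      then obtain i where i: "i < l" "NA u 18 ?X i \<in> hitset u1" using u1 ri(1) by blast
      show "meets (insert s (hitset u1)) l y v x"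
        by (rule trk_meets[OF _ i(1)]) (use b(2) d i(2) in auto)
    qed
    show "spec (Seq NewC BF) u1 (OI (2 * l)) (50 * R * n + 2 * l * (3 * ?k * M + 2 * ?k * n * (2 * l) + 60 * R * ?k * n))
      (20 * R + 20 * R * (2 * l))"
    proof (rule spec_step[OF spec_NewC[OF S1 l(2)]])
      fix u2 assume "fr {3,4,5,6,14,15,16,29,30} u1 u2 \<and> (\<exists>z'. srcs ?k (2 * l) z' u2 \<and> z' 0 = s \<and> z' ` {..<?k} = insert s (hitset u1))"
      then obtain z' where z': "srcs ?k (2 * l) z' u2" "z' 0 = s" "z' ` {..<?k} = insert s (hitset u1)" by blast
      show "spec BF u2 (OI (2 * l)) (2 * l * (3 * ?k * M + 2 * ?k * n * (2 * l) + 60 * R * ?k * n)) (20 * R * (2 * l))"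
      proof (rule spec_mono[OF spec_BF[OF z'(1)]])
        fix u3 assume u3: "fr {3,4,5,6,17,18,19} u2 u3 \<and> BFst ?k (2 * l) z' u3"
        have "srcs ?k (2 * l) z' u3" by (rule srcs_fr[OF z'(1)]) (use u3 in auto)
        then show "OI (2 * l) u3" unfolding OI_def using u3 z'(2) hd[folded z'(3)] kb by blast
      qed simp_all
    qed simp_all
  qed
  let ?w = "18 * R * n * M + 1800 * R ^ 5 * n * n * l - 220 * R * R * R * R * (k * n * l * l)"
  show ?thesis unfolding Dbl_def
  proof (rule spec_step[OF spec_Hit[OF S B l(1)]])
    fix u1 assume u1: "fr ?F u u1 \<and> card (hitset u1) \<le> R * (n div l + 1) \<and> (\<forall>X<k * n. NA u 17 X 0 = l + 1 \<longrightarrow> (\<exists>i<l. NA u 18 X i \<in> hitset u1))"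
    note m = main[OF u1]
    have n1: "1 \<le> n" using n0 by simp
    show "spec (Seq NewC BF) u1 (OI (2 * l)) ?w (20 * R + 20 * R * (2 * l))"
      by (rule spec_mono[OF conjunct1[OF m]])
        (use cost_Dbl[OF R_pos n1 l1 kl conjunct2[OF m]] in simp_all)
  next
    have n1: "1 \<le> n" using n0 by simp
    have "220 * R * R * R * R * (k * n * l * l) \<le> 18 * R * n * M + 1800 * R ^ 5 * n * n * l"
      using cost_Dbl[OF R_pos n1 l1 kl, of 0] by simp
    then show "220 * R * R * R * R * (k * n * l * l) + ?w \<le> 18 * R * n * M + 1800 * R ^ 5 * n * n * l" by simp
  qed simp
qed

definition Outer :: com where "Outer = Seq InitC (Seq BF (Wh (Ls lE (sc 10)) Dbl))"

lemma spec_Outer: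
  assumes st: "static u"
  shows "spec Outer u (\<lambda>u'. \<exists>l. hp \<le> l \<and> l \<le> 2 * hp \<and> OI l u')
     (60 * R * R * n * M + 3000 * R ^ 6 * n * n * hp) (300 * R ^ 5 + 100 * R * hp)"
proof -
  \<comment> \<open>By minimality the final length 2^t overshoots hp by less than a factor of
    two.\<close>
  define t where "t = (LEAST t. hp \<le> 2 ^ t)"
  have "hp \<le> 2 ^ hp" using less_exp[of hp] by simp
  then have t: "hp \<le> 2 ^ t" unfolding t_def by (rule LeastI)
  have below: "2 ^ j < hp" if "j < t" for j using not_less_Least[OF that[unfolded t_def]] by simp
  have t2: "2 ^ t \<le> 2 * hp"
  proof (cases t)
    case 0
    then show ?thesis using hp by simp
  next
    case (Suc j)
    then show ?thesis using below[of j] by simp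
  qed
  have tR: "t \<le> R"
  proof (rule ccontr)
    assume "\<not> t \<le> R"
    then have "2 ^ R < hp" using below by simp
    then show False using hp le_P[of "n + 1" 1] by simp
  qed
  have n1: "1 \<le> n" using n0 by simp
  let ?w = "\<lambda>j. 18 * R * n * M + 1800 * R ^ 5 * n * n * 2 ^ j"
  let ?d = "\<lambda>j. 60 * R * R * R * R + (20 * R + 20 * R * (2 * 2 ^ j))"
  show ?thesis unfolding Outer_def
  proof (rule spec_step[OF spec_InitC[OF st]])
    fix u1 assume "\<exists>z. srcs (n + 1) 1 z u1 \<and> z 0 = s \<and> z ` {..<n + 1} = {..<n}"
    then obtain z where z: "srcs (n + 1) 1 z u1" "z 0 = s" "z ` {..<n + 1} = {..<n}" by blast
    show "spec (Seq BF (Wh (Ls lE (sc 10)) Dbl)) u1 (\<lambda>u'. \<exists>l. hp \<le> l \<and> l \<le> 2 * hp \<and> OI l u')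
      (1 * (3 * (n + 1) * M + 2 * (n + 1) * n * 1 + 60 * R * (n + 1) * n) + (1 + (\<Sum>j<t. ?w j + 1)))
      (20 * R * 1 + (1 + (\<Sum>j<t. ?d j + 1)))"
    proof (rule spec_step[OF spec_BF[OF z(1)]])
      fix u2 assume u2: "fr {3,4,5,6,17,18,19} u1 u2 \<and> BFst (n + 1) 1 z u2"
      have S2: "srcs (n + 1) 1 z u2" by (rule srcs_fr[OF z(1)]) (use u2 in auto)
      have h1: "hits 1 (z ` {..<n + 1})" by (rule hits_1) (simp only: z(3) order_refl)
      have "(n + 1) * 1 \<le> 6 * R * n" 
      proof -
        have "n \<le> R * n" "1 \<le> n" using R_pos n1 by simp_all
        then have "n + 1 \<le> 6 * (R * n)" by linarith
        then show ?thesis by simp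
      qed
      then have O2: "OI 1 u2" unfolding OI_def using S2 u2 h1 z(2) by blast
      show "spec (Wh (Ls lE (sc 10)) Dbl) u2 (\<lambda>u'. \<exists>l. hp \<le> l \<and> l \<le> 2 * hp \<and> OI l u') (1 + (\<Sum>j<t. ?w j + 1)) (1 + (\<Sum>j<t. ?d j + 1))"
      proof (rule spec_Wh[where I = "\<lambda>j u'. OI (2 ^ j) u'" and L = t])
        fix u' assume "OI (2 ^ t) u'"
        then show "nev u' 0 0 (Ls lE (sc 10)) = 0" using t unfolding OI_def srcs_def static_def by auto
      next
        fix j u' assume j: "j < t" and O: "OI (2 ^ j) u'"
        have lt: "2 ^ j < hp" by (rule below[OF j])
        then have "nev u' 0 0 (Ls lE (sc 10)) \<noteq> 0" using O unfolding OI_def srcs_def static_def by auto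
        moreover have "2 ^ j \<le> n" using lt hp by simp
        ultimately show "nev u' 0 0 (Ls lE (sc 10)) \<noteq> 0 \<and> spec Dbl u' (OI (2 ^ Suc j)) (?w j) (?d j)"
          using spec_Dbl[OF O refl] by simp
      next
        fix u' assume "OI (2 ^ t) u'"
        then show "\<exists>l. hp \<le> l \<and> l \<le> 2 * hp \<and> OI l u'" using t t2 by blast
      qed (use O2 in auto)
    qed simp_all
  next
    \<comment> \<open>For the work each round is bounded as if its length were hp, at the price of a
      sixth factor R; the geometric sum is needed for the depth only.\<close>
    have "(\<Sum>j<t. ?w j + 1) \<le> (\<Sum>j<t. 18 * R * n * M + 1801 * R ^ 5 * n * n * hp)"
    proof (rule sum_mono)
      fix j assume j: "j \<in> {..<t}"
      have "R ^ 5 * n * n * 2 ^ j \<le> R ^ 5 * n * n * hp" using below[of j] j by (intro mult_le_mono2) simp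
      moreover have "1 \<le> R ^ 5 * n * n * hp" using R_pos n1 hp(1) by (simp add: Suc_le_eq)
      ultimately show "?w j + 1 \<le> 18 * R * n * M + 1801 * R ^ 5 * n * n * hp" unfolding mult.assoc by linarith
    qed
    also have "\<dots> = t * (18 * R * n * M + 1801 * R ^ 5 * n * n * hp)" by simp
    also have "\<dots> \<le> R * (18 * R * n * M + 1801 * R ^ 5 * n * n * hp)" using tR by (intro mult_le_mono1)
    also have "\<dots> = 18 * (R * R * n * M) + 1801 * (R ^ 6 * n * n * hp)" by (simp add: pow56 power4_eq_xxxx algebra_simps)
    finally have a: "(\<Sum>j<t. ?w j + 1) \<le> 18 * (R * R * n * M) + 1801 * (R ^ 6 * n * n * hp)" .
    have b: "n * M \<le> R * R * n * M" "M \<le> R * R * n * M"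
      using mult_le_mono1[of 1 "R * R" "n * M"] mult_le_mono1[of 1 "R * R * n" M] R_pos n1 by (simp_all add: Suc_le_eq mult.assoc)
    have c: "n * n \<le> R ^ 6 * n * n * hp" "n \<le> R ^ 6 * n * n * hp" "1 \<le> R ^ 6 * n * n * hp" "R * (n * n) \<le> R ^ 6 * n * n * hp" "R * n \<le> R ^ 6 * n * n * hp"
    proof -
      have p: "1 \<le> R ^ 6" "1 \<le> hp" "R \<le> R ^ 6" "1 \<le> n" using R_pos hp(1) n1 self_le_power[of R 6] by auto
      show "n * n \<le> R ^ 6 * n * n * hp" using mult_le_mono[OF mult_le_mono[OF p(1) order_refl[of "n * n"]] p(2)] by (simp add: mult.assoc)
      show "n \<le> R ^ 6 * n * n * hp" using mult_le_mono[OF mult_le_mono[OF mult_le_mono[OF p(1) order_refl[of n]] p(4)] p(2)] by simp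
      show "1 \<le> R ^ 6 * n * n * hp" using p by (simp add: Suc_le_eq)
      show "R * (n * n) \<le> R ^ 6 * n * n * hp" using mult_le_mono[OF mult_le_mono[OF p(3) order_refl[of "n * n"]] p(2)] by (simp add: mult.assoc)
      show "R * n \<le> R ^ 6 * n * n * hp" using mult_le_mono[OF mult_le_mono[OF mult_le_mono[OF p(3) order_refl[of n]] p(4)] p(2)] by simp
    qed
    have e: "1 * (3 * (n + 1) * M + 2 * (n + 1) * n * 1 + 60 * R * (n + 1) * n) = 3 * (n * M) + 3 * M + 2 * (n * n) + 2 * n + 60 * (R * (n * n)) + 60 * (R * n)"
      by (simp add: algebra_simps)
    show "9 + n + (1 * (3 * (n + 1) * M + 2 * (n + 1) * n * 1 + 60 * R * (n + 1) * n) + (1 + (\<Sum>j<t. ?w j + 1))) \<le> 60 * R * R * n * M + 3000 * R ^ 6 * n * n * hp"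
    proof -
      have "60 * R * R * n * M = 60 * (R * R * n * M)" "3000 * R ^ 6 * n * n * hp = 3000 * (R ^ 6 * n * n * hp)" by simp_all
      then show ?thesis unfolding e using a b c by linarith
    qed
    have "(\<Sum>j<t. ?d j + 1) = t * (60 * R * R * R * R + 20 * R + 1) + 40 * R * (\<Sum>j<t. 2 ^ j)"
    proof -
      have "(\<Sum>j<t. ?d j + 1) = (\<Sum>j<t. (60 * R * R * R * R + 20 * R + 1) + 40 * R * 2 ^ j)" by (intro sum.cong) auto
      also have "\<dots> = (\<Sum>j<t. 60 * R * R * R * R + 20 * R + 1) + 40 * R * (\<Sum>j<t. 2 ^ j)"
        by (simp only: sum.distrib[of "\<lambda>_. 60 * R * R * R * R + 20 * R + 1"] sum_distrib_left)
      finally show ?thesis by (simp only: sum_constant card_lessThan of_nat_id)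
    qed
    also have "\<dots> \<le> R * (60 * R * R * R * R + 20 * R + 1) + 40 * R * (2 * hp)"
    proof (intro add_mono mult_le_mono tR order_refl)
      have "(\<Sum>j<t. 2 ^ j) < (2::nat) ^ t" by (simp add: lessThan_atLeast0 sum_power2)
      then show "(\<Sum>j<t. 2 ^ j) \<le> 2 * hp" using t2 by linarith
    qed
    also have "\<dots> = 60 * R ^ 5 + 20 * (R * R) + R + 80 * (R * hp)" by (simp add: pow56 power4_eq_xxxx algebra_simps)
    finally have f: "(\<Sum>j<t. ?d j + 1) \<le> 60 * R ^ 5 + 20 * (R * R) + R + 80 * (R * hp)" .
    have g: "R \<le> R ^ 5" "R * R \<le> R ^ 5" "1 \<le> R ^ 5"
      using R_pos self_le_power[of R 5] power_increasing[of 2 5 R] by (auto simp: power2_eq_square)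
    have "300 * R ^ 5 + 100 * R * hp = 300 * R ^ 5 + 100 * (R * hp)" by simp
    then show "3 + (20 * R * 1 + (1 + (\<Sum>j<t. ?d j + 1))) \<le> 300 * R ^ 5 + 100 * R * hp" using f g by linarith
  qed
qed

end

section \<open>Min-plus squaring over the sources and the final product\<close>

context sssp_machine
begin

definition plN :: "nexp \<Rightarrow> nexp \<Rightarrow> nexp" where
  "plN p q = Cond p (Cond q (Op Minus (Op Plus p q) (C 1)) (C 0)) (C 0)"

lemma plN_simps [simp]: "nev u x y (plN p q) = (if nev u x y p = 0 \<or> nev u x y q = 0 then 0 else nev u x y p + nev u x y q - 1)"
    "arn (plN p q) = arn p \<union> arn q" "gn (plN p q) = 2 * gn p + 2 * gn q + 14"
  by (auto simp: plN_def)

lemma index_pair: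
  fixes c k t m :: nat
  assumes "c < k" "t < m"
  shows "c * m + t < k * m" "(c * m + t) div m = c" "(c * m + t) mod m = t"
proof -
  have "c * m + t < Suc c * m" using assms by simp
  also have "\<dots> \<le> k * m" using assms by (intro mult_le_mono1) simp
  finally show "c * m + t < k * m" .
qed (use assms in auto)

abbreviation "kE \<equiv> sc 15"
abbreviation "kk \<equiv> Op Times kE kE"
text \<open>The pair (a, b) of source numbers is row a k + b, so composing via source e reads the
  rows a k + e and e k + b.\<close>

definition "a1E e = Op Plus (Op Times (Op Div VX kE) kE) e"
definition "a2E e = Op Plus (Op Times e kE) (Op Mod VX kE)"
definition "sqN e = plN (Rd 31 (a1E e) (C 0)) (Rd 31 (a2E e) (C 0))"
definition "sqR e = RAd (RRd 31 (a1E e) (C 0)) (RRd 31 (a2E e) (C 0))"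

definition sqK :: "nat \<Rightarrow> store \<Rightarrow> nat \<Rightarrow> nat \<Rightarrow> cell" where
  "sqK k u X i = cpl (cell 31 u (X div k * k + i)) (cell 31 u (i * k + X mod k))"

lemma sqK:
  assumes "NA u 15 0 0 = k" "fr F u u'" "{15,31} \<inter> F = {}"
  shows "(nev u' X y (sqN e), rev u' X y (sqR e)) = sqK k u X (nev u' X y e)"
  using assms by (simp add: sqN_def sqR_def a1E_def a2E_def sqK_def cell_def fr_def)

definition SqIt :: com where
  "SqIt = Seq (Mn sqN sqR kk kE) (Up 31 kk (C 1) (sqN (Rd 5 VX (C 0))) (sqR (Rd 5 VX (C 0))))"

definition MI :: "nat \<Rightarrow> nat \<Rightarrow> (nat \<Rightarrow> nat) \<Rightarrow> nat \<Rightarrow> store \<Rightarrow> bool" where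
  "MI k l z j u \<longleftrightarrow> (\<forall>X<k * k. sq_ok l (z ` {..<k}) (2 ^ j) (z (X div k)) (z (X mod k)) (cell 31 u X) \<and>
     fst (cell 31 u X) \<le> l * 2 ^ j + 1)"

lemma fst_cpl_le: "fst a \<le> x + 1 \<Longrightarrow> fst b \<le> y + 1 \<Longrightarrow> fst (cpl a b) \<le> x + y + 1" for a b :: cell and x y :: nat
  by (cases a; cases b) auto

text \<open>Walks joined at sources may repeat vertices, so after j squarings only l 2^j bounds
  their arcs. V leaves room for these counts and for the rest of at most l arcs in the final
  product.\<close>

lemma hop_V:
  assumes "l \<le> 2 * n + 2" "a \<le> l * 2 ^ R + 1 + (l + 1)"
  shows "a < V"
proof -
  have "a \<le> l * 2 ^ R + l + 2" using assms by simp
  also have "\<dots> \<le> 2 ^ R * (4 * (n + 2))"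
  proof -
    have "l * 2 ^ R + (l + 2) \<le> l * 2 ^ R + (l + 2) * 2 ^ R" using mult_le_mono2[of 1 "2 ^ R" "l + 2"] by simp
    also have "\<dots> = 2 ^ R * (l + (l + 2))" by (simp add: algebra_simps)
    also have "\<dots> \<le> 2 ^ R * (4 * (n + 2))" using assms(1) by (intro mult_le_mono2) simp
    finally show ?thesis by simp
  qed
  also have "\<dots> \<le> 2 ^ R * (n + 2) ^ 20"
  proof (intro mult_le_mono2)
    have "(4::nat) \<le> (n + 2) ^ 2" using power_mono[of 2 "n + 2" 2] by simp
    from mult_bd[OF this, of "n + 2" 1] have "4 * (n + 2) \<le> (n + 2) ^ 3" by simp
    then show "4 * (n + 2) \<le> (n + 2) ^ 20" using pow_mono[of 3 20] by linarith
  qed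
  also have "\<dots> < V" by (rule P_V)
  finally show ?thesis .
qed

lemma spec_SqIt:
  assumes S: "srcs k l z u" and I: "MI k l z j u" and j: "j < R"
  shows "spec SqIt u (\<lambda>u'. fr {3,4,5,6,31} u u' \<and> MI k l z (Suc j) u')
    (8 + R * (9 + 4 * (k * k)) + k * k + 3 * (k * k * k) + 2 * (1 + k * k + k * k)) (4 + R * 5 + 2)"
proof -
  let ?r = "k * k" let ?S = "z ` {..<k}"
  have st: "static u" and k: "NA u 15 0 0 = k" "1 \<le> k" "k \<le> n + 1" and l: "1 \<le> l" "l \<le> 2 * n + 2"
    using S unfolding srcs_def by auto
  have R1: "NA u 1 0 0 = R" using st unfolding static_def by auto
  have rV: "?r \<le> V ^ 4" using mult_bd[of k 1 k 1] k le_V4[of ?r 2] by (auto simp: numeral_2_eq_2)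
  have kP: "k \<le> 2 ^ R" using le_P[of k 1] k by simp
  have g: "gn (sqN e) + gr (sqR e) \<le> 10 ^ 20" if "gn e \<le> 10000" for e
    using that by (simp add: sqN_def sqR_def a1E_def a2E_def)
  have K: "(nev u' x y (sqN e), rev u' x y (sqR e)) = sqK k u x (nev u' x y e)" if "fr {3,4,5,6} u u'" for u' x y e
    by (rule sqK[OF k(1) that]) auto
  have D: "sq_ok l ?S (2 ^ j) (z a) (z b) (cell 31 u (a * k + b))" "fst (cell 31 u (a * k + b)) \<le> l * 2 ^ j + 1" if "a < k" "b < k" for a b
    using I[unfolded MI_def, rule_format, OF index_pair(1)[OF that]] unfolding index_pair(2,3)[OF that] by auto
  show ?thesis unfolding SqIt_def
  proof (rule spec_step[OF spec_Mn[where r = ?r and k = "\<lambda>_. k" and K = "sqK k u" and R = R]])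
    fix u1 assume u1: "fr {3,4,5,6} u u1 \<and> (\<forall>X<?r. 0 < k \<longrightarrow> NA u1 5 X 0 < k \<and> (\<forall>i<k. \<not> dlt (sqK k u X i) (sqK k u X (NA u1 5 X 0))))"
    let ?b = "\<lambda>X. NA u1 5 X 0"
    have f1: "fr {3,4,5,6} u u1" and b: "\<And>X. X < ?r \<Longrightarrow> ?b X < k" "\<And>X i. X < ?r \<Longrightarrow> i < k \<Longrightarrow> \<not> dlt (sqK k u X i) (sqK k u X (?b X))"
      using u1 k by auto
    let ?g = "\<lambda>X (y::nat). sqK k u X (?b X)"
    define u2 where "u2 = setA 31 ?r (\<lambda>_. 1) (\<lambda>X y. fst (?g X y)) (\<lambda>X y. snd (?g X y)) (setA 6 ?r (\<lambda>_. 1) (\<lambda>X y. fst (?g X y)) (\<lambda>X y. snd (?g X y)) u1)"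
    have f2: "fr {3,4,5,6,31} u u2" unfolding u2_def by (intro fr_setA fr_mono[OF f1]) auto
    have kb: "fst (sqK k u X (?b X)) \<le> l * 2 ^ Suc j + 1" and ok: "sq_ok l ?S (2 ^ Suc j) (z (X div k)) (z (X mod k)) (sqK k u X (?b X))"
      if X: "X < ?r" for X
    proof -
      have c: "X div k < k" "X mod k < k" using X k by (auto simp: less_mult_imp_div_less)
      show "fst (sqK k u X (?b X)) \<le> l * 2 ^ Suc j + 1"
        using fst_cpl_le[OF D(2)[OF c(1) b(1)[OF X]] D(2)[OF b(1)[OF X] c(2)]] unfolding sqK_def by simp
      have "sq_ok l ?S (2 * 2 ^ j) (z (X div k)) (z (X mod k)) (sqK k u X (?b X))"
      proof (rule sq_ok_double)
        show "z (X div k) \<in> ?S" using c by blast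
        show "\<exists>y\<in>?S. \<exists>a' b'. sq_ok l ?S (2 ^ j) (z (X div k)) y a' \<and> sq_ok l ?S (2 ^ j) y (z (X mod k)) b' \<and> sqK k u X (?b X) = cpl a' b'"
          using D(1)[OF c(1) b(1)[OF X]] D(1)[OF b(1)[OF X] c(2)] b(1)[OF X] unfolding sqK_def by blast
        fix y assume "y \<in> ?S"
        then obtain i where i: "i < k" "y = z i" by auto
        show "\<exists>a' b'. sq_ok l ?S (2 ^ j) (z (X div k)) y a' \<and> sq_ok l ?S (2 ^ j) y (z (X mod k)) b' \<and> \<not> dlt (cpl a' b') (sqK k u X (?b X))"
          using D(1)[OF c(1) i(1)] D(1)[OF i(1) c(2)] b(2)[OF X i(1)] i(2) unfolding sqK_def[of k u X i] by blast
      qed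
      then show "sq_ok l ?S (2 ^ Suc j) (z (X div k)) (z (X mod k)) (sqK k u X (?b X))" by simp
    qed
    have c2: "cell 31 u2 X = sqK k u X (?b X)" if "X < ?r" for X using that by (simp add: cell_def u2_def)
    have Q: "fr {3,4,5,6,31} u u2 \<and> MI k l z (Suc j) u2" using f2 kb ok c2 unfolding MI_def by auto
    have gV: "fst (?g X y) < V" if "X < ?r" for X and y :: nat
    proof (rule hop_V[OF l(2)])
      have "l * 2 ^ Suc j \<le> l * 2 ^ R" using j by (intro mult_le_mono2 power_increasing) auto
      then show "fst (?g X y) \<le> l * 2 ^ R + 1 + (l + 1)" using kb[OF that] by linarith
    qed
    show "spec (Up 31 kk (C 1) (sqN (Rd 5 VX (C 0))) (sqR (Rd 5 VX (C 0)))) u1 (\<lambda>u'. fr {3,4,5,6,31} u u' \<and> MI k l z (Suc j) u')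
      (2 * (1 + ?r + (\<Sum>X<?r. 1))) 2"
    proof (rule spec_Up[where f = "\<lambda>X y. fst (?g X y)" and g = "\<lambda>X y. snd (?g X y)"])
      fix X y :: nat
      have "(nev u1 X y (sqN (Rd 5 VX (C 0))), rev u1 X y (sqR (Rd 5 VX (C 0)))) = sqK k u X (nev u1 X y (Rd 5 VX (C 0)))"
        by (rule K[OF f1])
      then have "?g X y = (nev u1 X y (sqN (Rd 5 VX (C 0))), rev u1 X y (sqR (Rd 5 VX (C 0))))" by simp
      then show "nev u1 X y (sqN (Rd 5 VX (C 0))) = fst (?g X y)" "rev u1 X y (sqR (Rd 5 VX (C 0))) = snd (?g X y)" by simp_all
    next
      show "fr {3,4,5,6,31} u (setA 31 ?r (\<lambda>_. 1) (\<lambda>X y. fst (?g X y)) (\<lambda>X y. snd (?g X y)) (setA 6 ?r (\<lambda>_. 1) (\<lambda>X y. fst (?g X y)) (\<lambda>X y. snd (?g X y)) u1)) \<and>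
        MI k l z (Suc j) (setA 31 ?r (\<lambda>_. 1) (\<lambda>X y. fst (?g X y)) (\<lambda>X y. snd (?g X y)) (setA 6 ?r (\<lambda>_. 1) (\<lambda>X y. fst (?g X y)) (\<lambda>X y. snd (?g X y)) u1))"
        using Q unfolding u2_def .
      show "nev u1 0 0 kk = ?r" using f1 k by (simp add: fr_def)
      show "gn kk + gn (C 1) + gn (sqN (Rd 5 VX (C 0))) + gr (sqR (Rd 5 VX (C 0))) + 31 \<le> 10 ^ 20"
        by (simp add: sqN_def sqR_def a1E_def a2E_def)
    qed (use rV V2 gV in \<open>simp_all add: sqN_def sqR_def a1E_def a2E_def\<close>)
  next
    fix u' x y e assume "fr {3,4,5,6} u u'"
    then show "(nev u' x y (sqN e), rev u' x y (sqR e)) = sqK k u x (nev u' x y e)" by (rule K)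
  qed (use g k R1 R_V rV kP in \<open>auto simp: sqN_def sqR_def a1E_def a2E_def\<close>)
qed

definition Sq :: com where
  "Sq = Seq (PX 31 kk (C 1) (Rd 17 (Op Plus (Op Times (Op Div VX kE) (sc 7)) (Rd 14 (C 0) (Op Mod VX kE))) (C 0))
      (RRd 17 (Op Plus (Op Times (Op Div VX kE) (sc 7)) (Rd 14 (C 0) (Op Mod VX kE))) (C 0)))
    (For 32 (sc 1) SqIt)"

lemma cost_Sq:
  fixes r k :: nat
  assumes "1 \<le> r" "1 \<le> k"
  shows "(1 + k * k + k * k) + (4 + r * (8 + r * (9 + 4 * (k * k)) + k * k + 3 * (k * k * k) + 2 * (1 + k * k + k * k) + 4)) \<le> 3 * r * k ^ 3 + 50 * r * r * (k * k)"
proof -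
  obtain x y where "r = Suc x" "k * k = Suc y" using assms by (metis One_nat_def Suc_le_D mult_le_mono mult_1)
  moreover have "k ^ 3 = k * k * k" by (simp add: power3_eq_cube)
  ultimately show ?thesis by (simp add: algebra_simps)
qed

lemma spec_Sq:
  assumes S: "srcs k l z u" and B: "BFst k l z u"
  shows "spec Sq u (\<lambda>u'. fr {3,4,5,6,31,32} u u' \<and> MI k l z R u') (3 * R * k ^ 3 + 50 * R * R * (k * k)) (20 * R * R)"
proof -
  let ?r = "k * k" let ?F = "{3,4,5,6,31,32}"
  have st: "static u" and k: "NA u 15 0 0 = k" "1 \<le> k" "k \<le> n + 1" and l: "1 \<le> l" "l \<le> 2 * n + 2"
    and z: "\<And>c. c < k \<Longrightarrow> NA u 14 0 c = z c \<and> z c < n"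
    using S unfolding srcs_def by auto
  have S1: "NA u 1 0 0 = R" "NA u 7 0 0 = n" using st unfolding static_def by auto
  have rV: "?r \<le> V ^ 4" using mult_bd[of k 1 k 1] k le_V4[of ?r 2] by (auto simp: numeral_2_eq_2)
  have RV: "R < V" using R_V less_exp[of R] by linarith
  let ?i = "\<lambda>X. X div k * n + z (X mod k)"
  let ?u1 = "setA 31 ?r (\<lambda>_. 1) (\<lambda>X _. NA u 17 (?i X) 0) (\<lambda>X _. RA u 17 (?i X) 0) u"
  have f1: "fr ?F u ?u1" by (intro fr_setA fr_refl) auto
  have c1: "cell 31 ?u1 X = cell 17 u (?i X)" if "X < ?r" for X using that by (simp add: cell_def)
  have M1: "bst l (z (X div k)) (z (X mod k)) (cell 17 u (?i X))" if X: "X < ?r" for X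
  proof -
    have c: "X div k < k" "X mod k < k" using X k by (auto simp: less_mult_imp_div_less)
    note ri = row_index[OF c(1) conjunct2[OF z[OF c(2)]]]
    show ?thesis using B[unfolded BFst_def, rule_format, OF ri(1)] unfolding ri(2,3) by blast
  qed
  have M0: "MI k l z 0 ?u1" unfolding MI_def
  proof (intro allI impI)
    fix X assume X: "X < ?r"
    show "sq_ok l (z ` {..<k}) (2 ^ 0) (z (X div k)) (z (X mod k)) (cell 31 ?u1 X) \<and> fst (cell 31 ?u1 X) \<le> l * 2 ^ 0 + 1"
      unfolding c1[OF X] using sq_ok_1[OF M1[OF X]] M1[OF X] by (auto simp: bst_def)
  qed
  have lV: "NA u 17 (?i X) 0 < V" if "X < ?r" for X
  proof (rule hop_V[OF l(2)])
    show "NA u 17 (?i X) 0 \<le> l * 2 ^ R + 1 + (l + 1)" using M1[OF that] by (auto simp: bst_def cell_def)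
  qed
  have MI_setv: "MI k l z j (setv 32 v u') \<longleftrightarrow> MI k l z j u'" for j v u' by (simp add: MI_def cell_def)
  define J where "J = (\<lambda>j u'. fr ?F u u' \<and> NA u' 32 0 0 = j \<and> MI k l z j u')"
  show ?thesis unfolding Sq_def
  proof (rule spec_step[where P = "\<lambda>u'. u' = ?u1"])
    show "spec (PX 31 kk (C 1) (Rd 17 (Op Plus (Op Times (Op Div VX kE) (sc 7)) (Rd 14 (C 0) (Op Mod VX kE))) (C 0))
      (RRd 17 (Op Plus (Op Times (Op Div VX kE) (sc 7)) (Rd 14 (C 0) (Op Mod VX kE))) (C 0))) u (\<lambda>u'. u' = ?u1) (1 + ?r + (\<Sum>X<?r. 1)) 1"
      by (rule spec_PX[where f = "\<lambda>X _. NA u 17 (?i X) 0" and g = "\<lambda>X _. RA u 17 (?i X) 0"])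
        (use k S1 z rV lV V2 in \<open>auto simp: gb_def\<close>)
    fix u1 assume u1: "u1 = ?u1"
    show "spec (For 32 (sc 1) SqIt) u1 (\<lambda>u'. fr ?F u u' \<and> MI k l z R u')
      (4 + (\<Sum>j<R. 8 + R * (9 + 4 * (k * k)) + k * k + 3 * (k * k * k) + 2 * (1 + k * k + k * k) + 4)) (2 + (\<Sum>j<R. 4 + R * 5 + 2 + 2))"
    proof (rule spec_For[where I = J and L = R])
      have "fr ?F u (setv 32 0 ?u1)" by (rule fr_setv[OF f1]) simp
      then show "J 0 (setv 32 0 u1)" unfolding J_def u1 MI_setv using M0 by simp
    next
      fix j u' assume "J j u'"
      then show "nev u' 0 0 (sc 1) = R \<and> NA u' 32 0 0 = j" using S1 unfolding J_def by (auto simp: fr_def)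
    next
      fix j u' assume j: "j < R" and J: "J j u'"
      have f: "fr ?F u u'" and v: "NA u' 32 0 0 = j" "MI k l z j u'" using J unfolding J_def by auto
      have S': "srcs k l z u'" by (rule srcs_fr[OF S f]) auto
      show "spec SqIt u' (\<lambda>u'. NA u' 32 0 0 = j \<and> J (Suc j) (setv 32 (Suc j) u'))
        (8 + R * (9 + 4 * (k * k)) + k * k + 3 * (k * k * k) + 2 * (1 + k * k + k * k)) (4 + R * 5 + 2)"
      proof (rule spec_mono[OF spec_SqIt[OF S' v(2) j]])
        fix u'' assume a: "fr {3,4,5,6,31} u' u'' \<and> MI k l z (Suc j) u''"
        have "fr ?F u u''" by (rule fr_trans[OF f conjunct1[OF a]]) auto
        then have "fr ?F u (setv 32 (Suc j) u'')" by (rule fr_setv) simp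
        moreover have "NA u'' 32 0 0 = j" using a v by (simp add: fr_def)
        ultimately show "NA u'' 32 0 0 = j \<and> J (Suc j) (setv 32 (Suc j) u'')" unfolding J_def MI_setv using a by simp
      qed simp_all
    qed (use RV in \<open>auto simp: J_def\<close>)
  next
    have sums: "(\<Sum>X<?r. 1) = ?r" "(\<Sum>j<R. 8 + R * (9 + 4 * (k * k)) + k * k + 3 * (k * k * k) + 2 * (1 + k * k + k * k) + 4) =
       R * (8 + R * (9 + 4 * (k * k)) + k * k + 3 * (k * k * k) + 2 * (1 + k * k + k * k) + 4)" by simp_all
    show "1 + ?r + (\<Sum>X<?r. 1) + (4 + (\<Sum>j<R. 8 + R * (9 + 4 * (k * k)) + k * k + 3 * (k * k * k) + 2 * (1 + k * k + k * k) + 4)) \<le> 3 * R * k ^ 3 + 50 * R * R * (k * k)"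
      unfolding sums by (rule cost_Sq[OF R_pos k(2)])
    show "1 + (2 + (\<Sum>j<R. 4 + R * 5 + 2 + 2)) \<le> 20 * R * R" using R_pos by (cases R) (auto simp: algebra_simps)
  qed
qed

text \<open>Source 0 is s, so the entries e < k of the matrix form its row 0, the distances from s
  to the sources.\<close>

definition "fN e = plN (Rd 31 e (C 0)) (Rd 17 (Op Plus (Op Times e (sc 7)) VX) (C 0))"
definition "fR e = RAd (RRd 31 e (C 0)) (RRd 17 (Op Plus (Op Times e (sc 7)) VX) (C 0))"

definition fK :: "store \<Rightarrow> nat \<Rightarrow> nat \<Rightarrow> cell" where
  "fK u v i = cpl (cell 31 u i) (cell 17 u (i * n + v))"

definition Fin1 :: com where
  "Fin1 = Seq (Mn fN fR (sc 7) kE) (Up 33 (sc 7) (C 1) (fN (Rd 5 VX (C 0))) (fR (Rd 5 VX (C 0))))"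

definition DF :: "store \<Rightarrow> bool" where
  "DF u \<longleftrightarrow> static u \<and> (\<forall>v<n. dist_ok s v (cell 33 u v))"

lemma spec_Fin1:
  assumes S: "srcs k l z u" and B: "BFst k l z u" and h: "hits l (z ` {..<k})" and z0: "z 0 = s" and I: "MI k l z R u"
  shows "spec Fin1 u DF (8 + R * (9 + 4 * n) + n + 3 * (n * k) + 2 * (1 + n + n)) (4 + R * 5 + 2)"
proof -
  let ?S = "z ` {..<k}"
  have st: "static u" and k: "NA u 15 0 0 = k" "1 \<le> k" "k \<le> n + 1" and l: "1 \<le> l" "l \<le> 2 * n + 2" and zn: "\<And>c. c < k \<Longrightarrow> z c < n"
    using S unfolding srcs_def by auto
  have S1: "NA u 1 0 0 = R" "NA u 7 0 0 = n" using st unfolding static_def by auto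
  have nV: "n \<le> V ^ 4" using le_V4[of n 1] by simp
  have nP: "n \<le> 2 ^ R" using le_P[of n 1] by simp
  have kP: "k \<le> 2 ^ R" using le_P[of k 1] k by simp
  have g: "gn (fN e) + gr (fR e) \<le> 10 ^ 20" if "gn e \<le> 10000" for e using that by (simp add: fN_def fR_def)
  have K: "(nev u' x y (fN e), rev u' x y (fR e)) = fK u x (nev u' x y e)" if "fr {3,4,5,6} u u'" for u' x y e
    using that S1 by (simp add: fN_def fR_def fK_def cell_def fr_def)
  have D: "sq_ok l ?S (2 ^ R) s (z i) (cell 31 u i)" "fst (cell 31 u i) \<le> l * 2 ^ R + 1" if "i < k" for i
  proof -
    have "k \<le> k * k" using mult_le_mono2[OF k(2), of k] by simp
    have "i < k * k" using that \<open>k \<le> k * k\<close> by (rule less_le_trans)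
    moreover have "i div k = 0" "i mod k = i" using that by auto
    ultimately show "sq_ok l ?S (2 ^ R) s (z i) (cell 31 u i)" "fst (cell 31 u i) \<le> l * 2 ^ R + 1"
      using I z0 unfolding MI_def by metis+
  qed
  have b: "bst l (z i) v (cell 17 u (i * n + v))" if "i < k" "v < n" for i v
    using B[unfolded BFst_def, rule_format, OF row_index(1)[OF that]] unfolding row_index(2,3)[OF that] by blast
  show ?thesis unfolding Fin1_def
  proof (rule spec_step[OF spec_Mn[where r = n and k = "\<lambda>_. k" and K = "fK u" and R = R]])
    fix u1 assume u1: "fr {3,4,5,6} u u1 \<and> (\<forall>X<n. 0 < k \<longrightarrow> NA u1 5 X 0 < k \<and> (\<forall>i<k. \<not> dlt (fK u X i) (fK u X (NA u1 5 X 0))))"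
    let ?b = "\<lambda>X. NA u1 5 X 0"
    have f1: "fr {3,4,5,6} u u1" and bb: "\<And>v. v < n \<Longrightarrow> ?b v < k" "\<And>v i. v < n \<Longrightarrow> i < k \<Longrightarrow> \<not> dlt (fK u v i) (fK u v (?b v))"
      using u1 k by auto
    let ?g = "\<lambda>X (y::nat). fK u X (?b X)"
    define u2 where "u2 = setA 33 n (\<lambda>_. 1) (\<lambda>X y. fst (?g X y)) (\<lambda>X y. snd (?g X y)) (setA 6 n (\<lambda>_. 1) (\<lambda>X y. fst (?g X y)) (\<lambda>X y. snd (?g X y)) u1)"
    have f2: "fr {3,4,5,6,33} u u2" unfolding u2_def by (intro fr_setA fr_mono[OF f1]) auto
    have "static u2" by (rule static_fr[OF st f2]) auto
    moreover have "dist_ok s v (cell 33 u2 v)" if v: "v < n" for v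
    proof -
      have c: "cell 33 u2 v = fK u v (?b v)" using v by (simp add: cell_def u2_def)
      show ?thesis unfolding c
      \<comment> \<open>R squarings allow for 2^R links, and n \<le> 2^R suffices.\<close>
      proof (rule dist_ok_final[OF h _ l(1) _ nP])
        show "?S \<subseteq> {..<n}" using zn by auto
        show "s \<in> ?S" using z0 k(2) by (metis image_eqI lessThan_iff less_eq_Suc_le One_nat_def)
        show "\<exists>y\<in>?S. \<exists>a' b'. sq_ok l ?S (2 ^ R) s y a' \<and> bst l y v b' \<and> fK u v (?b v) = cpl a' b'"
          using D(1)[OF bb(1)[OF v]] b[OF bb(1)[OF v] v] bb(1)[OF v] unfolding fK_def by blast
        fix y assume "y \<in> ?S"
        then obtain i where i: "i < k" "y = z i" by auto
        show "\<exists>a' b'. sq_ok l ?S (2 ^ R) s y a' \<and> bst l y v b' \<and> \<not> dlt (cpl a' b') (fK u v (?b v))"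
          using D(1)[OF i(1)] b[OF i(1) v] bb(2)[OF v i(1)] i(2) unfolding fK_def[of u v i] by blast
      qed
    qed
    ultimately have Q: "DF u2" unfolding DF_def by blast
    have gV: "fst (?g v y) < V" if v: "v < n" for v and y :: nat
    proof (rule hop_V[OF l(2)])
      have le: "fst (cell 17 u (?b v * n + v)) \<le> l + 1" using b[OF bb(1)[OF v] v] unfolding bst_def by auto
      then show "fst (?g v y) \<le> l * 2 ^ R + 1 + (l + 1)"
        using fst_cpl_le[OF D(2)[OF bb(1)[OF v]] le] unfolding fK_def by simp
    qed
    show "spec (Up 33 (sc 7) (C 1) (fN (Rd 5 VX (C 0))) (fR (Rd 5 VX (C 0)))) u1 DF (2 * (1 + n + (\<Sum>X<n. 1))) 2"
    proof (rule spec_Up[where f = "\<lambda>X y. fst (?g X y)" and g = "\<lambda>X y. snd (?g X y)"])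
      fix X y :: nat
      have "(nev u1 X y (fN (Rd 5 VX (C 0))), rev u1 X y (fR (Rd 5 VX (C 0)))) = fK u X (nev u1 X y (Rd 5 VX (C 0)))"
        by (rule K[OF f1])
      then have "?g X y = (nev u1 X y (fN (Rd 5 VX (C 0))), rev u1 X y (fR (Rd 5 VX (C 0))))" by simp
      then show "nev u1 X y (fN (Rd 5 VX (C 0))) = fst (?g X y)" "rev u1 X y (fR (Rd 5 VX (C 0))) = snd (?g X y)" by simp_all
    next
      show "DF (setA 33 n (\<lambda>_. 1) (\<lambda>X y. fst (?g X y)) (\<lambda>X y. snd (?g X y)) (setA 6 n (\<lambda>_. 1) (\<lambda>X y. fst (?g X y)) (\<lambda>X y. snd (?g X y)) u1))"
        using Q unfolding u2_def .
      show "nev u1 0 0 (sc 7) = n" using f1 S1 by (simp add: fr_def)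
    qed (use nV V2 gV in \<open>simp_all add: fN_def fR_def\<close>)
  next
    fix u' x y e assume "fr {3,4,5,6} u u'"
    then show "(nev u' x y (fN e), rev u' x y (fR e)) = fK u x (nev u' x y e)" by (rule K)
  qed (use g k S1 R_V nV kP in \<open>auto simp: fN_def fR_def\<close>)
qed

end

section \<open>Shortest path tree and output\<close>

context sssp_machine
begin

definition "pN e = Cond (Rd 33 (Rd 13 VX e) (C 0)) (Op Plus (Rd 33 (Rd 13 VX e) (C 0)) (C 1)) (C 0)"
definition "pR e = RAd (RRd 33 (Rd 13 VX e) (C 0)) (RRd 13 VX e)"
abbreviation "dE \<equiv> Rd 12 VX (C 0)"

definition pK :: "store \<Rightarrow> nat \<Rightarrow> nat \<Rightarrow> cell" where
  "pK u v i = ext (cell 33 u (NA u 13 v i)) (RA u 13 v i)"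

text \<open>Parents are found afresh from the final distances, so the squarings need not keep track
  of walks.\<close>

definition Fin2 :: com where
  "Fin2 = Seq (Mn pN pR (sc 7) dE) (PX 34 (sc 7) (C 1) (Rd 11 VX (Rd 5 VX (C 0))) RZ)"

definition par_ok :: "(nat \<Rightarrow> nat) \<Rightarrow> bool" where
  "par_ok f \<longleftrightarrow> (\<forall>v<n. \<forall>k x. v \<noteq> s \<longrightarrow> ow k s v x \<longrightarrow>
     (\<exists>y<ideg v. f v = arc v y \<and> (\<exists>i. k = Suc i \<and> ow i s (tl v y) (x - w (tl v y) v))))"

lemma spec_Fin2:
  assumes D: "DF u"
  shows "spec Fin2 u (\<lambda>u'. DF u' \<and> par_ok (\<lambda>v. NA u' 34 v 0)) (8 + R * (9 + 4 * n) + n + 3 * M + (1 + n + n)) (4 + R * 5 + 1)"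
proof -
  have st: "static u" using D unfolding DF_def by blast
  have S1: "NA u 1 0 0 = R" "NA u 7 0 0 = n" using st unfolding static_def by auto
  have g: "NA u 12 v 0 = ideg v" "\<And>y. y < ideg v \<Longrightarrow> NA u 11 v y = arc v y \<and> NA u 13 v y = tl v y \<and> RA u 13 v y = w (tl v y) v" if "v < n" for v
    using st that unfolding static_def by blast+
  have nV: "n \<le> V ^ 4" using le_V4[of n 1] by simp
  have dP: "NA u 12 v 0 \<le> 2 ^ R" if "v < n" for v using g(1)[OF that] ideg(1)[OF that] le_P[of n 1] by simp
  have gs: "gn (pN e) + gr (pR e) \<le> 10 ^ 20" if "gn e \<le> 10000" for e using that by (simp add: pN_def pR_def)
  have K: "(nev u' x y (pN e), rev u' x y (pR e)) = pK u x (nev u' x y e)" if "fr {3,4,5,6} u u'" for u' x y e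
    using that by (simp add: pN_def pR_def pK_def cell_def fr_def)
  have sm: "(\<Sum>x<n. NA u 12 x 0) = M" using g(1) ideg(2) by (metis (no_types, lifting) lessThan_iff sum.cong)
  show ?thesis unfolding Fin2_def
  proof (rule spec_step[OF spec_Mn[where r = n and k = "\<lambda>v. NA u 12 v 0" and K = "pK u" and R = R]])
    fix u1 assume b1: "bdd u1" and u1: "fr {3,4,5,6} u u1 \<and> (\<forall>v<n. 0 < NA u 12 v 0 \<longrightarrow> NA u1 5 v 0 < NA u 12 v 0 \<and> (\<forall>i<NA u 12 v 0. \<not> dlt (pK u v i) (pK u v (NA u1 5 v 0))))"
    let ?b = "\<lambda>v. NA u1 5 v 0"
    have f1: "fr {3,4,5,6} u u1" using u1 by blast
    let ?g = "\<lambda>v (y::nat). NA u 11 v (?b v)"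
    define u2 where "u2 = setA 34 n (\<lambda>_. 1) ?g (\<lambda>_ _. 0) u1"
    have f2: "fr {3,4,5,6,34} u u2" unfolding u2_def by (intro fr_setA fr_mono[OF f1]) auto
    have "static u2" by (rule static_fr[OF st f2]) auto
    moreover have "cell 33 u2 = cell 33 u" using f2 by (simp add: cell_def[abs_def] fr_def)
    ultimately have D2: "DF u2" using D unfolding DF_def by simp
    have "par_ok (\<lambda>v. NA u2 34 v 0)" unfolding par_ok_def
    proof (intro allI impI)
      fix v k x assume v: "v < n" and vs: "v \<noteq> s" and o: "ow k s v x"
      obtain j where "k = Suc j" using o vs by (cases k) (auto simp: ow_def)
      then obtain z where "E z v" using o unfolding ow_def by auto
      then have "0 < ideg v" using E_iff by force
      then have b: "?b v < ideg v" "\<And>i. i < ideg v \<Longrightarrow> \<not> dlt (pK u v i) (pK u v (?b v))" using u1 v g(1)[OF v] by auto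
      have pk: "pK u v i = ext (cell 33 u (tl v i)) (w (tl v i) v)" if "i < ideg v" for i using g(2)[OF v that] by (simp add: pK_def)
      have "\<exists>i. k = Suc i \<and> ow i s (tl v (?b v)) (x - w (tl v (?b v)) v)"
      proof (rule parent_ok[where F = "cell 33 u"])
        show "dist_ok s z (cell 33 u z)" if "z < n" for z using D that unfolding DF_def by blast
        show "E (tl v (?b v)) v" using E_tl[OF v b(1)] by blast
        fix z assume "E z v"
        then obtain i where i: "i < ideg v" "tl v i = z" using E_iff by blast
        then show "\<not> dlt (ext (cell 33 u z) (w z v)) (ext (cell 33 u (tl v (?b v))) (w (tl v (?b v)) v))"
          using b(2)[OF i(1)] pk[OF i(1)] pk[OF b(1)] by simp
      qed (use s o vs in auto)
      moreover have "NA u2 34 v 0 = arc v (?b v)" using v g(2)[OF v b(1)] by (simp add: u2_def)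
      ultimately show "\<exists>y<ideg v. NA u2 34 v 0 = arc v y \<and> (\<exists>i. k = Suc i \<and> ow i s (tl v y) (x - w (tl v y) v))"
        using b(1) by blast
    qed
    then have Q: "DF u2 \<and> par_ok (\<lambda>v. NA u2 34 v 0)" using D2 by blast
    \<comment> \<open>For in-degree 0 the index found in array 5 is arbitrary, so the bound comes
      from the store as a whole and not from \<open>arc\<close>.\<close>
    have gV: "NA u 11 v i < V" for v i
    proof -
      have "NA u1 11 v i < V" using b1 unfolding bdd_def by blast
      then show ?thesis using f1 by (simp add: fr_def)
    qed
    show "spec (PX 34 (sc 7) (C 1) (Rd 11 VX (Rd 5 VX (C 0))) RZ) u1 (\<lambda>u'. DF u' \<and> par_ok (\<lambda>v. NA u' 34 v 0)) (1 + n + (\<Sum>v<n. 1)) 1"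
    proof (rule spec_PX[where f = ?g and g = "\<lambda>_ _. 0"])
      show "DF (setA 34 n (\<lambda>_. 1) ?g (\<lambda>_ _. 0) u1) \<and> par_ok (\<lambda>v. NA (setA 34 n (\<lambda>_. 1) ?g (\<lambda>_ _. 0) u1) 34 v 0)"
        using Q unfolding u2_def .
      show "nev u1 0 0 (sc 7) = n" using f1 S1 by (simp add: fr_def)
      show "nev u1 x y (Rd 11 VX (Rd 5 VX (C 0))) = ?g x y" for x y using f1 by (simp add: fr_def)
    qed (use nV V2 gV in \<open>simp_all add: gb_def\<close>)
  next
    fix u' x y e assume "fr {3,4,5,6} u u'"
    then show "(nev u' x y (pN e), rev u' x y (pR e)) = pK u x (nev u' x y e)" by (rule K)
  next
    show "8 + R * (9 + 4 * n) + n + 3 * (\<Sum>x<n. NA u 12 x 0) + (1 + n + (\<Sum>v<n. 1)) \<le> 8 + R * (9 + 4 * n) + n + 3 * M + (1 + n + n)"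
      unfolding sm by simp
  qed (use gs S1 R_V nV dP in \<open>auto simp: pN_def pR_def\<close>)
qed

text \<open>Array 0 is the raw memory, so this places the results at the prescribed addresses, over
  the input. The second assignment also stores the real 0, but at n + v, clear of the
  distances.\<close>

definition Outp :: com where
  "Outp = Seq (PA 0 (sc 7) (C 1) VX VY (notE (notE (Rd 33 VX (C 0)))) (RRd 33 VX (C 0)))
    (PA 0 (sc 7) (C 1) (Op Plus (sc 7) VX) VY (Rd 34 VX (C 0)) RZ)"

definition out_ok :: "store \<Rightarrow> bool" where
  "out_ok u \<longleftrightarrow> (\<forall>v<n. NA u 0 v 0 = of_bool (\<exists>k x. ow k s v x) \<and> (\<forall>k x. ow k s v x \<longrightarrow> RA u 0 v 0 = x)) \<and>
     par_ok (\<lambda>v. NA u 0 (n + v) 0)"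

lemma spec_Outp:
  assumes D: "DF u \<and> par_ok (\<lambda>v. NA u 34 v 0)" and bd: "bdd u"
  shows "spec Outp u out_ok (2 * (1 + n + n)) 2"
proof -
  have st: "static u" and Dv: "\<And>v. v < n \<Longrightarrow> dist_ok s v (cell 33 u v)" using D unfolding DF_def by blast+
  have S1: "NA u 7 0 0 = n" using st unfolding static_def by auto
  have nV: "n \<le> V ^ 4" "2 * n < V" using le_V4[of n 1] less_V[of "2 * n" 2] by (simp_all add: power2_eq_square)
  have ad: "adr V 0 p q = p" if "p < V" for p q using that by (simp add: adr_def)
  define Q1 where "Q1 = (\<lambda>u1. fr {0} u u1 \<and> (\<forall>v<n. NA u1 0 v 0 = of_bool (NA u 33 v 0 \<noteq> 0) \<and> RA u1 0 v 0 = RA u 33 v 0))"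
  show ?thesis unfolding Outp_def
  proof (rule spec_step[where P = Q1])
    have "spec (PA 0 (sc 7) (C 1) VX VY (notE (notE (Rd 33 VX (C 0)))) (RRd 33 VX (C 0))) u Q1 (1 + n + (\<Sum>x<n. nev u x 0 (C 1))) 1"
    proof (rule spec_PA)
      fix u' :: store assume o: "\<And>b. b \<noteq> 0 \<Longrightarrow> NA u' b = NA u b \<and> RA u' b = RA u b"
        and v: "\<And>x y. x < n \<Longrightarrow> y < nev u x 0 (C 1) \<Longrightarrow> NA u' 0 (nev u x y VX) (nev u x y VY) = nev u x y (notE (notE (Rd 33 VX (C 0)))) \<and>
            RA u' 0 (nev u x y VX) (nev u x y VY) = rev u x y (RRd 33 VX (C 0))"
      show "Q1 u'" unfolding Q1_def using o v[of _ 0] by (simp add: fr_def)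
    qed (use S1 nV V2 in \<open>auto simp: gb_def ad intro: order_trans[OF _ G_big]\<close>)
    then show "spec (PA 0 (sc 7) (C 1) VX VY (notE (notE (Rd 33 VX (C 0)))) (RRd 33 VX (C 0))) u Q1 (1 + n + n) 1" by simp
    fix u1 assume b1: "bdd u1" and q: "Q1 u1"
    have S2: "NA u1 7 0 0 = n" "NA u1 34 = NA u 34" using q S1 unfolding Q1_def by (simp_all add: fr_def)
    have "spec (PA 0 (sc 7) (C 1) (Op Plus (sc 7) VX) VY (Rd 34 VX (C 0)) RZ) u1 out_ok (1 + n + (\<Sum>x<n. nev u1 x 0 (C 1))) 1"
    proof (rule spec_PA)
      fix u' :: store assume v: "\<And>x y. x < n \<Longrightarrow> y < nev u1 x 0 (C 1) \<Longrightarrow> NA u' 0 (nev u1 x y (Op Plus (sc 7) VX)) (nev u1 x y VY) = nev u1 x y (Rd 34 VX (C 0)) \<and>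
            RA u' 0 (nev u1 x y (Op Plus (sc 7) VX)) (nev u1 x y VY) = rev u1 x y RZ"
        and e: "\<And>p q. (\<And>x y. x < n \<Longrightarrow> y < nev u1 x 0 (C 1) \<Longrightarrow> adr V 0 p q \<noteq> adr V 0 (nev u1 x y (Op Plus (sc 7) VX)) (nev u1 x y VY)) \<Longrightarrow>
           NA u' 0 p q = NA u1 0 p q \<and> RA u' 0 p q = RA u1 0 p q"
      have 1: "NA u' 0 (n + v) 0 = NA u 34 v 0" if "v < n" for v using v[OF that, of 0] S2 by simp
      have 2: "NA u' 0 v 0 = NA u1 0 v 0 \<and> RA u' 0 v 0 = RA u1 0 v 0" if "v < n" for v
        by (rule e) (use that nV S2 ad in auto)
      have 3: "NA u' 0 v 0 = of_bool (NA u 33 v 0 \<noteq> 0)" "RA u' 0 v 0 = RA u 33 v 0" if "v < n" for v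
        using 2[OF that] q that unfolding Q1_def by auto
      have r: "NA u 33 v 0 \<noteq> 0 \<longleftrightarrow> (\<exists>k x. ow k s v x)" "\<And>k x. ow k s v x \<Longrightarrow> RA u 33 v 0 = x" if v: "v < n" for v
      proof -
        note d = Dv[OF v, unfolded dist_ok_def cell_def fst_conv snd_conv]
        show "NA u 33 v 0 \<noteq> 0 \<longleftrightarrow> (\<exists>k x. ow k s v x)"
        proof
          assume "NA u 33 v 0 \<noteq> 0"
          then show "\<exists>k x. ow k s v x" using d ow_exists s by blast
        next
          assume "\<exists>k x. ow k s v x"
          then show "NA u 33 v 0 \<noteq> 0" using d by auto
        qed
        show "RA u 33 v 0 = x" if "ow k s v x" for k x using d that by auto
      qed
      have "par_ok (\<lambda>v. NA u' 0 (n + v) 0)" using D 1 unfolding par_ok_def by auto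
      then show "out_ok u'" unfolding out_ok_def using 3 r by auto
    qed (use S2 nV V2 bd in \<open>auto simp: gb_def ad bdd_def intro: order_trans[OF _ G_big]\<close>)
    then show "spec (PA 0 (sc 7) (C 1) (Op Plus (sc 7) VX) VY (Rd 34 VX (C 0)) RZ) u1 out_ok (1 + n + n) 1" by simp
  qed simp_all
qed

definition Main :: com where
  "Main = Seq Outer (Seq Sq (Seq Fin1 (Seq Fin2 Outp)))"

lemma cost_Main:
  fixes r m k K h :: nat
  assumes "1 \<le> r" "1 \<le> m" "1 \<le> h" "k \<le> K" "k \<le> 2 * m"
  shows "3 * r * k ^ 3 + 50 * r * r * (k * k) + (8 + r * (9 + 4 * m) + m + 3 * (m * k) + 2 * (1 + m + m) +
      (8 + r * (9 + 4 * m) + m + 3 * M + (1 + m + m) + 2 * (1 + m + m)))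
    \<le> 3 * r * K ^ 3 + 270 * r ^ 6 * m * m * h + 3 * M"
proof -
  have 1: "3 * r * k ^ 3 \<le> 3 * r * K ^ 3" using assms(4) by (intro mult_le_mono2 power_mono) simp_all
  have "k * k \<le> (2 * m) * (2 * m)" using assms(5) by (intro mult_le_mono)
  then have 2: "k * k \<le> 4 * (m * m)" by simp
  have 3: "m * k \<le> 2 * (m * m)" using mult_le_mono2[OF assms(5), of m] by simp
  have 4: "r * r * (k * k) \<le> r * r * (4 * (m * m))" using 2 by (rule mult_le_mono2)
  have p: "1 \<le> r ^ 6" "r \<le> r ^ 6" "r * r \<le> r ^ 6" using assms(1) self_le_power[of r 6] power_increasing[of 2 6 r] by (auto simp: power2_eq_square)
  have q: "1 \<le> m * m * h" "m \<le> m * m * h" "m * m \<le> m * m * h" using assms(2,3) by (simp_all add: Suc_le_eq)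
  have m: "a * b \<le> r ^ 6 * m * m * h" if "a \<le> r ^ 6" "b \<le> m * m * h" for a b using mult_le_mono[OF that] by (simp add: mult.assoc)
  have "1 * 1 \<le> r ^ 6 * m * m * h" "r * 1 \<le> r ^ 6 * m * m * h" "r * m \<le> r ^ 6 * m * m * h" "1 * m \<le> r ^ 6 * m * m * h" "1 * (m * m) \<le> r ^ 6 * m * m * h"
    "(r * r) * (m * m) \<le> r ^ 6 * m * m * h"
    by (rule m; fact)+
  note x = this[unfolded mult_1 mult_1_right]
  have gen: "x + 50 * p + ((8 + (9 * r + 4 * d)) + m + 3 * f + 2 * (1 + m + m) + ((8 + (9 * r + 4 * d)) + m + 3 * M + (1 + m + m) + 2 * (1 + m + m)))
      \<le> X + 270 * A + 3 * M"
    if "p \<le> 4 * q" "x \<le> X" "f \<le> 2 * e" "1 \<le> A" "r \<le> A" "d \<le> A" "m \<le> A" "e \<le> A" "q \<le> A" for p q x X f e A d :: nat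
    using that by simp
  have eq: "50 * r * r * (k * k) = 50 * (r * r * (k * k))" "r * (9 + 4 * m) = 9 * r + 4 * (r * m)"
    "270 * r ^ 6 * m * m * h = 270 * (r ^ 6 * m * m * h)" by (simp_all add: algebra_simps)
  show ?thesis unfolding eq
    by (rule gen[where q = "(r * r) * (m * m)" and e = "m * m"]) (use 1 3 4 x in \<open>simp_all add: ac_simps\<close>)
qed

lemma spec_Main:
  assumes st: "static u"
  shows "spec Main u out_ok (70 * R * R * n * M + 3300 * R ^ 6 * n * n * hp + 3 * R * (6 * R * n div hp) ^ 3) (400 * R ^ 5 + 100 * R * hp)"
proof -
  let ?W = "3 * R * (6 * R * n div hp) ^ 3 + 270 * R ^ 6 * n * n * hp + 3 * M"
  have n1: "1 \<le> n" using n0 by simp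
  show ?thesis unfolding Main_def
  proof (rule spec_step[OF spec_Outer[OF st]])
    fix u1 assume "\<exists>l. hp \<le> l \<and> l \<le> 2 * hp \<and> OI l u1"
    then obtain l k z where l: "hp \<le> l" "l \<le> 2 * hp" and S: "srcs k l z u1" and B: "BFst k l z u1" and h: "hits l (z ` {..<k})"
      and z0: "z 0 = s" and kl: "k * l \<le> 6 * R * n" unfolding OI_def by blast
    have k: "k \<le> 2 * n" using S n1 unfolding srcs_def by auto
    have "k * hp \<le> 6 * R * n" using kl mult_le_mono2[OF l(1), of k] by linarith
    \<comment> \<open>This bound gets cubed by the squarings; with hp of order h / R it is of order
      R^2 n / h.\<close>
    then have kK: "k \<le> 6 * R * n div hp" using hp(1) by (simp add: less_eq_div_iff_mult_less_eq)
    show "spec (Seq Sq (Seq Fin1 (Seq Fin2 Outp))) u1 out_ok ?W (20 * R * R + ((4 + R * 5 + 2) + ((4 + R * 5 + 1) + 2)))"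
    proof (rule spec_step[OF spec_Sq[OF S B]])
      fix u2 assume u2: "fr {3,4,5,6,31,32} u1 u2 \<and> MI k l z R u2"
      have f2: "fr {3,4,5,6,31,32} u1 u2" and I: "MI k l z R u2" using u2 by auto
      have S2: "srcs k l z u2" by (rule srcs_fr[OF S f2]) auto
      have B2: "BFst k l z u2" by (rule BFst_fr[OF B f2]) auto
      show "spec (Seq Fin1 (Seq Fin2 Outp)) u2 out_ok (8 + R * (9 + 4 * n) + n + 3 * (n * k) + 2 * (1 + n + n) +
          (8 + R * (9 + 4 * n) + n + 3 * M + (1 + n + n) + 2 * (1 + n + n))) ((4 + R * 5 + 2) + ((4 + R * 5 + 1) + 2))"
      proof (rule spec_step[OF spec_Fin1[OF S2 B2 h z0 I]])
        fix u3 assume D: "DF u3"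
        show "spec (Seq Fin2 Outp) u3 out_ok (8 + R * (9 + 4 * n) + n + 3 * M + (1 + n + n) + 2 * (1 + n + n)) ((4 + R * 5 + 1) + 2)"
          by (rule spec_step[OF spec_Fin2[OF D] spec_Outp]) simp_all
      qed simp_all
    next
      show "3 * R * k ^ 3 + 50 * R * R * (k * k) + (8 + R * (9 + 4 * n) + n + 3 * (n * k) + 2 * (1 + n + n) +
          (8 + R * (9 + 4 * n) + n + 3 * M + (1 + n + n) + 2 * (1 + n + n))) \<le> ?W"
        by (rule cost_Main[OF R_pos n1 hp(1) kK k])
    qed simp
  next
    have "M \<le> R * R * n * M" using mult_le_mono1[of 1 "R * R * n" M] R_pos n1 by (simp add: Suc_le_eq)
    moreover have "70 * R * R * n * M = 70 * (R * R * n * M)" "60 * R * R * n * M = 60 * (R * R * n * M)"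
      "3000 * R ^ 6 * n * n * hp = 3000 * (R ^ 6 * n * n * hp)" "3300 * R ^ 6 * n * n * hp = 3300 * (R ^ 6 * n * n * hp)"
      "270 * R ^ 6 * n * n * hp = 270 * (R ^ 6 * n * n * hp)" by simp_all
    ultimately show "60 * R * R * n * M + 3000 * R ^ 6 * n * n * hp + ?W \<le> 70 * R * R * n * M + 3300 * R ^ 6 * n * n * hp + 3 * R * (6 * R * n div hp) ^ 3"
      by linarith
    have g: "R \<le> R ^ 5" "R * R \<le> R ^ 5" "1 \<le> R ^ 5"
      using R_pos self_le_power[of R 5] power_increasing[of 2 5 R] by (auto simp: power2_eq_square)
    have "20 * R * R = 20 * (R * R)" by simp
    then show "300 * R ^ 5 + 100 * R * hp + (20 * R * R + ((4 + R * 5 + 2) + ((4 + R * 5 + 1) + 2))) \<le> 400 * R ^ 5 + 100 * R * hp"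
      using g by linarith
  qed
qed

end

section \<open>Graphs\<close>

locale sssp_graph =
  fixes T :: "(nat, nat) pre_digraph" and c :: "nat \<Rightarrow> real" and n m s :: nat
  assumes inst: "sssp_instance T c n m s"
begin

sublocale fin_digraph T using inst unfolding sssp_instance_def by blast

lemma no_multi: "e < m \<Longrightarrow> e' < m \<Longrightarrow> tail T e = tail T e' \<Longrightarrow> head T e = head T e' \<Longrightarrow> e = e'"
  using inst nomulti_digraph.no_multi_arcs[of T e e'] unfolding sssp_instance_def arc_to_ends_def by auto

lemma VA: "verts T = {..<n}" "arcs T = {..<m}" "s < n"
  using inst unfolding sssp_instance_def by auto

lemma ends: "e < m \<Longrightarrow> tail T e < n" "e < m \<Longrightarrow> head T e < n"
  using tail_in_verts[of e] head_in_verts[of e] VA by auto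

definition E :: "nat \<Rightarrow> nat \<Rightarrow> bool" where "E x v \<longleftrightarrow> (\<exists>e<m. tail T e = x \<and> head T e = v)"
definition w :: "nat \<Rightarrow> nat \<Rightarrow> real" where "w x v = c (THE e. e < m \<and> tail T e = x \<and> head T e = v)"

text \<open>Without parallel arcs the pair of its ends determines an arc, so walks in the graph can
  be traded for walks over pairs of vertices.\<close>

lemma w_arc: "e < m \<Longrightarrow> w (tail T e) (head T e) = c e"
  unfolding w_def by (rule arg_cong[of _ _ c], rule the_equality) (use no_multi in auto)

lemma awalk_end: "awalk u p v \<Longrightarrow> awlast u p = v"
  by (auto elim: awalkE)

lemma awalk_snoc: "awalk u p (tail T e) \<Longrightarrow> e < m \<Longrightarrow> awalk u (p @ [e]) (head T e)"
  using arc_implies_awalk[of e] VA by (intro awalk_appendI) auto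

lemma cost_append: "awalk_cost c (p @ q) = awalk_cost c p + awalk_cost c q"
  by (induction p) auto

lemma wk_awalk: "wk E w k u v x \<Longrightarrow> u < n \<Longrightarrow> \<exists>p. awalk u p v \<and> length p = k \<and> awalk_cost c p = x"
proof (induction k arbitrary: v x)
  case 0
  then show ?case using VA by (intro exI[of _ "[]"]) (auto simp: awalk_Nil_iff)
next
  case (Suc k)
  then obtain z y where y: "wk E w k u z y" "E z v" "x = y + w z v" by auto
  obtain p where p: "awalk u p z" "length p = k" "awalk_cost c p = y" using Suc.IH[OF y(1)] Suc.prems by blast
  obtain e where e: "e < m" "tail T e = z" "head T e = v" using y(2) unfolding E_def by blast
  have "awalk u (p @ [e]) v" using awalk_snoc[of u p e] p e by simp
  then show ?case using p y(3) w_arc[OF e(1)] e by (intro exI[of _ "p @ [e]"]) (auto simp: cost_append)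
qed

lemma awalk_wk: "awalk u p v \<Longrightarrow> wk E w (length p) u v (awalk_cost c p)"
proof (induction p arbitrary: v rule: rev_induct)
  case Nil
  then show ?case by (auto simp: awalk_Nil_iff)
next
  case (snoc e p)
  then have 1: "awalk u p (awlast u p)" "awalk (awlast u p) [e] v" by auto
  then have e: "e < m" "tail T e = awlast u p" "head T e = v" using VA by (auto simp: awalk_Cons_iff awalk_Nil_iff)
  have "E (awlast u p) v" using e unfolding E_def by blast
  then have "wk E w (Suc (length p)) u v (awalk_cost c p + w (awlast u p) v)" using snoc.IH[OF 1(1)] unfolding wk.simps by blast
  then show ?case using w_arc[OF e(1)] e by (simp add: cost_append)
qed

text \<open>The instance speaks of simple cycles only. A closed walk that repeats a vertex splits
  into two shorter closed walks, so induction on the length extends the bound to all of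
  them.\<close>

lemma closed_nonneg: "awalk u p u \<Longrightarrow> 0 \<le> awalk_cost c p"
proof (induction "length p" arbitrary: u p rule: less_induct)
  case less
  show ?case
  proof (cases p)
    case (Cons e p')
    have e: "e \<in> arcs T" "u = tail T e" "awalk (head T e) p' u" using less.prems Cons by (auto simp: awalk_Cons_iff)
    show ?thesis
    proof (cases "distinct (awalk_verts (head T e) p')")
      case True
      then have "pre_digraph.cycle T p" unfolding cycle_def using less.prems Cons by auto
      then show ?thesis using inst unfolding sssp_instance_def by blast
    next
      case False
      obtain q r t where d: "awalk_cyc_decomp p' = (q, r, t)" by (metis prod_cases3)
      then have "is_awalk_cyc_decomp p' (q, r, t)" using awalk_cyc_decomp_has_prop[OF e(3) False] by simp
      then obtain a z b where qrt: "p' = q @ r @ t" "awalk a q z" "awalk z r z" "awalk z t b" "0 < length r" by auto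
      have 1: "0 \<le> awalk_cost c r" by (rule less.hyps[OF _ qrt(3)]) (use qrt Cons in auto)
      \<comment> \<open>The decomposition starts in an unnamed vertex \<open>a\<close>. A nonempty
        \<open>q\<close> fixes its own end; for empty \<open>q\<close> the nonempty walk
        \<open>r @ t\<close> identifies z instead.\<close>
      have l: "awlast (head T e) q = z"
      proof (cases q)
        case Nil
        have "awalk (head T e) (r @ t) u" using e(3) qrt(1) Nil by simp
        moreover have "awalk z (r @ t) b" using awalk_appendI[OF qrt(3,4)] .
        moreover have "r @ t \<noteq> []" using qrt(5) by simp
        ultimately have "head T e = z" by (metis awalk_ends)
        then show ?thesis using Nil by simp
      next
        case (Cons f q')
        have "awlast a q = z" using qrt(2) by (rule awalk_end)
        then show ?thesis using Cons by simp
      qed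
      have "awalk (head T e) q z" "awalk z (r @ t) u" using e(3) l unfolding qrt(1) by auto
      moreover from this(2) have "awalk (awlast z r) t u" by simp
      then have "awalk z t u" using awalk_end[OF qrt(3)] by simp
      ultimately have "awalk (head T e) (q @ t) u" by (intro awalk_appendI)
      then have "awalk u (e # q @ t) u" using e by (auto simp: awalk_Cons_iff)
      from less.hyps[OF _ this] have "0 \<le> awalk_cost c (e # q @ t)" using qrt Cons by simp
      then show ?thesis using 1 Cons qrt(1) by (simp add: cost_append)
    qed
  qed simp
qed

sublocale wgraph n E w
proof
  show "E u v \<Longrightarrow> u < n \<and> v < n" for u v using ends unfolding E_def by blast
  fix k u x assume W: "wk E w k u u x"
  show "0 \<le> x"
  proof (cases k)
    case (Suc j)
    then have "u < n" using W ends unfolding E_def by auto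
    then show ?thesis using wk_awalk[OF W] closed_nonneg by blast
  qed (use W in simp)
qed

definition indeg :: "nat \<Rightarrow> nat" where "indeg v = card {e. e < m \<and> head T e = v}"

lemma indeg_le: "indeg v \<le> n"
proof -
  have "inj_on (tail T) {e. e < m \<and> head T e = v}" using no_multi by (intro inj_onI) auto
  moreover have "tail T ` {e. e < m \<and> head T e = v} \<subseteq> {..<n}" using ends by auto
  ultimately show ?thesis unfolding indeg_def using card_inj_on_le[of "tail T" _ "{..<n}"] by simp
qed

lemma sum_indeg: "(\<Sum>v<n. indeg v) = m"
proof -
  have "(\<Sum>v<n. indeg v) = card (\<Union>v\<in>{..<n}. {e. e < m \<and> head T e = v})"
    unfolding indeg_def by (rule card_UN_disjoint[symmetric]) auto
  also have "(\<Union>v\<in>{..<n}. {e. e < m \<and> head T e = v}) = {..<m}" using ends by auto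
  finally show ?thesis by simp
qed

lemma m_le: "m \<le> n * n"
proof -
  have "(\<Sum>v<n. indeg v) \<le> (\<Sum>v<n. n)" using indeg_le by (intro sum_mono)
  then show ?thesis unfolding sum_indeg by simp
qed

lemma reach_iff: "s \<rightarrow>\<^sup>*\<^bsub>T\<^esub> v \<longleftrightarrow> (\<exists>k x. ow k s v x)"
proof
  assume "s \<rightarrow>\<^sup>*\<^bsub>T\<^esub> v"
  then obtain p where "awalk s p v" unfolding reachable_awalk by blast
  from ow_exists[OF awalk_wk[OF this] VA(3)] show "\<exists>k x. ow k s v x" .
next
  assume "\<exists>k x. ow k s v x"
  then obtain p where "awalk s p v" using wk_awalk VA(3) unfolding ow_def by blast
  then show "s \<rightarrow>\<^sup>*\<^bsub>T\<^esub> v" unfolding reachable_awalk by blast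
qed

text \<open>The distance is an infimum over arbitrary walks, and an optimal walk attains it.\<close>

lemma mu_eq:
  assumes "ow k s v x"
  shows "\<mu> c s v = ereal x"
proof -
  obtain p where p: "awalk s p v" "awalk_cost c p = x" using wk_awalk VA(3) assms unfolding ow_def by blast
  have "\<mu> c s v \<le> ereal x" using min_cost_le_walk_cost[OF p(1), of c] unfolding p(2) .
  moreover have "ereal x \<le> \<mu> c s v" unfolding \<mu>_def
  proof (rule INF_greatest)
    fix q assume "q \<in> {p. awalk s p v}"
    then have "\<not> dlt (Suc (length q), awalk_cost c q) (Suc k, x)" using assms awalk_wk unfolding ow_def by blast
    then show "ereal x \<le> ereal (awalk_cost c q)" by (auto simp: dlt_def)
  qed
  ultimately show ?thesis by simp
qed

text \<open>Simplicity needs the stronger induction hypothesis that all vertices of the path have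
  optimal walks with at most k arcs: then v, whose optimum has k + 1 arcs, cannot be among them by
  \<open>ow_unique\<close>.\<close>

lemma tree_path:
  assumes par: "\<And>v k x. v < n \<Longrightarrow> v \<noteq> s \<Longrightarrow> ow k s v x \<Longrightarrow>
      \<exists>e<m. f v = e \<and> head T e = v \<and> (\<exists>i. k = Suc i \<and> ow i s (tail T e) (x - w (tail T e) v))"
  shows "ow k s v x \<Longrightarrow> v < n \<Longrightarrow> \<exists>p. apath s p v \<and> awalk_cost c p = x \<and> (\<forall>e\<in>set p. f (head T e) = e) \<and>
     (\<forall>z\<in>set (awalk_verts s p). \<exists>k'\<le>k. \<exists>x'. ow k' s z x')"
proof (induction k arbitrary: v x)
  case 0
  then show ?case using VA by (intro exI[of _ "[]"]) (auto simp: apath_Nil_iff ow_def)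
next
  case (Suc k)
  \<comment> \<open>Otherwise the empty walk, with cell (1, 0), would beat a closed walk with at
    least one arc.\<close>
  have "v \<noteq> s"
  proof
    assume "v = s"
    then have W: "W (Suc k) s s x" "\<not> dlt (1, 0) (Suc (Suc k), x)" using Suc.prems unfolding ow_def by auto
    then show False using nonneg[OF W(1)] by (auto simp: dlt_def)
  qed
  from par[OF Suc.prems(2) this Suc.prems(1)] obtain e where e: "e < m" "f v = e" "head T e = v" "ow k s (tail T e) (x - w (tail T e) v)" by auto
  from Suc.IH[OF e(4) ends(1)[OF e(1)]] obtain p where p: "apath s p (tail T e)" "awalk_cost c p = x - w (tail T e) v"
    "\<forall>e\<in>set p. f (head T e) = e" "\<forall>z\<in>set (awalk_verts s p). \<exists>k'\<le>k. \<exists>x'. ow k' s z x'" by blast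
  have aw: "awalk s p (tail T e)" using p(1) unfolding apath_def by blast
  have aw2: "awalk s (p @ [e]) v" using awalk_snoc[OF aw e(1)] e(3) by simp
  have vs: "awalk_verts s (p @ [e]) = awalk_verts s p @ [v]" using awalk_verts_append[OF aw2] e(3) by simp
  have "v \<notin> set (awalk_verts s p)"
  proof
    assume "v \<in> set (awalk_verts s p)"
    then obtain k' x' where "k' \<le> k" "ow k' s v x'" using p(4) by blast
    then show False using ow_unique[OF Suc.prems(1)] by fastforce
  qed
  then have "apath s (p @ [e]) v" unfolding apath_def vs using aw2 p(1) unfolding apath_def by simp
  moreover have "awalk_cost c (p @ [e]) = x" using p(2) w_arc[OF e(1)] e(3) by (simp add: cost_append)
  moreover have "\<forall>z\<in>set (awalk_verts s (p @ [e])). \<exists>k'\<le>Suc k. \<exists>x'. ow k' s z x'"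
  proof
    fix z assume "z \<in> set (awalk_verts s (p @ [e]))"
    then show "\<exists>k'\<le>Suc k. \<exists>x'. ow k' s z x'"
      using p(4) Suc.prems(1) le_SucI unfolding vs set_append list.set Un_iff by blast
  qed
  ultimately show ?case using p(3) e(2,3) by (intro exI[of _ "p @ [e]"]) auto
qed

end


section \<open>Reading the input\<close>

context machine
begin

definition "p16 = (let a = Op Plus (sc 7) (C 2); b = Op Times a a; c = Op Times b b; d = Op Times c c in Op Times d d)"

lemma p16 [simp]: "nev u x y p16 = (NA u 7 0 0 + 2) ^ 16" "gn p16 \<le> 10 ^ 6"
proof -
  have e: "a ^ 16 = (((a ^ 2) ^ 2) ^ 2) ^ 2" for a :: nat by (simp flip: power_mult)
  show "nev u x y p16 = (NA u 7 0 0 + 2) ^ 16" unfolding e power2_eq_square p16_def Let_def nev.simps nop_val.simps sc_simps ..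
  show "gn p16 \<le> 10 ^ 6" by (simp add: p16_def Let_def)
qed

text \<open>The machine has no logarithm, so \<open>R\<close> is found by doubling until (n + 2)^16
  is reached.\<close>

definition InitR :: com where
  "InitR = Seq (asg 2 (C 1)) (Seq (asg 1 (C 0)) (Wh (Ls (sc 2) p16) (Seq (asg 2 (Op Times (C 2) (sc 2))) (asg 1 (Op Plus (sc 1) (C 1))))))"

lemma spec_InitR:
  assumes n: "NA u 7 0 0 = n" and V: "(n + 2) ^ 40 \<le> V"
  defines "R \<equiv> LEAST R. (n + 2) ^ 16 \<le> 2 ^ R"
  shows "spec InitR u (\<lambda>u'. fr {1,2} u u' \<and> NA u' 1 0 0 = R) (7 + 7 * R) (3 + 3 * R)"
    "(n + 2) ^ 16 \<le> 2 ^ R" "2 ^ R \<le> 2 * (n + 2) ^ 16"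
proof -
  have ex: "(n + 2) ^ 16 \<le> 2 ^ ((n + 2) ^ 16)" by (simp add: less_imp_le)
  show R: "(n + 2) ^ 16 \<le> 2 ^ R" unfolding R_def by (rule LeastI[of "\<lambda>R. (n + 2) ^ 16 \<le> 2 ^ R", OF ex])
  have below: "2 ^ j < (n + 2) ^ 16" if "j < R" for j using not_less_Least[OF that[unfolded R_def]] by simp
  show R2: "2 ^ R \<le> 2 * (n + 2) ^ 16"
  proof (cases R)
    case (Suc j)
    then show ?thesis using below[of j] by simp
  qed simp
  have RV: "2 ^ R < V"
  proof -
    have "2 * (n + 2) ^ 16 < (n + 2) ^ 2 * (n + 2) ^ 16"
    proof (rule mult_strict_right_mono)
      have "(2::nat) < 2 ^ 2" by simp
      also have "\<dots> \<le> (n + 2) ^ 2" by (rule power_mono) auto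
      finally show "2 < (n + 2) ^ 2" .
    qed simp
    also have "\<dots> = (n + 2) ^ 18" by (simp add: power_add[symmetric])
    also have "\<dots> \<le> (n + 2) ^ 40" by (rule power_increasing) auto
    finally show ?thesis using R2 V by linarith
  qed
  have RV': "R < V" using RV less_exp[of R] by linarith
  define u1 where "u1 = setv 2 1 u"
  define u2 where "u2 = setv 1 0 u1"
  define J where "J = (\<lambda>j u'. fr {1,2} u u' \<and> NA u' 1 0 0 = j \<and> NA u' 2 0 0 = 2 ^ j)"
  have f2: "fr {1,2} u u2" unfolding u2_def u1_def by (intro fr_setv fr_refl) auto
  show "spec InitR u (\<lambda>u'. fr {1,2} u u' \<and> NA u' 1 0 0 = R) (7 + 7 * R) (3 + 3 * R)" unfolding InitR_def
  proof (rule spec_step[where P = "\<lambda>u'. u' = u1"])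
    show "spec (asg 2 (C 1)) u (\<lambda>u'. u' = u1) 3 1" by (rule spec_asg) (use V2 in \<open>auto simp: u1_def\<close>)
    fix v1 assume v1: "v1 = u1"
    show "spec (Seq (asg 1 (C 0)) (Wh (Ls (sc 2) p16) (Seq (asg 2 (Op Times (C 2) (sc 2))) (asg 1 (Op Plus (sc 1) (C 1)))))) v1
      (\<lambda>u'. fr {1,2} u u' \<and> NA u' 1 0 0 = R) (3 + (1 + (\<Sum>j<R. (3 + 3) + 1))) (1 + (1 + (\<Sum>j<R. (1 + 1) + 1)))"
    proof (rule spec_step[where P = "\<lambda>u'. u' = u2"])
      show "spec (asg 1 (C 0)) v1 (\<lambda>u'. u' = u2) 3 1" by (rule spec_asg) (use V2 v1 in \<open>auto simp: u2_def\<close>)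
      fix v2 assume v2: "v2 = u2"
      show "spec (Wh (Ls (sc 2) p16) (Seq (asg 2 (Op Times (C 2) (sc 2))) (asg 1 (Op Plus (sc 1) (C 1))))) v2
        (\<lambda>u'. fr {1,2} u u' \<and> NA u' 1 0 0 = R) (1 + (\<Sum>j<R. (3 + 3) + 1)) (1 + (\<Sum>j<R. (1 + 1) + 1))"
      proof (rule spec_Wh[where I = J and L = R])
        show "gn (Ls (sc 2) p16) + 3 \<le> 10 ^ 30" using p16(2) by simp
        show "J 0 v2" unfolding J_def v2 using f2 by (simp add: u2_def u1_def)
      next
        fix u' assume "J R u'"
        then show "nev u' 0 0 (Ls (sc 2) p16) = 0" using n R unfolding J_def by (simp add: fr_def)
      next
        fix j u' assume j: "j < R" and J: "J j u'"
        have f: "fr {1,2} u u'" and v: "NA u' 1 0 0 = j" "NA u' 2 0 0 = 2 ^ j" using J unfolding J_def by auto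
        have j2: "2 * 2 ^ j < V"
        proof -
          have "(2::nat) ^ Suc j \<le> 2 ^ R" using j by (intro power_increasing) auto
          then show ?thesis using RV by simp
        qed
        have "nev u' 0 0 (Ls (sc 2) p16) \<noteq> 0" using n below[OF j] f v by (simp add: fr_def)
        moreover have "spec (Seq (asg 2 (Op Times (C 2) (sc 2))) (asg 1 (Op Plus (sc 1) (C 1)))) u' (J (Suc j)) (3 + 3) (1 + 1)"
        proof (rule spec_step[where P = "\<lambda>u''. u'' = setv 2 (2 * 2 ^ j) u'"])
          show "spec (asg 2 (Op Times (C 2) (sc 2))) u' (\<lambda>u''. u'' = setv 2 (2 * 2 ^ j) u') 3 1"
            by (rule spec_asg) (use v j2 in auto)
          fix u'' assume u'': "u'' = setv 2 (2 * 2 ^ j) u'"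
          show "spec (asg 1 (Op Plus (sc 1) (C 1))) u'' (J (Suc j)) 3 1"
            by (rule spec_asg[where v = "Suc j"]) (use u'' v j RV' f in \<open>auto simp: J_def intro!: fr_setv\<close>)
        qed simp_all
        ultimately show "nev u' 0 0 (Ls (sc 2) p16) \<noteq> 0 \<and> spec (Seq (asg 2 (Op Times (C 2) (sc 2))) (asg 1 (Op Plus (sc 1) (C 1)))) u' (J (Suc j)) (3 + 3) (1 + 1)"
          by blast
      qed (auto simp: J_def)
    qed simp_all
  qed simp_all
qed

text \<open>Every vertex filters the whole list of arcs. These n m entries are scanned R times,
  which still fits into m n log^2 n.\<close>

definition Lists :: com where
  "Lists = Seq (Compact 11 12 (sc 7) (sc 8) (eqE (Rd 0 (Op Plus (C 4) (Op Plus (sc 8) VY)) (C 0)) VX))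
    (PX 13 (sc 7) (Rd 12 VX (C 0)) (Rd 0 (Op Plus (C 4) (Rd 11 VX VY)) (C 0)) (RRd 0 (Rd 11 VX VY) (C 0)))"

text \<open>Scalar 10 is set to h div R + 1: lengths are limited by h / R because each Bellman-Ford
  round has depth of order R.\<close>

definition InitM :: com where
  "InitM = Seq (asg 7 (Rd 0 (C 0) (C 0))) (Seq (asg 8 (Rd 0 (C 1) (C 0))) (Seq (asg 9 (Rd 0 (C 2) (C 0)))
    (Seq InitR (Seq (asg 10 (Op Plus (Op Div (Rd 0 (C 3) (C 0)) (sc 1)) (C 1))) Lists))))"

lemma cost_Lists:
  fixes r n m :: nat
  assumes "1 \<le> r" "1 \<le> n"
  shows "(1 + n + n * m) + ((7 + r * (9 + 2 * (n + n * m))) + ((1 + n + n * m) + (1 + n + n))) + (1 + n + m) \<le> 40 * r * n + 5 * r * n * m"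
proof -
  obtain x y where xy: "r = Suc x" "n = Suc y" using assms by (metis One_nat_def Suc_le_D)
  show ?thesis unfolding xy by (simp add: algebra_simps)
qed

lemma spec_InitM:
  assumes G: "sssp_graph T c n m s" and h: "h \<le> n" and V: "(n + 2) ^ 40 \<le> V"
    and u: "NA u 0 0 0 = n" "NA u 0 1 0 = m" "NA u 0 2 0 = s" "NA u 0 3 0 = h"
      "\<And>e. e < m \<Longrightarrow> NA u 0 (4 + e) 0 = tail T e \<and> NA u 0 (4 + (m + e)) 0 = head T e \<and> RA u 0 e 0 = c e"
  defines "R \<equiv> LEAST R. (n + 2) ^ 16 \<le> 2 ^ R"
  shows "spec InitM u (\<lambda>u'. NA u' 1 0 0 = R \<and> NA u' 7 0 0 = n \<and> NA u' 9 0 0 = s \<and> NA u' 10 0 0 = h div R + 1 \<and>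
      (\<forall>v<n. NA u' 12 v 0 = sssp_graph.indeg T m v \<and> NA u' 11 v ` {..<sssp_graph.indeg T m v} = {e. e < m \<and> head T e = v} \<and>
        (\<forall>y<sssp_graph.indeg T m v. NA u' 13 v y = tail T (NA u' 11 v y) \<and> RA u' 13 v y = c (NA u' 11 v y))))
     (70 * R * n + 5 * R * n * m) (40 * R)"
proof -
  interpret sssp_graph T c n m s by (rule G)
  let ?F = "{1,2,7,8,9,10}"
  let ?d = "sssp_graph.indeg T m"
  have n1: "1 \<le> n" using VA by simp
  have R: "(n + 2) ^ 16 \<le> 2 ^ R" "2 ^ R \<le> 2 * (n + 2) ^ 16"
    using spec_InitR(2,3)[of "setv 7 n u" n] V unfolding R_def by simp_all
  have R1: "1 \<le> R"
  proof (rule ccontr)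
    assume "\<not> 1 \<le> R"
    then have "(n + 2) ^ 16 \<le> 1" using R(1) by (simp add: not_le)
    moreover have "1 < (n + 2) ^ 16" by (rule one_less_power) auto
    ultimately show False by simp
  qed
  have pm: "(n + 2) ^ a \<le> (n + 2) ^ b" if "a \<le> b" for a b using that by (intro power_increasing) auto
  have RV: "2 ^ R < V"
  proof -
    have "2 * (n + 2) ^ 16 < (n + 2) ^ 2 * (n + 2) ^ 16"
    proof (rule mult_strict_right_mono)
      have "(2::nat) < 2 ^ 2" by simp
      also have "\<dots> \<le> (n + 2) ^ 2" by (rule power_mono) auto
      finally show "2 < (n + 2) ^ 2" .
    qed simp
    also have "\<dots> = (n + 2) ^ 18" by (simp add: power_add[symmetric])
    also have "\<dots> \<le> (n + 2) ^ 40" by (rule pm) simp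
    finally show ?thesis using R(2) V by linarith
  qed
  have nn: "n * n + 2 \<le> (n + 2) ^ 16"
  proof -
    have "n * n + 2 \<le> (n + 2) ^ 2" by (simp add: power2_eq_square)
    also have "\<dots> \<le> (n + 2) ^ 16" by (rule pm) simp
    finally show ?thesis .
  qed
  then have mP: "m \<le> 2 ^ R" "n \<le> 2 ^ R" "n + 1 < V" "m < V"
  proof -
    have "n \<le> n * n" using n1 by simp
    then show "m \<le> 2 ^ R" "n \<le> 2 ^ R" "n + 1 < V" "m < V" using m_le nn R(1) RV by linarith+
  qed
  have V4: "x \<le> V ^ 4" if "x < V" for x using that self_le_power[of V 4] V2 by simp
  define u1 where "u1 = setv 7 n u"
  define u2 where "u2 = setv 8 m u1"
  define u3 where "u3 = setv 9 s u2"
  have f3: "fr ?F u u3" unfolding u3_def u2_def u1_def by (intro fr_setv fr_refl) auto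
  have v3: "NA u3 7 0 0 = n" "NA u3 8 0 0 = m" "NA u3 9 0 0 = s" by (simp_all add: u3_def u2_def u1_def)
  let ?Q = "\<lambda>u'. NA u' 1 0 0 = R \<and> NA u' 7 0 0 = n \<and> NA u' 9 0 0 = s \<and> NA u' 10 0 0 = h div R + 1 \<and>
      (\<forall>v<n. NA u' 12 v 0 = ?d v \<and> NA u' 11 v ` {..<?d v} = {e. e < m \<and> head T e = v} \<and>
        (\<forall>y<?d v. NA u' 13 v y = tail T (NA u' 11 v y) \<and> RA u' 13 v y = c (NA u' 11 v y)))"
  have lists: "spec Lists u5 ?Q (((1 + n + n * m) + ((7 + R * (9 + 2 * (n + n * m))) + ((1 + n + n * m) + (1 + n + n)))) + (1 + n + m)) (1 + ((3 + R * 5) + (1 + 1)) + 1)"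
    if f5: "fr ?F u u5" and v5: "NA u5 1 0 0 = R" "NA u5 7 0 0 = n" "NA u5 8 0 0 = m" "NA u5 9 0 0 = s" "NA u5 10 0 0 = h div R + 1" for u5
  proof -
    have u0: "NA u5 0 = NA u 0" "RA u5 0 = RA u 0" using f5 by (simp_all add: fr_def)
    let ?f = "\<lambda>x y. NA u 0 (4 + (m + y)) 0 = x"
    have fl: "{y. y < m \<and> ?f x y} = {e. e < m \<and> head T e = x}" for x using u(5) by auto
    have ms: "(\<Sum>x<n. m) = n * m" by simp
    show ?thesis unfolding Lists_def
    proof (rule spec_step[OF spec_Compact[where r = n and k = "\<lambda>_. m" and R = R and f = ?f]])
      fix u6 assume b6: "bdd u6" and "fr {3,4,5,6,11,12} u5 u6 \<and> (\<forall>x<n. NA u6 12 x 0 = card {y. y < m \<and> ?f x y} \<and>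
        NA u6 11 x ` {..<NA u6 12 x 0} = {y. y < m \<and> ?f x y})"
      then have f6: "fr {3,4,5,6,11,12} u5 u6" and q: "\<forall>v<n. NA u6 12 v 0 = ?d v \<and> NA u6 11 v ` {..<NA u6 12 v 0} = {e. e < m \<and> head T e = v}"
        unfolding fl indeg_def by blast+
      have d6: "NA u6 12 v 0 = ?d v" and l6: "NA u6 11 v ` {..<?d v} = {e. e < m \<and> head T e = v}" if "v < n" for v
        using q that by metis+
      have v6: "NA u6 1 0 0 = R" "NA u6 7 0 0 = n" "NA u6 9 0 0 = s" "NA u6 10 0 0 = h div R + 1" "NA u6 0 = NA u 0" "RA u6 0 = RA u 0"
        using f6 v5 u0 by (simp_all add: fr_def)
      have em: "NA u6 11 v y < m" if "v < n" "y < ?d v" for v y using l6[OF that(1)] that(2) by blast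
      have dV: "?d v < V" for v using indeg_le[of v] mP by linarith
      show "spec (PX 13 (sc 7) (Rd 12 VX (C 0)) (Rd 0 (Op Plus (C 4) (Rd 11 VX VY)) (C 0)) (RRd 0 (Rd 11 VX VY) (C 0))) u6 ?Q
        (1 + n + (\<Sum>v<n. ?d v)) 1"
      proof (rule spec_PX[where f = "\<lambda>v y. tail T (NA u6 11 v y)" and g = "\<lambda>v y. c (NA u6 11 v y)"])
        show "tail T (NA u6 11 v y) < V" if "v < n" "y < ?d v" for v y using ends(1)[OF em[OF that]] mP by linarith
      qed (use v6 d6 l6 em u(5) V4 mP dV in \<open>auto simp: gb_def\<close>)
    next
      show "stab {3,4,5,6,11,12} u5 (sc 7) (\<lambda>_ _. n)" "stab {3,4,5,6,11,12} u5 (sc 8) (\<lambda>_ _. m)"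
        "stab {3,4,5,6,11,12} u5 (eqE (Rd 0 (Op Plus (C 4) (Op Plus (sc 8) VY)) (C 0)) VX) (\<lambda>x y. of_bool (?f x y))"
        by (rule stabI; use v5 u0 in simp)+
    next
      show "1 + n + (\<Sum>x<n. m) + (7 + R * (9 + 2 * (n + (\<Sum>x<n. m))) + (1 + n + (\<Sum>x<n. m) + (1 + n + n))) + (1 + n + (\<Sum>v<n. ?d v))
        \<le> 1 + n + n * m + (7 + R * (9 + 2 * (n + n * m)) + (1 + n + n * m + (1 + n + n))) + (1 + n + m)"
        unfolding ms sum_indeg by simp
    qed (use v5 RV V4 mP in auto)
  qed
  have rest: "spec (Seq InitR (Seq (asg 10 (Op Plus (Op Div (Rd 0 (C 3) (C 0)) (sc 1)) (C 1))) Lists)) u3 ?Q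
     ((7 + 7 * R) + (3 + (((1 + n + n * m) + ((7 + R * (9 + 2 * (n + n * m))) + ((1 + n + n * m) + (1 + n + n)))) + (1 + n + m))))
     ((3 + 3 * R) + (1 + (1 + ((3 + R * 5) + (1 + 1)) + 1)))"
  proof (rule spec_step[OF spec_InitR(1)[OF v3(1) V]])
    fix u4 assume "fr {1,2} u3 u4 \<and> NA u4 1 0 0 = (LEAST R. (n + 2) ^ 16 \<le> 2 ^ R)"
    then have f4: "fr {1,2} u3 u4" and r4: "NA u4 1 0 0 = R" unfolding R_def by auto
    have F4: "fr ?F u u4" by (rule fr_trans[OF f3 f4]) auto
    have v4: "NA u4 7 0 0 = n" "NA u4 8 0 0 = m" "NA u4 9 0 0 = s" "NA u4 0 = NA u 0" using f4 v3 F4 by (simp_all add: fr_def)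
    define u5 where "u5 = setv 10 (h div R + 1) u4"
    have "h div R + 1 < V"
    proof -
      have "h div R \<le> n" using h by (meson div_le_dividend order_trans)
      then show ?thesis using mP by linarith
    qed
    then have A: "spec (asg 10 (Op Plus (Op Div (Rd 0 (C 3) (C 0)) (sc 1)) (C 1))) u4 (\<lambda>u'. u' = u5) 3 1"
      by (intro spec_asg) (use v4 r4 u in \<open>auto simp: u5_def\<close>)
    have F5: "fr ?F u u5" unfolding u5_def by (rule fr_setv[OF F4]) simp
    have v5: "NA u5 1 0 0 = R" "NA u5 7 0 0 = n" "NA u5 8 0 0 = m" "NA u5 9 0 0 = s" "NA u5 10 0 0 = h div R + 1"
      using v4 r4 by (simp_all add: u5_def)
    show "spec (Seq (asg 10 (Op Plus (Op Div (Rd 0 (C 3) (C 0)) (sc 1)) (C 1))) Lists) u4 ?Q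
     (3 + (((1 + n + n * m) + ((7 + R * (9 + 2 * (n + n * m))) + ((1 + n + n * m) + (1 + n + n)))) + (1 + n + m)))
     (1 + (1 + ((3 + R * 5) + (1 + 1)) + 1))"
    proof (rule spec_step[OF A])
      fix u' assume e: "u' = u5"
      show "spec Lists u' ?Q (((1 + n + n * m) + ((7 + R * (9 + 2 * (n + n * m))) + ((1 + n + n * m) + (1 + n + n)))) + (1 + n + m))
        (1 + ((3 + R * 5) + (1 + 1)) + 1)" unfolding e by (rule lists[OF F5 v5])
    qed (rule order_refl)+
  qed (simp_all add: R_def)
  show ?thesis unfolding InitM_def
  proof (rule spec_step[where P = "\<lambda>u'. u' = u1"])
    show "spec (asg 7 (Rd 0 (C 0) (C 0))) u (\<lambda>u'. u' = u1) 3 1" by (rule spec_asg) (use u mP in \<open>auto simp: u1_def\<close>)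
    fix v1 assume v1: "v1 = u1"
    show "spec (Seq (asg 8 (Rd 0 (C 1) (C 0))) (Seq (asg 9 (Rd 0 (C 2) (C 0)))
      (Seq InitR (Seq (asg 10 (Op Plus (Op Div (Rd 0 (C 3) (C 0)) (sc 1)) (C 1))) Lists)))) v1 ?Q
      (3 + (3 + ((7 + 7 * R) + (3 + (((1 + n + n * m) + ((7 + R * (9 + 2 * (n + n * m))) + ((1 + n + n * m) + (1 + n + n)))) + (1 + n + m))))))
      (1 + (1 + ((3 + 3 * R) + (1 + (1 + ((3 + R * 5) + (1 + 1)) + 1)))))"
    proof (rule spec_step[where P = "\<lambda>u'. u' = u2"])
      show "spec (asg 8 (Rd 0 (C 1) (C 0))) v1 (\<lambda>u'. u' = u2) 3 1" by (rule spec_asg) (use u mP v1 in \<open>auto simp: u2_def u1_def\<close>)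
      fix v2 assume v2: "v2 = u2"
      show "spec (Seq (asg 9 (Rd 0 (C 2) (C 0))) (Seq InitR (Seq (asg 10 (Op Plus (Op Div (Rd 0 (C 3) (C 0)) (sc 1)) (C 1))) Lists))) v2 ?Q
        (3 + ((7 + 7 * R) + (3 + (((1 + n + n * m) + ((7 + R * (9 + 2 * (n + n * m))) + ((1 + n + n * m) + (1 + n + n)))) + (1 + n + m)))))
        (1 + ((3 + 3 * R) + (1 + (1 + ((3 + R * 5) + (1 + 1)) + 1))))"
      proof (rule spec_step[where P = "\<lambda>u'. u' = u3"])
        show "spec (asg 9 (Rd 0 (C 2) (C 0))) v2 (\<lambda>u'. u' = u3) 3 1"
          by (rule spec_asg) (use u mP v2 VA(3) in \<open>auto simp: u3_def u2_def u1_def\<close>)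
        fix v3 assume "v3 = u3"
        then show "spec (Seq InitR (Seq (asg 10 (Op Plus (Op Div (Rd 0 (C 3) (C 0)) (sc 1)) (C 1))) Lists)) v3 ?Q
         ((7 + 7 * R) + (3 + (((1 + n + n * m) + ((7 + R * (9 + 2 * (n + n * m))) + ((1 + n + n * m) + (1 + n + n)))) + (1 + n + m))))
         ((3 + 3 * R) + (1 + (1 + ((3 + R * 5) + (1 + 1)) + 1)))" using rest by simp
      qed simp_all
    qed simp_all
  next
    have "19 + 7 * R \<le> 26 * (R * n)"
    proof -
      have "R \<le> R * n" "1 \<le> R * n" using n1 R1 by (simp_all add: Suc_le_eq)
      then show ?thesis by linarith
    qed
    then show "3 + (3 + (3 + ((7 + 7 * R) + (3 + (((1 + n + n * m) + ((7 + R * (9 + 2 * (n + n * m))) + ((1 + n + n * m) + (1 + n + n)))) + (1 + n + m))))))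
       \<le> 70 * R * n + 5 * R * n * m"
      using cost_Lists[OF R1 n1, of m] by simp
    show "1 + (1 + (1 + ((3 + 3 * R) + (1 + (1 + ((3 + R * 5) + (1 + 1)) + 1))))) \<le> 40 * R" using R1 by simp
  qed
qed

end

section \<open>The program\<close>

text \<open>V = (n + 2)^40 must be in register 1 before the first array access, as all addresses
  depend on it.\<close>

definition Pre :: com where
  "Pre = Seq (Do (NLoad 4 0)) (blk ([NConst 5 2, NOp Plus 4 4 5, NConst 1 1] @ replicate 40 (NOp Times 1 1 4)))"

lemma stp_replicate:
  assumes "1 \<le> nreg s 4" "nreg s 1 * nreg s 4 ^ j \<le> B"
  shows "stp B (replicate j (NOp Times 1 1 4)) s = Some (s\<lparr>nreg := (nreg s)(1 := nreg s 1 * nreg s 4 ^ j)\<rparr>)"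
  using assms
proof (induction j arbitrary: s)
  case (Suc j)
  let ?s = "s\<lparr>nreg := (nreg s)(1 := nreg s 1 * nreg s 4)\<rparr>"
  have "nreg s 1 * nreg s 4 * 1 \<le> nreg s 1 * nreg s 4 * nreg s 4 ^ j" using Suc.prems(1) by (intro mult_le_mono2) simp
  moreover have "nreg s 1 * nreg s 4 * nreg s 4 ^ j \<le> B" using Suc.prems(2) by (simp add: mult.assoc)
  ultimately have "nreg s 1 * nreg s 4 \<le> B" by linarith
  then have "step B (NOp Times 1 1 4) s = Some ?s" by (simp add: set_nreg_def)
  moreover have "stp B (replicate j (NOp Times 1 1 4)) ?s = Some (?s\<lparr>nreg := (nreg ?s)(1 := nreg ?s 1 * nreg ?s 4 ^ j)\<rparr>)"
    by (rule Suc.IH) (use Suc.prems in \<open>simp_all add: mult.assoc\<close>)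
  ultimately show ?case by (simp add: mult.assoc, intro state.equality ext; simp)
qed simp

lemma exec_Pre:
  assumes s: "nreg s = (\<lambda>_. 0)" "nmem s 0 = n" and B: "(n + 2) ^ 40 \<le> B"
  shows "\<exists>t R. exec B Pre s t R {} 44 44 \<and> nmem t = nmem s \<and> rmem t = rmem s \<and> nreg t 1 = (n + 2) ^ 40 \<and> nreg t 2 = 0 \<and> nreg t 3 = 0"
proof -
  have "n + 2 \<le> (n + 2) ^ 40" by (rule self_le_power) auto
  then have n2: "n + 2 \<le> B" using B by simp
  define s1 where "s1 = s\<lparr>nreg := (nreg s)(4 := n)\<rparr>"
  define s2 where "s2 = s\<lparr>nreg := (\<lambda>_. 0)(5 := 2, 4 := n + 2, 1 := 1)\<rparr>"
  define s3 where "s3 = s2\<lparr>nreg := (nreg s2)(1 := nreg s2 1 * nreg s2 4 ^ 40)\<rparr>"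
  have 1: "step B (NLoad 4 0) s = Some s1" using s n2 by (simp add: set_nreg_def s1_def)
  have 2: "stp B [NConst 5 2, NOp Plus 4 4 5, NConst 1 1] s1 = Some s2"
    using s n2 by (simp add: set_nreg_def s1_def s2_def fun_upd_twist)
  have 3: "stp B (replicate 40 (NOp Times 1 1 4)) s2 = Some s3" unfolding s3_def
    by (rule stp_replicate) (use B in \<open>simp_all add: s2_def\<close>)
  have l: "length ([NConst 5 2, NOp Plus 4 4 5, NConst 1 1] @ replicate 40 (NOp Times 1 1 4)) = 43" by simp
  have "exec B (blk ([NConst 5 2, NOp Plus 4 4 5, NConst 1 1] @ replicate 40 (NOp Times 1 1 4))) s1 s3 {} {} 43 43"
    unfolding l[symmetric] by (rule exec_blk) (simp_all only: stp_append 2 3 option.case list_all_append, simp_all add: list_all_iff)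
  from exec.Seq[OF exec.Do[OF 1] this] have "exec B Pre s s3 {NLoc 0} {} 44 44" unfolding Pre_def using s by simp
  then show ?thesis by (intro exI[of _ s3] exI[of _ "{NLoc 0}"] conjI) (simp_all add: s3_def s2_def)
qed

text \<open>For n \<ge> 2 we have n + 2 \<le> n^2, so 2^R \<le> 2 n^32 and R \<le> 1 + 32 log n; the
  1 is absorbed into a 33rd logarithm.\<close>

lemma log_bound:
  fixes n R :: nat
  assumes n: "2 \<le> n" and R: "2 ^ R \<le> 2 * (n + 2) ^ 16"
  shows "real R \<le> 33 * log 2 (real n)" "1 \<le> log 2 (real n)"
proof -
  show L: "1 \<le> log 2 (real n)" using n by (simp add: le_log_iff)
  have "n + 2 \<le> n ^ 2"
  proof -
    have "2 * n \<le> n * n" using n by simp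
    then show ?thesis using n unfolding power2_eq_square by linarith
  qed
  then have "(n + 2) ^ 16 \<le> (n ^ 2) ^ 16" by (rule power_mono) simp
  then have "2 ^ R \<le> 2 * n ^ 32" using R by (simp flip: power_mult)
  then have "real (2 ^ R) \<le> real (2 * n ^ 32)" by (simp only: of_nat_le_iff)
  then have "2 powr real R \<le> 2 * real n ^ 32" by (simp add: powr_realpow)
  then have "real R \<le> log 2 (2 * real n ^ 32)" using n by (simp add: le_log_iff)
  also have "\<dots> = 1 + 32 * log 2 (real n)" using n by (simp add: log_mult log_nat_power)
  finally show "real R \<le> 33 * log 2 (real n)" using L by linarith
qed

text \<open>10^15 dominates all constants; the largest is 3 * 216 * 33^7, from the cubed number of
  sources times the number of squarings.\<close>

lemma final_bounds:
  fixes n m h R :: nat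
  assumes n: "2 \<le> n" and h: "1 \<le> h" "h \<le> n" and R: "2 ^ R \<le> 2 * (n + 2) ^ 16" "1 \<le> R"
  defines "hp \<equiv> h div R + 1" and "L \<equiv> log 2 (real n)"
  shows "real (70 * R * n + 5 * R * n * m + (70 * R * R * n * m + 3300 * R ^ 6 * n * n * hp + 3 * R * (6 * R * n div hp) ^ 3))
      \<le> 10 ^ 15 * (real m * real n * L ^ 2 + real n ^ 3 / real h ^ 3 * L ^ 7 + real n ^ 2 * real h * L ^ 11)" (is "_ \<le> _ * (?X + ?Y + ?Z)")
    and "real (40 * R + (400 * R ^ 5 + 100 * R * hp)) \<le> 10 ^ 15 * (real h + L ^ 11)"
    and "1 \<le> real n ^ 2 * real h * L ^ 11" "1 \<le> L ^ 11"
proof -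
  have r: "real R \<le> 33 * L" and L: "1 \<le> L" using log_bound[OF n R(1)] unfolding L_def by auto
  have r1: "1 \<le> real R" using R by simp
  have h1: "1 \<le> real h" "1 \<le> real n" using h n by auto
  have rp: "real R ^ k \<le> 33 ^ k * L ^ k" for k
    using power_mono[OF r, of k] r1 by (simp add: power_mult_distrib)
  have Lp: "L ^ k \<le> L ^ 11" if "k \<le> 11" for k using power_increasing[OF that L] .
  show L11: "1 \<le> L ^ 11" using L by (rule one_le_power)
  have L0: "0 \<le> L ^ k" for k using L by simp
  have nn: "real n \<le> real n ^ 2 * real h"
    using mult_mono[of 1 "real n * real h" "real n" "real n"] h1 mult_mono[of 1 "real n" 1 "real h"] by (simp add: power2_eq_square mult.assoc mult.left_commute)
  have n2: "real n ^ 2 \<le> real n ^ 2 * real h" using h1 mult_left_mono[of 1 "real h" "real n ^ 2"] by simp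
  show Z1: "1 \<le> ?Z" using mult_mono[of 1 "real n ^ 2 * real h" 1 "L ^ 11"] nn h1 L11 by simp
  have hpn: "real hp \<le> 2 * real h"
  proof -
    have "hp \<le> h + 1" unfolding hp_def by simp
    then have "hp \<le> 2 * h" using h by simp
    then show ?thesis by (metis of_nat_le_iff of_nat_mult of_nat_numeral)
  qed
  \<comment> \<open>Rounding up in hp gives R hp \<ge> h, which turns division by hp into
    multiplication by R / h.\<close>
  have hlt: "real h \<le> real R * real hp"
  proof -
    have "h mod R < R" "h = R * (h div R) + h mod R" "R * hp = R * (h div R) + R" using R(2) by (simp_all add: hp_def)
    then have "h \<le> R * hp" by linarith
    then show ?thesis by (metis of_nat_le_iff of_nat_mult)
  qed
  have a1: "real R * real n \<le> 33 * ?Z"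
  proof -
    have "real R * real n \<le> (33 * L ^ 11) * (real n ^ 2 * real h)"
      using r nn Lp[of 1] L h1 by (intro mult_mono) auto
    then show ?thesis by (simp add: mult.commute mult.left_commute)
  qed
  have a2: "real R * real n * real m \<le> real R * real R * real n * real m"
    using r1 mult_right_mono[of 1 "real R" "real R * (real n * real m)"] by (simp add: mult.assoc)
  have a3: "real R * real R * real n * real m \<le> 33 ^ 2 * ?X"
  proof -
    have "real R ^ 2 * (real n * real m) \<le> (33 ^ 2 * L ^ 2) * (real n * real m)" by (intro mult_right_mono rp) auto
    then show ?thesis by (simp add: power2_eq_square mult.assoc mult.commute mult.left_commute)
  qed
  have a4: "real R ^ 6 * real n * real n * real hp \<le> 2 * 33 ^ 6 * ?Z"
  proof -
    have "real R ^ 6 * (real n ^ 2 * real hp) \<le> (33 ^ 6 * L ^ 11) * (real n ^ 2 * (2 * real h))"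
    proof (rule mult_mono)
      show "real R ^ 6 \<le> 33 ^ 6 * L ^ 11" using rp[of 6] Lp[of 6] by simp
      show "real n ^ 2 * real hp \<le> real n ^ 2 * (2 * real h)" by (intro mult_left_mono hpn) auto
    qed (use L0[of 11] in auto)
    then show ?thesis by (simp add: power2_eq_square mult.assoc mult.commute mult.left_commute)
  qed
  have a5: "real R * real (6 * R * n div hp) ^ 3 \<le> 216 * 33 ^ 7 * ?Y"
  proof -
    have hp0: "0 < real hp" unfolding hp_def by simp
    have "real (6 * R * n div hp) \<le> real (6 * R * n) / real hp" by (rule of_nat_div_le_of_nat)
    also have "\<dots> \<le> 6 * real R ^ 2 * real n / real h"
    proof -
      have "real h * (6 * real R * real n) \<le> (real R * real hp) * (6 * real R * real n)" using hlt by (intro mult_right_mono) auto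
      then show ?thesis using hp0 h1 by (simp add: field_simps power2_eq_square)
    qed
    finally have "real (6 * R * n div hp) ^ 3 \<le> (6 * real R ^ 2 * real n / real h) ^ 3" by (rule power_mono) simp
    then have "real R * real (6 * R * n div hp) ^ 3 \<le> real R * (6 * real R ^ 2 * real n / real h) ^ 3" by (rule mult_left_mono) simp
    also have "\<dots> = 216 * (real R ^ 7 * (real n ^ 3 / real h ^ 3))"
      by (simp add: power_divide power_mult_distrib eval_nat_numeral)
    also have "\<dots> \<le> 216 * ((33 ^ 7 * L ^ 7) * (real n ^ 3 / real h ^ 3))" by (intro mult_left_mono mult_right_mono rp) auto
    finally show ?thesis by (simp add: mult.assoc mult.commute mult.left_commute)
  qed
  have pos: "0 \<le> ?X" "0 \<le> ?Y" by (intro mult_nonneg_nonneg L0; simp)+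
  have "real (70 * R * n + 5 * R * n * m + (70 * R * R * n * m + 3300 * R ^ 6 * n * n * hp + 3 * R * (6 * R * n div hp) ^ 3)) =
     70 * (real R * real n) + 5 * (real R * real n * real m) + 70 * (real R * real R * real n * real m) +
     3300 * (real R ^ 6 * real n * real n * real hp) + 3 * (real R * real (6 * R * n div hp) ^ 3)"
    by (simp only: of_nat_add of_nat_mult of_nat_power of_nat_numeral mult.assoc)
  also have "\<dots> \<le> 70 * (33 * ?Z) + 75 * (33 ^ 2 * ?X) + 3300 * (2 * 33 ^ 6 * ?Z) + 3 * (216 * 33 ^ 7 * ?Y)"
    using a1 a2 a3 a4 a5 by linarith
  also have "\<dots> \<le> 10 ^ 15 * (?X + ?Y + ?Z)"
  proof -
    have "70 * (33 * z) + 75 * (33 ^ 2 * x) + 3300 * (2 * 33 ^ 6 * z) + 3 * (216 * 33 ^ 7 * y) \<le> 10 ^ 15 * (x + y + z)"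
      if "0 \<le> x" "0 \<le> y" "0 \<le> z" for x y z :: real using that by simp
    then show ?thesis using pos Z1 by (meson order_trans zero_le_one)
  qed
  finally show "real (70 * R * n + 5 * R * n * m + (70 * R * R * n * m + 3300 * R ^ 6 * n * n * hp + 3 * R * (6 * R * n div hp) ^ 3))
      \<le> 10 ^ 15 * (?X + ?Y + ?Z)" .
  have "R * hp \<le> h + R" unfolding hp_def by (simp add: algebra_simps)
  then have b1: "real R * real hp \<le> real h + real R" by (metis of_nat_add of_nat_le_iff of_nat_mult)
  have b2: "real R \<le> 33 * L ^ 11" using r Lp[of 1] by simp
  have b3: "real R ^ 5 \<le> 33 ^ 5 * L ^ 11" using rp[of 5] Lp[of 5] by simp
  have b4: "real R * real hp \<le> real h + 33 * L ^ 11" by (rule order_trans[OF b1 add_left_mono[OF b2]])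
  have "real (40 * R + (400 * R ^ 5 + 100 * R * hp)) = 40 * real R + 400 * real R ^ 5 + 100 * (real R * real hp)"
    by simp
  also have "\<dots> \<le> 40 * (33 * L ^ 11) + 400 * (33 ^ 5 * L ^ 11) + 100 * (real h + 33 * L ^ 11)"
    by (intro add_mono mult_left_mono b2 b3 b4) simp_all
  also have "\<dots> \<le> 10 ^ 15 * (real h + L ^ 11)" using L11 h1 by simp
  finally show "real (40 * R + (400 * R ^ 5 + 100 * R * hp)) \<le> 10 ^ 15 * (real h + L ^ 11)" .
qed


section \<open>The assembled program and the meaning of its output\<close>

context sssp_graph
begin

definition sol :: "store \<Rightarrow> bool" where
  "sol u \<longleftrightarrow> (\<forall>v<n. NA u 0 v 0 = of_bool (\<exists>k x. ow k s v x) \<and> (\<forall>k x. ow k s v x \<longrightarrow> RA u 0 v 0 = x)) \<and>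
     (\<forall>v k x. v < n \<longrightarrow> v \<noteq> s \<longrightarrow> ow k s v x \<longrightarrow>
        (\<exists>e<m. NA u 0 (n + v) 0 = e \<and> head T e = v \<and> (\<exists>i. k = Suc i \<and> ow i s (tail T e) (x - w (tail T e) v))))"

text \<open>The locale of the algorithm can only be interpreted after \<open>InitM\<close>, since
  the order of the arcs within each in-list is read off the store that it leaves. The program text
  itself does not depend on these parameters.\<close>

lemma spec_Sssp:
  fixes h :: nat
  assumes mc: "machine V Gc B" and h: "1 \<le> h" "h \<le> n" and V: "V = (n + 2) ^ 40"
    and u: "NA u 0 0 0 = n" "NA u 0 1 0 = m" "NA u 0 2 0 = s" "NA u 0 3 0 = h"
      "\<And>e. e < m \<Longrightarrow> NA u 0 (4 + e) 0 = tail T e \<and> NA u 0 (4 + (m + e)) 0 = head T e \<and> RA u 0 e 0 = c e"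
  defines "R \<equiv> LEAST R. (n + 2) ^ 16 \<le> 2 ^ R"
  defines "hp \<equiv> h div R + 1"
  shows "machine.spec V Gc B (Seq machine.InitM sssp_machine.Main) u sol
     (70 * R * n + 5 * R * n * m + (70 * R * R * n * m + 3300 * R ^ 6 * n * n * hp + 3 * R * (6 * R * n div hp) ^ 3))
     (40 * R + (400 * R ^ 5 + 100 * R * hp))"
    and "2 ^ R \<le> 2 * (n + 2) ^ 16" "1 \<le> R"
proof -
  interpret machine V Gc B by (rule mc)
  have G: "sssp_graph T c n m s" by unfold_locales (rule inst)
  have V': "(n + 2) ^ 40 \<le> V" using V by simp
  show R: "2 ^ R \<le> 2 * (n + 2) ^ 16" using spec_InitR(3)[of "setv 7 n u" n] V' unfolding R_def by simp
  have R': "(n + 2) ^ 16 \<le> 2 ^ R" using spec_InitR(2)[of "setv 7 n u" n] V' unfolding R_def by simp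
  show R1: "1 \<le> R"
  proof (rule ccontr)
    assume "\<not> 1 \<le> R"
    then have "(n + 2) ^ 16 \<le> 1" using R' by (simp add: not_le)
    moreover have "1 < (n + 2) ^ 16" by (rule one_less_power) auto
    ultimately show False by simp
  qed
  show "spec (Seq InitM sssp_machine.Main) u sol
     (70 * R * n + 5 * R * n * m + (70 * R * R * n * m + 3300 * R ^ 6 * n * n * hp + 3 * R * (6 * R * n div hp) ^ 3))
     (40 * R + (400 * R ^ 5 + 100 * R * hp))"
  proof (rule spec_step[OF spec_InitM[OF G h(2) V' u, folded R_def]])
    fix u' :: store assume a: "NA u' 1 0 0 = R \<and> NA u' 7 0 0 = n \<and> NA u' 9 0 0 = s \<and> NA u' 10 0 0 = h div R + 1 \<and>
      (\<forall>v<n. NA u' 12 v 0 = indeg v \<and> NA u' 11 v ` {..<indeg v} = {e. e < m \<and> head T e = v} \<and>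
        (\<forall>y<indeg v. NA u' 13 v y = tail T (NA u' 11 v y) \<and> RA u' 13 v y = c (NA u' 11 v y)))"
    define arc where "arc = NA u' 11"
    define tl where "tl = (\<lambda>v y. tail T (arc v y))"
    have im: "arc v ` {..<indeg v} = {e. e < m \<and> head T e = v}" if "v < n" for v using a that unfolding arc_def by blast
    have arc: "arc v y < m \<and> head T (arc v y) = v" if "v < n" "y < indeg v" for v y using im[OF that(1)] that(2) by blast
    interpret M: sssp_machine V Gc B n E w R s hp m indeg tl arc
    proof
      show "0 < n" "s < n" using VA by auto
      show "1 \<le> hp" "hp \<le> n + 1" unfolding hp_def using h(2) by (auto intro: order_trans[OF div_le_dividend])
      show "E x v \<longleftrightarrow> v < n \<and> (\<exists>y<indeg v. tl v y = x)" for x v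
      proof
        assume "E x v"
        then obtain e where e: "e < m" "tail T e = x" "head T e = v" unfolding E_def by blast
        have v: "v < n" using ends e by blast
        have "e \<in> arc v ` {..<indeg v}" unfolding im[OF v] using e by blast
        then show "v < n \<and> (\<exists>y<indeg v. tl v y = x)" using v e(2) unfolding tl_def by auto
      next
        assume "v < n \<and> (\<exists>y<indeg v. tl v y = x)"
        then show "E x v" using arc unfolding E_def tl_def by blast
      qed
    qed (use R R' V' indeg_le sum_indeg in auto)
    have "M.static u'" unfolding M.static_def
    proof (intro conjI allI impI)
      fix v y assume v: "v < n" and y: "y < indeg v"
      have "w (tl v y) v = c (arc v y)" using w_arc[of "arc v y"] arc[OF v y] by (simp add: tl_def)
      then show "RA u' 13 v y = w (tl v y) v" using a v y by (simp add: arc_def)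
      show "NA u' 13 v y = tl v y" "NA u' 11 v y = arc v y" using a v y by (simp_all add: arc_def tl_def)
    qed (use a in \<open>simp_all add: hp_def\<close>)
    then show "spec M.Main u' sol (70 * R * R * n * m + 3300 * R ^ 6 * n * n * hp + 3 * R * (6 * R * n div hp) ^ 3) (400 * R ^ 5 + 100 * R * hp)"
    proof (rule spec_mono[OF M.spec_Main])
      fix u'' assume o: "M.out_ok u''"
      have 1: "\<forall>v<n. NA u'' 0 v 0 = of_bool (\<exists>k x. ow k s v x) \<and> (\<forall>k x. ow k s v x \<longrightarrow> RA u'' 0 v 0 = x)"
        and p: "M.par_ok (\<lambda>v. NA u'' 0 (n + v) 0)" using o unfolding M.out_ok_def by blast+
      have 2: "\<exists>e<m. NA u'' 0 (n + v) 0 = e \<and> head T e = v \<and> (\<exists>i. k = Suc i \<and> ow i s (tail T e) (x - w (tail T e) v))"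
        if v: "v < n" "v \<noteq> s" "ow k s v x" for v k x
      proof -
        obtain y where y: "y < indeg v" "NA u'' 0 (n + v) 0 = arc v y" "\<exists>i. k = Suc i \<and> ow i s (tl v y) (x - w (tl v y) v)"
          using p v unfolding M.par_ok_def by blast
        show ?thesis using arc[OF v(1) y(1)] y(2,3) unfolding tl_def by blast
      qed
      show "sol u''" unfolding sol_def using 1 2 by blast
    qed simp_all
  qed simp_all
qed

lemma sol_output:
  assumes S: "sol (absr V t)" and V: "2 * n \<le> V"
  shows "sssp_output T c n s t"
proof -
  have ad: "NA (absr V t) 0 i 0 = nmem t i" "RA (absr V t) 0 i 0 = rmem t i" if "i < V" for i
    using that by (simp_all add: absr_def adr_def)
  let ?f = "\<lambda>v. nmem t (n + v)"
  have par: "\<exists>e<m. ?f v = e \<and> head T e = v \<and> (\<exists>i. k = Suc i \<and> ow i s (tail T e) (x - w (tail T e) v))"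
    if "v < n" "v \<noteq> s" "ow k s v x" for v k x
  proof -
    have "n + v < V" using that(1) V by linarith
    then show ?thesis using S that ad[of "n + v"] unfolding sol_def by metis
  qed
  show ?thesis unfolding sssp_output_def
  proof (intro ballI conjI impI)
    fix v assume "v \<in> verts T"
    then have v: "v < n" using VA by simp
    then have vV: "v < V" using V by linarith
    show "nmem t v = (if s \<rightarrow>\<^sup>*\<^bsub>T\<^esub> v then 1 else 0)"
    proof -
      have "nmem t v = of_bool (\<exists>k x. ow k s v x)" using S v ad(1)[OF vV] unfolding sol_def by metis
      then show ?thesis by (simp add: reach_iff)
    qed
    assume "s \<rightarrow>\<^sup>*\<^bsub>T\<^esub> v"
    then obtain k x where o: "ow k s v x" using reach_iff by blast
    show "ereal (rmem t v) = \<mu> c s v" using S v o ad[OF vV] mu_eq[OF o] unfolding sol_def by auto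
    obtain p where p: "apath s p v" "awalk_cost c p = x" "\<forall>e\<in>set p. ?f (head T e) = e"
      using tree_path[of ?f, OF par o v] by blast
    show "\<exists>p. apath s p v \<and> ereal (awalk_cost c p) = \<mu> c s v \<and> (\<forall>e\<in>set p. nmem t (n + head T e) = e)"
      by (intro exI[of _ p] conjI) (use p mu_eq[OF o] in auto)
  qed
qed

end

theorem theorem19:
  shows "\<exists>(P :: com) (b :: nat) (C :: real).
    \<forall>(G :: (nat, nat) pre_digraph) (c :: nat \<Rightarrow> real) (n :: nat) (m :: nat) (s :: nat) (h :: nat).
      sssp_instance G c n m s \<and> 1 \<le> h \<and> h \<le> n \<longrightarrow>
      (\<exists>t R W work depth.
         exec ((n + 2) ^ b) P (sssp_input G c n m s h) t R W work depth \<and>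
         sssp_output G c n s t \<and>
         (n \<ge> 2 \<longrightarrow>
            real work \<le> C * (real m * real n * log 2 (real n) ^ 2
                           + real n ^ 3 / real h ^ 3 * log 2 (real n) ^ 7
                           + real n ^ 2 * real h * log 2 (real n) ^ 11) \<and>
            real depth \<le> C * (real h + log 2 (real n) ^ 11)))"
proof -
  \<comment> \<open>The word bound V^Gc is (n + 2)^(40 * Gc), which fixes the exponent;
    \<open>C\<close> covers the 44 steps of \<open>Pre\<close> plus Gc machine steps per unit of the
    cost in \<open>final_bounds\<close>.\<close>
  define Gc :: nat where "Gc = 10 ^ 30"
  define C :: real where "C = 44 + real Gc * 10 ^ 15"
  let ?P = "Seq Pre (Seq machine.InitM sssp_machine.Main)"
  show ?thesis
  proof (rule exI[of _ ?P], rule exI[of _ "40 * Gc"], rule exI[of _ C], intro allI impI)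
    fix T :: "(nat, nat) pre_digraph" and c n m s h
    assume a: "sssp_instance T c n m s \<and> 1 \<le> h \<and> h \<le> n"
    let ?B = "(n + 2) ^ (40 * Gc)" let ?V = "(n + 2) ^ 40" let ?s = "sssp_input T c n m s h"
    interpret sssp_graph T c n m s by unfold_locales (use a in blast)
    have pm: "(n + 2) ^ i \<le> (n + 2) ^ j" if "i \<le> j" for i j using that by (intro power_increasing) auto
    have mc: "machine ?V Gc ?B"
    proof
      show "2 \<le> ?V" using pm[of 1 40] by simp
      show "?V ^ Gc \<le> ?B" by (simp add: power_mult)
      show "10 ^ 30 \<le> Gc" by (simp add: Gc_def)
    qed
    interpret M: machine ?V Gc ?B by (rule mc)
    have "40 * 1 \<le> 40 * Gc" unfolding Gc_def by (intro mult_le_mono2) simp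
    then have VB: "?V \<le> ?B" using pm[of 40 "40 * Gc"] by simp
    obtain s1 R1 where s1: "exec ?B Pre ?s s1 R1 {} 44 44" "nmem s1 = nmem ?s" "rmem s1 = rmem ?s"
        "nreg s1 1 = ?V" "nreg s1 2 = 0" "nreg s1 3 = 0"
      using exec_Pre[of ?s n ?B] VB by (auto simp: sssp_input_def)
    have big: "4 + 2 * (n * n) + n < ?V"
    proof -
      have "4 + 2 * (n * n) + n < (n + 2) ^ 3" by (simp add: power3_eq_cube algebra_simps)
      also have "\<dots> \<le> ?V" by (rule pm) simp
      finally show ?thesis .
    qed
    have mV: "4 + 2 * m < ?V" "n < ?V" "m < ?V" using big m_le by linarith+
    have hn: "1 \<le> h" "h \<le> n" using a by auto
    have nm: "nmem s1 i < ?V" for i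
    proof -
      have "tail T (i - 4) < n" if "4 \<le> i" "i < 4 + m" using ends(1)[of "i - 4"] that by simp
      moreover have "head T (i - (4 + m)) < n" if "4 + m \<le> i" "i < 4 + 2 * m" using ends(2)[of "i - (4 + m)"] that by simp
      ultimately show ?thesis unfolding s1(2) sssp_input_def using mV VA(3) hn by (auto simp: not_less intro: less_trans)
    qed
    have ok: "okst ?V s1" unfolding okst_def using s1 nm by simp
    let ?u = "absr ?V s1"
    have ad: "NA ?u 0 i 0 = nmem s1 i" "RA ?u 0 i 0 = rmem s1 i" if "i < ?V" for i
      using that by (simp_all add: absr_def adr_def)
    have u: "NA ?u 0 0 0 = n" "NA ?u 0 1 0 = m" "NA ?u 0 2 0 = s" "NA ?u 0 3 0 = h"
      using ad[of 0] ad[of 1] ad[of 2] ad[of 3] mV unfolding s1(2) by (simp_all add: sssp_input_def)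
    have ue: "NA ?u 0 (4 + e) 0 = tail T e \<and> NA ?u 0 (4 + (m + e)) 0 = head T e \<and> RA ?u 0 e 0 = c e" if "e < m" for e
      using ad[of "4 + e"] ad[of "4 + (m + e)"] ad[of e] mV that unfolding s1(2,3) by (simp add: sssp_input_def)
    define R where "R = (LEAST R. (n + 2) ^ 16 \<le> (2::nat) ^ R)"
    define hp where "hp = h div R + 1"
    let ?W = "70 * R * n + 5 * R * n * m + (70 * R * R * n * m + 3300 * R ^ 6 * n * n * hp + 3 * R * (6 * R * n div hp) ^ 3)"
    let ?D = "40 * R + (400 * R ^ 5 + 100 * R * hp)"
    note sp = spec_Sssp[OF mc hn refl u ue, folded R_def, folded hp_def]
    obtain t R2 W2 w d where t: "exec ?B (Seq machine.InitM sssp_machine.Main) s1 t R2 W2 w d" "okst ?V t" "sol (absr ?V t)"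
        "w \<le> Gc * ?W" "d \<le> Gc * ?D"
      by (rule M.specE[OF sp(1) ok refl])
    have out: "sssp_output T c n s t" by (rule sol_output[OF t(3)]) (use big le_square[of n] in linarith)
    have bounds: "real (44 + w) \<le> C * (real m * real n * log 2 (real n) ^ 2 + real n ^ 3 / real h ^ 3 * log 2 (real n) ^ 7
         + real n ^ 2 * real h * log 2 (real n) ^ 11) \<and> real (44 + d) \<le> C * (real h + log 2 (real n) ^ 11)" if n: "2 \<le> n"
    proof -
      let ?X = "real m * real n * log 2 (real n) ^ 2 + real n ^ 3 / real h ^ 3 * log 2 (real n) ^ 7 + real n ^ 2 * real h * log 2 (real n) ^ 11"
      let ?Y = "real h + log 2 (real n) ^ 11"
      note fb = final_bounds[OF n hn sp(2,3), folded hp_def]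
      have L: "0 \<le> log 2 (real n)" using log_bound(2)[OF n sp(2)] by linarith
      have "0 \<le> real m * real n * log 2 (real n) ^ 2" "0 \<le> real n ^ 3 / real h ^ 3 * log 2 (real n) ^ 7"
        by (intro mult_nonneg_nonneg zero_le_power L; simp)+
      then have X1: "1 \<le> ?X" using fb(3) by linarith
      have Y1: "1 \<le> ?Y" using fb(4) by linarith
      have "real w \<le> real Gc * real ?W" using t(4) by (metis of_nat_le_iff of_nat_mult)
      also have "\<dots> \<le> real Gc * (10 ^ 15 * ?X)" by (rule mult_left_mono[OF fb(1) of_nat_0_le_iff])
      finally have 1: "real (44 + w) \<le> 44 * ?X + real Gc * (10 ^ 15 * ?X)" using X1 by simp
      have "real d \<le> real Gc * real ?D" using t(5) by (metis of_nat_le_iff of_nat_mult)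
      also have "\<dots> \<le> real Gc * (10 ^ 15 * ?Y)" by (rule mult_left_mono[OF fb(2) of_nat_0_le_iff])
      finally have 2: "real (44 + d) \<le> 44 * ?Y + real Gc * (10 ^ 15 * ?Y)" using Y1 by simp
      have C: "C * z = 44 * z + real Gc * (10 ^ 15 * z)" for z unfolding C_def by (simp add: distrib_right)
      show ?thesis unfolding C using 1 2 by blast
    qed
    show "\<exists>t R W work depth. exec ?B ?P ?s t R W work depth \<and> sssp_output T c n s t \<and>
         (n \<ge> 2 \<longrightarrow> real work \<le> C * (real m * real n * log 2 (real n) ^ 2 + real n ^ 3 / real h ^ 3 * log 2 (real n) ^ 7
                           + real n ^ 2 * real h * log 2 (real n) ^ 11) \<and> real depth \<le> C * (real h + log 2 (real n) ^ 11))"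
      by (intro exI conjI impI, rule exec.Seq[OF s1(1) t(1)]) (use out bounds in auto)
  qed
qed

end
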